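(* Fix $\gamma>0$, let $\jmath$ satisfy Hypotheses J1–J3, and let $k>0$ be an admissible wavenumber. Consider small-amplitude periodic traveling waves $\eta_{\mathfrak g}(\varepsilon;k)$ of the gRMKP equation, and say that they are long-wave unstable if they are transversely unstable with respect to periodic perturbations in both directions with long wavelength in the transverse direction, i.e. if for every $\rho_0>0$ there is $\varepsilon_0>0$ such that for every $0<|\varepsilon|<\varepsilon_0$ there is $\rho$ with $0<|\rho|\le\rho_0$ at which the wave has a periodic instability. (1) Let $\alpha_1=1$, $\alpha_2=0$. (a) If $\jmath$ is increasing on $(0,\infty)$ and $|k^2(\jmath(2k)-\jmath(k))|>\dfrac{3\gamma}{4}$, the waves are long-wave unstable. (b) If $\jmath$ is decreasing on $(0,\infty)$, there is no such instability: there are $\rho_0,\varepsilon_0>0$ such that for $0<|\varepsilon|<\varepsilon_0$ the wave has no periodic instability at any $\rho$ with $0<|\rho|\le\rho_0$. (2) Let $\alpha_1=0$, $\alpha_2=-1$. Then, for all $\jmath$ and all (admissible) $k>0$, the waves are long-wave unstable. (3) Let $\alpha_1=1$, $\alpha_2=-1$. Then, for all $\jmath$, the waves are long-wave unstable if $$\frac{2k^2}{3\gamma+4k^2(\jmath(k)-\jmath(2k))}<\frac34 .$$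
   Context: Let $\mathbb T=\mathbb R/2\pi\mathbb Z$. The generalized rotation-modified Kadomtsev-Petviashvili (gRMKP) equation for $u=u(x,y,t)$ is $(u_t+\mathcal Ju_x+\alpha_1(u^2)_x+\alpha_2(u^3)_x)_x-\gamma u+u_{yy}=0$, $\gamma>0$, $\alpha_1\in\{0,1\}$, $\alpha_2\in\{-1,0\}$, where $\widehat{\mathcal Jf}(k)=\jmath(k)\widehat f(k)$ ($x$-variable) and: (J1) $\jmath$ is real valued, even, $\jmath(0)=1$; (J2) for some $\mathfrak b\ge-1$ and $A_1,A_2>0$, $A_1k^{\mathfrak b}\le\jmath(k)\le A_2k^{\mathfrak b}$ for $k\gg1$; (J3) $\jmath$ is strictly monotonic on $k>0$. Admissible wavenumbers: all $k>0$ if $\jmath$ is decreasing; if $\jmath$ is increasing, all $k>0$ such that $k^2(\jmath(kn)-\jmath(k))\neq\gamma(n^2-1)/n^2$ for every integer $n\ge2$. For these there is a one-parameter family of $y$-independent solutions $u=\eta_{\mathfrak g}(\varepsilon;k)(k(x-c_{\mathfrak g}(\varepsilon;k)t))$, $|\varepsilon|$ small, with $\eta_{\mathfrak g}$ $2\pi$-periodic, even and smooth in $z=k(x-c_{\mathfrak g}t)$, $c_{\mathfrak g}$ even in $\varepsilon$, analytic dependence on $\varepsilon,k$, and $\eta_{\mathfrak g}(z)=\varepsilon\cos z+\varepsilon^2\eta_{\mathfrak g_2}\cos2z+\varepsilon^3\eta_{\mathfrak g_3}\cos3z+O(\varepsilon^4)$, $c_{\mathfrak g}=c_{\mathfrak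 g_0}+\varepsilon^2c_{\mathfrak g_2}+O(\varepsilon^4)$, where $c_{\mathfrak g_0}=\jmath(k)+\frac{\gamma}{k^2}$, $\eta_{\mathfrak g_2}=\frac{2\alpha_1k^2}{3\gamma+4k^2(\jmath(k)-\jmath(2k))}$, $\eta_{\mathfrak g_3}=\frac{9\alpha_1k^2\eta_{\mathfrak g_2}+\frac94\alpha_2k^2}{8\gamma+9k^2(\jmath(k)-\jmath(3k))}$, $c_{\mathfrak g_2}=\alpha_1\eta_{\mathfrak g_2}+\frac34\alpha_2$. Spectral problem. Linearizing about $\eta_{\mathfrak g}$ and taking perturbations $e^{\lambda t/k+i\rho y}\varphi(z)$ gives $\mathcal G^{\mathfrak g}_\varepsilon(\lambda,\rho)\varphi=0$ with $\mathcal G^{\mathfrak g}_\varepsilon(\lambda,\rho)=\lambda\partial_z-k^2\partial_z^2(c_{\mathfrak g}-\mathcal J_k-2\alpha_1\eta_{\mathfrak g}-3\alpha_2\eta_{\mathfrak g}^2)-\rho^2-\gamma$, where $\mathcal J_ke^{inz}=\jmath(kn)e^{inz}$. For $\rho\ne0$ the wave has a periodic instability at $\rho$ if there is $\lambda\in\mathbb C$ with $\operatorname{Re}\lambda>0$ such that $\mathcal G^{\mathfrak g}_\varepsilon(\lambda,\rho)$, acting in $L^2(\mathbb T)$ with domain $H^{2+\max(\mathfrak b,0)}(\mathbb T)$, is not invertible. *)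

theory Defs
  imports "HOL-Analysis.Analysis" "HOL-Library.Landau_Symbols"
begin

section \<open>The dispersion symbol\<close>

definition hyp_J1 :: "(real \<Rightarrow> real) \<Rightarrow> bool" where
  "hyp_J1 j \<longleftrightarrow> (\<forall>\<kappa>. j (- \<kappa>) = j \<kappa>) \<and> j 0 = 1"

definition hyp_J2 :: "(real \<Rightarrow> real) \<Rightarrow> real \<Rightarrow> bool" where
  "hyp_J2 j b \<longleftrightarrow> b \<ge> -1 \<and>
     (\<exists>A1 A2. A1 > 0 \<and> A2 > 0 \<and>
        (\<forall>\<^sub>F \<kappa> in at_top. A1 * \<kappa> powr b \<le> j \<kappa> \<and> j \<kappa> \<le> A2 * \<kappa> powr b))"

definition hyp_J3 :: "(real \<Rightarrow> real) \<Rightarrow> bool" where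
  "hyp_J3 j \<longleftrightarrow> strict_mono_on {0<..} j \<or> strict_antimono_on {0<..} j"

definition admissible :: "(real \<Rightarrow> real) \<Rightarrow> real \<Rightarrow> real \<Rightarrow> bool" where
  "admissible j \<gamma> k \<longleftrightarrow> k > 0 \<and>
     (strict_mono_on {0<..} j \<longrightarrow>
        (\<forall>n::nat. n \<ge> 2 \<longrightarrow>
           k^2 * (j (k * real n) - j k) \<noteq> \<gamma> * ((real n)^2 - 1) / (real n)^2))"

section \<open>Function spaces on the torus\<close>

text \<open>The torus is represented by the interval from 0 to 2 pi with Lebesgue measure.  Elements of
  L2 are represented by functions, and two of them are identified when they agree almost
  everywhere with respect to this measure.\<close>

abbreviation torus :: "real measure" where
  "torus \<equiv> lebesgue_on {0..2*pi}"

definition L2T :: "(real \<Rightarrow> complex) set" where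
  "L2T = {f. f \<in> borel_measurable torus \<and> integrable torus (\<lambda>z. (cmod (f z))^2)}"

definition L2T_norm :: "(real \<Rightarrow> complex) \<Rightarrow> real" where
  "L2T_norm f = sqrt (\<integral>z. (cmod (f z))^2 \<partial>torus)"

definition fourier :: "(real \<Rightarrow> complex) \<Rightarrow> int \<Rightarrow> complex" where
  "fourier f n = (\<integral>z. f z * cis (- (of_int n * z)) \<partial>torus) / of_real (2*pi)"

definition sobolevT :: "real \<Rightarrow> (real \<Rightarrow> complex) set" where
  "sobolevT s = {f \<in> L2T.
     (\<lambda>n::int. (1 + (of_int n)^2) powr s * (cmod (fourier f n))^2) summable_on UNIV}"

section \<open>The equation\<close>

text \<open>The multiplier operator in the physical variable x, for functions v of period 2 pi / k:
  the harmonic exp (i k n x) is multiplied by j (k n).  For real v and even j the sum is real.\<close>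

definition J_op :: "(real \<Rightarrow> real) \<Rightarrow> real \<Rightarrow> (real \<Rightarrow> real) \<Rightarrow> real \<Rightarrow> real" where
  "J_op j k v x = Re (\<Sum>\<^sub>\<infinity>n::int. of_real (j (k * of_int n))
       * fourier (\<lambda>z. of_real (v (z / k))) n * cis (k * of_int n * x))"

text \<open>Classical solutions of period 2 pi / k in x.  The derivatives are only meaningful for
  sufficiently regular u; the predicate is used for smooth profiles.\<close>

definition gRMKP_solution ::
  "(real \<Rightarrow> real) \<Rightarrow> real \<Rightarrow> real \<Rightarrow> real \<Rightarrow> real \<Rightarrow> (real \<Rightarrow> real \<Rightarrow> real \<Rightarrow> real) \<Rightarrow> bool" where
  "gRMKP_solution j \<gamma> \<alpha>1 \<alpha>2 k u \<longleftrightarrow> (\<forall>x y t.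
     deriv (\<lambda>x. deriv (\<lambda>t. u x y t) t
              + J_op j k (deriv (\<lambda>x. u x y t)) x
              + \<alpha>1 * deriv (\<lambda>x. (u x y t)^2) x
              + \<alpha>2 * deriv (\<lambda>x. (u x y t)^3) x) x
     - \<gamma> * u x y t + deriv (deriv (\<lambda>y. u x y t)) y = 0)"

section \<open>Small-amplitude periodic traveling waves\<close>

definition wave_c0 :: "(real \<Rightarrow> real) \<Rightarrow> real \<Rightarrow> real \<Rightarrow> real" where
  "wave_c0 j \<gamma> k = j k + \<gamma> / k^2"

definition wave_eta2 :: "(real \<Rightarrow> real) \<Rightarrow> real \<Rightarrow> real \<Rightarrow> real \<Rightarrow> real" where
  "wave_eta2 j \<gamma> \<alpha>1 k = 2 * \<alpha>1 * k^2 / (3 * \<gamma> + 4 * k^2 * (j k - j (2 * k)))"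

definition wave_eta3 :: "(real \<Rightarrow> real) \<Rightarrow> real \<Rightarrow> real \<Rightarrow> real \<Rightarrow> real \<Rightarrow> real" where
  "wave_eta3 j \<gamma> \<alpha>1 \<alpha>2 k =
     (9 * \<alpha>1 * k^2 * wave_eta2 j \<gamma> \<alpha>1 k + 9 / 4 * \<alpha>2 * k^2)
       / (8 * \<gamma> + 9 * k^2 * (j k - j (3 * k)))"

definition wave_c2 :: "(real \<Rightarrow> real) \<Rightarrow> real \<Rightarrow> real \<Rightarrow> real \<Rightarrow> real \<Rightarrow> real" where
  "wave_c2 j \<gamma> \<alpha>1 \<alpha>2 k = \<alpha>1 * wave_eta2 j \<gamma> \<alpha>1 k + 3 / 4 * \<alpha>2"

definition smooth :: "(real \<Rightarrow> real) \<Rightarrow> bool" where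
  "smooth f \<longleftrightarrow> (\<forall>m z. (deriv ^^ m) f differentiable (at z))"

text \<open>Analyticity at amplitude 0, for the speed and for the profile.  The latter is a convergent
  power series with values in the space of m times continuously differentiable functions, for
  every m (the radius may depend on m).\<close>

definition analytic_speed :: "(real \<Rightarrow> real) \<Rightarrow> bool" where
  "analytic_speed c \<longleftrightarrow>
     (\<exists>a \<delta>. \<delta> > 0 \<and> (\<forall>\<epsilon>. \<bar>\<epsilon>\<bar> < \<delta> \<longrightarrow> (\<lambda>n. a n * \<epsilon>^n) sums c \<epsilon>))"

definition analytic_profile :: "(real \<Rightarrow> real \<Rightarrow> real) \<Rightarrow> bool" where
  "analytic_profile \<eta> \<longleftrightarrow> (\<exists>a :: nat \<Rightarrow> real \<Rightarrow> real.
     (\<forall>n. smooth (a n)) \<and>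
     (\<forall>m. \<exists>\<delta> M. \<delta> > 0 \<and> summable (\<lambda>n. M n * \<delta>^n) \<and>
        (\<forall>n z. \<bar>(deriv ^^ m) (a n) z\<bar> \<le> M n) \<and>
        (\<forall>\<epsilon> z. \<bar>\<epsilon>\<bar> < \<delta> \<longrightarrow> (\<lambda>n. (deriv ^^ m) (a n) z * \<epsilon>^n) sums (deriv ^^ m) (\<eta> \<epsilon>) z)))"

text \<open>The profile at amplitude \<open>\<epsilon>\<close> is \<open>\<eta> \<epsilon>\<close>, a function of z = k (x - c t), and its speed is
  \<open>c \<epsilon>\<close>.  The remainder of the profile is of fourth order together with all its z-derivatives,
  uniformly in z.  The values at large amplitudes are irrelevant.\<close>

definition traveling_wave_family ::
  "(real \<Rightarrow> real) \<Rightarrow> real \<Rightarrow> real \<Rightarrow> real \<Rightarrow> real \<Rightarrow> (real \<Rightarrow> real \<Rightarrow> real) \<Rightarrow> (real \<Rightarrow> real) \<Rightarrow> bool" where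
  "traveling_wave_family j \<gamma> \<alpha>1 \<alpha>2 k \<eta> c \<longleftrightarrow>
     (\<exists>\<epsilon>1>0. \<forall>\<epsilon>. \<bar>\<epsilon>\<bar> < \<epsilon>1 \<longrightarrow>
        (\<forall>z. \<eta> \<epsilon> (z + 2*pi) = \<eta> \<epsilon> z) \<and> (\<forall>z. \<eta> \<epsilon> (- z) = \<eta> \<epsilon> z) \<and> smooth (\<eta> \<epsilon>) \<and>
        c (- \<epsilon>) = c \<epsilon> \<and>
        gRMKP_solution j \<gamma> \<alpha>1 \<alpha>2 k (\<lambda>x y t. \<eta> \<epsilon> (k * (x - c \<epsilon> * t)))) \<and>
     analytic_profile \<eta> \<and> analytic_speed c \<and>
     (\<forall>m. \<exists>C. \<exists>\<delta>>0. \<forall>\<epsilon> z. \<bar>\<epsilon>\<bar> < \<delta> \<longrightarrow>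
        \<bar>(deriv ^^ m) (\<lambda>z. \<eta> \<epsilon> z - (\<epsilon> * cos z + \<epsilon>^2 * wave_eta2 j \<gamma> \<alpha>1 k * cos (2 * z)
            + \<epsilon>^3 * wave_eta3 j \<gamma> \<alpha>1 \<alpha>2 k * cos (3 * z))) z\<bar> \<le> C * \<epsilon>^4) \<and>
     (\<lambda>\<epsilon>. c \<epsilon> - (wave_c0 j \<gamma> k + \<epsilon>^2 * wave_c2 j \<gamma> \<alpha>1 \<alpha>2 k)) \<in> O[at 0](\<lambda>\<epsilon>. \<epsilon>^4)"

section \<open>The spectral problem\<close>

text \<open>For a wave with profile \<open>\<eta>\<close> and speed c (at a fixed amplitude), \<open>G_coeff\<close> is the n-th
  Fourier coefficient of

  \<open>\<mu> \<partial>\<^sub>z \<phi> - k\<^sup>2 \<partial>\<^sub>z\<^sup>2 (c \<phi> - J\<^sub>k \<phi> - 2 \<alpha>1 \<eta> \<phi> - 3 \<alpha>2 \<eta>\<^sup>2 \<phi>) - \<rho>\<^sup>2 \<phi> - \<gamma> \<phi>\<close>,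

  where \<open>\<mu>\<close> is the spectral parameter and \<open>\<partial>\<^sub>z\<close> is multiplication by \<open>\<i> n\<close>, and \<open>G_maps\<close> says that the operator sends
  \<open>\<phi>\<close> to \<open>\<psi>\<close>.\<close>

definition G_coeff ::
  "(real \<Rightarrow> real) \<Rightarrow> real \<Rightarrow> real \<Rightarrow> real \<Rightarrow> real \<Rightarrow> (real \<Rightarrow> real) \<Rightarrow> real
     \<Rightarrow> complex \<Rightarrow> real \<Rightarrow> (real \<Rightarrow> complex) \<Rightarrow> int \<Rightarrow> complex" where
  "G_coeff j \<gamma> \<alpha>1 \<alpha>2 k \<eta> c \<mu> \<rho> \<phi> n =
     \<mu> * (\<i> * of_int n) * fourier \<phi> n
     - of_real (k^2) * (\<i> * of_int n)^2 *
         (of_real c * fourier \<phi> n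
          - of_real (j (k * of_int n)) * fourier \<phi> n
          - of_real (2 * \<alpha>1) * fourier (\<lambda>z. of_real (\<eta> z) * \<phi> z) n
          - of_real (3 * \<alpha>2) * fourier (\<lambda>z. of_real ((\<eta> z)^2) * \<phi> z) n)
     - of_real (\<rho>^2) * fourier \<phi> n - of_real \<gamma> * fourier \<phi> n"

definition G_maps ::
  "(real \<Rightarrow> real) \<Rightarrow> real \<Rightarrow> real \<Rightarrow> real \<Rightarrow> real \<Rightarrow> (real \<Rightarrow> real) \<Rightarrow> real
     \<Rightarrow> complex \<Rightarrow> real \<Rightarrow> (real \<Rightarrow> complex) \<Rightarrow> (real \<Rightarrow> complex) \<Rightarrow> bool" where
  "G_maps j \<gamma> \<alpha>1 \<alpha>2 k \<eta> c \<mu> \<rho> \<phi> \<psi> \<longleftrightarrow>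
     \<psi> \<in> L2T \<and> (\<forall>n. fourier \<psi> n = G_coeff j \<gamma> \<alpha>1 \<alpha>2 k \<eta> c \<mu> \<rho> \<phi> n)"

text \<open>Invertibility as an operator in L2 with the given Sobolev domain: surjective, injective,
  and with bounded inverse.\<close>

definition G_invertible ::
  "(real \<Rightarrow> real) \<Rightarrow> real \<Rightarrow> real \<Rightarrow> real \<Rightarrow> real \<Rightarrow> real \<Rightarrow> (real \<Rightarrow> real) \<Rightarrow> real
     \<Rightarrow> complex \<Rightarrow> real \<Rightarrow> bool" where
  "G_invertible j b \<gamma> \<alpha>1 \<alpha>2 k \<eta> c \<mu> \<rho> \<longleftrightarrow>
     (let D = sobolevT (2 + max b 0); G = G_maps j \<gamma> \<alpha>1 \<alpha>2 k \<eta> c \<mu> \<rho> in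
        (\<forall>\<psi>\<in>L2T. \<exists>\<phi>\<in>D. G \<phi> \<psi>) \<and>
        (\<forall>\<phi>\<in>D. G \<phi> (\<lambda>_. 0) \<longrightarrow> (AE z in torus. \<phi> z = 0)) \<and>
        (\<exists>C. \<forall>\<phi>\<in>D. \<forall>\<psi>. G \<phi> \<psi> \<longrightarrow> L2T_norm \<phi> \<le> C * L2T_norm \<psi>))"

definition periodic_instability ::
  "(real \<Rightarrow> real) \<Rightarrow> real \<Rightarrow> real \<Rightarrow> real \<Rightarrow> real \<Rightarrow> real \<Rightarrow> (real \<Rightarrow> real) \<Rightarrow> real \<Rightarrow> real \<Rightarrow> bool" where
  "periodic_instability j b \<gamma> \<alpha>1 \<alpha>2 k \<eta> c \<rho> \<longleftrightarrow>
     (\<exists>\<mu>. Re \<mu> > 0 \<and> \<not> G_invertible j b \<gamma> \<alpha>1 \<alpha>2 k \<eta> c \<mu> \<rho>)"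

definition long_wave_unstable ::
  "(real \<Rightarrow> real) \<Rightarrow> real \<Rightarrow> real \<Rightarrow> real \<Rightarrow> real \<Rightarrow> real \<Rightarrow> (real \<Rightarrow> real \<Rightarrow> real) \<Rightarrow> (real \<Rightarrow> real) \<Rightarrow> bool" where
  "long_wave_unstable j b \<gamma> \<alpha>1 \<alpha>2 k \<eta> c \<longleftrightarrow>
     (\<forall>\<rho>0>0. \<exists>\<epsilon>0>0. \<forall>\<epsilon>. 0 < \<bar>\<epsilon>\<bar> \<and> \<bar>\<epsilon>\<bar> < \<epsilon>0 \<longrightarrow>
        (\<exists>\<rho>. 0 < \<bar>\<rho>\<bar> \<and> \<bar>\<rho>\<bar> \<le> \<rho>0 \<and> periodic_instability j b \<gamma> \<alpha>1 \<alpha>2 k (\<eta> \<epsilon>) (c \<epsilon>) \<rho>))"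

definition long_wave_stable ::
  "(real \<Rightarrow> real) \<Rightarrow> real \<Rightarrow> real \<Rightarrow> real \<Rightarrow> real \<Rightarrow> real \<Rightarrow> (real \<Rightarrow> real \<Rightarrow> real) \<Rightarrow> (real \<Rightarrow> real) \<Rightarrow> bool" where
  "long_wave_stable j b \<gamma> \<alpha>1 \<alpha>2 k \<eta> c \<longleftrightarrow>
     (\<exists>\<rho>0>0. \<exists>\<epsilon>0>0. \<forall>\<epsilon>. 0 < \<bar>\<epsilon>\<bar> \<and> \<bar>\<epsilon>\<bar> < \<epsilon>0 \<longrightarrow>
        (\<forall>\<rho>. 0 < \<bar>\<rho>\<bar> \<and> \<bar>\<rho>\<bar> \<le> \<rho>0 \<longrightarrow> \<not> periodic_instability j b \<gamma> \<alpha>1 \<alpha>2 k (\<eta> \<epsilon>) (c \<epsilon>) \<rho>))"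

end

theory Submission
  imports Defs
begin

text \<open>In Fourier coefficients the operator becomes \<open>n\<^sup>2 ((\<i> \<mu> / n + d n) \<phi> n - (q * \<phi>) n)\<close>, where \<open>d\<close> is
  real with \<open>d 1 = d (-1) = - \<rho>\<^sup>2\<close> and \<open>q\<close> is the sequence of Fourier coefficients of
  \<open>k\<^sup>2 (2 \<alpha>1 \<eta> + 3 \<alpha>2 \<eta>\<^sup>2 - (c - c\<^sub>0))\<close>, which is of order \<open>\<epsilon>\<close> in a weighted summable norm.

  Instability, if \<open>d n\<close> is bounded away from 0 for \<open>n \<noteq> 0, 1, -1\<close>: the rows with \<open>\<bar>n\<bar> \<ge> 2\<close> are solved for
  given modes 1 and -1, which leaves a two by two problem. For real \<open>\<mu>\<close> its determinant is the difference of
  the squared moduli of its entries; with \<open>\<rho>\<^sup>2 = k\<^sup>2 \<bar>c\<^sub>2\<bar> \<epsilon>\<^sup>2\<close> and \<open>c\<^sub>2 < 0\<close> it changes sign between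
  \<open>\<mu> = 0\<close> and a value of order 1. If \<open>d n\<close> is not bounded away from 0, it tends to 0 at infinity, and the
  high frequency part of the operator is multiplication by a function that has a zero; wave packets concentrated
  there show that the operator has no bounded inverse, for every \<open>\<mu>\<close>.

  Stability for a decreasing symbol: \<open>L = d - q *\<close> is positive on the modes with \<open>\<bar>n\<bar> \<ge> 2\<close>. For a kernel element
  with \<open>Re \<mu> > 0\<close> both quadratic forms, of \<open>L\<close> and of \<open>A = 1 / n\<close>, vanish. Hence \<open>\<mu>\<close> is small and the modes 1 and -1
  dominate; testing the even and odd parts with \<open>\<eta>'\<close> and with an approximate kernel vector gives
  \<open>\<mu>\<^sup>2 \<approx> - \<rho>\<^sup>2 (\<rho>\<^sup>2 + 2 k\<^sup>2 c\<^sub>2 \<epsilon>\<^sup>2) < 0\<close>, and \<open>\<mu>\<^sup>2\<close> is real, a contradiction. Solvability follows from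
  the Lax-Milgram lemma for \<open>L\<close> modified on these two modes, and the Fredholm alternative.\<close>

section \<open>Square-summable sequences\<close>

text \<open>In the stability part \<rho> and \<epsilon> are independent, so an additive error of
  order \<epsilon>^3 would swamp \<rho>^2 when \<rho> is very small. One of the two test vectors
  therefore has to be exact: \<eta>' lies in the kernel at \<rho> = 0, so its equation carries
  \<rho>^2 as a factor, with no additive remainder. The other equation has a coefficient of size
  \<rho>^2 + \<epsilon>^2, and there an approximation of the derivative of the wave in \<epsilon> is
  enough. In the instability part \<rho> is free. At \<mu> = 0 the two by two problem has, to
  leading order, diagonal entry - \<rho>^2 - k^2 c2 \<epsilon>^2 and off-diagonal entry - k^2 c2
  \<epsilon>^2; the chosen \<rho> makes the former vanish, which maximises the leading-order growth
  rate. Admissibility excludes exact zeros of d n at \<rho> = 0, but not an increasing bounded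
  symbol with limit j k + \<gamma> / k^2: this is the degenerate case. A single packet is no
  contradiction there, since invertibility bounds only the L2 norm of the solution while the packets
  have size one in H2; infinitely many packets with disjoint frequencies are superposed.\<close>

typedef ell2 = "{x :: int \<Rightarrow> complex. (\<lambda>n. (cmod (x n))\<^sup>2) summable_on UNIV}"
  morphisms coef Abs_ell2
  by (intro exI[of _ "\<lambda>_. 0"]) simp

setup_lifting type_definition_ell2

lemma ell2_eqI: "(\<And>n. coef x n = coef y n) \<Longrightarrow> x = y"
  by (simp add: coef_inject[symmetric] fun_eq_iff)

lemma summable_coef_sq: "(\<lambda>n. (cmod (coef x n))\<^sup>2) summable_on UNIV"
  using coef[of x] by simp

lemma summable_on_add_sq:
  fixes f g :: "int \<Rightarrow> complex"
  assumes "(\<lambda>n. (cmod (f n))\<^sup>2) summable_on UNIV" "(\<lambda>n. (cmod (g n))\<^sup>2) summable_on UNIV"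
  shows "(\<lambda>n. (cmod (f n + g n))\<^sup>2) summable_on UNIV"
proof (rule summable_on_comparison_test)
  show "(\<lambda>n. 2 * (cmod (f n))\<^sup>2 + 2 * (cmod (g n))\<^sup>2) summable_on UNIV"
    by (intro summable_on_add summable_on_cmult_right assms)
  fix n
  have "(cmod (f n + g n))\<^sup>2 \<le> (cmod (f n) + cmod (g n))\<^sup>2"
    by (intro power_mono norm_triangle_ineq) auto
  also have "\<dots> \<le> 2 * (cmod (f n))\<^sup>2 + 2 * (cmod (g n))\<^sup>2"
    using sum_squares_bound[of "cmod (f n)" "cmod (g n)"] by (simp add: power2_sum)
  finally show "(cmod (f n + g n))\<^sup>2 \<le> 2 * (cmod (f n))\<^sup>2 + 2 * (cmod (g n))\<^sup>2" .
qed auto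

lemma summable_on_mult_sq:
  fixes f g :: "int \<Rightarrow> complex"
  assumes "(\<lambda>n. (cmod (f n))\<^sup>2) summable_on UNIV" "(\<lambda>n. (cmod (g n))\<^sup>2) summable_on UNIV"
  shows "(\<lambda>n. cmod (f n) * cmod (g n)) summable_on UNIV"
proof (rule summable_on_comparison_test)
  show "(\<lambda>n. (cmod (f n))\<^sup>2 + (cmod (g n))\<^sup>2) summable_on UNIV"
    by (intro summable_on_add assms)
  show "cmod (f n) * cmod (g n) \<le> (cmod (f n))\<^sup>2 + (cmod (g n))\<^sup>2" for n
    using sum_squares_bound[of "cmod (f n)" "cmod (g n)"]
      mult_nonneg_nonneg[OF norm_ge_zero norm_ge_zero, of "f n" "g n"] by linarith
qed auto

instantiation ell2 :: real_vector
begin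

lift_definition zero_ell2 :: ell2 is "\<lambda>_. 0" by simp
lift_definition plus_ell2 :: "ell2 \<Rightarrow> ell2 \<Rightarrow> ell2" is "\<lambda>x y n. x n + y n"
  by (simp add: summable_on_add_sq)
lift_definition uminus_ell2 :: "ell2 \<Rightarrow> ell2" is "\<lambda>x n. - x n" by simp
lift_definition minus_ell2 :: "ell2 \<Rightarrow> ell2 \<Rightarrow> ell2" is "\<lambda>x y n. x n - y n"
proof -
  fix f g :: "int \<Rightarrow> complex"
  assume "(\<lambda>n. (cmod (f n))\<^sup>2) summable_on UNIV" "(\<lambda>n. (cmod (g n))\<^sup>2) summable_on UNIV"
  then show "(\<lambda>n. (cmod (f n - g n))\<^sup>2) summable_on UNIV"
    using summable_on_add_sq[of f "\<lambda>n. - g n"] by simp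
qed
lift_definition scaleR_ell2 :: "real \<Rightarrow> ell2 \<Rightarrow> ell2" is "\<lambda>c x n. c *\<^sub>R x n"
  by (simp add: power_mult_distrib summable_on_cmult_right)

instance
  by standard (transfer; simp add: algebra_simps)+
end

text \<open>The class \<open>real_inner\<close> is over the reals, so complex scalars form a
  separate operation; linearity over them is proved operator by operator.\<close>

lift_definition cmul :: "complex \<Rightarrow> ell2 \<Rightarrow> ell2" is "\<lambda>c x n. c * x n"
  by (simp add: norm_mult power_mult_distrib summable_on_cmult_right)

lemma coef_simps [simp]:
  "coef 0 n = 0" "coef (x + y) n = coef x n + coef y n" "coef (x - y) n = coef x n - coef y n"
  "coef (- x) n = - coef x n" "coef (r *\<^sub>R x) n = r *\<^sub>R coef x n" "coef (cmul c x) n = c * coef x n"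
  by (simp_all add: zero_ell2.rep_eq plus_ell2.rep_eq minus_ell2.rep_eq uminus_ell2.rep_eq
      scaleR_ell2.rep_eq cmul.rep_eq)

definition cinner :: "ell2 \<Rightarrow> ell2 \<Rightarrow> complex" where
  "cinner x y = (\<Sum>\<^sub>\<infinity>n. coef x n * cnj (coef y n))"

lemma cinner_summable: "(\<lambda>n. coef x n * cnj (coef y n)) summable_on UNIV"
proof (rule abs_summable_summable)
  show "(\<lambda>n. norm (coef x n * cnj (coef y n))) summable_on UNIV"
    using summable_on_mult_sq[OF summable_coef_sq summable_coef_sq, of x y] by (simp add: norm_mult)
qed

lemma cinner_add_left: "cinner (x + y) z = cinner x z + cinner y z"
  unfolding cinner_def coef_simps distrib_right by (rule infsum_add) (rule cinner_summable)+

lemma cinner_commute: "cinner y x = cnj (cinner x y)"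
  unfolding cinner_def infsum_cnj[symmetric]
  by (rule infsum_cong) (simp only: complex_cnj_mult complex_cnj_cnj mult.commute)

lemma cinner_add_right: "cinner x (y + z) = cinner x y + cinner x z"
  by (metis cinner_commute cinner_add_left complex_cnj_add)

lemma cinner_cmul_left: "cinner (cmul c x) y = c * cinner x y"
  unfolding cinner_def by (simp add: mult.assoc infsum_cmult_right' )

lemma cinner_cmul_right: "cinner x (cmul c y) = cnj c * cinner x y"
  by (metis cinner_commute cinner_cmul_left complex_cnj_mult)

lemma cinner_scaleR_left: "cinner (r *\<^sub>R x) y = of_real r * cinner x y"
proof -
  have "r *\<^sub>R x = cmul (of_real r) x"
    by (rule ell2_eqI) (simp add: scaleR_conv_of_real)
  then show ?thesis by (simp add: cinner_cmul_left)
qed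

lemma cinner_self: "cinner x x = of_real (\<Sum>\<^sub>\<infinity>n. (cmod (coef x n))\<^sup>2)"
  unfolding cinner_def
  using infsumI[OF has_sum_of_real[OF has_sum_infsum[OF summable_coef_sq[of x]], where 'a = complex]]
  by (simp flip: complex_norm_square)

text \<open>The inner product is the real part of \<open>cinner\<close>. It carries coercivity and
  the Lax-Milgram lemma, while \<open>cinner\<close> itself is kept for symmetry, parity and the
  reality of quadratic forms.\<close>

instantiation ell2 :: real_inner
begin

definition inner_ell2 :: "ell2 \<Rightarrow> ell2 \<Rightarrow> real" where
  "inner_ell2 x y = Re (cinner x y)"
definition norm_ell2 :: "ell2 \<Rightarrow> real" where
  "norm_ell2 x = sqrt (inner x x)"
definition dist_ell2 :: "ell2 \<Rightarrow> ell2 \<Rightarrow> real" where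
  "dist_ell2 x y = norm (x - y)"
definition sgn_ell2 :: "ell2 \<Rightarrow> ell2" where
  "sgn_ell2 x = x /\<^sub>R norm x"
definition uniformity_ell2 :: "(ell2 \<times> ell2) filter" where
  "uniformity_ell2 = (INF e\<in>{0 <..}. principal {(x, y). dist x y < e})"
definition open_ell2 :: "ell2 set \<Rightarrow> bool" where
  "open_ell2 U \<longleftrightarrow> (\<forall>x\<in>U. \<forall>\<^sub>F (x', y) in uniformity. x' = x \<longrightarrow> y \<in> U)"

instance
proof
  fix x y z :: ell2 and r :: real
  show "inner x y = inner y x"
    by (simp add: inner_ell2_def cinner_commute[of y x])
  show "inner (x + y) z = inner x z + inner y z"
    by (simp add: inner_ell2_def cinner_add_left)
  show "inner (r *\<^sub>R x) y = r * inner x y"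
    by (simp add: inner_ell2_def cinner_scaleR_left)
  show "0 \<le> inner x x"
    by (simp add: inner_ell2_def cinner_self infsum_nonneg)
  show "inner x x = 0 \<longleftrightarrow> x = 0"
  proof
    assume "inner x x = 0"
    then have "(cmod (coef x n))\<^sup>2 = 0" for n
      using nonneg_infsum_le_0D[OF _ summable_coef_sq, of x n]
      by (simp add: inner_ell2_def cinner_self)
    then show "x = 0" by (intro ell2_eqI) simp
  qed (simp add: inner_ell2_def cinner_def)
  show "dist x y = norm (x - y)" by (fact dist_ell2_def)
  show "sgn x = x /\<^sub>R norm x" by (fact sgn_ell2_def)
  show "(uniformity :: (ell2 \<times> ell2) filter) = (INF e\<in>{0 <..}. principal {(x, y). dist x y < e})"
    by (fact uniformity_ell2_def)
  show "open U \<longleftrightarrow> (\<forall>x\<in>U. \<forall>\<^sub>F (x', y) in uniformity. x' = x \<longrightarrow> y \<in> U)" for U :: "ell2 set"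
    by (fact open_ell2_def)
  show "norm x = sqrt (inner x x)" by (fact norm_ell2_def)
qed

end

lemma norm_ell2_sq: "(norm x)\<^sup>2 = (\<Sum>\<^sub>\<infinity>n. (cmod (coef x n))\<^sup>2)"
  using inner_ge_zero[of x] by (simp add: power2_norm_eq_inner inner_ell2_def cinner_self)

lemma norm_coef_sum_le: "finite F \<Longrightarrow> (\<Sum>n\<in>F. (cmod (coef x n))\<^sup>2) \<le> (norm x)\<^sup>2"
  unfolding norm_ell2_sq by (rule finite_sum_le_infsum) (auto simp: summable_coef_sq)

lemma norm_coef_le: "cmod (coef x n) \<le> norm x"
  using norm_coef_sum_le[of "{n}" x] by (auto intro: power2_le_imp_le[OF _ norm_ge_zero])

lemma norm_cmul [simp]: "norm (cmul c x) = cmod c * norm x"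
proof -
  have "(norm (cmul c x))\<^sup>2 = (cmod c * norm x)\<^sup>2"
    by (simp add: norm_ell2_sq norm_mult power_mult_distrib infsum_cmult_right')
  then show ?thesis by simp
qed

text \<open>Serves where membership in the space is not known beforehand: a bound on all finite
  partial sums yields summability and the norm bound together.\<close>

lemma ell2_norm_le_iff_finite:
  assumes "\<And>F. finite F \<Longrightarrow> (\<Sum>n\<in>F. (cmod (f n))\<^sup>2) \<le> B\<^sup>2" and "B \<ge> 0"
  shows "(\<lambda>n. (cmod (f n))\<^sup>2) summable_on UNIV" "norm (Abs_ell2 f) \<le> B"
proof -
  show s: "(\<lambda>n. (cmod (f n))\<^sup>2) summable_on UNIV"
    by (rule nonneg_bdd_above_summable_on) (auto intro!: bdd_aboveI2[where M = "B\<^sup>2"] assms)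
  then have "coef (Abs_ell2 f) = f" by (simp add: Abs_ell2_inverse)
  then have "(norm (Abs_ell2 f))\<^sup>2 \<le> B\<^sup>2"
    unfolding norm_ell2_sq by (intro infsum_le_finite_sums) (auto simp: s assms(1))
  then show "norm (Abs_ell2 f) \<le> B" using assms(2) by (rule power2_le_imp_le)
qed

lemma coef_Abs: "(\<lambda>n. (cmod (f n))\<^sup>2) summable_on UNIV \<Longrightarrow> coef (Abs_ell2 f) = f"
  by (simp add: Abs_ell2_inverse)

instance ell2 :: complete_space
proof
  fix X :: "nat \<Rightarrow> ell2"
  assume X: "Cauchy X"
  have "Cauchy (\<lambda>k. coef (X k) n)" for n
    unfolding Cauchy_def
  proof (intro allI impI)
    fix e :: real assume "e > 0"
    with X obtain M where M: "\<And>a b. a \<ge> M \<Longrightarrow> b \<ge> M \<Longrightarrow> dist (X a) (X b) < e"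
      unfolding Cauchy_def by blast
    show "\<exists>M. \<forall>a\<ge>M. \<forall>b\<ge>M. dist (coef (X a) n) (coef (X b) n) < e"
    proof (intro exI[of _ M] allI impI)
      fix a b assume "a \<ge> M" "b \<ge> M"
      then show "dist (coef (X a) n) (coef (X b) n) < e"
        using M[of a b] norm_coef_le[of "X a - X b" n] by (simp add: dist_norm)
    qed
  qed
  then have "\<exists>l. (\<lambda>k. coef (X k) n) \<longlonglongrightarrow> l" for n
    by (simp add: Cauchy_convergent_iff convergent_def)
  then obtain l where l: "\<And>n. (\<lambda>k. coef (X k) n) \<longlonglongrightarrow> l n" by metis
  \<comment> \<open>In the Cauchy estimate restricted to finitely many coordinates the second index
    tends to infinity; the threshold \<open>M\<close> does not depend on the finite set.\<close>
  have est: "\<exists>M. \<forall>a\<ge>M. \<forall>F. finite F \<longrightarrow> (\<Sum>n\<in>F. (cmod (coef (X a) n - l n))\<^sup>2) \<le> e\<^sup>2" if e: "e > 0" for e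
  proof -
    obtain M where M: "\<And>a b. a \<ge> M \<Longrightarrow> b \<ge> M \<Longrightarrow> dist (X a) (X b) < e"
      using X e unfolding Cauchy_def by blast
    have "(\<Sum>n\<in>F. (cmod (coef (X a) n - l n))\<^sup>2) \<le> e\<^sup>2" if "a \<ge> M" "finite F" for a F
    proof (rule tendsto_upperbound)
      show "(\<lambda>b. \<Sum>n\<in>F. (cmod (coef (X a) n - coef (X b) n))\<^sup>2) \<longlonglongrightarrow> (\<Sum>n\<in>F. (cmod (coef (X a) n - l n))\<^sup>2)"
        by (intro tendsto_intros l)
      show "\<forall>\<^sub>F b in sequentially. (\<Sum>n\<in>F. (cmod (coef (X a) n - coef (X b) n))\<^sup>2) \<le> e\<^sup>2"
        using eventually_ge_at_top[of M]
      proof eventually_elim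
        case (elim b)
        have "(\<Sum>n\<in>F. (cmod (coef (X a) n - coef (X b) n))\<^sup>2) \<le> (norm (X a - X b))\<^sup>2"
          using norm_coef_sum_le[OF that(2), of "X a - X b"] by simp
        also have "\<dots> \<le> e\<^sup>2" using M[OF that(1) elim] by (intro power_mono) (auto simp: dist_norm)
        finally show ?case .
      qed
    qed simp
    then show ?thesis by blast
  qed
  have sl: "(\<lambda>n. (cmod (l n))\<^sup>2) summable_on UNIV"
  proof -
    obtain M where M: "\<And>F. finite F \<Longrightarrow> (\<Sum>n\<in>F. (cmod (coef (X M) n - l n))\<^sup>2) \<le> 1\<^sup>2"
      using est[OF zero_less_one] by blast
    have "(\<lambda>n. (cmod (coef (X M) n - l n))\<^sup>2) summable_on UNIV"
      by (rule ell2_norm_le_iff_finite(1)[OF M]) auto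
    then have "(\<lambda>n. (cmod (- (coef (X M) n - l n) + coef (X M) n))\<^sup>2) summable_on UNIV"
      by (intro summable_on_add_sq summable_coef_sq) (simp add: norm_minus_commute)
    then show ?thesis by simp
  qed
  have "X \<longlonglongrightarrow> Abs_ell2 l"
    unfolding lim_sequentially
  proof (intro allI impI)
    fix e :: real assume "e > 0"
    then have "e / 2 > 0" by simp
    from est[OF this] obtain M where
      M: "\<And>a F. a \<ge> M \<Longrightarrow> finite F \<Longrightarrow> (\<Sum>n\<in>F. (cmod (coef (X a) n - l n))\<^sup>2) \<le> (e/2)\<^sup>2"
      by blast
    have "dist (X a) (Abs_ell2 l) < e" if "a \<ge> M" for a
    proof -
      have "X a - Abs_ell2 l = Abs_ell2 (\<lambda>n. coef (X a) n - l n)"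
      proof (rule ell2_eqI)
        show "coef (X a - Abs_ell2 l) n = coef (Abs_ell2 (\<lambda>n. coef (X a) n - l n)) n" for n
          using ell2_norm_le_iff_finite(1)[OF M[OF that]] \<open>e > 0\<close> by (simp add: coef_Abs sl)
      qed
      then have "dist (X a) (Abs_ell2 l) \<le> e / 2"
        using ell2_norm_le_iff_finite(2)[OF M[OF that]] \<open>e > 0\<close> by (simp add: dist_norm)
      then show ?thesis using \<open>e > 0\<close> by simp
    qed
    then show "\<exists>M. \<forall>a\<ge>M. dist (X a) (Abs_ell2 l) < e" by blast
  qed
  then show "convergent X" by (auto simp: convergent_def)
qed

lemma cmod_cinner_le: "cmod (cinner x y) \<le> norm x * norm y"
proof (cases "cinner x y = 0")
  case False
  define c where "c = cnj (sgn (cinner x y))"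
  have c: "cmod c = 1" using False by (simp add: c_def norm_sgn)
  have "c * cinner x y = of_real (cmod (cinner x y))"
    using False by (simp add: c_def sgn_eq complex_norm_square[symmetric] power2_eq_square field_simps)
  then have "cmod (cinner x y) = inner (cmul c x) y"
    by (simp add: inner_ell2_def cinner_cmul_left)
  also have "\<dots> \<le> norm (cmul c x) * norm y" by (rule norm_cauchy_schwarz)
  finally show ?thesis by (simp add: c)
qed simp

lemma infsum_Cauchy_Schwarz:
  fixes f g :: "int \<Rightarrow> real"
  assumes "(\<lambda>n. (f n)\<^sup>2) summable_on UNIV" "(\<lambda>n. (g n)\<^sup>2) summable_on UNIV"
  shows "(\<Sum>\<^sub>\<infinity>n. f n * g n)\<^sup>2 \<le> (\<Sum>\<^sub>\<infinity>n. (f n)\<^sup>2) * (\<Sum>\<^sub>\<infinity>n. (g n)\<^sup>2)"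
proof -
  let ?x = "Abs_ell2 (\<lambda>n. of_real (f n))" and ?y = "Abs_ell2 (\<lambda>n. of_real (g n))"
  have x: "coef ?x = (\<lambda>n. of_real (f n))" and y: "coef ?y = (\<lambda>n. of_real (g n))"
    using assms by (simp_all add: coef_Abs)
  have s: "(\<lambda>n. f n * g n) summable_on UNIV"
  proof (rule abs_summable_summable)
    show "(\<lambda>n. norm (f n * g n)) summable_on UNIV"
      using summable_on_mult_sq[of "\<lambda>n. of_real (f n)" "\<lambda>n. of_real (g n)"] assms
      by (simp add: abs_mult)
  qed
  have "cinner ?x ?y = of_real (\<Sum>\<^sub>\<infinity>n. f n * g n)"
    unfolding cinner_def x y using infsumI[OF has_sum_of_real[OF has_sum_infsum[OF s], where 'a = complex]]
    by simp
  then have "\<bar>\<Sum>\<^sub>\<infinity>n. f n * g n\<bar> \<le> norm ?x * norm ?y"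
    using cmod_cinner_le[of ?x ?y] by simp
  then have "(\<Sum>\<^sub>\<infinity>n. f n * g n)\<^sup>2 \<le> (norm ?x * norm ?y)\<^sup>2"
    using power_mono[of "\<bar>\<Sum>\<^sub>\<infinity>n. f n * g n\<bar>" "norm ?x * norm ?y" 2] by simp
  then show ?thesis by (simp add: power_mult_distrib norm_ell2_sq x y)
qed

section \<open>Matrices dominated by a summable convolution kernel\<close>

lemma bij_minus_left: "bij (\<lambda>m. n - m :: int)"
  by (rule bij_betwI[where g = "\<lambda>m. n - m"]) auto

lemma bij_minus_right: "bij (\<lambda>m. m - n :: int)"
  by (rule bij_betwI[where g = "\<lambda>m. m + n"]) auto

lemma summable_on_int_shift:
  fixes \<kappa> :: "int \<Rightarrow> 'a :: {comm_monoid_add, topological_space}"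
  assumes "\<kappa> summable_on UNIV"
  shows "(\<lambda>m. \<kappa> (n - m)) summable_on UNIV" "(\<lambda>m. \<kappa> (m - n)) summable_on UNIV"
  using summable_on_reindex_bij_betw[OF bij_minus_left, of \<kappa> n]
    summable_on_reindex_bij_betw[OF bij_minus_right, of \<kappa> n] assms by auto

lemma infsum_int_shift:
  fixes \<kappa> :: "int \<Rightarrow> 'a :: {comm_monoid_add, t2_space}"
  shows "(\<Sum>\<^sub>\<infinity>m. \<kappa> (n - m)) = (\<Sum>\<^sub>\<infinity>m. \<kappa> m)" "(\<Sum>\<^sub>\<infinity>m. \<kappa> (m - n)) = (\<Sum>\<^sub>\<infinity>m. \<kappa> m)"
  using infsum_reindex_bij_betw[OF bij_minus_left, of \<kappa> n]
    infsum_reindex_bij_betw[OF bij_minus_right, of \<kappa> n] by auto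

lemma summable_on_sum_finite:
  fixes f :: "'b \<Rightarrow> 'a \<Rightarrow> real"
  assumes "finite F" "\<And>n. n \<in> F \<Longrightarrow> f n summable_on A"
  shows "(\<lambda>m. \<Sum>n\<in>F. f n m) summable_on A"
  using assms by (induction F) (auto intro!: summable_on_add)

lemma infsum_sum_finite:
  fixes f :: "'b \<Rightarrow> 'a \<Rightarrow> real"
  assumes "finite F" "\<And>n. n \<in> F \<Longrightarrow> f n summable_on A"
  shows "(\<Sum>\<^sub>\<infinity>m\<in>A. \<Sum>n\<in>F. f n m) = (\<Sum>n\<in>F. \<Sum>\<^sub>\<infinity>m\<in>A. f n m)"
  using assms by (induction F) (auto simp: infsum_add summable_on_sum_finite)

text \<open>The common hypothesis for diagonal matrices, convolutions, and convolutions conjugated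
  by weights. It is preserved by differences, and the sum of \<open>\<kappa>\<close> bounds the
  operator norm.\<close>

definition dominated :: "(int \<Rightarrow> int \<Rightarrow> complex) \<Rightarrow> (int \<Rightarrow> real) \<Rightarrow> bool" where
  "dominated K \<kappa> \<longleftrightarrow> (\<forall>n m. cmod (K n m) \<le> \<kappa> (n - m)) \<and> \<kappa> summable_on UNIV"

lemma dominated_nonneg: "dominated K \<kappa> \<Longrightarrow> \<kappa> n \<ge> 0"
  unfolding dominated_def using norm_ge_zero[of "K n 0"] by (metis diff_zero order_trans)

lemma dominated_summable:
  assumes "dominated K \<kappa>"
  shows "(\<lambda>m. cmod (K n m) * cmod (coef x m)) summable_on UNIV"
proof (rule summable_on_comparison_test)
  show "(\<lambda>m. \<kappa> (n - m) * norm x) summable_on UNIV"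
    using assms by (intro summable_on_cmult_left summable_on_int_shift) (simp add: dominated_def)
  show "cmod (K n m) * cmod (coef x m) \<le> \<kappa> (n - m) * norm x" for m
    using assms dominated_nonneg[OF assms]
    by (intro mult_mono norm_coef_le) (auto simp: dominated_def)
qed auto

lemma dominated_summable':
  assumes "dominated K \<kappa>"
  shows "(\<lambda>m. K n m * coef x m) summable_on UNIV"
proof (rule abs_summable_summable)
  show "(\<lambda>m. norm (K n m * coef x m)) summable_on UNIV"
    using dominated_summable[OF assms] by (simp add: norm_mult)
qed

definition kop :: "(int \<Rightarrow> int \<Rightarrow> complex) \<Rightarrow> ell2 \<Rightarrow> ell2" where
  "kop K x = Abs_ell2 (\<lambda>n. \<Sum>\<^sub>\<infinity>m. K n m * coef x m)"

text \<open>Schur test. Write \<open>\<kappa> = sqrt \<kappa> * sqrt \<kappa>\<close> and apply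
  Cauchy-Schwarz in each row; the row sums and the column sums of \<open>\<kappa> (n - m)\<close>
  are both equal to the sum of \<open>\<kappa>\<close>. Only finitely many rows are added, as the
  image is not yet known to be square summable.\<close>

lemma kop_bound:
  assumes K: "dominated K \<kappa>" and F: "finite F"
  shows "(\<Sum>n\<in>F. (cmod (\<Sum>\<^sub>\<infinity>m. K n m * coef x m))\<^sup>2) \<le> ((\<Sum>\<^sub>\<infinity>n. \<kappa> n) * norm x)\<^sup>2"
proof -
  define S where "S = (\<Sum>\<^sub>\<infinity>n. \<kappa> n)"
  have k0: "\<kappa> n \<ge> 0" for n using dominated_nonneg[OF K] .
  have sk: "\<kappa> summable_on UNIV" using K by (simp add: dominated_def)
  have S0: "S \<ge> 0" unfolding S_def by (intro infsum_nonneg k0)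
  have s1: "(\<lambda>m. \<kappa> (n - m) * (cmod (coef x m))\<^sup>2) summable_on UNIV" for n
  proof (rule summable_on_comparison_test)
    show "(\<lambda>m. \<kappa> (n - m) * (norm x)\<^sup>2) summable_on UNIV"
      by (intro summable_on_cmult_left summable_on_int_shift sk)
    show "\<kappa> (n - m) * (cmod (coef x m))\<^sup>2 \<le> \<kappa> (n - m) * (norm x)\<^sup>2" for m
      by (intro mult_left_mono power_mono norm_coef_le k0) auto
  qed (auto intro!: mult_nonneg_nonneg k0)
  have row: "(cmod (\<Sum>\<^sub>\<infinity>m. K n m * coef x m))\<^sup>2 \<le> S * (\<Sum>\<^sub>\<infinity>m. \<kappa> (n - m) * (cmod (coef x m))\<^sup>2)" for n
  proof -
    have "cmod (\<Sum>\<^sub>\<infinity>m. K n m * coef x m) \<le> (\<Sum>\<^sub>\<infinity>m. cmod (K n m * coef x m))"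
      using dominated_summable[OF K] by (intro norm_infsum_bound) (simp add: norm_mult)
    also have "\<dots> \<le> (\<Sum>\<^sub>\<infinity>m. sqrt (\<kappa> (n - m)) * (sqrt (\<kappa> (n - m)) * cmod (coef x m)))"
    proof (rule infsum_mono)
      show "(\<lambda>m. cmod (K n m * coef x m)) summable_on UNIV"
        using dominated_summable[OF K] by (simp add: norm_mult)
      have "(\<lambda>m. \<kappa> (n - m) * cmod (coef x m)) summable_on UNIV"
        using dominated_summable[of "\<lambda>n m. of_real (\<kappa> (n - m))" \<kappa> n x] k0 sk by (simp add: dominated_def)
      then show "(\<lambda>m. sqrt (\<kappa> (n - m)) * (sqrt (\<kappa> (n - m)) * cmod (coef x m))) summable_on UNIV"
        using k0 by (simp flip: mult.assoc)
      show "cmod (K n m * coef x m) \<le> sqrt (\<kappa> (n - m)) * (sqrt (\<kappa> (n - m)) * cmod (coef x m))" for m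
        using k0 K by (simp add: norm_mult dominated_def mult_right_mono flip: mult.assoc)
    qed
    finally have "(cmod (\<Sum>\<^sub>\<infinity>m. K n m * coef x m))\<^sup>2
        \<le> (\<Sum>\<^sub>\<infinity>m. sqrt (\<kappa> (n - m)) * (sqrt (\<kappa> (n - m)) * cmod (coef x m)))\<^sup>2"
      by (rule power_mono) simp
    also have "\<dots> \<le> (\<Sum>\<^sub>\<infinity>m. (sqrt (\<kappa> (n - m)))\<^sup>2) * (\<Sum>\<^sub>\<infinity>m. (sqrt (\<kappa> (n - m)) * cmod (coef x m))\<^sup>2)"
      using s1 k0 by (intro infsum_Cauchy_Schwarz) (simp_all add: power_mult_distrib summable_on_int_shift sk)
    also have "\<dots> = S * (\<Sum>\<^sub>\<infinity>m. \<kappa> (n - m) * (cmod (coef x m))\<^sup>2)"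
      using k0 by (simp add: power_mult_distrib S_def infsum_int_shift)
    finally show ?thesis .
  qed
  have col: "(\<Sum>n\<in>F. \<kappa> (n - m)) \<le> S" for m
    unfolding S_def infsum_int_shift(2)[of \<kappa> m, symmetric]
    by (rule finite_sum_le_infsum) (auto intro: k0 summable_on_int_shift sk F)
  have "(\<Sum>n\<in>F. (cmod (\<Sum>\<^sub>\<infinity>m. K n m * coef x m))\<^sup>2) \<le> (\<Sum>n\<in>F. S * (\<Sum>\<^sub>\<infinity>m. \<kappa> (n - m) * (cmod (coef x m))\<^sup>2))"
    by (intro sum_mono row)
  also have "\<dots> = S * (\<Sum>\<^sub>\<infinity>m. \<Sum>n\<in>F. \<kappa> (n - m) * (cmod (coef x m))\<^sup>2)"
    unfolding sum_distrib_left[symmetric] by (simp add: infsum_sum_finite F s1)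
  also have "\<dots> \<le> S * (\<Sum>\<^sub>\<infinity>m. S * (cmod (coef x m))\<^sup>2)"
  proof (intro mult_left_mono S0 infsum_mono)
    show "(\<lambda>m. \<Sum>n\<in>F. \<kappa> (n - m) * (cmod (coef x m))\<^sup>2) summable_on UNIV"
      by (intro summable_on_sum_finite F s1)
    show "(\<lambda>m. S * (cmod (coef x m))\<^sup>2) summable_on UNIV"
      by (intro summable_on_cmult_right summable_coef_sq)
    show "(\<Sum>n\<in>F. \<kappa> (n - m) * (cmod (coef x m))\<^sup>2) \<le> S * (cmod (coef x m))\<^sup>2" for m
      unfolding sum_distrib_right[symmetric] by (intro mult_right_mono col) auto
  qed
  also have "(\<Sum>\<^sub>\<infinity>m. S * (cmod (coef x m))\<^sup>2) = S * (norm x)\<^sup>2"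
    by (simp add: norm_ell2_sq infsum_cmult_right')
  finally show ?thesis by (simp add: S_def[symmetric] power2_eq_square algebra_simps)
qed

lemma kop:
  assumes "dominated K \<kappa>"
  shows coef_kop: "coef (kop K x) n = (\<Sum>\<^sub>\<infinity>m. K n m * coef x m)"
    and norm_kop: "norm (kop K x) \<le> (\<Sum>\<^sub>\<infinity>n. \<kappa> n) * norm x"
proof -
  have nn: "0 \<le> (\<Sum>\<^sub>\<infinity>n. \<kappa> n) * norm x"
    by (intro mult_nonneg_nonneg infsum_nonneg dominated_nonneg[OF assms]) auto
  show "coef (kop K x) n = (\<Sum>\<^sub>\<infinity>m. K n m * coef x m)"
    unfolding kop_def by (subst coef_Abs) (use ell2_norm_le_iff_finite(1)[OF kop_bound[OF assms] nn] in auto)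
  show "norm (kop K x) \<le> (\<Sum>\<^sub>\<infinity>n. \<kappa> n) * norm x"
    unfolding kop_def by (rule ell2_norm_le_iff_finite(2)[OF kop_bound[OF assms] nn])
qed

lemma kop_bounded_linear:
  assumes "dominated K \<kappa>"
  shows "bounded_linear (kop K)"
proof (rule bounded_linear_intro)
  show "kop K (x + y) = kop K x + kop K y" for x y
    by (rule ell2_eqI) (simp add: coef_kop[OF assms] distrib_left infsum_add dominated_summable'[OF assms])
  show "kop K (r *\<^sub>R x) = r *\<^sub>R kop K x" for r x
    by (rule ell2_eqI) (simp add: coef_kop[OF assms] scaleR_conv_of_real mult.left_commute infsum_cmult_right')
  show "norm (kop K x) \<le> norm x * (\<Sum>\<^sub>\<infinity>n. \<kappa> n)" for x
    using norm_kop[OF assms, of x] by (simp add: mult.commute)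
qed

lemma kop_cmul: "dominated K \<kappa> \<Longrightarrow> kop K (cmul c x) = cmul c (kop K x)"
  by (rule ell2_eqI) (simp add: coef_kop mult.left_commute infsum_cmult_right')

lemma kop_adjoint:
  assumes K: "dominated K \<kappa>" and H: "\<And>n m. K m n = cnj (K n m)"
  shows "cinner (kop K x) y = cinner x (kop K y)"
proof -
  let ?f = "\<lambda>n m. K n m * coef x m * cnj (coef y n)"
  \<comment> \<open>The same estimate for the matrix and the vector of moduli makes the double
    series of \<open>?f\<close> absolutely summable, which justifies the exchange of the two
    sums.\<close>
  define ax where "ax = Abs_ell2 (\<lambda>n. of_real (cmod (coef x n)))"
  have ax: "coef ax n = of_real (cmod (coef x n))" for n
    unfolding ax_def by (subst coef_Abs) (simp_all add: summable_coef_sq)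
  have K': "dominated (\<lambda>n m. of_real (cmod (K n m))) \<kappa>" using K by (simp add: dominated_def)
  let ?z = "\<lambda>n. \<Sum>\<^sub>\<infinity>m. cmod (K n m) * cmod (coef x m)"
  have z: "coef (kop (\<lambda>n m. of_real (cmod (K n m))) ax) n = of_real (?z n)" for n
    unfolding coef_kop[OF K'] ax of_real_mult[symmetric]
    by (rule infsumI) (intro has_sum_of_real has_sum_infsum dominated_summable[OF K])
  have "(\<lambda>n. ?z n * cmod (coef y n)) summable_on UNIV"
    using summable_on_mult_sq[OF summable_coef_sq summable_coef_sq, of "kop (\<lambda>n m. of_real (cmod (K n m))) ax" y]
    unfolding z by (simp add: abs_of_nonneg infsum_nonneg)
  then have "(\<lambda>p. norm (case p of (n, m) \<Rightarrow> ?f n m)) summable_on (UNIV \<times> UNIV)"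
    using dominated_summable[OF K]
    by (subst Infinite_Sum.abs_summable_on_Sigma_iff)
      (simp add: norm_mult infsum_cmult_left' abs_mult abs_of_nonneg infsum_nonneg summable_on_cmult_left)
  then have "(\<lambda>(n, m). ?f n m) summable_on (UNIV \<times> UNIV)" by (rule abs_summable_summable)
  then have "(\<Sum>\<^sub>\<infinity>n. \<Sum>\<^sub>\<infinity>m. ?f n m) = (\<Sum>\<^sub>\<infinity>m. \<Sum>\<^sub>\<infinity>n. ?f n m)" by (rule infsum_swap_banach)
  moreover have "cinner (kop K x) y = (\<Sum>\<^sub>\<infinity>n. \<Sum>\<^sub>\<infinity>m. ?f n m)"
    unfolding cinner_def coef_kop[OF K] by (simp add: infsum_cmult_left')
  moreover have "cinner x (kop K y) = (\<Sum>\<^sub>\<infinity>m. \<Sum>\<^sub>\<infinity>n. ?f n m)"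
  proof -
    have "coef x m * cnj (\<Sum>\<^sub>\<infinity>n. K m n * coef y n) = (\<Sum>\<^sub>\<infinity>n. ?f n m)" for m
      unfolding infsum_cnj[symmetric] infsum_cmult_right'[symmetric] by (rule infsum_cong) (simp add: H[of m])
    then show ?thesis unfolding cinner_def coef_kop[OF K] by simp
  qed
  ultimately show ?thesis by simp
qed

section \<open>Coercive operators and finite-rank perturbations\<close>

theorem lax_milgram:
  fixes B :: "'a :: {real_inner, complete_space} \<Rightarrow> 'a"
  assumes B: "bounded_linear B" and \<delta>: "\<delta> > 0" and coercive: "\<And>x. \<delta> * (norm x)\<^sup>2 \<le> inner (B x) x"
  shows "\<exists>x. B x = f" and "\<delta> * norm x \<le> norm (B x)"
proof -
  interpret bounded_linear B by fact
  obtain M where M: "M > 0" "\<And>x. norm (B x) \<le> norm x * M" using pos_bounded by blast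
  \<comment> \<open>The value minimises \<open>1 - 2 * t * \<delta> + t\<^sup>2 * M\<^sup>2\<close>,
    so that \<open>x - t (B x - f)\<close> is a contraction in x whose fixed point solves
    \<open>B x = f\<close>.\<close>
  define t where "t = \<delta> / M\<^sup>2"
  have t: "t > 0" using \<delta> M by (simp add: t_def)
  have step: "(norm (x - t *\<^sub>R B x))\<^sup>2 \<le> (1 - \<delta>\<^sup>2 / M\<^sup>2) * (norm x)\<^sup>2" for x
  proof -
    have "(norm (x - t *\<^sub>R B x))\<^sup>2 = (norm x)\<^sup>2 - 2 * t * inner (B x) x + t\<^sup>2 * (norm (B x))\<^sup>2"
      unfolding power2_norm_eq_inner
      by (simp add: inner_diff_left inner_diff_right inner_commute power2_eq_square algebra_simps)
    also have "\<dots> \<le> (norm x)\<^sup>2 - 2 * t * (\<delta> * (norm x)\<^sup>2) + t\<^sup>2 * (norm x * M)\<^sup>2"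
      using t coercive[of x] M(2)[of x] by (intro add_mono diff_mono mult_left_mono power_mono) auto
    also have "\<dots> = (1 - \<delta>\<^sup>2 / M\<^sup>2) * (norm x)\<^sup>2"
      using M(1) by (simp add: t_def field_simps power2_eq_square)
    finally show ?thesis .
  qed
  define c where "c = sqrt (1 - \<delta>\<^sup>2 / M\<^sup>2)"
  show "\<exists>x. B x = f"
  \<comment> \<open>A nonzero vector is needed to see that the radicand in \<open>c\<close> is
    nonnegative.\<close>
  proof (cases "\<exists>x :: 'a. x \<noteq> 0")
    case True
    then obtain x0 :: 'a where x0: "x0 \<noteq> 0" by blast
    have "1 - \<delta>\<^sup>2 / M\<^sup>2 \<ge> 0"
      using order_trans[OF zero_le_power2 step[of x0]] x0 by (simp add: zero_le_mult_iff)
    then have c: "0 \<le> c" "c < 1" using \<delta> M by (auto simp: c_def)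
    have "dist (x - t *\<^sub>R (B x - f)) (y - t *\<^sub>R (B y - f)) \<le> c * dist x y" for x y
    proof -
      have "x - t *\<^sub>R (B x - f) - (y - t *\<^sub>R (B y - f)) = (x - y) - t *\<^sub>R B (x - y)"
        by (simp add: diff algebra_simps)
      moreover have "norm ((x - y) - t *\<^sub>R B (x - y)) \<le> c * norm (x - y)"
        using real_sqrt_le_mono[OF step[of "x - y"]] by (simp add: c_def real_sqrt_mult)
      ultimately show ?thesis by (simp only: dist_norm)
    qed
    then have "\<exists>!x. x - t *\<^sub>R (B x - f) = x" by (intro banach_fix_type[OF c]) auto
    then show ?thesis using t by auto
  next
    case False
    then have "B 0 = f" by metis
    then show ?thesis ..
  qed
  show "\<delta> * norm x \<le> norm (B x)"
  proof (cases "x = 0")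
    case False
    have "\<delta> * norm x * norm x \<le> norm (B x) * norm x"
      using coercive[of x] norm_cauchy_schwarz[of "B x" x] by (simp add: power2_eq_square)
    then show ?thesis using False by simp
  qed simp
qed

text \<open>Fredholm alternative in elementary form. With \<open>R\<close> the inverse of
  \<open>B\<close>, the equation \<open>B x - J (P x) = f\<close> reduces to
  \<open>N v = P (R f)\<close> for \<open>v = P x\<close>, where
  \<open>N = 1 - P \<circ> R \<circ> J\<close> acts on a space of finite dimension. A null vector
  \<open>v\<close> of \<open>N\<close> yields the null vector \<open>R (J v)\<close> of the
  perturbed operator, so \<open>inj\<close> makes \<open>N\<close> injective, hence surjective and
  bounded below.\<close>

lemma finite_rank_perturbation:
  fixes B :: "'a::real_normed_vector \<Rightarrow> 'a" and P :: "'a \<Rightarrow> 'f::euclidean_space" and J :: "'f \<Rightarrow> 'a"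
  assumes B: "bounded_linear B" and P: "bounded_linear P" and J: "bounded_linear J"
    and surj: "\<And>f. \<exists>x. B x = f" and \<delta>: "\<delta> > 0" "\<And>x. \<delta> * norm x \<le> norm (B x)"
    and inj: "\<And>x. B x = J (P x) \<Longrightarrow> x = 0"
  shows "\<exists>x. B x - J (P x) = f" and "\<exists>C. \<forall>x. norm x \<le> C * norm (B x - J (P x))"
proof -
  interpret B: bounded_linear B by fact
  interpret P: bounded_linear P by fact
  interpret J: bounded_linear J by fact
  obtain R where R: "\<And>f. B (R f) = f" using surj by metis
  have RB: "R f = x" if "B x = f" for x f
  proof -
    have "\<delta> * norm (R f - x) \<le> 0" using \<delta>(2)[of "R f - x"] by (simp add: B.diff R that)
    then show ?thesis using \<delta>(1) by (simp add: mult_le_0_iff)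
  qed
  have R_add: "R (f + g) = R f + R g" and R_scale: "R (r *\<^sub>R f) = r *\<^sub>R R f" for f g r
    by (rule RB; simp add: B.add B.scaleR R)+
  have R_norm: "norm (R f) \<le> norm f / \<delta>" for f
    using \<delta>(2)[of "R f"] \<delta>(1) by (simp add: R field_simps)
  interpret R: bounded_linear R
    by (rule bounded_linear_intro[where K = "1 / \<delta>"]) (use R_add R_scale R_norm in auto)
  define N where "N v = v - P (R (J v))" for v
  have "linear N"
    unfolding N_def by (intro linearI) (simp_all add: J.add J.scaleR R.add R.scaleR P.add P.scaleR algebra_simps)
  moreover have "v = 0" if "N v = 0" for v
  proof -
    have v: "P (R (J v)) = v" using that by (simp add: N_def)
    then have "B (R (J v)) = J (P (R (J v)))" by (simp add: R)
    then have "R (J v) = 0" by (rule inj)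
    then show ?thesis using v by (simp add: P.zero)
  qed
  ultimately have N: "linear N" "inj N" by (auto simp: linear_injective_0)
  obtain b where b: "b > 0" "\<And>v. b * norm v \<le> norm (N v)"
    using linear_inj_bounded_below_pos[OF N] by blast
  have "surj N" by (rule linear_injective_imp_surjective[OF N refl])
  then obtain v where v: "N v = P (R f)" by (metis surjD)
  have "P (R f + R (J v)) = v" using v by (simp add: N_def P.add algebra_simps)
  then have "B (R f + R (J v)) - J (P (R f + R (J v))) = f" by (simp add: B.add R)
  then show "\<exists>x. B x - J (P x) = f" ..
  obtain CJ where CJ: "CJ \<ge> 0" "\<And>v. norm (J v) \<le> norm v * CJ" using J.nonneg_bounded by blast
  obtain CP where CP: "CP \<ge> 0" "\<And>v. norm (P v) \<le> norm v * CP" using P.nonneg_bounded by blast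
  have "norm x \<le> ((1 + CP / \<delta> / b * CJ) / \<delta>) * norm (B x - J (P x))" for x
  proof -
    define g where "g = B x - J (P x)"
    have x: "x = R (g + J (P x))" by (rule RB[symmetric]) (simp add: g_def)
    have "P x = P (R g) + P (R (J (P x)))" by (subst x) (simp add: R.add P.add)
    then have "N (P x) = P (R g)" by (simp add: N_def algebra_simps)
    then have "b * norm (P x) \<le> norm (P (R g))" using b(2)[of "P x"] by simp
    also have "\<dots> \<le> norm (R g) * CP" by (rule CP)
    also have "\<dots> \<le> norm g / \<delta> * CP" by (intro mult_right_mono R_norm CP)
    finally have "norm (P x) * b \<le> norm g / \<delta> * CP" by (simp only: mult.commute)
    then have px: "norm (P x) \<le> norm g / \<delta> * CP / b" by (rule mult_imp_le_div_pos[OF b(1)])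
    have "norm x \<le> norm (g + J (P x)) / \<delta>" by (subst x) (rule R_norm)
    also have "norm (g + J (P x)) \<le> norm g + norm (P x) * CJ"
      using norm_triangle_ineq[of g "J (P x)"] CJ(2)[of "P x"] by linarith
    also have "\<dots> \<le> norm g + norm g / \<delta> * CP / b * CJ"
      by (intro add_left_mono mult_right_mono px CJ)
    finally show ?thesis using \<delta>(1) by (simp add: g_def divide_right_mono algebra_simps)
  qed
  then show "\<exists>C. \<forall>x. norm x \<le> C * norm (B x - J (P x))" by blast
qed

section \<open>Fourier series on the torus\<close>

lemma torus_finite_measure: "finite_measure torus"
  by (rule finite_measure_lebesgue_on) (simp add: lmeasurable_cbox[of 0 "2*pi", simplified])

lemma measure_torus: "measure torus {0..2*pi} = 2 * pi"
  by (simp add: measure_restrict_space)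

lemma torus_continuous_integrable:
  fixes f :: "real \<Rightarrow> complex"
  shows "continuous_on UNIV f \<Longrightarrow> integrable torus f"
  by (rule continuous_imp_integrable_real) (rule continuous_on_subset, auto)

lemma torus_integrable_mult:
  fixes f g :: "real \<Rightarrow> complex"
  assumes f: "integrable torus f" and g: "g \<in> borel_measurable torus" and B: "\<And>z. z \<in> {0..2*pi} \<Longrightarrow> cmod (g z) \<le> B"
  shows "integrable torus (\<lambda>z. g z * f z)"
proof (rule Bochner_Integration.integrable_bound)
  show "integrable torus (\<lambda>z. of_real B * f z)" using f by simp
  have B0: "B \<ge> 0" using B[of 0] norm_ge_zero[of "g 0"] by (simp del: norm_ge_zero)
  show "AE z in torus. norm (g z * f z) \<le> norm (of_real B * f z)"
    using B B0 by (intro AE_I2) (auto simp: norm_mult intro!: mult_right_mono)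
qed (use f g in measurable)

lemma torus_integral_bound:
  fixes f :: "real \<Rightarrow> complex"
  assumes "integrable torus f" "\<And>z. z \<in> {0..2*pi} \<Longrightarrow> cmod (f z) \<le> B"
  shows "cmod (\<integral>z. f z \<partial>torus) \<le> 2 * pi * B"
proof -
  have "cmod (\<integral>z. f z \<partial>torus) \<le> (\<integral>z. cmod (f z) \<partial>torus)" by (rule integral_norm_bound)
  also have "\<dots> \<le> (\<integral>z. B \<partial>torus)"
    using assms finite_measure.integrable_const[OF torus_finite_measure]
    by (intro integral_mono) auto
  finally show ?thesis by (simp add: measure_torus)
qed

lemma continuous_on_cis_mult [continuous_intros]:
  "continuous_on S f \<Longrightarrow> continuous_on S (\<lambda>z. cis (f z))"
  unfolding cis_conv_exp by (intro continuous_intros)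

lemma cis_borel_measurable [measurable]: "(\<lambda>z. cis (c * z)) \<in> borel_measurable torus"
  by (rule borel_measurable_integrable[OF torus_continuous_integrable]) (intro continuous_intros)

lemma integral_torus_eq:
  fixes f :: "real \<Rightarrow> complex"
  assumes "continuous_on UNIV F" "continuous_on UNIV f" "\<And>z. (F has_vector_derivative f z) (at z)"
  shows "(\<integral>z. f z \<partial>torus) = F (2*pi) - F 0"
proof -
  have "(f has_integral (F (2*pi) - F 0)) {0..2*pi}"
    using assms(3) by (intro fundamental_theorem_of_calculus) (auto intro: has_vector_derivative_at_within)
  moreover have "(\<integral>z. f z \<partial>torus) = integral {0..2*pi} f"
    by (rule lebesgue_integral_eq_integral[OF torus_continuous_integrable[OF assms(2)]]) simp
  ultimately show ?thesis by (simp add: integral_unique)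
qed

lemma cis_has_vector_derivative:
  "((\<lambda>z. cis (c * z)) has_vector_derivative (\<i> * of_real c * cis (c * z))) (at z)"
  unfolding cis_conv_exp
  by (rule derivative_eq_intros has_vector_derivative_real_field refl | simp add: mult_ac)+

lemma integral_torus_cis: "(\<integral>z. cis (of_int n * z) \<partial>torus) = (if n = 0 then of_real (2*pi) else 0)"
proof (cases "n = 0")
  case False
  have "(\<integral>z. \<i> * of_real (of_int n) * cis (of_int n * z) \<partial>torus) = cis (of_int n * (2*pi)) - cis (of_int n * 0)"
    by (rule integral_torus_eq) (intro continuous_intros cis_has_vector_derivative)+
  also have "\<dots> = 0" using cis_multiple_2pi[of "of_int n"] by (simp add: mult_ac)
  finally show ?thesis using False by simp
qed (simp add: measure_torus scaleR_conv_of_real)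

lemma cis_uminus_borel_measurable [measurable]: "(\<lambda>z. cis (- (c * z))) \<in> borel_measurable torus"
  using cis_borel_measurable[of "- c"] by simp

lemma fourier_bound:
  assumes "integrable torus f" "\<And>z. z \<in> {0..2*pi} \<Longrightarrow> cmod (f z) \<le> B"
  shows "cmod (fourier f n) \<le> B"
proof -
  have "integrable torus (\<lambda>z. cis (- (of_int n) * z) * f z)"
    by (rule torus_integrable_mult[OF assms(1), where B = 1]) auto
  then have "cmod (\<integral>z. f z * cis (- (of_int n * z)) \<partial>torus) \<le> 2 * pi * B"
    using assms(2) by (intro torus_integral_bound) (simp_all add: mult.commute norm_mult)
  then show ?thesis unfolding fourier_def by (simp add: norm_divide field_simps)
qed

lemma fourier_add:
  assumes "integrable torus f" "integrable torus g"
  shows "fourier (\<lambda>z. f z + g z) n = fourier f n + fourier g n"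
proof -
  have "integrable torus (\<lambda>z. cis (- (of_int n) * z) * h z)" if "integrable torus h" for h
    by (rule torus_integrable_mult[OF that, where B = 1]) auto
  from this[OF assms(1)] this[OF assms(2)] show ?thesis
    unfolding fourier_def distrib_right by (simp add: mult.commute add_divide_distrib)
qed

lemma fourier_cmult: "fourier (\<lambda>z. c * f z) n = c * fourier f n"
  unfolding fourier_def by (simp add: mult.assoc)

lemma fourier_diff:
  assumes "integrable torus f" "integrable torus g"
  shows "fourier (\<lambda>z. f z - g z) n = fourier f n - fourier g n"
proof -
  have "integrable torus (\<lambda>z. (-1) * g z)" using assms(2) by simp
  from fourier_add[OF assms(1) this] show ?thesis unfolding fourier_cmult by simp
qed

lemma fourier_cong_AE:
  assumes "AE z in torus. f z = g z" "f \<in> borel_measurable torus" "g \<in> borel_measurable torus"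
  shows "fourier f n = fourier g n"
proof -
  have "(\<integral>z. f z * cis (- (of_int n * z)) \<partial>torus) = (\<integral>z. g z * cis (- (of_int n * z)) \<partial>torus)"
    using assms by (intro integral_cong_AE) auto
  then show ?thesis unfolding fourier_def by simp
qed

section \<open>Uniqueness of the Fourier coefficients of integrable functions\<close>

inductive trigpoly :: "(real \<Rightarrow> complex) \<Rightarrow> bool" where
  trigpoly_cis: "trigpoly (\<lambda>z. c * cis (of_int n * z))"
| trigpoly_add: "trigpoly f \<Longrightarrow> trigpoly g \<Longrightarrow> trigpoly (\<lambda>z. f z + g z)"

lemma trigpoly_mult: "trigpoly f \<Longrightarrow> trigpoly g \<Longrightarrow> trigpoly (\<lambda>z. f z * g z)"
proof (induction rule: trigpoly.induct)
  case (trigpoly_cis c n)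
  from this show ?case
  proof (induction rule: trigpoly.induct)
    case (trigpoly_cis d m)
    have "(\<lambda>z. c * cis (of_int n * z) * (d * cis (of_int m * z))) = (\<lambda>z. (c * d) * cis (of_int (n + m) * z))"
      by (simp add: cis_mult[symmetric] distrib_right fun_eq_iff)
    then show ?case by (simp only: trigpoly.trigpoly_cis)
  qed (simp add: distrib_left trigpoly.trigpoly_add)
qed (simp add: distrib_right trigpoly.trigpoly_add)

text \<open>On the unit circle a real linear \<open>p\<close> equals
  \<open>cos z * p 1 + sin z * p \<i>\<close>, a sum of two exponentials; products stay
  trigonometric by \<open>trigpoly_mult\<close>. This links the Stone-Weierstrass theorem for
  polynomials on the circle to Fourier coefficients.\<close>

lemma trigpoly_real_polynomial:
  fixes p :: "complex \<Rightarrow> real"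
  shows "real_polynomial_function p \<Longrightarrow> trigpoly (\<lambda>z. of_real (p (cis z)))"
proof (induction rule: real_polynomial_function.induct)
  case (linear p)
  then interpret bounded_linear p .
  have "p (cis z) = cos z * p 1 + sin z * p \<i>" for z
  proof -
    have "cis z = cos z *\<^sub>R 1 + sin z *\<^sub>R \<i>" by (simp add: complex_eq_iff)
    then show ?thesis by (simp add: add scaleR)
  qed
  then have "(\<lambda>z. of_real (p (cis z)) :: complex) =
      (\<lambda>z. Complex (p 1 / 2) (- p \<i> / 2) * cis (of_int 1 * z) + Complex (p 1 / 2) (p \<i> / 2) * cis (of_int (-1) * z))"
    by (simp add: fun_eq_iff complex_eq_iff)
  then show ?case by (simp only: trigpoly.intros)
next
  case (const c)
  show ?case using trigpoly_cis[of "of_real c" 0] by simp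
qed (simp_all add: trigpoly_add trigpoly_mult)

lemma orthogonal_trigpoly:
  assumes h: "integrable torus h" and 0: "\<And>n. fourier h n = 0"
  shows "trigpoly f \<Longrightarrow> (\<integral>z. f z * h z \<partial>torus) = 0 \<and> integrable torus (\<lambda>z. f z * h z)"
proof (induction rule: trigpoly.induct)
  case (trigpoly_cis c n)
  have "integrable torus (\<lambda>z. cis (of_int n * z) * h z)"
    by (rule torus_integrable_mult[OF h, where B = 1]) auto
  moreover have "(\<integral>z. cis (of_int n * z) * h z \<partial>torus) = 0"
    using 0[of "-n"] unfolding fourier_def by (simp add: mult.commute)
  ultimately show ?case by (simp add: mult.assoc)
next
  case (trigpoly_add f g)
  then show ?case by (simp add: distrib_right)
qed

text \<open>Continuity on the circle makes uniform approximation by polynomials in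
  \<open>cis z\<close> possible; an approximation within e changes the integral by at most e times
  the L1 norm of \<open>h\<close>.\<close>

lemma orthogonal_circle:
  fixes F :: "complex \<Rightarrow> real"
  assumes h: "integrable torus h" and 0: "\<And>n. fourier h n = 0" and F: "continuous_on (sphere 0 1) F"
  shows "(\<integral>z. of_real (F (cis z)) * h z \<partial>torus) = 0"
proof -
  have cF: "continuous_on UNIV (\<lambda>z. of_real (F (cis z)) :: complex)"
    by (intro continuous_intros continuous_on_compose2[OF F, of _ cis]) auto
  have "bounded (F ` sphere 0 1)" by (intro compact_imp_bounded compact_continuous_image F compact_sphere)
  then obtain M where "\<forall>y\<in>F ` sphere 0 1. norm y \<le> M" unfolding bounded_iff by blast
  then have M: "\<bar>F w\<bar> \<le> M" if "w \<in> sphere 0 1" for w using that by auto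
  have iF: "integrable torus (\<lambda>z. of_real (F (cis z)) * h z)"
    by (rule torus_integrable_mult[OF h borel_measurable_integrable[OF torus_continuous_integrable[OF cF]], where B = M])
      (use M in auto)
  have "cmod (\<integral>z. of_real (F (cis z)) * h z \<partial>torus) \<le> e * (\<integral>z. cmod (h z) \<partial>torus)" if e: "e > 0" for e
  proof -
    obtain p where p: "real_polynomial_function p" "\<And>w. w \<in> sphere 0 1 \<Longrightarrow> \<bar>F w - p w\<bar> < e"
      using Stone_Weierstrass_real_polynomial_function[OF compact_sphere F e] by blast
    have P: "(\<integral>z. of_real (p (cis z)) * h z \<partial>torus) = 0" "integrable torus (\<lambda>z. of_real (p (cis z)) * h z)"
      using orthogonal_trigpoly[OF h 0 trigpoly_real_polynomial[OF p(1)]] by auto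
    have "(\<integral>z. of_real (F (cis z)) * h z \<partial>torus) = (\<integral>z. of_real (F (cis z)) * h z - of_real (p (cis z)) * h z \<partial>torus)"
      using P iF by simp
    also have "cmod \<dots> \<le> (\<integral>z. cmod (of_real (F (cis z)) * h z - of_real (p (cis z)) * h z) \<partial>torus)"
      by (rule integral_norm_bound)
    also have "\<dots> \<le> (\<integral>z. e * cmod (h z) \<partial>torus)"
    proof (rule integral_mono)
      fix z
      have "cmod (of_real (F (cis z)) * h z - of_real (p (cis z)) * h z) = \<bar>F (cis z) - p (cis z)\<bar> * cmod (h z)"
        by (simp flip: left_diff_distrib of_real_diff add: norm_mult)
      also have "\<dots> \<le> e * cmod (h z)" using p(2)[of "cis z"] by (intro mult_right_mono) auto
      finally show "cmod (of_real (F (cis z)) * h z - of_real (p (cis z)) * h z) \<le> e * cmod (h z)" .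
    qed (use P iF h in auto)
    finally show ?thesis by simp
  qed
  note * = this
  have "cmod (\<integral>z. of_real (F (cis z)) * h z \<partial>torus) \<le> 0"
  proof (rule field_le_epsilon)
    fix e :: real assume e: "e > 0"
    define I where "I = (\<integral>z. cmod (h z) \<partial>torus)"
    have I: "I \<ge> 0" unfolding I_def by (intro integral_nonneg_AE) auto
    have "e / (I + 1) * I \<le> e" using e I by (simp add: field_simps)
    with *[of "e / (I + 1)"] e I show "cmod (\<integral>z. of_real (F (cis z)) * h z \<partial>torus) \<le> 0 + e"
      by (simp flip: I_def)
  qed
  then show ?thesis by simp
qed

lemma AE_torus_interior: "AE z in torus. z \<in> {0<..<2*pi}"
proof -
  have "AE z in lebesgue. z \<notin> {0, 2*pi}"
    by (rule AE_not_in) (simp add: negligible_iff_null_sets[symmetric])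
  then show ?thesis by (subst AE_restrict_space_iff) auto
qed

lemma cis_eq_1_interior: "z \<in> {0<..<2*pi} \<Longrightarrow> cis z \<noteq> 1"
  using Arg2pi_exp[of "\<i> * of_real z"] Arg2pi_of_real[of 1] by (auto simp: cis_conv_exp)

text \<open>Here \<open>g\<close> need not be periodic, so it may fail to descend to a continuous
  function at the point 1 of the circle. The second factor in \<open>F k\<close> vanishes there and
  tends to 1 elsewhere; \<open>Arg2pi\<close> is continuous off the nonnegative reals.\<close>

lemma orthogonal_continuous:
  fixes g :: "real \<Rightarrow> real"
  assumes h: "integrable torus h" and 0: "\<And>n. fourier h n = 0"
    and g: "continuous_on UNIV g" and B: "\<And>z. \<bar>g z\<bar> \<le> B"
  shows "(\<integral>z. of_real (g z) * h z \<partial>torus) = 0"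
proof -
  define F where "F k w = g (Arg2pi w) * min 1 (real k * cmod (w - 1))" for k :: nat and w
  have F_bd: "\<bar>F k w\<bar> \<le> B" for k w
    using B[of "Arg2pi w"] mult_mono[OF B[of "Arg2pi w"], of "min 1 (real k * cmod (w - 1))" 1]
    unfolding F_def abs_mult by (simp add: abs_of_nonneg)
  have F_cont: "continuous_on (sphere 0 1) (F k)" for k
    unfolding continuous_on_eq_continuous_within
  proof
    fix w :: complex assume w: "w \<in> sphere 0 1"
    show "continuous (at w within sphere 0 1) (F k)"
    proof (cases "w = 1")
      case True
      have "((\<lambda>w. F k w) \<longlongrightarrow> 0) (at 1 within sphere 0 1)"
      proof (rule Lim_null_comparison)
        show "\<forall>\<^sub>F w in at 1 within sphere 0 1. norm (F k w) \<le> B * (real k * cmod (w - 1))"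
        proof (intro always_eventually allI)
          show "norm (F k w) \<le> B * (real k * cmod (w - 1))" for w
            unfolding F_def norm_mult using B[of "Arg2pi w"] by (intro mult_mono) auto
        qed
        have "((\<lambda>w. B * (real k * cmod (w - 1))) \<longlongrightarrow> B * (real k * cmod (1 - 1))) (at 1 within sphere 0 1)"
          by (intro tendsto_intros)
        then show "((\<lambda>w. B * (real k * cmod (w - 1))) \<longlongrightarrow> 0) (at 1 within sphere 0 1)" by simp
      qed
      moreover have "F k 1 = 0" by (simp add: F_def)
      ultimately show ?thesis unfolding continuous_within True by simp
    next
      case False
      have "w \<notin> \<real>\<^sub>\<ge>\<^sub>0"
        using False w by (auto simp: nonneg_Reals_def)
      then have "isCont Arg2pi w" by (rule continuous_at_Arg2pi)
      moreover have "isCont g (Arg2pi w)" using g by (simp add: continuous_on_eq_continuous_at)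
      ultimately have "isCont (\<lambda>w. g (Arg2pi w)) w" by (rule isCont_o2)
      then have "isCont (F k) w" unfolding F_def by (intro continuous_intros)
      then show ?thesis by (rule continuous_at_imp_continuous_at_within)
    qed
  qed
  have meas: "(\<lambda>z. of_real (F k (cis z)) :: complex) \<in> borel_measurable torus" for k
    by (intro borel_measurable_integrable[OF torus_continuous_integrable] continuous_intros
        continuous_on_compose2[OF F_cont, of _ cis]) auto
  have gm: "(\<lambda>z. of_real (g z) :: complex) \<in> borel_measurable torus"
    by (intro borel_measurable_integrable[OF torus_continuous_integrable] continuous_intros g)
  have "(\<lambda>k. \<integral>z. of_real (F k (cis z)) * h z \<partial>torus) \<longlonglongrightarrow> (\<integral>z. of_real (g z) * h z \<partial>torus)"
  proof (rule integral_dominated_convergence)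
    show "integrable torus (\<lambda>z. B * cmod (h z))" using h by simp
    show "AE z in torus. (\<lambda>k. of_real (F k (cis z)) * h z) \<longlonglongrightarrow> of_real (g z) * h z"
      using AE_torus_interior
    proof eventually_elim
      case (elim z)
      have A: "Arg2pi (cis z) = z"
        using elim Arg2pi_exp[of "\<i> * of_real z"] by (simp add: cis_conv_exp)
      have pos: "cmod (cis z - 1) > 0" using cis_eq_1_interior[OF elim] by simp
      obtain K :: nat where K: "1 / cmod (cis z - 1) < real K" using reals_Archimedean2 by blast
      have "F k (cis z) = g z" if "k \<ge> K" for k
      proof -
        have "1 \<le> real k * cmod (cis z - 1)"
        proof -
          have "1 < real K * cmod (cis z - 1)" using K pos by (simp add: pos_divide_less_eq)
          also have "\<dots> \<le> real k * cmod (cis z - 1)" using that by (intro mult_right_mono) auto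
          finally show ?thesis by simp
        qed
        then show ?thesis by (simp add: F_def A)
      qed
      then have "\<forall>\<^sub>F k in sequentially. of_real (F k (cis z)) * h z = of_real (g z) * h z"
        by (auto simp: eventually_sequentially)
      then show ?case by (rule tendsto_eventually)
    qed
    show "AE z in torus. norm (of_real (F k (cis z)) * h z) \<le> B * cmod (h z)" for k
      using F_bd by (intro AE_I2) (auto simp: norm_mult intro!: mult_right_mono)
  qed (use h meas gm in measurable)
  then show ?thesis
    unfolding orthogonal_circle[OF h 0 F_cont] by (simp add: LIMSEQ_const_iff)
qed

text \<open>A measurable function is almost everywhere a limit of continuous ones; truncation to
  [-1, 1] keeps the limit and supplies the majorant \<open>cmod (h z)\<close>.\<close>

lemma orthogonal_bounded_measurable:
  fixes f :: "real \<Rightarrow> real"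
  assumes h: "integrable torus h" and 0: "\<And>n. fourier h n = 0"
    and f: "f \<in> borel_measurable torus" and B: "\<And>z. \<bar>f z\<bar> \<le> 1"
  shows "(\<integral>z. of_real (f z) * h z \<partial>torus) = 0"
proof -
  have "f measurable_on {0..2*pi}"
    using f by (subst measurable_on_iff_borel_measurable) auto
  then obtain N g where N: "negligible N" and g: "\<And>n. continuous_on UNIV (g n)"
    and lim: "\<And>x. x \<notin> N \<Longrightarrow> (\<lambda>n. g n x) \<longlonglongrightarrow> (if x \<in> {0..2*pi} then f x else 0)"
    unfolding measurable_on_def by blast
  define G where "G n x = max (-1) (min 1 (g n x))" for n :: nat and x
  have G: "continuous_on UNIV (G n)" for n unfolding G_def by (intro continuous_intros g)
  have Gb: "\<bar>G n x\<bar> \<le> 1" for n x by (simp add: G_def)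
  have Gm: "(\<lambda>z. of_real (G n z) :: complex) \<in> borel_measurable torus" for n
    by (intro borel_measurable_integrable[OF torus_continuous_integrable] continuous_intros G)
  have "AE z in lebesgue. z \<notin> N" using N by (intro AE_not_in) (simp add: negligible_iff_null_sets)
  then have AEN: "AE z in torus. z \<notin> N" by (subst AE_restrict_space_iff) auto
  have "(\<lambda>n. \<integral>z. of_real (G n z) * h z \<partial>torus) \<longlonglongrightarrow> (\<integral>z. of_real (f z) * h z \<partial>torus)"
  proof (rule integral_dominated_convergence)
    show "integrable torus (\<lambda>z. cmod (h z))" using h by simp
    show "AE z in torus. (\<lambda>n. of_real (G n z) * h z) \<longlonglongrightarrow> of_real (f z) * h z"
      using AEN AE_torus_interior
    proof eventually_elim
      case (elim z)
      then have "(\<lambda>n. g n z) \<longlonglongrightarrow> f z" using lim[of z] by simp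
      then have "(\<lambda>n. G n z) \<longlonglongrightarrow> max (-1) (min 1 (f z))" unfolding G_def by (intro tendsto_intros)
      moreover have "max (-1) (min 1 (f z)) = f z" using B[of z] by auto
      ultimately show ?case by (intro tendsto_intros) simp
    qed
    show "AE z in torus. norm (of_real (G n z) * h z) \<le> cmod (h z)" for n
      using Gb by (intro AE_I2) (auto simp: norm_mult intro!: mult_left_le_one_le)
  qed (use h Gm f in measurable)
  then show ?thesis
    unfolding orthogonal_continuous[OF h 0 G Gb] by (simp add: LIMSEQ_const_iff)
qed

text \<open>Testing with the sign of \<open>Re (c * h z)\<close> shows that this real part has
  vanishing L1 norm; \<open>c = 1\<close> and \<open>c = - \<i>\<close> give the real and the
  imaginary part of \<open>h\<close>.\<close>

theorem fourier_uniqueness: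
  assumes h: "integrable torus h" and 0: "\<And>n. fourier h n = 0"
  shows "AE z in torus. h z = 0"
proof -
  have [measurable]: "h \<in> borel_measurable torus" using h by simp
  have re: "AE z in torus. Re (c * h z) = 0" for c
  proof -
    let ?r = "\<lambda>z. Re (c * h z)"
    have c0: "fourier (\<lambda>z. c * h z) n = 0" for n by (simp add: fourier_cmult 0)
    have ci: "integrable torus (\<lambda>z. c * h z)" using h by simp
    have sm: "(\<lambda>z. sgn (?r z)) \<in> borel_measurable torus" by measurable
    have "integrable torus (\<lambda>z. of_real (sgn (?r z)) * (c * h z))"
      by (rule torus_integrable_mult[OF ci, where B = 1]) (use sm in \<open>auto simp: sgn_if\<close>)
    then have "Re (\<integral>z. of_real (sgn (?r z)) * (c * h z) \<partial>torus) = (\<integral>z. Re (of_real (sgn (?r z)) * (c * h z)) \<partial>torus)"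
      by (rule integral_Re[symmetric])
    also have "\<dots> = (\<integral>z. \<bar>?r z\<bar> \<partial>torus)"
      by (intro Bochner_Integration.integral_cong) (auto simp: sgn_if)
    finally have "(\<integral>z. \<bar>?r z\<bar> \<partial>torus) = 0"
      using orthogonal_bounded_measurable[OF ci c0 sm] by (simp add: abs_sgn_eq)
    moreover have "integrable torus (\<lambda>z. \<bar>?r z\<bar>)" using ci by (intro integrable_abs integrable_Re)
    ultimately have "AE z in torus. \<bar>?r z\<bar> = 0" by (subst (asm) integral_nonneg_eq_0_iff_AE) auto
    then show ?thesis by simp
  qed
  from re[of 1] re[of "-\<i>"] show ?thesis
    by eventually_elim (simp add: complex_eq_iff)
qed

lemma summable_on_inverse_square_int: "(\<lambda>n::int. 1 / (1 + (of_int n)\<^sup>2 :: real)) summable_on UNIV"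
proof -
  let ?f = "\<lambda>n::int. 1 / (1 + (of_int n)\<^sup>2 :: real)"
  have "summable (\<lambda>n::nat. 1 / (1 + (real n)\<^sup>2))"
  proof (rule summable_comparison_test')
    show "summable (\<lambda>n::nat. inverse (real n ^ 2))" by (rule inverse_power_summable) simp
    show "norm (1 / (1 + (real n)\<^sup>2)) \<le> inverse (real n ^ 2)" if "n \<ge> 1" for n
      using that unfolding inverse_eq_divide real_norm_def by (subst abs_of_nonneg) (auto intro!: frac_le)
  qed
  then have *: "(\<lambda>n::nat. 1 / (1 + (real n)\<^sup>2)) summable_on UNIV"
    by (rule summable_nonneg_imp_summable_on) simp
  have 1: "?f summable_on range int"
    by (subst summable_on_reindex) (use * in \<open>auto simp: o_def inj_on_def\<close>)
  have 2: "?f summable_on range (\<lambda>n. - int n)"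
    by (subst summable_on_reindex) (use * in \<open>auto simp: o_def inj_on_def\<close>)
  have "n \<in> range int \<union> range (\<lambda>n. - int n)" for n
    by (cases n rule: int_cases2) auto
  then have "range int \<union> range (\<lambda>n. - int n) = UNIV" by blast
  with summable_on_union[OF 1 2] show ?thesis by simp
qed

section \<open>Absolutely convergent Fourier series\<close>

definition fser :: "(int \<Rightarrow> complex) \<Rightarrow> real \<Rightarrow> complex" where
  "fser a z = (\<Sum>\<^sub>\<infinity>n. a n * cis (of_int n * z))"

lemma fser_summable:
  assumes "(\<lambda>n. cmod (a n)) summable_on UNIV"
  shows "(\<lambda>n. a n * cis (of_int n * z)) summable_on UNIV"
proof (rule abs_summable_summable)
  show "(\<lambda>n. norm (a n * cis (of_int n * z))) summable_on UNIV"
    using assms by (simp add: norm_mult)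
qed

lemma fser_uniform_limit:
  assumes "(\<lambda>n. cmod (a n)) summable_on UNIV"
  shows "uniform_limit UNIV (\<lambda>X z. \<Sum>n\<in>X. a n * cis (of_int n * z)) (fser a) (finite_subsets_at_top UNIV)"
  unfolding fser_def[abs_def] using assms by (intro Weierstrass_m_test_general) (auto simp: norm_mult)

lemma fser_continuous:
  assumes "(\<lambda>n. cmod (a n)) summable_on UNIV"
  shows "continuous_on UNIV (fser a)"
  by (rule uniform_limit_theorem[OF _ fser_uniform_limit[OF assms]])
    (auto intro!: always_eventually continuous_intros)

lemma fser_bound:
  assumes "(\<lambda>n. cmod (a n)) summable_on UNIV"
  shows "cmod (fser a z) \<le> (\<Sum>\<^sub>\<infinity>n. cmod (a n))"
  unfolding fser_def using norm_infsum_bound[of "\<lambda>n. a n * cis (of_int n * z)" UNIV] assms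
  by (simp add: norm_mult)

lemma fser_measurable:
  assumes "(\<lambda>n. cmod (a n)) summable_on UNIV"
  shows "fser a \<in> borel_measurable torus"
  by (rule borel_measurable_integrable[OF torus_continuous_integrable[OF fser_continuous[OF assms]]])

lemma integrable_cis_mult:
  assumes "integrable torus h"
  shows "integrable torus (\<lambda>z. cis (of_int n * z) * h z)"
  by (rule torus_integrable_mult[OF assms, where B = 1]) auto

lemma fser_mult_integrable:
  assumes "(\<lambda>n. cmod (a n)) summable_on UNIV" "integrable torus h"
  shows "integrable torus (\<lambda>z. fser a z * h z)"
  by (rule torus_integrable_mult[OF assms(2) fser_measurable[OF assms(1)]]) (rule fser_bound[OF assms(1)])

text \<open>Termwise integration by uniform convergence. The coefficients of a series, the Parseval
  identity, the finite Bessel inequality and the convolution formula all come from it by the choice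
  of \<open>h\<close>.\<close>

lemma fser_mult_has_sum:
  assumes a: "(\<lambda>n. cmod (a n)) summable_on UNIV" and h: "integrable torus h"
  shows "((\<lambda>n. a n * (\<integral>z. cis (of_int n * z) * h z \<partial>torus)) has_sum (\<integral>z. fser a z * h z \<partial>torus)) UNIV"
  unfolding has_sum_def tendsto_iff
proof (intro allI impI)
  fix e :: real assume e: "e > 0"
  define I where "I = (\<integral>z. cmod (h z) \<partial>torus)"
  have I: "I \<ge> 0" unfolding I_def by (intro integral_nonneg_AE) auto
  let ?S = "\<lambda>X z. \<Sum>n\<in>X. a n * cis (of_int n * z)"
  have e': "e / (I + 1) > 0" using e I by simp
  have "\<forall>\<^sub>F X in finite_subsets_at_top UNIV. \<forall>z\<in>UNIV. dist (?S X z) (fser a z) < e / (I + 1)"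
    using fser_uniform_limit[OF a] e' unfolding uniform_limit_iff by blast
  then show "\<forall>\<^sub>F X in finite_subsets_at_top UNIV.
      dist (\<Sum>n\<in>X. a n * (\<integral>z. cis (of_int n * z) * h z \<partial>torus)) (\<integral>z. fser a z * h z \<partial>torus) < e"
  proof eventually_elim
    case (elim X)
    have S: "?S X z * h z = (\<Sum>n\<in>X. a n * (cis (of_int n * z) * h z))" for z
      by (simp add: sum_distrib_right mult.assoc)
    have Si: "integrable torus (\<lambda>z. ?S X z * h z)"
      unfolding S by (intro Bochner_Integration.integrable_sum integrable_mult_right integrable_cis_mult h)
    have "(\<Sum>n\<in>X. a n * (\<integral>z. cis (of_int n * z) * h z \<partial>torus)) = (\<integral>z. ?S X z * h z \<partial>torus)"
      unfolding S by (subst Bochner_Integration.integral_sum)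
        (auto intro!: integrable_mult_right integrable_cis_mult h)
    also have "\<dots> - (\<integral>z. fser a z * h z \<partial>torus) = (\<integral>z. ?S X z * h z - fser a z * h z \<partial>torus)"
      using Si fser_mult_integrable[OF a h] by simp
    also have "cmod \<dots> \<le> (\<integral>z. cmod (?S X z * h z - fser a z * h z) \<partial>torus)" by (rule integral_norm_bound)
    also have "\<dots> \<le> (\<integral>z. e / (I + 1) * cmod (h z) \<partial>torus)"
    proof (rule integral_mono)
      fix z
      show "cmod (?S X z * h z - fser a z * h z) \<le> e / (I + 1) * cmod (h z)"
        using elim[rule_format, of z] unfolding left_diff_distrib[symmetric] norm_mult
        by (intro mult_right_mono) (auto simp: dist_norm)
    qed (use Si fser_mult_integrable[OF a h] h in auto)
    also have "\<dots> = e / (I + 1) * I" by (simp add: I_def)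
    also have "\<dots> < e" using e I by (simp add: field_simps)
    finally show ?case by (simp add: dist_norm)
  qed
qed

lemma fourier_fser:
  assumes "(\<lambda>n. cmod (a n)) summable_on UNIV"
  shows "fourier (fser a) n = a n"
proof -
  have h: "integrable torus (\<lambda>z. cis (- (of_int n * z)))"
    by (intro torus_continuous_integrable continuous_intros)
  have "a m * (\<integral>z. cis (of_int m * z) * cis (- (of_int n * z)) \<partial>torus) = (if m = n then a n * of_real (2*pi) else 0)" for m
  proof -
    have "(\<integral>z. cis (of_int m * z) * cis (- (of_int n * z)) \<partial>torus) = (\<integral>z. cis (of_int (m - n) * z) \<partial>torus)"
      by (simp add: cis_mult left_diff_distrib)
    then show ?thesis unfolding integral_torus_cis by simp
  qed
  then have "((\<lambda>m. if m = n then a n * of_real (2*pi) else 0) has_sum (\<integral>z. fser a z * cis (- (of_int n * z)) \<partial>torus)) UNIV"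
    using fser_mult_has_sum[OF assms h] by simp
  moreover have "((\<lambda>m. if m = n then a n * of_real (2*pi) else 0) has_sum (a n * of_real (2*pi))) UNIV"
    by (rule has_sum_finite_neutralI[of "{n}"]) auto
  ultimately have "(\<integral>z. fser a z * cis (- (of_int n * z)) \<partial>torus) = a n * of_real (2*pi)"
    by (rule has_sum_unique)
  then show ?thesis unfolding fourier_def by simp
qed

lemma fser_L2T:
  assumes "(\<lambda>n. cmod (a n)) summable_on UNIV"
  shows "fser a \<in> L2T"
proof -
  have "continuous_on {0..2*pi} (\<lambda>z. (cmod (fser a z))\<^sup>2)"
    by (intro continuous_intros continuous_on_subset[OF fser_continuous[OF assms]]) auto
  then show ?thesis
    using fser_measurable[OF assms] by (simp add: L2T_def continuous_imp_integrable_real)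
qed

lemma fser_integrable: "(\<lambda>n. cmod (a n)) summable_on UNIV \<Longrightarrow> integrable torus (fser a)"
  by (rule torus_continuous_integrable[OF fser_continuous])

lemma L2T_norm_sq: "(L2T_norm f)\<^sup>2 = (\<integral>z. (cmod (f z))\<^sup>2 \<partial>torus)"
  unfolding L2T_norm_def by (simp add: integral_nonneg_AE)

lemma L2T_norm_nonneg: "0 \<le> L2T_norm f"
  unfolding L2T_norm_def by (simp add: integral_nonneg_AE)

lemma L2T_norm_cong_AE:
  assumes "AE z in torus. f z = g z" "f \<in> borel_measurable torus" "g \<in> borel_measurable torus"
  shows "L2T_norm f = L2T_norm g"
  unfolding L2T_norm_def using assms by (intro arg_cong[where f = sqrt] integral_cong_AE) auto

text \<open>Termwise integration of \<open>fser a\<close> against its own conjugate; the factor 2 pi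
  is the total mass of the unnormalised measure.\<close>

lemma Parseval_fser:
  assumes a: "(\<lambda>n. cmod (a n)) summable_on UNIV"
  shows "(\<lambda>n. (cmod (a n))\<^sup>2) summable_on UNIV" "(L2T_norm (fser a))\<^sup>2 = 2 * pi * (\<Sum>\<^sub>\<infinity>n. (cmod (a n))\<^sup>2)"
proof -
  have ic: "integrable torus (\<lambda>z. cnj (fser a z))"
    by (rule integrable_cnj[OF fser_integrable[OF a]])
  have "(\<integral>z. cis (of_int n * z) * cnj (fser a z) \<partial>torus) = of_real (2 * pi) * cnj (a n)" for n
  proof -
    have "(\<integral>z. cis (of_int n * z) * cnj (fser a z) \<partial>torus) = (\<integral>z. cnj (fser a z * cis (- (of_int n * z))) \<partial>torus)"
      by (simp add: cis_cnj mult.commute)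
    also have "\<dots> = cnj (\<integral>z. fser a z * cis (- (of_int n * z)) \<partial>torus)" by (rule Bochner_Integration.integral_cnj)
    also have "(\<integral>z. fser a z * cis (- (of_int n * z)) \<partial>torus) = of_real (2 * pi) * a n"
      using fourier_fser[OF a, of n] unfolding fourier_def by (simp add: field_simps)
    finally show ?thesis by simp
  qed
  note I = this
  have "((\<lambda>n. of_real (2 * pi * (cmod (a n))\<^sup>2)) has_sum (\<integral>z. fser a z * cnj (fser a z) \<partial>torus)) UNIV"
  proof -
    have "a n * (of_real (2 * pi) * cnj (a n)) = of_real (2 * pi * (cmod (a n))\<^sup>2)" for n
      by (simp only: of_real_mult complex_norm_square mult_ac)
    then show ?thesis using fser_mult_has_sum[OF a ic] by (simp only: I)
  qed
  also have "(\<integral>z. fser a z * cnj (fser a z) \<partial>torus) = of_real ((L2T_norm (fser a))\<^sup>2)"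
    unfolding L2T_norm_sq complex_norm_square[symmetric]
    by (rule integral_of_real) (use fser_L2T[OF a] in \<open>simp add: L2T_def\<close>)
  finally have *: "((\<lambda>n. 2 * pi * (cmod (a n))\<^sup>2) has_sum (L2T_norm (fser a))\<^sup>2) UNIV"
    unfolding has_sum_of_real_iff .
  have "((\<lambda>n. (cmod (a n))\<^sup>2) has_sum ((L2T_norm (fser a))\<^sup>2 / (2 * pi))) UNIV"
    using has_sum_cmult_right[OF *, of "1 / (2 * pi)"] by simp
  then show "(\<lambda>n. (cmod (a n))\<^sup>2) summable_on UNIV" "(L2T_norm (fser a))\<^sup>2 = 2 * pi * (\<Sum>\<^sub>\<infinity>n. (cmod (a n))\<^sup>2)"
    by (auto simp: has_sum_iff)
qed

lemma L2T_integrable: "f \<in> L2T \<Longrightarrow> integrable torus f"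
proof (rule Bochner_Integration.integrable_bound)
  assume f: "f \<in> L2T"
  then show "integrable torus (\<lambda>z. 1 + (cmod (f z))\<^sup>2)"
    using finite_measure.integrable_const[OF torus_finite_measure, of "1::real"] by (simp add: L2T_def)
  have "x \<le> 1 + x\<^sup>2" for x :: real using zero_le_power2[of "x - 1/2"] by (simp add: power2_eq_square algebra_simps)
  then show "AE z in torus. norm (f z) \<le> norm (1 + (cmod (f z))\<^sup>2)" by (intro AE_I2) auto
qed (simp add: L2T_def)

text \<open>Nonnegativity of the squared distance from \<open>f\<close> to its partial Fourier sum
  over \<open>F\<close>.\<close>

lemma Bessel_finite:
  assumes f: "f \<in> L2T" and F: "finite F"
  shows "2 * pi * (\<Sum>n\<in>F. (cmod (fourier f n))\<^sup>2) \<le> (L2T_norm f)\<^sup>2"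
proof -
  define a where "a n = (if n \<in> F then fourier f n else 0)" for n
  have a: "(\<lambda>n. cmod (a n)) summable_on UNIV"
    using F by (intro finite_nonzero_values_imp_summable_on) (auto simp: a_def elim: finite_subset[rotated])
  have fi: "integrable torus f" and f2: "integrable torus (\<lambda>z. (cmod (f z))\<^sup>2)" using f by (auto simp: L2T_integrable L2T_def)
  have p2: "integrable torus (\<lambda>z. (cmod (fser a z))\<^sup>2)" using fser_L2T[OF a] by (simp add: L2T_def)
  have cfi: "integrable torus (\<lambda>z. cnj (f z))" by (rule integrable_cnj[OF fi])
  have pf: "integrable torus (\<lambda>z. fser a z * cnj (f z))" by (rule fser_mult_integrable[OF a cfi])
  have "(\<integral>z. cis (of_int n * z) * cnj (f z) \<partial>torus) = of_real (2 * pi) * cnj (fourier f n)" for n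
  proof -
    have "(\<integral>z. cis (of_int n * z) * cnj (f z) \<partial>torus) = (\<integral>z. cnj (f z * cis (- (of_int n * z))) \<partial>torus)"
      by (simp add: cis_cnj mult.commute)
    also have "\<dots> = cnj (\<integral>z. f z * cis (- (of_int n * z)) \<partial>torus)" by (rule Bochner_Integration.integral_cnj)
    finally show ?thesis unfolding fourier_def by simp
  qed
  then have "((\<lambda>n. a n * (of_real (2 * pi) * cnj (fourier f n))) has_sum (\<integral>z. fser a z * cnj (f z) \<partial>torus)) UNIV"
    using fser_mult_has_sum[OF a cfi] by simp
  moreover have "((\<lambda>n. a n * (of_real (2 * pi) * cnj (fourier f n))) has_sum of_real (2 * pi * (\<Sum>n\<in>F. (cmod (fourier f n))\<^sup>2))) UNIV"
    by (rule has_sum_finite_neutralI[OF F])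
      (auto simp: a_def sum_distrib_left complex_norm_square mult_ac simp del: of_real_power)
  ultimately have *: "(\<integral>z. fser a z * cnj (f z) \<partial>torus) = of_real (2 * pi * (\<Sum>n\<in>F. (cmod (fourier f n))\<^sup>2))"
    by (rule has_sum_unique)
  have P: "(\<integral>z. (cmod (fser a z))\<^sup>2 \<partial>torus) = 2 * pi * (\<Sum>n\<in>F. (cmod (fourier f n))\<^sup>2)"
  proof -
    have "((\<lambda>n. (cmod (a n))\<^sup>2) has_sum (\<Sum>n\<in>F. (cmod (fourier f n))\<^sup>2)) UNIV"
      by (rule has_sum_finite_neutralI[OF F]) (auto simp: a_def)
    then show ?thesis using Parseval_fser(2)[OF a] unfolding L2T_norm_sq by (simp add: infsumI)
  qed
  define R where "R z = Re (fser a z * cnj (f z))" for z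
  have R: "integrable torus R" "(\<integral>z. R z \<partial>torus) = 2 * pi * (\<Sum>n\<in>F. (cmod (fourier f n))\<^sup>2)"
    using integrable_Re[OF pf] integral_Re[OF pf] unfolding R_def[abs_def] * by simp_all
  have ex: "(cmod (f z - fser a z))\<^sup>2 = (cmod (f z))\<^sup>2 - 2 * R z + (cmod (fser a z))\<^sup>2" for z
    unfolding cmod_power2 R_def by (simp add: power2_eq_square algebra_simps)
  have "0 \<le> (\<integral>z. (cmod (f z - fser a z))\<^sup>2 \<partial>torus)" by (intro integral_nonneg_AE) auto
  also have "\<dots> = (\<integral>z. (cmod (f z))\<^sup>2 \<partial>torus) - 2 * (\<integral>z. R z \<partial>torus) + (\<integral>z. (cmod (fser a z))\<^sup>2 \<partial>torus)"
    unfolding ex using f2 p2 R by simp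
  also note R(2)
  finally show ?thesis unfolding P L2T_norm_sq by simp
qed

lemma Bessel:
  assumes f: "f \<in> L2T"
  shows "(\<lambda>n. (cmod (fourier f n))\<^sup>2) summable_on UNIV"
    and "2 * pi * (\<Sum>\<^sub>\<infinity>n. (cmod (fourier f n))\<^sup>2) \<le> (L2T_norm f)\<^sup>2"
proof -
  have *: "(\<Sum>n\<in>F. (cmod (fourier f n))\<^sup>2) \<le> (L2T_norm f)\<^sup>2 / (2 * pi)" if "finite F" for F
    using Bessel_finite[OF f that] by (simp add: field_simps)
  then show s: "(\<lambda>n. (cmod (fourier f n))\<^sup>2) summable_on UNIV"
    by (intro nonneg_bdd_above_summable_on) (auto intro!: bdd_aboveI2)
  have "(\<Sum>\<^sub>\<infinity>n. (cmod (fourier f n))\<^sup>2) \<le> (L2T_norm f)\<^sup>2 / (2 * pi)"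
    by (rule infsum_le_finite_sums[OF s]) (rule *)
  then show "2 * pi * (\<Sum>\<^sub>\<infinity>n. (cmod (fourier f n))\<^sup>2) \<le> (L2T_norm f)\<^sup>2" by (simp add: field_simps)
qed

lemma fourier_fser_mult:
  assumes a: "(\<lambda>n. cmod (a n)) summable_on UNIV" and f: "integrable torus f"
  shows "fourier (\<lambda>z. fser a z * f z) n = (\<Sum>\<^sub>\<infinity>m. a (n - m) * fourier f m)"
proof -
  have h: "integrable torus (\<lambda>z. f z * cis (- (of_int n * z)))"
    using integrable_cis_mult[OF f, of "-n"] by (simp add: mult.commute)
  have "(\<integral>z. cis (of_int m * z) * (f z * cis (- (of_int n * z))) \<partial>torus) = fourier f (n - m) * of_real (2 * pi)" for m
  proof -
    have "cis (of_int m * z) * (f z * cis (- (of_int n * z))) = f z * cis (- (of_int (n - m) * z))" for z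
    proof -
      have "cis (of_int m * z) * cis (- (of_int n * z)) = cis (- (of_int (n - m) * z))"
        unfolding cis_mult by (simp add: left_diff_distrib)
      then show ?thesis by (simp only: mult.left_commute)
    qed
    then have "(\<integral>z. cis (of_int m * z) * (f z * cis (- (of_int n * z))) \<partial>torus)
        = (\<integral>z. f z * cis (- (of_int (n - m) * z)) \<partial>torus)" by (simp only:)
    then show ?thesis unfolding fourier_def by simp
  qed
  then have "((\<lambda>m. a m * (fourier f (n - m) * of_real (2 * pi))) has_sum (\<integral>z. fser a z * (f z * cis (- (of_int n * z))) \<partial>torus)) UNIV"
    using fser_mult_has_sum[OF a h] by simp
  from has_sum_divide_const[OF this, of "of_real (2 * pi)"]
  have "((\<lambda>m. a m * fourier f (n - m)) has_sum fourier (\<lambda>z. fser a z * f z) n) UNIV"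
    unfolding fourier_def by (simp add: mult.assoc)
  then have "fourier (\<lambda>z. fser a z * f z) n = (\<Sum>\<^sub>\<infinity>m. a m * fourier f (n - m))" by (simp add: infsumI)
  also have "\<dots> = (\<Sum>\<^sub>\<infinity>m. a (n - m) * fourier f m)"
    using infsum_int_shift(1)[of "\<lambda>m. a m * fourier f (n - m)" n] by simp
  finally show ?thesis .
qed

lemma AE_eq_fser:
  assumes f: "integrable torus f" and a: "(\<lambda>n. cmod (fourier f n)) summable_on UNIV"
  shows "AE z in torus. f z = fser (fourier f) z"
proof -
  have "AE z in torus. f z - fser (fourier f) z = 0"
    using f fser_integrable[OF a] by (intro fourier_uniqueness) (auto simp: fourier_diff fourier_fser[OF a])
  then show ?thesis by simp
qed

lemma continuous_AE_zero:
  fixes f :: "real \<Rightarrow> complex"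
  assumes f: "continuous_on UNIV f" and AE: "AE z in torus. f z = 0" and z: "z \<in> {0..2*pi}"
  shows "f z = 0"
proof -
  have "AE x in lebesgue. x \<in> {0..2*pi} \<longrightarrow> f x = 0" using AE by (subst (asm) AE_restrict_space_iff) auto
  then have ae: "AE x \<in> {0<..<2*pi} in lebesgue. x \<in> f -` {0}" by eventually_elim auto
  have cl: "closed (f -` {0})" using f by (intro closed_vimage) auto
  have int: "f x = 0" if "x \<in> {0<..<2*pi}" for x
    using mem_closed_if_AE_lebesgue_open[OF _ cl ae that] by auto
  have "closure {0<..<2*pi} \<subseteq> f -` {0}" using int cl by (intro closure_minimal) auto
  then show ?thesis using z by auto
qed

lemma fser_periodic: "fser a (z + 2 * pi) = fser a z"
proof -
  have "cis (of_int n * (z + 2 * pi)) = cis (of_int n * z)" for n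
    using cis_multiple_2pi[of "of_int n"] by (simp add: distrib_left mult_ac flip: cis_mult)
  then show ?thesis unfolding fser_def by simp
qed

lemma periodic_reduce:
  fixes f :: "real \<Rightarrow> 'a"
  assumes f: "\<And>z. f (z + 2 * pi) = f z"
  obtains z' where "z' \<in> {0..2*pi}" "f z = f z'"
proof -
  have shift: "f (z - 2 * pi * of_int k) = f z" for k z
  proof (induction k rule: int_induct[where k = 0])
    case (step1 i)
    have "f (z - 2 * pi * of_int i) = f (z - 2 * pi * of_int (i + 1))"
      using f[of "z - 2 * pi * of_int (i + 1)"] by (simp add: algebra_simps)
    with step1 show ?case by simp
  next
    case (step2 i)
    have "f (z - 2 * pi * of_int (i - 1)) = f (z - 2 * pi * of_int i)"
      using f[of "z - 2 * pi * of_int i"] by (simp add: algebra_simps)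
    with step2 show ?case by simp
  qed simp
  define k where "k = \<lfloor>z / (2 * pi)\<rfloor>"
  have "of_int k \<le> z / (2 * pi)" "z / (2 * pi) < of_int k + 1" by (auto simp: k_def)
  then have "z - 2 * pi * of_int k \<in> {0..2*pi}" by (simp add: field_simps)
  then show ?thesis using shift[of z k] by (intro that[of "z - 2 * pi * of_int k"]) auto
qed

text \<open>Equality at every point, ends of the period included: later the value of a series at one
  prescribed zero of the function matters.\<close>

lemma continuous_eq_fser:
  fixes f :: "real \<Rightarrow> complex"
  assumes f: "continuous_on UNIV f" and per: "\<And>z. f (z + 2 * pi) = f z"
    and a: "(\<lambda>n. cmod (fourier f n)) summable_on UNIV"
  shows "f = fser (fourier f)"
proof
  fix z
  have *: "f z - fser (fourier f) z = 0" if "z \<in> {0..2*pi}" for z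
    by (rule continuous_AE_zero[OF _ _ that])
      (use f fser_continuous[OF a] AE_eq_fser[OF torus_continuous_integrable[OF f] a] in
        \<open>auto intro: continuous_on_diff\<close>)
  obtain z' where "z' \<in> {0..2*pi}" "f z - fser (fourier f) z = f z' - fser (fourier f) z'"
    by (rule periodic_reduce[of "\<lambda>z. f z - fser (fourier f) z" z]) (simp_all add: per fser_periodic)
  with * show "f z = fser (fourier f) z" by simp
qed

lemma summable_on_minus:
  fixes f g :: "'a \<Rightarrow> 'b :: topological_ab_group_add"
  assumes "f summable_on A" "g summable_on A"
  shows "(\<lambda>x. f x - g x) summable_on A"
  using summable_on_add[OF assms(1), of "\<lambda>x. - g x"] assms(2) by (simp add: summable_on_uminus)

lemma infsum_minus:
  fixes f g :: "'a \<Rightarrow> 'b :: {topological_ab_group_add, t2_space}"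
  assumes "f summable_on A" "g summable_on A"
  shows "(\<Sum>\<^sub>\<infinity>x\<in>A. f x - g x) = (\<Sum>\<^sub>\<infinity>x\<in>A. f x) - (\<Sum>\<^sub>\<infinity>x\<in>A. g x)"
  using infsum_add[OF assms(1), of "\<lambda>x. - g x"] assms(2) by (simp add: infsum_uminus summable_on_uminus)

lemma cis_Taylor: "cmod (cis t - 1 - \<i> * of_real t) \<le> t\<^sup>2"
  using Taylor_exp[of "\<i> * of_real t" 1] by (simp add: cis_conv_exp norm_mult diff_diff_eq power2_eq_square)

text \<open>The bound \<open>cis_Taylor\<close> is summed over the modes, which leaves a remainder
  \<open>M * (w - z)\<^sup>2\<close> with \<open>M\<close> the sum of
  \<open>(of_int n)\<^sup>2 * cmod (a n)\<close>. The lemma makes the dispersive term of the wave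
  equation differentiable.\<close>

lemma fser_has_vector_derivative:
  assumes a: "(\<lambda>n. (1 + (of_int n)\<^sup>2) * cmod (a n)) summable_on UNIV"
  shows "(fser a has_vector_derivative fser (\<lambda>n. \<i> * of_int n * a n) z) (at z)"
proof -
  let ?b = "\<lambda>n. \<i> * of_int n * a n"
  have sa: "(\<lambda>n. cmod (a n)) summable_on UNIV"
    by (rule summable_on_comparison_test[OF a]) (auto simp: distrib_right)
  have "\<bar>x\<bar> \<le> 1 + x\<^sup>2" for x :: real
    using zero_le_power2[of "\<bar>x\<bar> - 1/2"] by (simp add: power2_eq_square algebra_simps)
  then have sb: "(\<lambda>n. cmod (?b n)) summable_on UNIV"
    by (intro summable_on_comparison_test[OF a]) (auto simp: norm_mult intro!: mult_right_mono)
  have s2: "(\<lambda>n. (of_int n)\<^sup>2 * cmod (a n)) summable_on UNIV"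
    by (rule summable_on_comparison_test[OF a]) (auto simp: distrib_right)
  define M where "M = (\<Sum>\<^sub>\<infinity>n. (of_int n)\<^sup>2 * cmod (a n))"
  have est: "cmod (fser a w - fser a z - (w - z) *\<^sub>R fser ?b z) \<le> M * (w - z)\<^sup>2" for w
  proof -
    let ?t = "\<lambda>n. a n * cis (of_int n * w) - a n * cis (of_int n * z) - of_real (w - z) * (?b n * cis (of_int n * z))"
    have t: "?t n = a n * cis (of_int n * z) * (cis (of_int n * (w - z)) - 1 - \<i> * of_real (of_int n * (w - z)))" for n
    proof -
      have "cis (of_int n * w) = cis (of_int n * z) * cis (of_int n * (w - z))"
        by (simp add: cis_mult flip: distrib_left)
      then show ?thesis by (simp add: algebra_simps)
    qed
    have tb: "cmod (?t n) \<le> (w - z)\<^sup>2 * ((of_int n)\<^sup>2 * cmod (a n))" for n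
      unfolding t norm_mult norm_cis using mult_left_mono[OF cis_Taylor[of "of_int n * (w - z)"], of "cmod (a n)"]
      by (simp add: power_mult_distrib mult_ac)
    have ts: "(\<lambda>n. cmod (?t n)) summable_on UNIV"
      by (rule summable_on_comparison_test[OF summable_on_cmult_right[OF s2, of "(w - z)\<^sup>2"]]) (use tb in auto)
    have "fser a w - fser a z - (w - z) *\<^sub>R fser ?b z = (\<Sum>\<^sub>\<infinity>n. ?t n)"
    proof -
      have 1: "(\<Sum>\<^sub>\<infinity>n. ?t n) = (\<Sum>\<^sub>\<infinity>n. a n * cis (of_int n * w) - a n * cis (of_int n * z))
          - (\<Sum>\<^sub>\<infinity>n. of_real (w - z) * (?b n * cis (of_int n * z)))"
        by (rule infsum_minus[OF summable_on_minus[OF fser_summable[OF sa] fser_summable[OF sa]]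
              summable_on_cmult_right[OF fser_summable[OF sb]]])
      have 2: "(\<Sum>\<^sub>\<infinity>n. a n * cis (of_int n * w) - a n * cis (of_int n * z)) = fser a w - fser a z"
        unfolding fser_def by (rule infsum_minus[OF fser_summable[OF sa] fser_summable[OF sa]])
      have 3: "(\<Sum>\<^sub>\<infinity>n. of_real (w - z) * (?b n * cis (of_int n * z))) = (w - z) *\<^sub>R fser ?b z"
        unfolding infsum_cmult_right' fser_def scaleR_conv_of_real by (rule refl)
      show ?thesis unfolding 1 2 3 by (rule refl)
    qed
    moreover have "cmod (\<Sum>\<^sub>\<infinity>n. ?t n) \<le> (\<Sum>\<^sub>\<infinity>n. cmod (?t n))" by (rule norm_infsum_bound) (rule ts)
    moreover have "(\<Sum>\<^sub>\<infinity>n. cmod (?t n)) \<le> (\<Sum>\<^sub>\<infinity>n. (w - z)\<^sup>2 * ((of_int n)\<^sup>2 * cmod (a n)))"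
      by (intro infsum_mono ts summable_on_cmult_right s2 tb)
    moreover have "(\<Sum>\<^sub>\<infinity>n. (w - z)\<^sup>2 * ((of_int n)\<^sup>2 * cmod (a n))) = M * (w - z)\<^sup>2"
      unfolding infsum_cmult_right' M_def by (rule mult.commute)
    ultimately show ?thesis by (simp only: order_trans)
  qed
  have M0: "M \<ge> 0" unfolding M_def by (intro infsum_nonneg) auto
  show ?thesis
    unfolding has_vector_derivative_def has_derivative_within_alt2
  proof (intro conjI allI impI)
    show "bounded_linear (\<lambda>h. h *\<^sub>R fser ?b z)" by (intro bounded_linear_intros)
    fix e :: real assume e: "e > 0"
    have "\<forall>\<^sub>F w in at z. dist w z < e / (M + 1)"
      unfolding eventually_at using e M0 by (intro exI[of _ "e / (M + 1)"]) auto
    then show "\<forall>\<^sub>F w in at z. norm (fser a w - fser a z - (w - z) *\<^sub>R fser ?b z) \<le> e * norm (w - z)"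
    proof eventually_elim
      case (elim w)
      have "M * \<bar>w - z\<bar> \<le> (M + 1) * (e / (M + 1))"
        using elim M0 by (intro mult_mono) (auto simp: dist_real_def)
      then have "M * \<bar>w - z\<bar> * \<bar>w - z\<bar> \<le> e * \<bar>w - z\<bar>" using M0 by (intro mult_right_mono) auto
      then show ?case using est[of w] by (simp add: power2_eq_square mult.assoc)
    qed
  qed
qed

section \<open>Smooth periodic functions and weighted summability\<close>

lemma smooth_has_derivative:
  assumes "smooth f"
  shows "((deriv ^^ m) f has_real_derivative (deriv ^^ Suc m) f z) (at z)"
  using assms by (simp add: smooth_def DERIV_deriv_iff_real_differentiable)

lemma smooth_continuous: "smooth f \<Longrightarrow> continuous_on UNIV ((deriv ^^ m) f)"
  using smooth_has_derivative by (intro DERIV_continuous_on) blast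

lemma deriv_periodic:
  fixes f :: "real \<Rightarrow> real"
  assumes "\<And>z. f (z + c) = f z"
  shows "(deriv ^^ m) f (z + c) = (deriv ^^ m) f z"
proof (induction m arbitrary: z)
  case (Suc m)
  have "(\<lambda>x. (deriv ^^ m) f (x + c)) = (deriv ^^ m) f" using Suc by auto
  moreover have "deriv g (z + c) = deriv (\<lambda>x. g (x + c)) z" for g :: "real \<Rightarrow> real"
    by (simp add: deriv_def DERIV_shift)
  ultimately show ?case by simp
qed (simp add: assms)

lemma smooth_diff:
  assumes f: "smooth f" and g: "smooth g"
  shows "(deriv ^^ m) (\<lambda>z. f z - g z) = (\<lambda>z. (deriv ^^ m) f z - (deriv ^^ m) g z)" and "smooth (\<lambda>z. f z - g z)"
proof -
  show *: "(deriv ^^ m) (\<lambda>z. f z - g z) = (\<lambda>z. (deriv ^^ m) f z - (deriv ^^ m) g z)" for m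
  proof (induction m)
    case (Suc m)
    have "((\<lambda>z. (deriv ^^ m) f z - (deriv ^^ m) g z) has_real_derivative
        (deriv ^^ Suc m) f z - (deriv ^^ Suc m) g z) (at z)" for z
      by (intro DERIV_diff smooth_has_derivative f g)
    then show ?case by (simp add: Suc DERIV_imp_deriv fun_eq_iff)
  qed simp
  show "smooth (\<lambda>z. f z - g z)"
    unfolding smooth_def * using f g unfolding smooth_def by (intro allI differentiable_diff) auto
qed

lemma smooth_add:
  assumes f: "smooth f" and g: "smooth g"
  shows "smooth (\<lambda>z. f z + g z)"
proof -
  have "(deriv ^^ m) (\<lambda>z. f z + g z) = (\<lambda>z. (deriv ^^ m) f z + (deriv ^^ m) g z)" for m
  proof (induction m)
    case (Suc m)
    have "((\<lambda>z. (deriv ^^ m) f z + (deriv ^^ m) g z) has_real_derivative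
        (deriv ^^ Suc m) f z + (deriv ^^ Suc m) g z) (at z)" for z
      by (intro DERIV_add smooth_has_derivative f g)
    then show ?case by (simp add: Suc DERIV_imp_deriv fun_eq_iff)
  qed simp
  then show ?thesis using f g unfolding smooth_def by (auto intro!: differentiable_add)
qed

lemma smooth_cos: "smooth (\<lambda>z. A * cos (a * z))"
proof -
  have "\<exists>B C. (deriv ^^ m) (\<lambda>z. A * cos (a * z)) = (\<lambda>z. B * cos (a * z) + C * sin (a * z))" for m
  proof (induction m)
    case 0
    show ?case by (intro exI[of _ A] exI[of _ 0]) simp
  next
    case (Suc m)
    then obtain B C where BC: "(deriv ^^ m) (\<lambda>z. A * cos (a * z)) = (\<lambda>z. B * cos (a * z) + C * sin (a * z))" by blast
    have "((\<lambda>z. B * cos (a * z) + C * sin (a * z)) has_real_derivative (C * a) * cos (a * z) + (- B * a) * sin (a * z)) (at z)" for z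
      by (auto intro!: derivative_eq_intros)
    then have "(deriv ^^ Suc m) (\<lambda>z. A * cos (a * z)) = (\<lambda>z. (C * a) * cos (a * z) + (- B * a) * sin (a * z))"
      by (simp add: BC DERIV_imp_deriv fun_eq_iff)
    then show ?case by blast
  qed
  note form = this
  have diff: "(\<lambda>z. B * cos (a * z) + C * sin (a * z)) differentiable (at z)" for B C z :: real
    unfolding real_differentiable_def by (rule exI) (auto intro!: derivative_eq_intros)
  show ?thesis
    unfolding smooth_def
  proof (intro allI)
    fix m z
    obtain B C where "(deriv ^^ m) (\<lambda>z. A * cos (a * z)) = (\<lambda>z. B * cos (a * z) + C * sin (a * z))"
      using form by blast
    then show "(deriv ^^ m) (\<lambda>z. A * cos (a * z)) differentiable at z" using diff by simp
  qed
qed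

text \<open>Integration by parts, written as the integral of the derivative of \<open>f\<close>
  times an exponential, which vanishes by periodicity.\<close>

lemma fourier_derivative:
  fixes f f' :: "real \<Rightarrow> real"
  assumes f: "\<And>z. (f has_real_derivative f' z) (at z)" and f': "continuous_on UNIV f'" and per: "f (2 * pi) = f 0"
  shows "fourier (\<lambda>z. of_real (f' z)) n = \<i> * of_int n * fourier (\<lambda>z. of_real (f z)) n"
proof -
  have cf: "continuous_on UNIV f" using f by (intro DERIV_continuous_on) blast
  let ?e = "\<lambda>z. cis (- of_int n * z)"
  let ?A = "\<lambda>z. of_real (f' z) * ?e z" and ?B = "\<lambda>z. of_real (f z) * ?e z"
  have A: "integrable torus ?A" and B: "integrable torus ?B"
    by (intro torus_continuous_integrable continuous_intros f' cf)+
  have fv: "((\<lambda>z. of_real (f z) :: complex) has_vector_derivative of_real (f' z)) (at z)" for z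
    using f[of z] by (intro has_vector_derivative_of_real) (simp add: has_real_derivative_iff_has_vector_derivative)
  have "(\<integral>z. of_real (f z) * (\<i> * of_real (- of_int n) * ?e z) + ?A z \<partial>torus) = ?B (2 * pi) - ?B 0"
    by (rule integral_torus_eq)
      (intro continuous_intros f' cf has_vector_derivative_mult fv cis_has_vector_derivative)+
  also have "?B (2 * pi) = ?B 0"
    using cis_multiple_2pi[of "of_int (-n)"] per by (simp add: mult_ac)
  finally have "(\<integral>z. - (\<i> * of_int n) * ?B z + ?A z \<partial>torus) = 0" by (simp add: mult_ac)
  then have "(\<integral>z. ?A z \<partial>torus) = \<i> * of_int n * (\<integral>z. ?B z \<partial>torus)"
    using A B by (subst (asm) Bochner_Integration.integral_add) auto
  then show ?thesis unfolding fourier_def by simp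
qed

lemma fourier_deriv:
  assumes f: "smooth f" and per: "\<And>z. f (z + 2 * pi) = f z"
  shows "fourier (\<lambda>z. of_real ((deriv ^^ m) f z)) n = (\<i> * of_int n) ^ m * fourier (\<lambda>z. of_real (f z)) n"
proof (induction m)
  case (Suc m)
  have "fourier (\<lambda>z. of_real ((deriv ^^ Suc m) f z)) n = \<i> * of_int n * fourier (\<lambda>z. of_real ((deriv ^^ m) f z)) n"
    using deriv_periodic[of f "2 * pi" m 0, OF per]
    by (intro fourier_derivative smooth_has_derivative f smooth_continuous) simp
  then show ?case using Suc by simp
qed simp

text \<open>Submultiplicative weights. They make the weighted summable sequences an algebra under
  convolution, and they compare with the Sobolev weights: an element of \<open>ell2\<close> divided
  by \<open>wt p\<close> has p square integrable derivatives.\<close>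

definition wt :: "nat \<Rightarrow> int \<Rightarrow> real" where
  "wt p n = (1 + \<bar>of_int n\<bar>) ^ p"

lemma wt_ge_1: "wt p n \<ge> 1" unfolding wt_def by simp

lemma wt_pos [simp]: "wt p n > 0" "wt p n \<ge> 0" "wt p n \<noteq> 0" "\<bar>wt p n\<bar> = wt p n"
  using wt_ge_1[of p n] by auto

lemma wt_uminus [simp]: "wt p (- n) = wt p n" unfolding wt_def by simp

lemma wt_mult: "wt p n \<le> wt p (n - m) * wt p m"
proof -
  have "1 + \<bar>of_int n\<bar> \<le> (1 + \<bar>of_int (n - m)\<bar>) * (1 + \<bar>of_int m :: real\<bar>)"
  proof -
    have "(1 + x) * (1 + y) \<ge> 1 + (x + y)" if "x \<ge> 0" "y \<ge> 0" for x y :: real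
      using that by (simp add: algebra_simps)
    from this[of "\<bar>of_int (n - m)\<bar>" "\<bar>of_int m\<bar>"] show ?thesis
      using abs_triangle_ineq[of "of_int (n - m)" "of_int m :: real"] by simp
  qed
  then show ?thesis unfolding wt_def power_mult_distrib[symmetric] by (intro power_mono) auto
qed

definition Cdecay :: "nat \<Rightarrow> real" where
  "Cdecay p = 2 ^ (p + 1) * (\<Sum>\<^sub>\<infinity>n::int. 1 / (1 + (of_int n)\<^sup>2))"

lemma Cdecay_nonneg: "Cdecay p \<ge> 0"
  unfolding Cdecay_def by (intro mult_nonneg_nonneg infsum_nonneg) auto

text \<open>Of the p + 2 derivatives, p pay for the weight and two for summability over n. The
  factor \<open>2 ^ (p + 1)\<close> in \<open>Cdecay\<close> comes from
  \<open>1 + \<bar>n\<bar> \<le> 2 * \<bar>n\<bar>\<close> and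
  \<open>1 + n\<^sup>2 \<le> 2 * n\<^sup>2\<close> for n \<noteq> 0; the bound on \<open>f\<close>
  itself takes care of n = 0.\<close>

lemma fourier_decay:
  assumes f: "smooth f" and per: "\<And>z. f (z + 2 * pi) = f z"
    and B: "\<And>z. z \<in> {0..2*pi} \<Longrightarrow> \<bar>f z\<bar> \<le> B" "\<And>z. z \<in> {0..2*pi} \<Longrightarrow> \<bar>(deriv ^^ (p + 2)) f z\<bar> \<le> B"
  shows "(\<lambda>n. wt p n * cmod (fourier (\<lambda>z. of_real (f z)) n)) summable_on UNIV"
    and "(\<Sum>\<^sub>\<infinity>n. wt p n * cmod (fourier (\<lambda>z. of_real (f z)) n)) \<le> Cdecay p * B"
proof -
  let ?h = "fourier (\<lambda>z. of_real (f z))"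
  have int: "integrable torus (\<lambda>z. of_real ((deriv ^^ m) f z) :: complex)" for m
    by (intro torus_continuous_integrable continuous_intros smooth_continuous f)
  have B0: "B \<ge> 0" using B(1)[of 0] by simp
  have bd: "wt p n * cmod (?h n) \<le> 2 ^ (p + 1) * B * (1 / (1 + (of_int n)\<^sup>2))" for n
  proof (cases "n = 0")
    case True
    have "cmod (?h 0) \<le> B" using B(1) int[of 0] by (intro fourier_bound) auto
    also have "B \<le> 2 ^ (p + 1) * B" using mult_right_mono[OF one_le_power[of "2::real" "p + 1"] B0] by simp
    finally show ?thesis using True by (simp add: wt_def)
  next
    case False
    then have n1: "\<bar>of_int n :: real\<bar> \<ge> 1" by (simp add: Ints_nonzero_abs_ge1)
    have "cmod (fourier (\<lambda>z. of_real ((deriv ^^ (p + 2)) f z)) n) \<le> B"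
      by (intro fourier_bound int) (use B(2) in auto)
    then have hB: "\<bar>of_int n\<bar> ^ (p + 2) * cmod (?h n) \<le> B"
      unfolding fourier_deriv[OF f per] by (simp add: norm_mult norm_power)
    have "wt p n \<le> (2 * \<bar>of_int n\<bar>) ^ p" unfolding wt_def using n1 by (intro power_mono) auto
    then have "wt p n * (1 + (of_int n)\<^sup>2) \<le> (2 * \<bar>of_int n\<bar>) ^ p * (2 * \<bar>of_int n\<bar>\<^sup>2)"
      using n1 power_mono[OF n1, of 2] by (intro mult_mono) auto
    also have "\<dots> = 2 ^ (p + 1) * \<bar>of_int n\<bar> ^ (p + 2)"
      by (simp add: power_mult_distrib power_add power2_eq_square)
    finally have "wt p n * (1 + (of_int n)\<^sup>2) * cmod (?h n) \<le> 2 ^ (p + 1) * \<bar>of_int n\<bar> ^ (p + 2) * cmod (?h n)"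
      by (rule mult_right_mono) simp
    also have "\<dots> \<le> 2 ^ (p + 1) * B" using hB by (simp add: mult.assoc)
    finally show ?thesis by (simp add: pos_le_divide_eq add_pos_nonneg mult_ac)
  qed
  have s: "(\<lambda>n::int. 2 ^ (p + 1) * B * (1 / (1 + (of_int n)\<^sup>2))) summable_on UNIV"
    by (intro summable_on_cmult_right summable_on_inverse_square_int)
  show 1: "(\<lambda>n. wt p n * cmod (?h n)) summable_on UNIV"
    by (rule summable_on_comparison_test[OF s bd]) auto
  have "(\<Sum>\<^sub>\<infinity>n. wt p n * cmod (?h n)) \<le> (\<Sum>\<^sub>\<infinity>n::int. 2 ^ (p + 1) * B * (1 / (1 + (of_int n)\<^sup>2)))"
    by (intro infsum_mono 1 s bd)
  also have "\<dots> = Cdecay p * B" unfolding infsum_cmult_right' Cdecay_def by simp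
  finally show "(\<Sum>\<^sub>\<infinity>n. wt p n * cmod (?h n)) \<le> Cdecay p * B" .
qed

lemma fourier_smooth_summable:
  assumes f: "smooth f" and per: "\<And>z. f (z + 2 * pi) = f z"
  shows "(\<lambda>n. wt p n * cmod (fourier (\<lambda>z. of_real (f z)) n)) summable_on UNIV"
proof -
  have "\<exists>B. \<forall>z\<in>{0..2*pi}. \<bar>(deriv ^^ m) f z\<bar> \<le> B" for m
  proof -
    have "bounded ((deriv ^^ m) f ` {0..2*pi})"
      by (intro compact_imp_bounded compact_continuous_image continuous_on_subset[OF smooth_continuous[OF f]]) auto
    then obtain B where "\<forall>y\<in>(deriv ^^ m) f ` {0..2*pi}. norm y \<le> B" unfolding bounded_iff by blast
    then show ?thesis by auto
  qed
  from this[of 0] this[of "p + 2"] obtain B1 B2 where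
    "\<forall>z\<in>{0..2*pi}. \<bar>f z\<bar> \<le> B1" "\<forall>z\<in>{0..2*pi}. \<bar>(deriv ^^ (p + 2)) f z\<bar> \<le> B2" by auto
  then show ?thesis by (intro fourier_decay(1)[OF f per, where B = "max B1 B2"]) fastforce+
qed

lemma wt_summable_imp:
  fixes f :: "int \<Rightarrow> 'a :: real_normed_vector"
  assumes "(\<lambda>n. wt p n * norm (f n)) summable_on UNIV"
  shows "(\<lambda>n. norm (f n)) summable_on UNIV"
  by (rule summable_on_comparison_test[OF assms]) (use wt_ge_1 in \<open>auto simp: mult_le_cancel_right1\<close>)

section \<open>The convolution algebra of weighted summable sequences\<close>

definition conv :: "(int \<Rightarrow> complex) \<Rightarrow> (int \<Rightarrow> complex) \<Rightarrow> int \<Rightarrow> complex" where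
  "conv f g n = (\<Sum>\<^sub>\<infinity>m. f (n - m) * g m)"

definition wnorm :: "nat \<Rightarrow> (int \<Rightarrow> complex) \<Rightarrow> real" where
  "wnorm p f = (\<Sum>\<^sub>\<infinity>n. wt p n * cmod (f n))"

definition wfinite :: "nat \<Rightarrow> (int \<Rightarrow> complex) \<Rightarrow> bool" where
  "wfinite p f \<longleftrightarrow> (\<lambda>n. wt p n * cmod (f n)) summable_on UNIV"

lemma wnorm_nonneg: "wnorm p f \<ge> 0"
  unfolding wnorm_def by (intro infsum_nonneg) auto

lemma wfinite_summable: "wfinite p f \<Longrightarrow> (\<lambda>n. cmod (f n)) summable_on UNIV"
  unfolding wfinite_def by (rule wt_summable_imp)

lemma wfinite_add:
  assumes f: "wfinite p f" and g: "wfinite p g"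
  shows "wfinite p (\<lambda>n. f n + g n)" and "wnorm p (\<lambda>n. f n + g n) \<le> wnorm p f + wnorm p g"
proof -
  have s: "(\<lambda>n. wt p n * cmod (f n) + wt p n * cmod (g n)) summable_on UNIV"
    using f g unfolding wfinite_def by (rule summable_on_add)
  have le: "wt p n * cmod (f n + g n) \<le> wt p n * cmod (f n) + wt p n * cmod (g n)" for n
    unfolding distrib_left[symmetric] by (intro mult_left_mono norm_triangle_ineq) auto
  show 1: "wfinite p (\<lambda>n. f n + g n)"
    unfolding wfinite_def by (rule summable_on_comparison_test[OF s le]) auto
  show "wnorm p (\<lambda>n. f n + g n) \<le> wnorm p f + wnorm p g"
    unfolding wnorm_def infsum_add[OF f[unfolded wfinite_def] g[unfolded wfinite_def], symmetric]
    by (intro infsum_mono s le) (use 1 in \<open>auto simp: wfinite_def\<close>)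
qed

lemma wfinite_cmult: "wfinite p f \<Longrightarrow> wfinite p (\<lambda>n. c * f n)" "wnorm p (\<lambda>n. c * f n) = cmod c * wnorm p f"
  unfolding wfinite_def wnorm_def
  by (simp_all add: norm_mult mult.left_commute summable_on_cmult_right infsum_cmult_right')

lemma wfinite_finite:
  assumes "finite F" "\<And>n. n \<notin> F \<Longrightarrow> f n = 0"
  shows "wfinite p f" and "wnorm p f = (\<Sum>n\<in>F. wt p n * cmod (f n))"
proof -
  have "((\<lambda>n. wt p n * cmod (f n)) has_sum (\<Sum>n\<in>F. wt p n * cmod (f n))) UNIV"
    by (rule has_sum_finite_neutralI[OF assms(1)]) (auto simp: assms(2))
  then show "wfinite p f" "wnorm p f = (\<Sum>n\<in>F. wt p n * cmod (f n))"
    unfolding wfinite_def wnorm_def by (auto simp: has_sum_iff)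
qed

text \<open>By \<open>wt_mult\<close> the weighted terms are dominated by \<open>F\<close>, whose
  double sum factors into the product of the two norms; exchanging the sums also gives summability
  over m for every n.\<close>

lemma wfinite_conv:
  assumes f: "wfinite p f" and g: "wfinite p g"
  shows "wfinite p (conv f g)" and "wnorm p (conv f g) \<le> wnorm p f * wnorm p g"
    and "(\<lambda>m. f (n - m) * g m) summable_on UNIV"
proof -
  define F where "F m n = wt p (n - m) * cmod (f (n - m)) * (wt p m * cmod (g m))" for m n
  have F0: "F m n \<ge> 0" for m n unfolding F_def by simp
  have row: "(\<lambda>n. F m n) summable_on UNIV" "(\<Sum>\<^sub>\<infinity>n. F m n) = wnorm p f * (wt p m * cmod (g m))" for m
    unfolding F_def wnorm_def infsum_cmult_left'
    using summable_on_int_shift(2)[OF f[unfolded wfinite_def], of m]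
      infsum_int_shift(2)[of "\<lambda>n. wt p n * cmod (f n)" m]
    by (simp_all add: summable_on_cmult_left)
  have "(\<lambda>x. norm (case x of (m, n) \<Rightarrow> F m n)) summable_on (UNIV \<times> UNIV)"
    using row g F0 unfolding wfinite_def
    by (subst Infinite_Sum.abs_summable_on_Sigma_iff) (simp add: abs_mult abs_of_nonneg[OF wnorm_nonneg] summable_on_cmult_right)
  then have FF: "(\<lambda>(m, n). F m n) summable_on (UNIV \<times> UNIV)"
    by (rule abs_summable_summable)
  then have FF': "(\<lambda>(n, m). F m n) summable_on (UNIV \<times> UNIV)"
    by (subst summable_on_swap) (simp add: case_prod_unfold)
  have col: "(\<lambda>m. F m n) summable_on UNIV" for n
    using summable_on_SigmaD1[OF FF'] by simp
  have cols: "(\<lambda>n. \<Sum>\<^sub>\<infinity>m. F m n) summable_on UNIV"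
    using summable_on_Sigma_banach[OF FF'] by simp
  have le: "wt p n * cmod (f (n - m) * g m) \<le> F m n" for m n
  proof -
    have "wt p n * cmod (f (n - m) * g m) \<le> wt p (n - m) * wt p m * cmod (f (n - m) * g m)"
      by (intro mult_right_mono wt_mult) auto
    then show ?thesis by (simp add: F_def norm_mult mult_ac)
  qed
  have s1: "(\<lambda>m. wt p n * cmod (f (n - m) * g m)) summable_on UNIV" for n
    by (rule summable_on_comparison_test[OF col le]) auto
  have s2: "(\<lambda>m. cmod (f (n - m) * g m)) summable_on UNIV" for n
    using summable_on_cmult_right[OF s1[of n], of "inverse (wt p n)"] by (simp flip: mult.assoc)
  then show "(\<lambda>m. f (n - m) * g m) summable_on UNIV" by (rule abs_summable_summable)
  have le': "wt p n * cmod (conv f g n) \<le> (\<Sum>\<^sub>\<infinity>m. F m n)" for n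
  proof -
    have "wt p n * cmod (conv f g n) \<le> wt p n * (\<Sum>\<^sub>\<infinity>m. cmod (f (n - m) * g m))"
      unfolding conv_def by (intro mult_left_mono norm_infsum_bound s2) auto
    also have "\<dots> = (\<Sum>\<^sub>\<infinity>m. wt p n * cmod (f (n - m) * g m))" by (rule infsum_cmult_right'[symmetric])
    also have "\<dots> \<le> (\<Sum>\<^sub>\<infinity>m. F m n)" by (intro infsum_mono s1 col le)
    finally show ?thesis .
  qed
  show 1: "wfinite p (conv f g)"
    unfolding wfinite_def by (rule summable_on_comparison_test[OF cols le']) auto
  have "wnorm p (conv f g) \<le> (\<Sum>\<^sub>\<infinity>n. \<Sum>\<^sub>\<infinity>m. F m n)"
    unfolding wnorm_def by (intro infsum_mono cols le') (use 1 in \<open>simp add: wfinite_def\<close>)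
  also have "\<dots> = (\<Sum>\<^sub>\<infinity>m. \<Sum>\<^sub>\<infinity>n. F m n)" by (rule infsum_swap_banach[OF FF'])
  also have "\<dots> = wnorm p f * wnorm p g"
    unfolding row(2) infsum_cmult_right' wnorm_def by (rule refl)
  finally show "wnorm p (conv f g) \<le> wnorm p f * wnorm p g" .
qed

lemma conv_add_left:
  assumes "wfinite p f" "wfinite p f'" "wfinite p g"
  shows "conv (\<lambda>n. f n + f' n) g n = conv f g n + conv f' g n"
  unfolding conv_def distrib_right using assms by (intro infsum_add wfinite_conv(3))

lemma conv_add_right:
  assumes "wfinite p f" "wfinite p g" "wfinite p g'"
  shows "conv f (\<lambda>n. g n + g' n) n = conv f g n + conv f g' n"
  unfolding conv_def distrib_left using assms by (intro infsum_add wfinite_conv(3))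

lemma conv_uminus:
  shows "conv f g (- n) = conv (\<lambda>n. f (- n)) (\<lambda>n. g (- n)) n"
  unfolding conv_def
  by (subst infsum_reindex_bij_betw[where g = uminus and A = UNIV, symmetric])
    (auto intro!: bij_betwI[where g = uminus] infsum_cong simp: algebra_simps)

lemma conv_cnj: "cnj (conv f g n) = conv (\<lambda>n. cnj (f n)) (\<lambda>n. cnj (g n)) n"
  unfolding conv_def infsum_cnj[symmetric] by simp

lemma fourier_cnj: "cnj (fourier f n) = fourier (\<lambda>z. cnj (f z)) (- n)"
proof -
  have "cnj (\<integral>z. f z * cis (- (of_int n * z)) \<partial>torus) = (\<integral>z. cnj (f z * cis (- (of_int n * z))) \<partial>torus)"
    by (rule Bochner_Integration.integral_cnj[symmetric])
  then show ?thesis unfolding fourier_def by (simp add: cis_cnj)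
qed

text \<open>Evenness in Fourier space follows from uniqueness of the coefficients; no change of
  variables in the integral is needed.\<close>

lemma fourier_even:
  assumes f: "smooth f" and per: "\<And>z. f (z + 2 * pi) = f z" and even: "\<And>z. f (- z) = f z"
  defines "h \<equiv> fourier (\<lambda>z. of_real (f z))"
  shows "h (- n) = h n" and "(\<lambda>z. of_real (f z)) = fser h" and "Im (h n) = 0" and "wfinite p h"
proof -
  show w: "wfinite p h" for p
    unfolding wfinite_def h_def by (rule fourier_smooth_summable[OF f per])
  have s: "(\<lambda>n. cmod (h n)) summable_on UNIV" by (rule wfinite_summable[OF w[of 0]])
  have c: "continuous_on UNIV (\<lambda>z. of_real (f z) :: complex)"
    using smooth_continuous[OF f, of 0] by (intro continuous_intros) simp
  show eq: "(\<lambda>z. of_real (f z)) = fser h"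
    unfolding h_def by (rule continuous_eq_fser[OF c]) (use per s in \<open>auto simp: h_def\<close>)
  have s': "(\<lambda>n. cmod (h (- n))) summable_on UNIV"
    using summable_on_int_shift(1)[OF s, of 0] by simp
  have "fser (\<lambda>n. h (- n)) z = fser h z" for z
  proof -
    have "fser (\<lambda>n. h (- n)) z = (\<Sum>\<^sub>\<infinity>n. h n * cis (of_int (- n) * z))"
      unfolding fser_def using infsum_int_shift(1)[of "\<lambda>n. h n * cis (of_int (- n) * z)" 0] by simp
    also have "\<dots> = fser h (- z)" by (simp add: fser_def)
    also have "\<dots> = fser h z" using even[of z] fun_cong[OF eq, of z] fun_cong[OF eq, of "-z"] by simp
    finally show ?thesis .
  qed
  then have "fser (\<lambda>n. h (- n)) = fser h" by auto
  then show ev: "h (- n) = h n" for n using fourier_fser[OF s', of n] fourier_fser[OF s, of n] by simp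
  have "cnj (h n) = h (- n)" unfolding h_def fourier_cnj by simp
  then have "cnj (h n) = h n" by (simp add: ev)
  then show "Im (h n) = 0" by (simp add: complex_eq_iff)
qed

lemma fourier_cos:
  assumes "k \<noteq> 0"
  shows "fourier (\<lambda>z. of_real (A * cos (of_int k * z))) n = (if \<bar>n\<bar> = \<bar>k\<bar> then of_real A / 2 else 0)"
proof -
  define a where "a n = (if \<bar>n\<bar> = \<bar>k\<bar> then of_real A / 2 else 0 :: complex)" for n
  have s: "(\<lambda>n. cmod (a n)) summable_on UNIV"
    by (rule finite_nonzero_values_imp_summable_on, rule finite_subset[of _ "{k, -k}"]) (auto simp: a_def split: if_splits)
  have "fser a z = of_real (A * cos (of_int k * z))" for z
  proof -
    have "((\<lambda>n. a n * cis (of_int n * z)) has_sum (\<Sum>n\<in>{k, -k}. a n * cis (of_int n * z))) UNIV"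
      by (rule has_sum_finite_neutralI) (auto simp: a_def)
    then have "fser a z = (\<Sum>n\<in>{k, -k}. a n * cis (of_int n * z))" unfolding fser_def by (rule infsumI)
    also have "\<dots> = of_real (A * cos (of_int k * z))"
      using assms by (simp add: a_def complex_eq_iff)
    finally show ?thesis .
  qed
  then have eq: "(\<lambda>z. of_real (A * cos (of_int k * z))) = fser a" by auto
  show ?thesis unfolding eq fourier_fser[OF s] by (simp only: a_def)
qed

section \<open>The waves in Fourier space\<close>

locale profile =
  fixes \<eta> :: "real \<Rightarrow> real"
  assumes smooth: "smooth \<eta>" and per: "\<And>z. \<eta> (z + 2 * pi) = \<eta> z" and even: "\<And>z. \<eta> (- z) = \<eta> z"
begin

definition "h = fourier (\<lambda>z. of_real (\<eta> z))"

lemmas h_even = fourier_even(1)[OF smooth per even, folded h_def]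
lemmas h_fser = fourier_even(2)[OF smooth per even, folded h_def]
lemmas h_real = fourier_even(3)[OF smooth per even, folded h_def]
lemmas h_wfinite = fourier_even(4)[OF smooth per even, folded h_def]
lemmas h_summable = wfinite_summable[OF h_wfinite[of 0]]

lemma \<eta>_continuous: "continuous_on UNIV \<eta>" using smooth_continuous[OF smooth, of 0] by simp

lemma \<eta>_cont_complex: "continuous_on UNIV (\<lambda>z. of_real (\<eta> z) :: complex)"
  by (intro continuous_intros \<eta>_continuous)

lemma fourier_\<eta>_mult:
  assumes "integrable torus f"
  shows "fourier (\<lambda>z. of_real (\<eta> z) * f z) n = conv h (fourier f) n" "integrable torus (\<lambda>z. of_real (\<eta> z) * f z)"
proof -
  have *: "(\<lambda>z. of_real (\<eta> z) * f z) = (\<lambda>z. fser h z * f z)" using fun_cong[OF h_fser] by (simp add: fun_eq_iff)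
  show "fourier (\<lambda>z. of_real (\<eta> z) * f z) n = conv h (fourier f) n"
    unfolding conv_def * by (rule fourier_fser_mult[OF h_summable assms])
  show "integrable torus (\<lambda>z. of_real (\<eta> z) * f z)" unfolding * by (rule fser_mult_integrable[OF h_summable assms])
qed

lemma fourier_\<eta>_sq: "fourier (\<lambda>z. of_real ((\<eta> z)\<^sup>2)) n = conv h h n"
  using fourier_\<eta>_mult(1)[OF torus_continuous_integrable[OF \<eta>_cont_complex], of n]
  by (simp add: power2_eq_square h_def)

text \<open>In the applications \<open>a\<close> is \<open>c - wave_c0 j \<gamma> k\<close>, the
  deviation of the speed from its value at amplitude 0; the rest of the speed enters the diagonal
  part \<open>disp\<close>. Thus \<open>wave_fun\<close> is of order \<epsilon>.\<close>

definition "wave_fun k \<alpha>1 \<alpha>2 a z = k\<^sup>2 * (2 * \<alpha>1 * \<eta> z + 3 * \<alpha>2 * (\<eta> z)\<^sup>2 - a)"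

definition "wave_q k \<alpha>1 \<alpha>2 a = fourier (\<lambda>z. of_real (wave_fun k \<alpha>1 \<alpha>2 a z))"

lemma fourier_const: "fourier (\<lambda>z. c) n = (if n = 0 then c else 0)"
  using integral_torus_cis[of "-n"] unfolding fourier_def by simp

lemma wave_q_eq:
  "wave_q k \<alpha>1 \<alpha>2 a n = of_real (k\<^sup>2) * (of_real (2 * \<alpha>1) * h n + of_real (3 * \<alpha>2) * conv h h n - (if n = 0 then of_real a else 0))"
proof -
  have i1: "integrable torus (\<lambda>z. of_real (2 * \<alpha>1) * of_real (\<eta> z) :: complex)"
    and i2: "integrable torus (\<lambda>z. of_real (3 * \<alpha>2) * of_real ((\<eta> z)\<^sup>2) :: complex)"
    and i3: "integrable torus (\<lambda>z. of_real (2 * \<alpha>1) * of_real (\<eta> z) + of_real (3 * \<alpha>2) * of_real ((\<eta> z)\<^sup>2) :: complex)"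
    and i4: "integrable torus (\<lambda>z. of_real a :: complex)"
    by (intro torus_continuous_integrable continuous_intros \<eta>_continuous)+
  have "wave_q k \<alpha>1 \<alpha>2 a n = fourier (\<lambda>z. of_real (k\<^sup>2) * (of_real (2 * \<alpha>1) * of_real (\<eta> z) + of_real (3 * \<alpha>2) * of_real ((\<eta> z)\<^sup>2) - of_real a)) n"
    unfolding wave_q_def wave_fun_def by simp
  also have "\<dots> = of_real (k\<^sup>2) * (of_real (2 * \<alpha>1) * h n + of_real (3 * \<alpha>2) * conv h h n - (if n = 0 then of_real a else 0))"
    by (simp only: fourier_cmult fourier_diff[OF i3 i4] fourier_add[OF i1 i2] fourier_\<eta>_sq h_def fourier_const)
  finally show ?thesis .
qed

lemma wave_q_wfinite: "wfinite p (wave_q k \<alpha>1 \<alpha>2 a)"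
proof -
  have "wave_q k \<alpha>1 \<alpha>2 a = (\<lambda>n. of_real (k\<^sup>2) * ((of_real (2 * \<alpha>1) * h n + of_real (3 * \<alpha>2) * conv h h n) + (if n = 0 then - of_real a else 0)))"
    by (simp add: fun_eq_iff wave_q_eq)
  moreover have "wfinite p \<dots>"
    by (intro wfinite_cmult wfinite_add wfinite_conv h_wfinite wfinite_finite(1)[of "{0}"]) auto
  ultimately show ?thesis by simp
qed

lemmas wave_q_summable = wfinite_summable[OF wave_q_wfinite[of 0]]

lemma wave_q_even: "wave_q k \<alpha>1 \<alpha>2 a (- n) = wave_q k \<alpha>1 \<alpha>2 a n"
  unfolding wave_q_eq conv_uminus h_even by simp

lemma cnj_h: "cnj (h n) = h n" using h_real[of n] by (simp add: complex_eq_iff)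

lemma cnj_wave_q: "cnj (wave_q k \<alpha>1 \<alpha>2 a n) = wave_q k \<alpha>1 \<alpha>2 a n"
  unfolding wave_q_eq by (simp add: conv_cnj cnj_h)

lemma wave_fun_continuous: "continuous_on UNIV (\<lambda>z. of_real (wave_fun k \<alpha>1 \<alpha>2 a z) :: complex)"
  unfolding wave_fun_def by (intro continuous_intros \<eta>_continuous)

lemma wave_fun_fser: "(\<lambda>z. of_real (wave_fun k \<alpha>1 \<alpha>2 a z)) = fser (wave_q k \<alpha>1 \<alpha>2 a)"
  unfolding wave_q_def
  by (rule continuous_eq_fser[OF wave_fun_continuous])
    (use wave_q_summable in \<open>auto simp: wave_q_def wave_fun_def per\<close>)

lemma wave_q_mult:
  assumes f: "integrable torus f"
  shows "of_real (k\<^sup>2) * (of_real (2 * \<alpha>1) * fourier (\<lambda>z. of_real (\<eta> z) * f z) n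
      + of_real (3 * \<alpha>2) * fourier (\<lambda>z. of_real ((\<eta> z)\<^sup>2) * f z) n - of_real a * fourier f n)
    = conv (wave_q k \<alpha>1 \<alpha>2 a) (fourier f) n"
proof -
  have m1: "integrable torus (\<lambda>z. of_real (\<eta> z) * f z)" by (rule fourier_\<eta>_mult(2)[OF f])
  have "integrable torus (\<lambda>z. of_real (\<eta> z) * (of_real (\<eta> z) * f z))" by (rule fourier_\<eta>_mult(2)[OF m1])
  then have m2: "integrable torus (\<lambda>z. of_real ((\<eta> z)\<^sup>2) * f z)" by (simp add: power2_eq_square mult.assoc)
  have i1: "integrable torus (\<lambda>z. of_real (2 * \<alpha>1) * (of_real (\<eta> z) * f z))"
    and i2: "integrable torus (\<lambda>z. of_real (3 * \<alpha>2) * (of_real ((\<eta> z)\<^sup>2) * f z))"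
    and i4: "integrable torus (\<lambda>z. of_real a * f z)"
    by (intro integrable_mult_right m1 m2 f)+
  have i3: "integrable torus (\<lambda>z. of_real (2 * \<alpha>1) * (of_real (\<eta> z) * f z) + of_real (3 * \<alpha>2) * (of_real ((\<eta> z)\<^sup>2) * f z))"
    by (intro Bochner_Integration.integrable_add i1 i2)
  have "conv (wave_q k \<alpha>1 \<alpha>2 a) (fourier f) n = fourier (\<lambda>z. of_real (wave_fun k \<alpha>1 \<alpha>2 a z) * f z) n"
    unfolding conv_def fun_cong[OF wave_fun_fser] by (rule fourier_fser_mult[OF wave_q_summable f, symmetric])
  also have "\<dots> = fourier (\<lambda>z. of_real (k\<^sup>2) * (of_real (2 * \<alpha>1) * (of_real (\<eta> z) * f z)
      + of_real (3 * \<alpha>2) * (of_real ((\<eta> z)\<^sup>2) * f z) - of_real a * f z)) n"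
    unfolding wave_fun_def by (simp add: algebra_simps)
  also have "\<dots> = of_real (k\<^sup>2) * (of_real (2 * \<alpha>1) * fourier (\<lambda>z. of_real (\<eta> z) * f z) n
      + of_real (3 * \<alpha>2) * fourier (\<lambda>z. of_real ((\<eta> z)\<^sup>2) * f z) n - of_real a * fourier f n)"
    by (simp only: fourier_cmult fourier_diff[OF i3 i4] fourier_add[OF i1 i2])
  finally show ?thesis by simp
qed

lemma fourier_of_real_Re:
  assumes "integrable torus f"
  shows "fourier (\<lambda>z. of_real (Re (f z))) n = (fourier f n + cnj (fourier f (- n))) / 2"
proof -
  have "(\<lambda>z. of_real (Re (f z)) :: complex) = (\<lambda>z. (1/2) * (f z + cnj (f z)))"
    by (simp add: fun_eq_iff complex_eq_iff)
  then show ?thesis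
    using assms by (simp only: fourier_cmult fourier_add integrable_cnj) (simp add: fourier_cnj)
qed

text \<open>The profile equation, mode by mode. The solution property is read at t = 0, y = 0 and x
  = z / k, where it becomes \<open>k * G' z = \<gamma> * \<eta> z\<close> with \<open>G\<close> the
  expression inside the outer x-derivative; integration by parts then gives the
  coefficients.\<close>

lemma steady_fourier:
  assumes sol: "gRMKP_solution j \<gamma> 1 0 k (\<lambda>x y t. \<eta> (k * (x - c * t)))" and k: "k > 0"
    and jeven: "\<And>x. j (- x) = j x" and jb: "\<And>n::int. \<bar>j (k * of_int n)\<bar> \<le> B"
  shows "of_real (k\<^sup>2 * (of_int n)\<^sup>2) * (of_real (c - j (k * of_int n)) * h n - conv h h n) = of_real \<gamma> * h n"
proof -
  let ?\<eta>' = "deriv \<eta>" and ?\<eta>'' = "deriv (deriv \<eta>)"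
  have d1: "(\<eta> has_real_derivative ?\<eta>' z) (at z)" and d2: "(?\<eta>' has_real_derivative ?\<eta>'' z) (at z)" for z
    using smooth_has_derivative[OF smooth, of 0 z] smooth_has_derivative[OF smooth, of 1 z] by simp_all
  define a where "a n = of_real (j (k * of_int n)) * (of_real k * (\<i> * of_int n * h n))" for n
  have B0: "B \<ge> 0" using jb[of 0] by simp
  \<comment> \<open>The coefficients of the dispersive term contain one factor n from the
    x-derivative; two further powers make its series differentiable. Hence the weight of order
    three.\<close>
  have sa: "(\<lambda>n. (1 + (of_int n)\<^sup>2) * cmod (a n)) summable_on UNIV"
  proof (rule summable_on_comparison_test)
    show "(\<lambda>n. (B * k) * (wt 3 n * cmod (h n))) summable_on UNIV"
      using h_wfinite[of 3] unfolding wfinite_def by (rule summable_on_cmult_right)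
    fix n :: int
    have "(1 + x\<^sup>2) * x \<le> (1 + x) ^ 3" if "x \<ge> 0" for x :: real
      using that by (simp add: power3_eq_cube power2_eq_square algebra_simps)
    from this[of "\<bar>of_int n\<bar>"] have w: "(1 + (of_int n)\<^sup>2) * \<bar>of_int n\<bar> \<le> wt 3 n" by (simp add: wt_def)
    have "cmod (a n) = \<bar>j (k * of_int n)\<bar> * (k * (\<bar>of_int n\<bar> * cmod (h n)))" using k by (simp add: a_def norm_mult)
    also have "\<dots> \<le> B * (k * (\<bar>of_int n\<bar> * cmod (h n)))" using k jb by (intro mult_right_mono) auto
    finally have "(1 + (of_int n)\<^sup>2) * cmod (a n) \<le> (1 + (of_int n)\<^sup>2) * (B * (k * (\<bar>of_int n\<bar> * cmod (h n))))"
      by (intro mult_left_mono) auto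
    also have "\<dots> = (B * k) * (((1 + (of_int n)\<^sup>2) * \<bar>of_int n\<bar>) * cmod (h n))" by (simp only: mult_ac)
    also have "\<dots> \<le> (B * k) * (wt 3 n * cmod (h n))"
      using B0 k by (intro mult_left_mono mult_right_mono w) auto
    finally show "(1 + (of_int n)\<^sup>2) * cmod (a n) \<le> (B * k) * (wt 3 n * cmod (h n))" .
  qed auto
  have sa0: "(\<lambda>n. cmod (a n)) summable_on UNIV"
    by (rule summable_on_comparison_test[OF sa]) (auto simp: distrib_right)
  define S where "S z = Re (fser a z)" for z
  define S' where "S' z = Re (fser (\<lambda>n. \<i> * of_int n * a n) z)" for z
  have dS: "(S has_real_derivative S' z) (at z)" for z
    using bounded_linear.has_vector_derivative[OF bounded_linear_Re fser_has_vector_derivative[OF sa, of z]]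
    by (simp add: S_def[abs_def] S'_def has_real_derivative_iff_has_vector_derivative)
  define G where "G z = - k * c * ?\<eta>' z + S z + 2 * k * (\<eta> z * ?\<eta>' z)" for z
  define G' where "G' z = - k * c * ?\<eta>'' z + S' z + 2 * k * (?\<eta>' z * ?\<eta>' z + \<eta> z * ?\<eta>'' z)" for z
  have dG: "(G has_real_derivative G' z) (at z)" for z
    unfolding G_def G'_def by (auto intro!: derivative_eq_intros d1 d2 dS)
  have f\<eta>': "fourier (\<lambda>z. of_real (?\<eta>' z)) n = \<i> * of_int n * h n" for n
    using fourier_deriv[OF smooth per, of 1 n] by (simp add: h_def)
  have dx: "deriv (\<lambda>x. \<eta> (k * x)) = (\<lambda>x. k * ?\<eta>' (k * x))"
  proof
    fix x
    have "((\<lambda>x. \<eta> (k * x)) has_real_derivative ?\<eta>' (k * x) * k) (at x)"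
      by (rule DERIV_chain2[OF d1]) (auto intro!: derivative_eq_intros)
    then show "deriv (\<lambda>x. \<eta> (k * x)) x = k * ?\<eta>' (k * x)" by (simp add: DERIV_imp_deriv mult.commute)
  qed
  have dt: "deriv (\<lambda>t. \<eta> (k * (x - c * t))) 0 = - k * c * ?\<eta>' (k * x)" for x
  proof (rule DERIV_imp_deriv)
    have "((\<lambda>t. \<eta> (k * (x - c * t))) has_real_derivative ?\<eta>' (k * (x - c * 0)) * (k * (0 - c * 1))) (at 0)"
      by (rule DERIV_chain2[OF d1]) (auto intro!: derivative_eq_intros)
    then show "((\<lambda>t. \<eta> (k * (x - c * t))) has_real_derivative - k * c * ?\<eta>' (k * x)) (at 0)" by (simp add: mult_ac)
  qed
  have dsq: "deriv (\<lambda>x. (\<eta> (k * x))\<^sup>2) x = 2 * k * (\<eta> (k * x) * ?\<eta>' (k * x))" for x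
  proof (rule DERIV_imp_deriv)
    have "((\<lambda>x. \<eta> (k * x)) has_real_derivative ?\<eta>' (k * x) * k) (at x)"
      by (rule DERIV_chain2[OF d1]) (auto intro!: derivative_eq_intros)
    from DERIV_power[OF this, of 2]
    show "((\<lambda>x. (\<eta> (k * x))\<^sup>2) has_real_derivative 2 * k * (\<eta> (k * x) * ?\<eta>' (k * x))) (at x)" by (simp add: mult_ac)
  qed
  have J: "J_op j k (\<lambda>x. k * ?\<eta>' (k * x)) x = S (k * x)" for x
  proof -
    have "fourier (\<lambda>z. of_real (k * ?\<eta>' (k * (z / k)))) n = of_real k * (\<i> * of_int n * h n)" for n
      using k by (simp add: fourier_cmult f\<eta>')
    then show ?thesis unfolding J_op_def S_def fser_def a_def by (simp add: mult_ac)
  qed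
  have eq: "k * G' z = \<gamma> * \<eta> z" for z
  proof -
    have "deriv (\<lambda>x. G (k * x)) (z / k) = k * G' z"
    proof (rule DERIV_imp_deriv)
      have "((\<lambda>x. G (k * x)) has_real_derivative G' (k * (z / k)) * k) (at (z / k))"
        by (rule DERIV_chain2[OF dG]) (auto intro!: derivative_eq_intros)
      then show "((\<lambda>x. G (k * x)) has_real_derivative k * G' z) (at (z / k))" using k by (simp add: mult.commute)
    qed
    moreover have "deriv (\<lambda>x. deriv (\<lambda>t. \<eta> (k * (x - c * t))) 0 + J_op j k (deriv (\<lambda>x. \<eta> (k * (x - c * 0)))) x
        + 1 * deriv (\<lambda>x. (\<eta> (k * (x - c * 0)))\<^sup>2) x + 0 * deriv (\<lambda>x. (\<eta> (k * (x - c * 0))) ^ 3) x) (z / k)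
        - \<gamma> * \<eta> (k * (z / k - c * 0)) + deriv (deriv (\<lambda>y::real. \<eta> (k * (z / k - c * 0)))) 0 = 0"
      using sol unfolding gRMKP_solution_def by blast
    moreover have "deriv (deriv (\<lambda>y::real. C :: real)) 0 = 0" for C
    proof -
      have "deriv (\<lambda>y::real. C :: real) = (\<lambda>_. 0)" by (auto intro!: DERIV_imp_deriv)
      then show ?thesis by simp
    qed
    ultimately show ?thesis using k by (simp add: dx dt dsq J G_def)
  qed
  \<comment> \<open>Continuity of \<open>G'\<close> is read off from the equation, which expresses
    it through \<open>\<eta>\<close>.\<close>
  have G'c: "continuous_on UNIV G'"
  proof -
    have "G' = (\<lambda>z. \<gamma> * \<eta> z / k)" using eq k by (simp add: fun_eq_iff field_simps)
    then show ?thesis using k by (auto intro!: continuous_intros \<eta>_continuous)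
  qed
  have Gper: "G (2 * pi) = G 0"
    using per[of 0] deriv_periodic[of \<eta> "2 * pi" 1 0, OF per] fser_periodic[of a 0] by (simp add: G_def S_def)
  have c1: "continuous_on UNIV ?\<eta>'" using smooth_continuous[OF smooth, of 1] by simp
  have cS: "continuous_on UNIV S" using dS by (intro DERIV_continuous_on) blast
  have fG: "fourier (\<lambda>z. of_real (G z)) n = of_real k * (\<i> * of_int n) * (of_real (j (k * of_int n) - c) * h n + conv h h n)"
  proof -
    \<comment> \<open>\<open>J_op\<close> takes a real part. Since \<open>j\<close> and
      \<open>h\<close> are even and real, \<open>a\<close> satisfies
      \<open>cnj (a (- n)) = a n\<close>, so the series is already real and its coefficients are
      \<open>a n\<close>.\<close>
    have fS: "fourier (\<lambda>z. of_real (S z)) n = a n"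
    proof -
      have "cnj (a (- n)) = a n" using h_even[of n] jeven[of "k * of_int n"] by (simp add: a_def cnj_h)
      then show ?thesis unfolding S_def by (simp add: fourier_of_real_Re fser_integrable[OF sa0] fourier_fser[OF sa0])
    qed
    have sq': "((\<lambda>z. (\<eta> z)\<^sup>2) has_real_derivative 2 * (\<eta> z * ?\<eta>' z)) (at z)" for z
      using DERIV_power[OF d1[of z], of 2] by (simp add: mult_ac)
    have fsq: "fourier (\<lambda>z. of_real (2 * (\<eta> z * ?\<eta>' z))) n = \<i> * of_int n * conv h h n"
      using per[of 0] unfolding fourier_\<eta>_sq[symmetric]
      by (intro fourier_derivative sq' continuous_intros \<eta>_continuous c1) auto
    have i1: "integrable torus (\<lambda>z. of_real (- k * c) * of_real (?\<eta>' z) :: complex)"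
      and i2: "integrable torus (\<lambda>z. of_real (S z) :: complex)"
      and i3: "integrable torus (\<lambda>z. of_real (- k * c) * of_real (?\<eta>' z) + of_real (S z) :: complex)"
      and i4: "integrable torus (\<lambda>z. of_real k * of_real (2 * (\<eta> z * ?\<eta>' z)) :: complex)"
      by (intro torus_continuous_integrable continuous_intros \<eta>_continuous c1 cS)+
    have "fourier (\<lambda>z. of_real (G z)) n = fourier (\<lambda>z. (of_real (- k * c) * of_real (?\<eta>' z) + of_real (S z)) + of_real k * of_real (2 * (\<eta> z * ?\<eta>' z))) n"
      by (simp add: G_def mult_ac)
    also have "\<dots> = of_real (- k * c) * (\<i> * of_int n * h n) + a n + of_real k * (\<i> * of_int n * conv h h n)"
      by (simp only: fourier_add[OF i3 i4] fourier_add[OF i1 i2] fourier_cmult f\<eta>' fS fsq)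
    finally show ?thesis by (simp add: a_def algebra_simps)
  qed
  have "fourier (\<lambda>z. of_real (G' z)) n = \<i> * of_int n * fourier (\<lambda>z. of_real (G z)) n"
    by (rule fourier_derivative[OF dG G'c Gper])
  moreover have "of_real k * fourier (\<lambda>z. of_real (G' z)) n = of_real \<gamma> * h n"
    unfolding h_def fourier_cmult[symmetric] of_real_mult[symmetric] eq by (rule refl)
  ultimately have "of_real \<gamma> * h n = of_real k * (\<i> * of_int n * (of_real k * (\<i> * of_int n) * (of_real (j (k * of_int n) - c) * h n + conv h h n)))"
    unfolding fG by simp
  also have "\<dots> = of_real (k\<^sup>2 * (of_int n)\<^sup>2) * (of_real (c - j (k * of_int n)) * h n - conv h h n)"
  proof -
    have "\<i> * (\<i> * x) = - x" for x by (simp flip: mult.assoc)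
    then show ?thesis by (simp add: power2_eq_square algebra_simps)
  qed
  finally show ?thesis by simp
qed

end

text \<open>Coefficients of the expansion of the profile up to second order. The third harmonic is
  left to the remainder, since the comparison is made modulo \<epsilon>^3.\<close>

definition h0 :: "real \<Rightarrow> real \<Rightarrow> int \<Rightarrow> complex" where
  "h0 e2 \<epsilon> n = (if \<bar>n\<bar> = 1 then of_real (\<epsilon> / 2) else if \<bar>n\<bar> = 2 then of_real (\<epsilon>\<^sup>2 * e2 / 2) else 0)"

text \<open>Coefficients of \<open>wave_fun\<close> up to second order. The entry at n = 2, -2
  collects \<open>\<alpha>1 * e2\<close> from the second harmonic and
  \<open>3 / 4 * \<alpha>2\<close> from the square of the first one; by the formula for
  \<open>wave_c2\<close> their sum is c2, which is how the sign of c2 comes to decide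
  stability.\<close>

definition q0 :: "real \<Rightarrow> real \<Rightarrow> real \<Rightarrow> real \<Rightarrow> real \<Rightarrow> int \<Rightarrow> complex" where
  "q0 k \<alpha>1 \<alpha>2 c2 \<epsilon> n = of_real (if n = 0 then k\<^sup>2 * \<epsilon>\<^sup>2 * (3 * \<alpha>2 / 2 - c2)
     else if \<bar>n\<bar> = 1 then k\<^sup>2 * \<alpha>1 * \<epsilon> else if \<bar>n\<bar> = 2 then k\<^sup>2 * \<epsilon>\<^sup>2 * c2 else 0)"

text \<open>The remainder bounds for the derivatives of order 0 and p + 2 become a weighted bound on
  coefficients by \<open>fourier_decay\<close>; the cubic harmonic is counted as part of the
  error.\<close>

lemma traveling_wave_asymptotics:
  assumes tw: "traveling_wave_family j \<gamma> \<alpha>1 \<alpha>2 k \<eta> c"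
  defines "e2 \<equiv> wave_eta2 j \<gamma> \<alpha>1 k" and "c0 \<equiv> wave_c0 j \<gamma> k" and "c2 \<equiv> wave_c2 j \<gamma> \<alpha>1 \<alpha>2 k"
  shows "\<exists>\<epsilon>1>0. \<exists>C\<ge>0. \<epsilon>1 \<le> 1 \<and> (\<forall>\<epsilon>. 0 < \<bar>\<epsilon>\<bar> \<and> \<bar>\<epsilon>\<bar> < \<epsilon>1 \<longrightarrow>
      profile (\<eta> \<epsilon>) \<and> gRMKP_solution j \<gamma> \<alpha>1 \<alpha>2 k (\<lambda>x y t. \<eta> \<epsilon> (k * (x - c \<epsilon> * t))) \<and>
      wfinite p (\<lambda>n. profile.h (\<eta> \<epsilon>) n - h0 e2 \<epsilon> n) \<and> wnorm p (\<lambda>n. profile.h (\<eta> \<epsilon>) n - h0 e2 \<epsilon> n) \<le> C * \<bar>\<epsilon>\<bar> ^ 3 \<and>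
      \<bar>c \<epsilon> - c0 - \<epsilon>\<^sup>2 * c2\<bar> \<le> C * \<bar>\<epsilon>\<bar> ^ 3)"
proof -
  define e3 where "e3 = wave_eta3 j \<gamma> \<alpha>1 \<alpha>2 k"
  define T where "T \<epsilon> z = \<epsilon> * cos z + \<epsilon>\<^sup>2 * e2 * cos (2 * z) + \<epsilon> ^ 3 * e3 * cos (3 * z)" for \<epsilon> z
  obtain \<epsilon>1 where \<epsilon>1: "\<epsilon>1 > 0" and prof: "\<And>\<epsilon>. \<bar>\<epsilon>\<bar> < \<epsilon>1 \<Longrightarrow> profile (\<eta> \<epsilon>)"
    and sol: "\<And>\<epsilon>. \<bar>\<epsilon>\<bar> < \<epsilon>1 \<Longrightarrow> gRMKP_solution j \<gamma> \<alpha>1 \<alpha>2 k (\<lambda>x y t. \<eta> \<epsilon> (k * (x - c \<epsilon> * t)))"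
  proof -
    from conjunct1[OF tw[unfolded traveling_wave_family_def]] obtain \<epsilon>1 where "\<epsilon>1 > 0"
      and *: "\<And>\<epsilon>. \<bar>\<epsilon>\<bar> < \<epsilon>1 \<Longrightarrow> (\<forall>z. \<eta> \<epsilon> (z + 2*pi) = \<eta> \<epsilon> z) \<and> (\<forall>z. \<eta> \<epsilon> (- z) = \<eta> \<epsilon> z) \<and> smooth (\<eta> \<epsilon>) \<and>
        c (- \<epsilon>) = c \<epsilon> \<and> gRMKP_solution j \<gamma> \<alpha>1 \<alpha>2 k (\<lambda>x y t. \<eta> \<epsilon> (k * (x - c \<epsilon> * t)))" by (elim exE conjE) blast
    show ?thesis by (rule that[OF \<open>\<epsilon>1 > 0\<close>]) (use * in \<open>simp_all add: profile_def\<close>)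
  qed
  have rem: "\<exists>C. \<exists>\<delta>>0. \<forall>\<epsilon> z. \<bar>\<epsilon>\<bar> < \<delta> \<longrightarrow> \<bar>(deriv ^^ m) (\<lambda>z. \<eta> \<epsilon> z - T \<epsilon> z) z\<bar> \<le> C * \<epsilon> ^ 4" for m
    using tw unfolding traveling_wave_family_def T_def e2_def e3_def by blast
  obtain Ca \<delta>a where a: "\<delta>a > 0" "\<And>\<epsilon> z. \<bar>\<epsilon>\<bar> < \<delta>a \<Longrightarrow> \<bar>\<eta> \<epsilon> z - T \<epsilon> z\<bar> \<le> Ca * \<epsilon> ^ 4"
    using rem[of 0] by auto
  obtain Cb \<delta>b where b: "\<delta>b > 0" "\<And>\<epsilon> z. \<bar>\<epsilon>\<bar> < \<delta>b \<Longrightarrow> \<bar>(deriv ^^ (p + 2)) (\<lambda>z. \<eta> \<epsilon> z - T \<epsilon> z) z\<bar> \<le> Cb * \<epsilon> ^ 4"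
    using rem[of "p + 2"] by blast
  have "(\<lambda>\<epsilon>. c \<epsilon> - (c0 + \<epsilon>\<^sup>2 * c2)) \<in> O[at 0](\<lambda>\<epsilon>. \<epsilon> ^ 4)"
    using tw unfolding traveling_wave_family_def c0_def c2_def by blast
  then obtain Cc where "Cc > 0" "\<forall>\<^sub>F \<epsilon> in at 0. norm (c \<epsilon> - (c0 + \<epsilon>\<^sup>2 * c2)) \<le> Cc * norm (\<epsilon> ^ 4)"
    by (auto elim: landau_o.bigE)
  then obtain \<delta>c where c: "Cc > 0" "\<delta>c > 0" "\<And>\<epsilon>. \<epsilon> \<noteq> 0 \<Longrightarrow> \<bar>\<epsilon>\<bar> < \<delta>c \<Longrightarrow> \<bar>c \<epsilon> - (c0 + \<epsilon>\<^sup>2 * c2)\<bar> \<le> Cc * \<epsilon> ^ 4"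
    unfolding eventually_at by (auto simp: dist_real_def)
  \<comment> \<open>The three summands cover the remainder of fourth order, the third harmonic with
    weight \<open>4 ^ p\<close> at n = 3, -3, and the speed.\<close>
  define C where "C = Cdecay p * (\<bar>Ca\<bar> + \<bar>Cb\<bar>) + 4 ^ p * \<bar>e3\<bar> + Cc"
  have C: "C \<ge> 0" "Cc \<le> C" unfolding C_def using c(1) Cdecay_nonneg[of p] by (auto intro!: add_nonneg_nonneg mult_nonneg_nonneg)
  define \<epsilon>' where "\<epsilon>' = min 1 (min \<epsilon>1 (min \<delta>a (min \<delta>b \<delta>c)))"
  have \<epsilon>': "\<epsilon>' > 0" "\<epsilon>' \<le> 1" using \<epsilon>1 a(1) b(1) c(2) by (auto simp: \<epsilon>'_def)
  show ?thesis
  proof (rule exI[of _ \<epsilon>'], rule conjI[OF \<epsilon>'(1)], rule exI[of _ C], rule conjI[OF C(1)],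
      rule conjI[OF \<epsilon>'(2)], intro allI impI conjI, goal_cases)
    case (1 \<epsilon>) then show ?case by (intro prof) (auto simp: \<epsilon>'_def)
  next
    case (2 \<epsilon>) then show ?case by (intro sol) (auto simp: \<epsilon>'_def)
  next
    case (5 \<epsilon>)
    then have "\<bar>c \<epsilon> - c0 - \<epsilon>\<^sup>2 * c2\<bar> \<le> Cc * \<epsilon> ^ 4" using c(3)[of \<epsilon>] by (auto simp: \<epsilon>'_def diff_diff_eq)
    also have "\<epsilon> ^ 4 = \<bar>\<epsilon>\<bar> * \<bar>\<epsilon>\<bar> ^ 3" by (simp add: power4_eq_xxxx power3_eq_cube flip: abs_mult)
    also have "Cc * (\<bar>\<epsilon>\<bar> * \<bar>\<epsilon>\<bar> ^ 3) \<le> C * (1 * \<bar>\<epsilon>\<bar> ^ 3)"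
      using 5 \<epsilon>' C c(1) by (intro mult_mono) auto
    finally show ?case by simp
  next
    case (3 \<epsilon>)
    then interpret profile "\<eta> \<epsilon>" by (intro prof) (auto simp: \<epsilon>'_def)
    show ?case
      by (rule wfinite_add(1)[OF h_wfinite wfinite_cmult(1)[OF wfinite_finite(1)[of "{1,-1,2,-2}"], where c = "-1"], simplified])
        (auto simp: h0_def)
  next
    case (4 \<epsilon>)
    then interpret profile "\<eta> \<epsilon>" by (intro prof) (auto simp: \<epsilon>'_def)
    have sT: "smooth (T \<epsilon>)"
      unfolding T_def[abs_def] using smooth_cos[of \<epsilon> 1] smooth_cos[of "\<epsilon>\<^sup>2 * e2" 2] smooth_cos[of "\<epsilon> ^ 3 * e3" 3]
      by (intro smooth_add) simp_all
    let ?D = "\<lambda>z. \<eta> \<epsilon> z - T \<epsilon> z"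
    have "T \<epsilon> (z + 2 * pi) = T \<epsilon> z" for z
      using cos_periodic[of z] cos_periodic[of "2 * z + 2 * pi"] cos_periodic[of "2 * z"]
        cos_periodic[of "3 * z + 4 * pi"] cos_periodic[of "3 * z + 2 * pi"] cos_periodic[of "3 * z"]
      by (simp add: T_def algebra_simps)
    then have Dper: "?D (z + 2 * pi) = ?D z" for z by (simp only: per)
    have Dd: "wfinite p (fourier (\<lambda>z. of_real (?D z)))" "wnorm p (fourier (\<lambda>z. of_real (?D z))) \<le> Cdecay p * ((\<bar>Ca\<bar> + \<bar>Cb\<bar>) * \<epsilon> ^ 4)"
    proof -
      have 1: "\<bar>?D z\<bar> \<le> (\<bar>Ca\<bar> + \<bar>Cb\<bar>) * \<epsilon> ^ 4" for z
        by (rule order_trans[OF a(2) mult_right_mono]) (use 4 in \<open>auto simp: \<epsilon>'_def\<close>)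
      have 2: "\<bar>(deriv ^^ (p + 2)) ?D z\<bar> \<le> (\<bar>Ca\<bar> + \<bar>Cb\<bar>) * \<epsilon> ^ 4" for z
        by (rule order_trans[OF b(2) mult_right_mono]) (use 4 in \<open>auto simp: \<epsilon>'_def\<close>)
      show "wfinite p (fourier (\<lambda>z. of_real (?D z)))" "wnorm p (fourier (\<lambda>z. of_real (?D z))) \<le> Cdecay p * ((\<bar>Ca\<bar> + \<bar>Cb\<bar>) * \<epsilon> ^ 4)"
        using fourier_decay[OF smooth_diff(2)[OF smooth sT] Dper 1 2] unfolding wfinite_def wnorm_def by auto
    qed
    let ?t = "\<lambda>n::int. if \<bar>n\<bar> = 3 then of_real (\<epsilon> ^ 3 * e3 / 2) else 0 :: complex"
    have t: "wfinite p ?t" "wnorm p ?t = 4 ^ p * \<bar>\<epsilon> ^ 3 * e3\<bar>"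
    proof -
      have z: "?t n = 0" if "n \<notin> {3, -3}" for n using that by auto
      have "cmod (of_real (\<epsilon> ^ 3 * e3 / 2)) = \<bar>\<epsilon> ^ 3 * e3\<bar> / 2" by (simp only: norm_of_real abs_divide abs_numeral)
      then have "(\<Sum>n\<in>{3, -3}. wt p n * cmod (?t n)) = 4 ^ p * \<bar>\<epsilon> ^ 3 * e3\<bar>"
        by (simp add: wt_def del: of_real_divide of_real_mult of_real_power)
      moreover have "wnorm p ?t = (\<Sum>n\<in>{3, -3}. wt p n * cmod (?t n))"
        by (rule wfinite_finite(2)) (simp, rule z)
      ultimately show "wnorm p ?t = 4 ^ p * \<bar>\<epsilon> ^ 3 * e3\<bar>" by (rule trans[rotated])
      show "wfinite p ?t" by (rule wfinite_finite(1)[where F = "{3, -3}"]) (simp, rule z)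
    qed
    have eq: "(\<lambda>n. h n - h0 e2 \<epsilon> n) = (\<lambda>n. fourier (\<lambda>z. of_real (?D z)) n + ?t n)"
    proof
      fix n
      let ?c1 = "\<lambda>z. of_real (\<epsilon> * cos (of_int 1 * z)) :: complex"
        and ?c2 = "\<lambda>z. of_real (\<epsilon>\<^sup>2 * e2 * cos (of_int 2 * z)) :: complex"
        and ?c3 = "\<lambda>z. of_real (\<epsilon> ^ 3 * e3 * cos (of_int 3 * z)) :: complex"
      have i: "integrable torus ?c1" "integrable torus ?c2" "integrable torus ?c3" "integrable torus (\<lambda>z. ?c1 z + ?c2 z)"
        "integrable torus (\<lambda>z. ?c1 z + ?c2 z + ?c3 z)"
        by (intro torus_continuous_integrable continuous_intros)+
      have "fourier (\<lambda>z. of_real (?D z)) n = fourier (\<lambda>z. of_real (\<eta> \<epsilon> z) - (?c1 z + ?c2 z + ?c3 z)) n"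
        by (simp add: T_def)
      also have "\<dots> = h n - (fourier ?c1 n + fourier ?c2 n + fourier ?c3 n)"
        by (simp only: fourier_diff[OF torus_continuous_integrable[OF \<eta>_cont_complex] i(5)] fourier_add[OF i(4) i(3)] fourier_add[OF i(1) i(2)] h_def)
      also have "fourier ?c1 n + fourier ?c2 n + fourier ?c3 n = h0 e2 \<epsilon> n + ?t n"
        by (subst (1 2 3) fourier_cos) (auto simp: h0_def)
      finally show "h n - h0 e2 \<epsilon> n = fourier (\<lambda>z. of_real (?D z)) n + ?t n" by simp
    qed
    have "wnorm p (\<lambda>n. h n - h0 e2 \<epsilon> n) \<le> Cdecay p * ((\<bar>Ca\<bar> + \<bar>Cb\<bar>) * \<epsilon> ^ 4) + 4 ^ p * \<bar>\<epsilon> ^ 3 * e3\<bar>"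
      unfolding eq using wfinite_add(2)[OF Dd(1) t(1)] Dd(2) t(2) by linarith
    also have "\<dots> \<le> Cdecay p * ((\<bar>Ca\<bar> + \<bar>Cb\<bar>) * \<bar>\<epsilon>\<bar> ^ 3) + 4 ^ p * (\<bar>\<epsilon>\<bar> ^ 3 * \<bar>e3\<bar>)"
    proof -
      have "\<epsilon> ^ 4 = \<bar>\<epsilon>\<bar> * \<bar>\<epsilon>\<bar> ^ 3" by (simp add: power4_eq_xxxx power3_eq_cube flip: abs_mult)
      also have "\<dots> \<le> 1 * \<bar>\<epsilon>\<bar> ^ 3" using 4 \<epsilon>' by (intro mult_right_mono) auto
      finally show ?thesis using Cdecay_nonneg[of p]
        by (intro add_mono mult_left_mono) (auto simp: abs_mult power_abs)
    qed
    also have "\<dots> \<le> C * \<bar>\<epsilon>\<bar> ^ 3" using c(1) by (simp add: C_def algebra_simps)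
    finally show ?case .
  qed
qed

lemma wave_q_asymptotics:
  assumes tw: "traveling_wave_family j \<gamma> \<alpha>1 \<alpha>2 k \<eta> c"
  defines "e2 \<equiv> wave_eta2 j \<gamma> \<alpha>1 k" and "c0 \<equiv> wave_c0 j \<gamma> k" and "c2 \<equiv> wave_c2 j \<gamma> \<alpha>1 \<alpha>2 k"
  shows "\<exists>\<epsilon>1>0. \<exists>C\<ge>0. \<epsilon>1 \<le> 1 \<and> (\<forall>\<epsilon>. 0 < \<bar>\<epsilon>\<bar> \<and> \<bar>\<epsilon>\<bar> < \<epsilon>1 \<longrightarrow>
      profile (\<eta> \<epsilon>) \<and> gRMKP_solution j \<gamma> \<alpha>1 \<alpha>2 k (\<lambda>x y t. \<eta> \<epsilon> (k * (x - c \<epsilon> * t))) \<and>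
      wfinite p (\<lambda>n. profile.h (\<eta> \<epsilon>) n - h0 e2 \<epsilon> n) \<and> wnorm p (\<lambda>n. profile.h (\<eta> \<epsilon>) n - h0 e2 \<epsilon> n) \<le> C * \<bar>\<epsilon>\<bar> ^ 3 \<and>
      wfinite p (\<lambda>n. profile.wave_q (\<eta> \<epsilon>) k \<alpha>1 \<alpha>2 (c \<epsilon> - c0) n - q0 k \<alpha>1 \<alpha>2 c2 \<epsilon> n) \<and>
      wnorm p (\<lambda>n. profile.wave_q (\<eta> \<epsilon>) k \<alpha>1 \<alpha>2 (c \<epsilon> - c0) n - q0 k \<alpha>1 \<alpha>2 c2 \<epsilon> n) \<le> C * \<bar>\<epsilon>\<bar> ^ 3)"
proof -
  obtain \<epsilon>1 C where e1: "\<epsilon>1 > 0" "\<epsilon>1 \<le> 1" "C \<ge> 0" and tw': "\<And>\<epsilon>. 0 < \<bar>\<epsilon>\<bar> \<Longrightarrow> \<bar>\<epsilon>\<bar> < \<epsilon>1 \<Longrightarrow>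
      profile (\<eta> \<epsilon>) \<and> gRMKP_solution j \<gamma> \<alpha>1 \<alpha>2 k (\<lambda>x y t. \<eta> \<epsilon> (k * (x - c \<epsilon> * t))) \<and>
      wfinite p (\<lambda>n. profile.h (\<eta> \<epsilon>) n - h0 e2 \<epsilon> n) \<and> wnorm p (\<lambda>n. profile.h (\<eta> \<epsilon>) n - h0 e2 \<epsilon> n) \<le> C * \<bar>\<epsilon>\<bar> ^ 3 \<and>
      \<bar>c \<epsilon> - c0 - \<epsilon>\<^sup>2 * c2\<bar> \<le> C * \<bar>\<epsilon>\<bar> ^ 3"
    using traveling_wave_asymptotics[OF tw, of p] unfolding e2_def c0_def c2_def by blast
  \<comment> \<open>\<open>C1\<close> bounds the profile without its first harmonic relative to
    \<epsilon>^2, \<open>C2\<close> the part of its square beyond the square of the first harmonic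
    relative to \<epsilon>^3, and \<open>C3\<close> the remainder of \<open>wave_q\<close> relative
    to \<epsilon>^3.\<close>
  define C1 where "C1 = C + 3 ^ p * \<bar>e2\<bar>"
  define C2 where "C2 = 2 ^ p * C1 + C1 * (2 ^ p + C1)"
  define C3 where "C3 = k\<^sup>2 * (\<bar>2 * \<alpha>1\<bar> * C + \<bar>3 * \<alpha>2\<bar> * C2 + C)"
  have C1: "C1 \<ge> 0" using e1 by (simp add: C1_def)
  have C2: "C2 \<ge> 0" using C1 by (simp add: C2_def)
  have C3: "C3 \<ge> 0" using C2 e1 by (simp add: C3_def)
  have main: "wfinite p (\<lambda>n. profile.wave_q (\<eta> \<epsilon>) k \<alpha>1 \<alpha>2 (c \<epsilon> - c0) n - q0 k \<alpha>1 \<alpha>2 c2 \<epsilon> n) \<and>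
      wnorm p (\<lambda>n. profile.wave_q (\<eta> \<epsilon>) k \<alpha>1 \<alpha>2 (c \<epsilon> - c0) n - q0 k \<alpha>1 \<alpha>2 c2 \<epsilon> n) \<le> C3 * \<bar>\<epsilon>\<bar> ^ 3"
    if \<epsilon>: "0 < \<bar>\<epsilon>\<bar>" "\<bar>\<epsilon>\<bar> < \<epsilon>1" for \<epsilon>
  proof -
    interpret profile "\<eta> \<epsilon>" using tw'[OF \<epsilon>] by blast
    have hb: "wfinite p (\<lambda>n. h n - h0 e2 \<epsilon> n)" "wnorm p (\<lambda>n. h n - h0 e2 \<epsilon> n) \<le> C * \<bar>\<epsilon>\<bar> ^ 3"
      and cb: "\<bar>c \<epsilon> - c0 - \<epsilon>\<^sup>2 * c2\<bar> \<le> C * \<bar>\<epsilon>\<bar> ^ 3"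
      using tw'[OF \<epsilon>] by blast+
    let ?E = "\<bar>\<epsilon>\<bar>"
    have E: "?E \<le> 1" "?E ^ 3 \<le> ?E\<^sup>2" "?E\<^sup>2 \<le> ?E"
      using \<epsilon> e1 power_decreasing[of 2 3 ?E] power_decreasing[of 1 2 ?E] by auto
    let ?h1 = "h0 0 \<epsilon>"
    define t where "t n = (if \<bar>n\<bar> = 2 then of_real (\<epsilon>\<^sup>2 * e2 / 2) else 0 :: complex)" for n :: int
    define r where "r n = (h n - h0 e2 \<epsilon> n) + t n" for n
    have h: "h = (\<lambda>n. ?h1 n + r n)" by (auto simp: fun_eq_iff r_def t_def h0_def)
    have tz: "n \<notin> {2, -2} \<Longrightarrow> t n = 0" for n by (auto simp: t_def)
    have tw: "wfinite p t" by (rule wfinite_finite(1)[where F = "{2, -2}"]) (simp, rule tz)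
    have tn: "wnorm p t = 3 ^ p * (\<epsilon>\<^sup>2 * \<bar>e2\<bar>)"
    proof -
      have "cmod (of_real (\<epsilon>\<^sup>2 * e2 / 2)) = \<epsilon>\<^sup>2 * \<bar>e2\<bar> / 2" by (simp only: norm_of_real abs_divide abs_numeral abs_mult) simp
      then have "(\<Sum>n\<in>{2, -2}. wt p n * cmod (t n)) = 3 ^ p * (\<epsilon>\<^sup>2 * \<bar>e2\<bar>)"
        by (simp add: wt_def t_def del: of_real_divide of_real_mult of_real_power)
      moreover have "wnorm p t = (\<Sum>n\<in>{2, -2}. wt p n * cmod (t n))" by (rule wfinite_finite(2)) (simp, rule tz)
      ultimately show ?thesis by simp
    qed
    have rw: "wfinite p r" unfolding r_def[abs_def] by (rule wfinite_add(1)[OF hb(1) tw])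
    have rn: "wnorm p r \<le> C1 * ?E\<^sup>2"
    proof -
      have "wnorm p r \<le> C * ?E ^ 3 + 3 ^ p * (\<epsilon>\<^sup>2 * \<bar>e2\<bar>)"
        unfolding r_def[abs_def] using wfinite_add(2)[OF hb(1) tw] hb(2) tn by linarith
      also have "\<dots> \<le> C * ?E\<^sup>2 + 3 ^ p * (\<epsilon>\<^sup>2 * \<bar>e2\<bar>)" using E e1 by (intro add_right_mono mult_left_mono) auto
      finally show ?thesis by (simp add: C1_def algebra_simps)
    qed
    have h1z: "n \<notin> {1, -1} \<Longrightarrow> ?h1 n = 0" for n by (auto simp: h0_def)
    have h1w: "wfinite p ?h1" by (rule wfinite_finite(1)[where F = "{1, -1}"]) (simp, rule h1z)
    have h1n: "wnorm p ?h1 = 2 ^ p * ?E"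
    proof -
      have "wnorm p ?h1 = (\<Sum>n\<in>{1, -1}. wt p n * cmod (?h1 n))" by (rule wfinite_finite(2)) (simp, rule h1z)
      then show ?thesis by (simp add: h0_def wt_def norm_divide)
    qed
    have hn: "wnorm p h \<le> (2 ^ p + C1) * ?E"
    proof -
      have "wnorm p h \<le> 2 ^ p * ?E + C1 * ?E\<^sup>2" using wfinite_add(2)[OF h1w rw] h1n rn unfolding h by linarith
      also have "\<dots> \<le> 2 ^ p * ?E + C1 * ?E" using E C1 by (intro add_left_mono mult_left_mono) auto
      finally show ?thesis by (simp add: algebra_simps)
    qed
    \<comment> \<open>From \<open>h = ?h1 + r\<close> the convolution square of \<open>h\<close> is
      that of \<open>?h1\<close> plus \<open>conv ?h1 r\<close> plus \<open>conv r h\<close>; each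
      of the last two is of order \<epsilon>^3.\<close>
    define g where "g n = conv ?h1 r n + conv r h n" for n
    have gw: "wfinite p g" unfolding g_def[abs_def] by (intro wfinite_add(1) wfinite_conv(1) h1w rw h_wfinite)
    have gn: "wnorm p g \<le> C2 * ?E ^ 3"
    proof -
      have "wnorm p g \<le> wnorm p (conv ?h1 r) + wnorm p (conv r h)"
        unfolding g_def[abs_def] by (intro wfinite_add(2) wfinite_conv(1) h1w rw h_wfinite)
      also have "\<dots> \<le> wnorm p ?h1 * wnorm p r + wnorm p r * wnorm p h"
        by (intro add_mono wfinite_conv(2) h1w rw h_wfinite)
      also have "\<dots> \<le> 2 ^ p * ?E * (C1 * ?E\<^sup>2) + C1 * ?E\<^sup>2 * ((2 ^ p + C1) * ?E)"
        unfolding h1n using C1 by (intro add_mono mult_mono rn hn mult_left_mono wnorm_nonneg) auto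
      also have "\<dots> = C2 * ?E ^ 3" by (simp add: C2_def power2_eq_square power3_eq_cube algebra_simps)
      finally show ?thesis .
    qed
    have conv_h: "conv h h n = conv ?h1 ?h1 n + g n" for n
    proof -
      have "conv h h n = conv (\<lambda>n. ?h1 n + r n) h n" using h by simp
      also have "\<dots> = conv ?h1 h n + conv r h n" by (rule conv_add_left[OF h1w rw h_wfinite])
      also have "conv ?h1 h n = conv ?h1 (\<lambda>n. ?h1 n + r n) n" using h by simp
      also have "\<dots> = conv ?h1 ?h1 n + conv ?h1 r n" by (rule conv_add_right[OF h1w h1w rw])
      finally show ?thesis by (simp add: g_def)
    qed
    have h11: "conv ?h1 ?h1 n = (?h1 (n - 1) + ?h1 (n + 1)) * of_real (\<epsilon> / 2)" for n
    proof -
      have "((\<lambda>m. ?h1 (n - m) * ?h1 m) has_sum (\<Sum>m\<in>{1, -1}. ?h1 (n - m) * ?h1 m)) UNIV"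
        by (rule has_sum_finite_neutralI[of "{1, -1}"]) (auto simp: h0_def)
      then have "conv ?h1 ?h1 n = (\<Sum>m\<in>{1, -1}. ?h1 (n - m) * ?h1 m)" unfolding conv_def by (rule infsumI)
      then show ?thesis by (simp add: h0_def algebra_simps)
    qed
    have q0: "q0 k \<alpha>1 \<alpha>2 c2 \<epsilon> n = of_real (k\<^sup>2) * (of_real (2 * \<alpha>1) * h0 e2 \<epsilon> n + of_real (3 * \<alpha>2) * conv ?h1 ?h1 n
        - (if n = 0 then of_real (\<epsilon>\<^sup>2 * c2) else 0))" for n
    proof -
      have c2: "c2 = \<alpha>1 * e2 + 3 / 4 * \<alpha>2" by (simp add: c2_def e2_def wave_c2_def)
      consider "n = 0" | "n = 1" | "n = -1" | "n = 2" | "n = -2" | "\<bar>n\<bar> \<noteq> 0" "\<bar>n\<bar> \<noteq> 1" "\<bar>n\<bar> \<noteq> 2" by fastforce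
      then show ?thesis
        unfolding h11 by cases (auto simp: q0_def h0_def c2 complex_eq_iff power2_eq_square algebra_simps)
    qed
    define s where "s n = (if n = 0 then - of_real (c \<epsilon> - c0 - \<epsilon>\<^sup>2 * c2) else 0 :: complex)" for n :: int
    have sz: "n \<notin> {0} \<Longrightarrow> s n = 0" for n by (auto simp: s_def)
    have sw: "wfinite p s" by (rule wfinite_finite(1)[where F = "{0}"]) (simp, rule sz)
    have sn: "wnorm p s \<le> C * ?E ^ 3"
    proof -
      have "cmod (s 0) = \<bar>c \<epsilon> - c0 - \<epsilon>\<^sup>2 * c2\<bar>" by (simp only: s_def simp_thms if_True norm_minus_cancel norm_of_real)
      moreover have "wnorm p s = (\<Sum>n\<in>{0}. wt p n * cmod (s n))" by (rule wfinite_finite(2)) (simp, rule sz)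
      ultimately show ?thesis using cb by (simp add: wt_def)
    qed
    have eq: "(\<lambda>n. wave_q k \<alpha>1 \<alpha>2 (c \<epsilon> - c0) n - q0 k \<alpha>1 \<alpha>2 c2 \<epsilon> n)
        = (\<lambda>n. of_real (k\<^sup>2) * ((of_real (2 * \<alpha>1) * (h n - h0 e2 \<epsilon> n) + of_real (3 * \<alpha>2) * g n) + s n))"
      unfolding wave_q_eq q0 conv_h s_def by (auto simp: fun_eq_iff algebra_simps)
    let ?A = "\<lambda>n. of_real (2 * \<alpha>1) * (h n - h0 e2 \<epsilon> n)" and ?B = "\<lambda>n. of_real (3 * \<alpha>2) * g n"
    have Aw: "wfinite p ?A" and Bw: "wfinite p ?B" by (intro wfinite_cmult(1) hb gw)+
    have ABw: "wfinite p (\<lambda>n. ?A n + ?B n)" by (rule wfinite_add(1)[OF Aw Bw])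
    have "wnorm p (\<lambda>n. (?A n + ?B n) + s n) \<le> (wnorm p ?A + wnorm p ?B) + wnorm p s"
      using wfinite_add(2)[OF ABw sw] wfinite_add(2)[OF Aw Bw] by linarith
    also have "\<dots> \<le> (\<bar>2 * \<alpha>1\<bar> * (C * ?E ^ 3) + \<bar>3 * \<alpha>2\<bar> * (C2 * ?E ^ 3)) + C * ?E ^ 3"
      unfolding wfinite_cmult(2) norm_of_real
      by (intro add_mono mult_left_mono hb gn sn) auto
    finally have "k\<^sup>2 * wnorm p (\<lambda>n. (?A n + ?B n) + s n) \<le> k\<^sup>2 * ((\<bar>2 * \<alpha>1\<bar> * (C * ?E ^ 3) + \<bar>3 * \<alpha>2\<bar> * (C2 * ?E ^ 3)) + C * ?E ^ 3)"
      by (intro mult_left_mono) auto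
    also have "\<dots> = C3 * ?E ^ 3" unfolding C3_def by (simp only: algebra_simps)
    finally show ?thesis
      unfolding eq wfinite_cmult(2) norm_of_real abs_power2
      using wfinite_cmult(1)[OF wfinite_add(1)[OF ABw sw], of "of_real (k\<^sup>2)"] by blast
  qed
  have "C * x \<le> (C + C3) * x" "C3 * x \<le> (C + C3) * x" if "x \<ge> 0" for x
    using that C3 e1 by (auto simp: distrib_right)
  then have up: "C * \<bar>\<epsilon>\<bar> ^ 3 \<le> (C + C3) * \<bar>\<epsilon>\<bar> ^ 3" "C3 * \<bar>\<epsilon>\<bar> ^ 3 \<le> (C + C3) * \<bar>\<epsilon>\<bar> ^ 3" for \<epsilon> by auto
  have "profile (\<eta> \<epsilon>) \<and> gRMKP_solution j \<gamma> \<alpha>1 \<alpha>2 k (\<lambda>x y t. \<eta> \<epsilon> (k * (x - c \<epsilon> * t))) \<and>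
      wfinite p (\<lambda>n. profile.h (\<eta> \<epsilon>) n - h0 e2 \<epsilon> n) \<and> wnorm p (\<lambda>n. profile.h (\<eta> \<epsilon>) n - h0 e2 \<epsilon> n) \<le> (C + C3) * \<bar>\<epsilon>\<bar> ^ 3 \<and>
      wfinite p (\<lambda>n. profile.wave_q (\<eta> \<epsilon>) k \<alpha>1 \<alpha>2 (c \<epsilon> - c0) n - q0 k \<alpha>1 \<alpha>2 c2 \<epsilon> n) \<and>
      wnorm p (\<lambda>n. profile.wave_q (\<eta> \<epsilon>) k \<alpha>1 \<alpha>2 (c \<epsilon> - c0) n - q0 k \<alpha>1 \<alpha>2 c2 \<epsilon> n) \<le> (C + C3) * \<bar>\<epsilon>\<bar> ^ 3"
    if "0 < \<bar>\<epsilon>\<bar> \<and> \<bar>\<epsilon>\<bar> < \<epsilon>1" for \<epsilon>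
    using tw'[of \<epsilon>] main[of \<epsilon>] that order_trans[OF _ up(1)[of \<epsilon>]] order_trans[OF _ up(2)[of \<epsilon>]] by blast
  note fin = this
  have CC: "C + C3 \<ge> 0" using e1 C3 by simp
  show ?thesis
    by (rule exI[of _ \<epsilon>1], rule conjI[OF e1(1)], rule exI[of _ "C + C3"], rule conjI[OF CC],
        rule conjI[OF e1(2)], intro allI impI, rule fin)
qed

section \<open>Diagonal and convolution matrices on \<open>ell2\<close>\<close>

lemma kop_diff:
  assumes "dominated K \<kappa>" "dominated L \<kappa>'"
  shows "kop K x - kop L x = kop (\<lambda>n m. K n m - L n m) x" and "dominated (\<lambda>n m. K n m - L n m) (\<lambda>l. \<kappa> l + \<kappa>' l)"
proof -
  show d: "dominated (\<lambda>n m. K n m - L n m) (\<lambda>l. \<kappa> l + \<kappa>' l)"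
    using assms unfolding dominated_def by (auto intro!: summable_on_add order_trans[OF norm_triangle_ineq4] add_mono)
  show "kop K x - kop L x = kop (\<lambda>n m. K n m - L n m) x"
    by (rule ell2_eqI) (simp add: coef_kop[OF assms(1)] coef_kop[OF assms(2)] coef_kop[OF d] left_diff_distrib
        infsum_minus dominated_summable'[OF assms(1)] dominated_summable'[OF assms(2)])
qed

lemma dominated_diag:
  assumes "\<And>n. cmod (g n) \<le> B"
  shows "dominated (\<lambda>n m. if n = m then g n else 0) (\<lambda>l. if l = 0 then B else 0)"
    and "(\<Sum>\<^sub>\<infinity>l::int. if l = 0 then B else 0) = B"
    and "coef (kop (\<lambda>n m. if n = m then g n else 0) x) n = g n * coef x n"
proof -
  have hs: "((\<lambda>l::int. if l = 0 then B else 0) has_sum B) UNIV" by (rule has_sum_finite_neutralI[of "{0}"]) auto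
  then show "(\<Sum>\<^sub>\<infinity>l::int. if l = 0 then B else 0) = B" by (rule infsumI)
  have B: "B \<ge> 0" using assms[of 0] norm_ge_zero[of "g 0"] by linarith
  show d: "dominated (\<lambda>n m. if n = m then g n else 0) (\<lambda>l. if l = 0 then B else 0)"
    using hs assms B by (auto simp: dominated_def has_sum_iff)
  have "((\<lambda>m. (if n = m then g n else 0) * coef x m) has_sum (g n * coef x n)) UNIV"
    by (rule has_sum_finite_neutralI[of "{n}"]) auto
  then show "coef (kop (\<lambda>n m. if n = m then g n else 0) x) n = g n * coef x n"
    unfolding coef_kop[OF d] by (rule infsumI)
qed

lemma kop_diag_plus:
  assumes g: "\<And>n. cmod (g n) \<le> B" and R: "dominated R \<kappa>"
  defines "K \<equiv> \<lambda>n m. (if n = m then g n else 0) + R n m"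
  shows "dominated K (\<lambda>l. (if l = 0 then B else 0) + \<kappa> l)"
    and "(\<Sum>\<^sub>\<infinity>l. (if l = 0 then B else 0) + \<kappa> l) = B + (\<Sum>\<^sub>\<infinity>l. \<kappa> l)"
    and "coef (kop K x) n = g n * coef x n + (\<Sum>\<^sub>\<infinity>m. R n m * coef x m)"
proof -
  note D = dominated_diag[where g = g, OF g]
  have s: "(\<lambda>l::int. if l = 0 then B else 0) summable_on UNIV" "\<kappa> summable_on UNIV"
    using D(1) R by (auto simp: dominated_def)
  show "(\<Sum>\<^sub>\<infinity>l. (if l = 0 then B else 0) + \<kappa> l) = B + (\<Sum>\<^sub>\<infinity>l. \<kappa> l)"
    unfolding infsum_add[OF s] D(2) by (rule refl)
  have uR: "dominated (\<lambda>n m. - R n m) \<kappa>" using R by (simp add: dominated_def)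
  show d: "dominated K (\<lambda>l. (if l = 0 then B else 0) + \<kappa> l)"
    using kop_diff(2)[OF D(1) uR] by (simp add: K_def)
  have "coef (kop K x) n = coef (kop (\<lambda>n m. if n = m then g n else 0) x - kop (\<lambda>n m. - R n m) x) n"
    unfolding kop_diff(1)[OF D(1) uR] by (simp add: K_def)
  then show "coef (kop K x) n = g n * coef x n + (\<Sum>\<^sub>\<infinity>m. R n m * coef x m)"
    by (simp add: D(3) coef_kop[OF uR] infsum_uminus)
qed

lift_definition unit :: "int \<Rightarrow> ell2" is "\<lambda>k n. if n = k then 1 else 0"
  by (rule finite_nonzero_values_imp_summable_on, rule finite_subset[of _ "{k}" for k]) auto

lemma coef_unit [simp]: "coef (unit k) n = (if n = k then 1 else 0)"
  by (simp add: unit.rep_eq)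

lemma norm_unit [simp]: "norm (unit k) = 1"
proof -
  have "((\<lambda>n. (cmod (coef (unit k) n))\<^sup>2) has_sum 1) UNIV"
    by (rule has_sum_finite_neutralI[of "{k}"]) auto
  then have "(norm (unit k))\<^sup>2 = 1\<^sup>2" unfolding norm_ell2_sq by (simp add: infsumI)
  then show ?thesis by (rule power2_eq_imp_eq) auto
qed

text \<open>Conjugation of a convolution by \<open>wt p\<close> stays dominated because
  \<open>wt p n / wt p m \<le> wt p (n - m)\<close>; the bounded factor \<open>g\<close> will be the
  inverse of the diagonal part.\<close>

lemma dominated_conv:
  assumes "wfinite p q" "\<And>n. \<bar>g n\<bar> \<le> B"
  shows "dominated (\<lambda>n m. of_real (g n) * q (n - m) * of_real (wt p n / wt p m)) (\<lambda>l. B * (wt p l * cmod (q l)))"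
    and "(\<Sum>\<^sub>\<infinity>l. B * (wt p l * cmod (q l))) = B * wnorm p q"
proof -
  have B0: "B \<ge> 0" using assms(2)[of 0] by linarith
  have "cmod (of_real (g n) * q (n - m) * of_real (wt p n / wt p m)) \<le> B * (wt p (n - m) * cmod (q (n - m)))" for n m
  proof -
    have "wt p n / wt p m \<le> wt p (n - m)" using wt_mult[of p n m] by (simp add: pos_divide_le_eq)
    then have "cmod (q (n - m)) * (wt p n / wt p m) \<le> cmod (q (n - m)) * wt p (n - m)" by (intro mult_left_mono) auto
    then have "\<bar>g n\<bar> * (cmod (q (n - m)) * (wt p n / wt p m)) \<le> B * (cmod (q (n - m)) * wt p (n - m))"
      by (rule mult_mono[OF assms(2) _ B0]) auto
    then show ?thesis by (simp add: norm_mult norm_divide mult_ac)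
  qed
  then show "dominated (\<lambda>n m. of_real (g n) * q (n - m) * of_real (wt p n / wt p m)) (\<lambda>l. B * (wt p l * cmod (q l)))"
    using assms(1) by (auto simp: dominated_def wfinite_def summable_on_cmult_right)
  show "(\<Sum>\<^sub>\<infinity>l. B * (wt p l * cmod (q l))) = B * wnorm p q"
    unfolding wnorm_def by (rule infsum_cmult_right')
qed

lemma dominated_wconv:
  assumes "wfinite p q"
  shows "dominated (\<lambda>n m. q (n - m) * of_real (inverse (wt p m))) (\<lambda>l. wt p l * cmod (q l))"
proof -
  have "cmod (q (n - m) * of_real (inverse (wt p m))) \<le> wt p (n - m) * cmod (q (n - m))" for n m
    using mult_mono[of "inverse (wt p m)" 1 "cmod (q (n - m))" "cmod (q (n - m))"]
      mult_right_mono[OF wt_ge_1[of p "n - m"], of "cmod (q (n - m))"] wt_ge_1[of p m]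
    by (simp add: norm_mult norm_inverse inverse_le_1_iff mult.commute)
  then show ?thesis using assms by (simp add: dominated_def wfinite_def)
qed

section \<open>Instability\<close>

text \<open>Modes 1 and -1 are exempt from the lower bound on \<open>d\<close>: in the application
  \<open>d\<close> is the small number \<open>- \<rho>\<^sup>2\<close> there. The smallness of
  \<open>q\<close> relative to \<open>\<delta>\<close> makes the remaining rows, divided by
  \<open>d n\<close>, a perturbation of the identity.\<close>

locale nondegenerate_symbol =
  fixes d :: "int \<Rightarrow> real" and q :: "int \<Rightarrow> complex" and \<delta> :: real and p :: nat
  assumes \<delta>: "\<delta> > 0" and d: "\<And>n. \<bar>n\<bar> \<ge> 2 \<Longrightarrow> \<bar>d n\<bar> \<ge> \<delta>" and d_even: "\<And>n. d (- n) = d n"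
    and q: "wfinite p q" and q_small: "wnorm p q \<le> \<delta> / 4"
    and q_even: "\<And>n. q (- n) = q n" and q_real: "\<And>n. cnj (q n) = q n"
begin

definition "di n = (if \<bar>n\<bar> \<ge> 2 then 1 / d n else 0)"

lemma di_bound: "\<bar>di n\<bar> \<le> 1 / \<delta>"
  using d[of n] \<delta> by (auto simp: di_def abs_divide intro!: frac_le)

text \<open>Row \<open>n\<close> of \<open>1 + kop (K \<mu>)\<close> is the eigenvalue equation divided by \<open>d n\<close> if \<open>\<bar>n\<bar> \<ge> 2\<close>,
  and the identity otherwise; the weights turn \<open>\<ell>\<^sup>2\<close> into a Sobolev space.\<close>

definition "g \<mu> n = \<i> * of_real (\<mu> * di n / of_int n)"
definition "R n m = - (of_real (di n) * q (n - m) * of_real (wt p n / wt p m))"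
definition "K \<mu> n m = (if n = m then g \<mu> n else 0) + R n m"

lemma g_bound: "cmod (g \<mu> n) \<le> \<bar>\<mu>\<bar> / (2 * \<delta>)"
proof (cases "\<bar>n\<bar> \<ge> 2")
  case True
  then have "\<bar>of_int n :: real\<bar> \<ge> 2" by linarith
  then have "\<bar>\<mu>\<bar> * \<bar>di n\<bar> / \<bar>of_int n\<bar> \<le> \<bar>\<mu>\<bar> * (1 / \<delta>) / 2"
    using di_bound[of n] \<delta> by (intro frac_le mult_left_mono) auto
  then show ?thesis by (simp add: g_def norm_mult abs_mult abs_divide norm_divide mult.commute)
qed (use \<delta> in \<open>simp add: g_def di_def\<close>)

lemma R_dom: "dominated R (\<lambda>l. 1 / \<delta> * (wt p l * cmod (q l)))"
  using dominated_conv(1)[where g = di, OF q di_bound] by (simp add: dominated_def R_def)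

lemma K_dom: "dominated (K \<mu>) (\<lambda>l. (if l = 0 then \<bar>\<mu>\<bar> / (2 * \<delta>) else 0) + 1 / \<delta> * (wt p l * cmod (q l)))"
  unfolding K_def[abs_def] by (rule kop_diag_plus(1)[OF g_bound R_dom])

text \<open>The diagonal and the convolution part contribute 1/4 each; the 2 in the denominator of
  \<open>g_bound\<close> comes from \<bar>n\<bar> \<ge> 2 in the active rows.\<close>

lemma K_norm:
  assumes "\<bar>\<mu>\<bar> \<le> \<delta> / 2"
  shows "norm (kop (K \<mu>) x) \<le> 1 / 2 * norm x"
proof -
  have "norm (kop (K \<mu>) x) \<le> (\<bar>\<mu>\<bar> / (2 * \<delta>) + 1 / \<delta> * wnorm p q) * norm x"
    using norm_kop[OF K_dom[of \<mu>], of x] unfolding kop_diag_plus(2)[OF g_bound R_dom] dominated_conv(2)[where g = di, OF q di_bound] .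
  also have "\<dots> \<le> 1 / 2 * norm x"
  proof (rule mult_right_mono)
    show "\<bar>\<mu>\<bar> / (2 * \<delta>) + 1 / \<delta> * wnorm p q \<le> 1 / 2"
      using assms q_small \<delta> by (simp add: field_simps)
  qed simp
  finally show ?thesis .
qed

text \<open>A perturbation of the identity of norm at most 1/2 is coercive with constant
  1/2.\<close>

lemma B_solve:
  assumes "\<bar>\<mu>\<bar> \<le> \<delta> / 2"
  shows "\<exists>x. x + kop (K \<mu>) x = f" and "norm x \<le> 2 * norm (x + kop (K \<mu>) x)"
proof -
  have bl: "bounded_linear (\<lambda>x. x + kop (K \<mu>) x)"
    by (intro bounded_linear_add bounded_linear_ident kop_bounded_linear[OF K_dom])
  have co: "1 / 2 * (norm x)\<^sup>2 \<le> inner (x + kop (K \<mu>) x) x" for x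
  proof -
    have "- inner (kop (K \<mu>) x) x \<le> norm (kop (K \<mu>) x) * norm x"
      using norm_cauchy_schwarz[of "- kop (K \<mu>) x" x] by simp
    also have "\<dots> \<le> 1 / 2 * norm x * norm x" by (intro mult_right_mono K_norm assms) auto
    finally show ?thesis by (simp add: inner_add_left power2_norm_eq_inner[symmetric] power2_eq_square)
  qed
  show "\<exists>x. x + kop (K \<mu>) x = f" by (rule lax_milgram(1)[OF bl _ co]) simp
  have "1 / 2 * norm x \<le> norm (x + kop (K \<mu>) x)" by (rule lax_milgram(2)[OF bl _ co]) simp
  then show "norm x \<le> 2 * norm (x + kop (K \<mu>) x)" by simp
qed

text \<open>As \<open>wt p 1 = 2 ^ p\<close>, this is the vector whose unweighted mode 1 has
  amplitude 1. \<open>X \<mu>\<close> is the response to it: mode 1 is kept, the modes 0 and -1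
  vanish, and all rows with \<bar>n\<bar> \<ge> 2 are satisfied.\<close>

definition "e = (2 ^ p) *\<^sub>R unit 1"
definition "X \<mu> = (SOME x. x + kop (K \<mu>) x = e)"

lemma X: "\<bar>\<mu>\<bar> \<le> \<delta> / 2 \<Longrightarrow> X \<mu> + kop (K \<mu>) (X \<mu>) = e"
  unfolding X_def by (rule someI_ex) (rule B_solve(1))

lemma norm_e: "norm e = 2 ^ p" by (simp add: e_def)

lemma X_norm: "\<bar>\<mu>\<bar> \<le> \<delta> / 2 \<Longrightarrow> norm (X \<mu>) \<le> 2 * 2 ^ p"
  using B_solve(2)[of \<mu> "X \<mu>"] X[of \<mu>] norm_e by simp

text \<open>Resolvent identity: the difference of two responses solves the equation with datum
  \<open>K \<nu> - K \<mu>\<close> applied to one of them, and this matrix is diagonal and linear in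
  \<open>\<nu> - \<mu>\<close>.\<close>

lemma X_lipschitz:
  assumes "\<bar>\<mu>\<bar> \<le> \<delta> / 2" "\<bar>\<nu>\<bar> \<le> \<delta> / 2"
  shows "norm (X \<mu> - X \<nu>) \<le> 2 * 2 ^ p / \<delta> * \<bar>\<mu> - \<nu>\<bar>"
proof -
  interpret K: bounded_linear "kop (K \<mu>)" by (rule kop_bounded_linear[OF K_dom])
  have "(X \<mu> - X \<nu>) + kop (K \<mu>) (X \<mu> - X \<nu>) = kop (K \<nu>) (X \<nu>) - kop (K \<mu>) (X \<nu>)"
    using X[OF assms(1)] X[OF assms(2)] by (simp add: K.diff algebra_simps)
  also have "\<dots> = kop (\<lambda>n m. K \<nu> n m - K \<mu> n m) (X \<nu>)" by (rule kop_diff(1)[OF K_dom K_dom])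
  also have "(\<lambda>n m. K \<nu> n m - K \<mu> n m) = (\<lambda>n m. if n = m then g (\<nu> - \<mu>) n else 0)"
    by (auto simp: fun_eq_iff K_def g_def algebra_simps diff_divide_distrib)
  finally have eq: "(X \<mu> - X \<nu>) + kop (K \<mu>) (X \<mu> - X \<nu>) = kop (\<lambda>n m. if n = m then g (\<nu> - \<mu>) n else 0) (X \<nu>)" .
  have "norm (X \<mu> - X \<nu>) \<le> 2 * norm (kop (\<lambda>n m. if n = m then g (\<nu> - \<mu>) n else 0) (X \<nu>))"
    using B_solve(2)[OF assms(1), of "X \<mu> - X \<nu>"] unfolding eq .
  also have "\<dots> \<le> 2 * (\<bar>\<nu> - \<mu>\<bar> / (2 * \<delta>) * norm (X \<nu>))"
    using norm_kop[OF dominated_diag(1)[where g = "g (\<nu> - \<mu>)", OF g_bound], of "X \<nu>"]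
    unfolding dominated_diag(2)[where g = "g (\<nu> - \<mu>)", OF g_bound] by simp
  also have "\<dots> \<le> 2 * (\<bar>\<nu> - \<mu>\<bar> / (2 * \<delta>) * (2 * 2 ^ p))"
    using \<delta> by (intro mult_left_mono X_norm assms) auto
  finally show ?thesis by (simp add: abs_minus_commute mult_ac)
qed

definition "Kq n m = q (n - m) * of_real (inverse (wt p m))"

lemma Kq_dom: "dominated Kq (\<lambda>l. wt p l * cmod (q l))"
  unfolding Kq_def[abs_def] by (rule dominated_wconv[OF q])

lemma Kq_norm: "cmod (coef (kop Kq x) n) \<le> wnorm p q * norm x"
  using norm_kop[OF Kq_dom, of x] norm_coef_le[of "kop Kq x" n] by (simp add: wnorm_def)

text \<open>Residuals of the rows 1 and -1 for \<open>X \<mu>\<close>, that is, the first column of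
  the reduced two by two matrix. The second column follows by symmetry.\<close>

definition "r \<mu> = \<i> * of_real \<mu> + of_real (d 1) - coef (kop Kq (X \<mu>)) 1"
definition "s \<mu> = - coef (kop Kq (X \<mu>)) (-1)"

lemma coef_kop_K: "coef (kop (K \<mu>) x) n = of_real (di n) * (\<i> * of_real (\<mu> / of_int n) * coef x n - of_real (wt p n) * coef (kop Kq x) n)"
proof -
  have "(\<Sum>\<^sub>\<infinity>m. R n m * coef x m) = (\<Sum>\<^sub>\<infinity>m. - (of_real (di n * wt p n)) * (Kq n m * coef x m))"
    by (rule infsum_cong) (simp add: R_def Kq_def divide_inverse mult_ac)
  also have "\<dots> = - (of_real (di n * wt p n)) * coef (kop Kq x) n"
    unfolding infsum_cmult_right' coef_kop[OF Kq_dom] ..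
  finally show ?thesis
    unfolding K_def[abs_def] kop_diag_plus(3)[OF g_bound R_dom] by (simp add: g_def algebra_simps)
qed

lemma X_coef:
  assumes "\<bar>\<mu>\<bar> \<le> \<delta> / 2"
  shows "coef (X \<mu>) 0 = 0" "coef (X \<mu>) (-1) = 0" "coef (X \<mu>) 1 = 2 ^ p"
    and "\<bar>n\<bar> \<ge> 2 \<Longrightarrow> (\<i> * of_real \<mu> / of_int n + of_real (d n)) * coef (X \<mu>) n = of_real (wt p n) * coef (kop Kq (X \<mu>)) n"
proof -
  have c: "coef (X \<mu>) n + coef (kop (K \<mu>) (X \<mu>)) n = coef e n" for n
    using X[OF assms] by (metis coef_simps(2))
  show "coef (X \<mu>) 0 = 0" "coef (X \<mu>) (-1) = 0" "coef (X \<mu>) 1 = 2 ^ p"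
    using c[of 0] c[of "-1"] c[of 1] by (simp_all add: coef_kop_K di_def e_def scaleR_conv_of_real)
  assume n: "\<bar>n\<bar> \<ge> 2"
  then have dn: "d n \<noteq> 0" using d[of n] \<delta> by auto
  have "of_real (d n) * (coef (X \<mu>) n + coef (kop (K \<mu>) (X \<mu>)) n) = 0"
    using c[of n] n by (auto simp: e_def)
  then have "(\<i> * of_real \<mu> / of_int n + of_real (d n)) * coef (X \<mu>) n - of_real (wt p n) * coef (kop Kq (X \<mu>)) n = 0"
    using n dn by (simp add: coef_kop_K di_def algebra_simps)
  then show "(\<i> * of_real \<mu> / of_int n + of_real (d n)) * coef (X \<mu>) n = of_real (wt p n) * coef (kop Kq (X \<mu>)) n"
    by (simp only: right_minus_eq)
qed

text \<open>Reflection composed with conjugation commutes with the equation for real \<open>\<mu>\<close>. The determinant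
  of the reduced two by two system is therefore \<open>\<bar>r\<bar>\<^sup>2 - \<bar>s\<bar>\<^sup>2\<close>.\<close>

lemma null_vector:
  assumes \<mu>: "\<bar>\<mu>\<bar> \<le> \<delta> / 2" and rs: "cmod (r \<mu>) = cmod (s \<mu>)"
  shows "\<exists>x. x \<noteq> 0 \<and> coef x 0 = 0 \<and> (\<forall>n. n \<noteq> 0 \<longrightarrow>
      (\<i> * of_real \<mu> / of_int n + of_real (d n)) * coef x n = of_real (wt p n) * coef (kop Kq x) n)"
proof -
  define Y where "Y = Abs_ell2 (\<lambda>n. cnj (coef (X \<mu>) (- n)))"
  have Y: "coef Y n = cnj (coef (X \<mu>) (- n))" for n
    unfolding Y_def using summable_on_int_shift(1)[OF summable_coef_sq[of "X \<mu>"], of 0]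
    by (subst coef_Abs) simp_all
  have KY: "coef (kop Kq Y) n = cnj (coef (kop Kq (X \<mu>)) (- n))" for n
  proof -
    have "Kq n m * coef Y m = cnj (Kq (- n) (- m) * coef (X \<mu>) (- m))" for m
      using q_even[of "n - m"] by (simp add: Y Kq_def q_real)
    then have "coef (kop Kq Y) n = (\<Sum>\<^sub>\<infinity>m. cnj (Kq (- n) (- m) * coef (X \<mu>) (- m)))"
      unfolding coef_kop[OF Kq_dom] by (simp only:)
    also have "\<dots> = cnj (\<Sum>\<^sub>\<infinity>m. Kq (- n) (- m) * coef (X \<mu>) (- m))" by (rule infsum_cnj)
    also have "(\<Sum>\<^sub>\<infinity>m. Kq (- n) (- m) * coef (X \<mu>) (- m)) = coef (kop Kq (X \<mu>)) (- n)"
      unfolding coef_kop[OF Kq_dom] using infsum_int_shift(1)[of "\<lambda>m. Kq (- n) m * coef (X \<mu>) m" 0] by simp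
    finally show ?thesis .
  qed
  \<comment> \<open>Coefficients of a null vector of the matrix with columns (r, s) and (cnj s, cnj
    r). If \<open>r \<mu> = 0\<close>, then also \<open>s \<mu> = 0\<close>, and
    \<open>X \<mu>\<close> itself works.\<close>
  define a where "a = (if r \<mu> = 0 then 1 else cnj (s \<mu>))"
  define b where "b = (if r \<mu> = 0 then 0 else - r \<mu>)"
  define x where "x = cmul a (X \<mu>) + cmul b Y"
  interpret kq: bounded_linear "kop Kq" by (rule kop_bounded_linear[OF Kq_dom])
  have kx: "coef (kop Kq x) n = a * coef (kop Kq (X \<mu>)) n + b * coef (kop Kq Y) n" for n
    by (simp add: x_def kq.add kop_cmul[OF Kq_dom])
  have ab: "a * r \<mu> + b * cnj (s \<mu>) = 0" "a * s \<mu> + b * cnj (r \<mu>) = 0"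
  proof -
    have "s \<mu> = 0" if "r \<mu> = 0" using rs that by simp
    moreover have "cnj (s \<mu>) * s \<mu> = r \<mu> * cnj (r \<mu>)"
      using rs complex_norm_square[of "s \<mu>"] complex_norm_square[of "r \<mu>"] by (simp add: mult.commute)
    ultimately show "a * r \<mu> + b * cnj (s \<mu>) = 0" "a * s \<mu> + b * cnj (r \<mu>) = 0"
      by (auto simp: a_def b_def mult.commute)
  qed
  have "coef x n = a * coef (X \<mu>) n + b * coef Y n" for n by (simp add: x_def)
  note xc = this Y X_coef(1-3)[OF \<mu>]
  have eq: "(\<i> * of_real \<mu> / of_int n + of_real (d n)) * coef x n = of_real (wt p n) * coef (kop Kq x) n" if n0: "n \<noteq> 0" for n
  proof -
    consider "n = 1" | "n = -1" | "\<bar>n\<bar> \<ge> 2" using n0 by fastforce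
    then show ?thesis
    proof cases
      case 1
      have "2 ^ p * (a * r \<mu> + b * cnj (s \<mu>)) = 0" unfolding ab by simp
      then show ?thesis unfolding 1 kx KY xc by (simp add: xc wt_def r_def s_def algebra_simps)
    next
      case 2
      have "2 ^ p * (a * s \<mu> + b * cnj (r \<mu>)) = 0" unfolding ab by simp
      then show ?thesis unfolding 2 kx KY xc by (simp add: xc wt_def r_def s_def d_even algebra_simps)
    next
      case 3
      have "cnj ((\<i> * of_real \<mu> / of_int (- n) + of_real (d (- n))) * coef (X \<mu>) (- n)) = cnj (of_real (wt p (- n)) * coef (kop Kq (X \<mu>)) (- n))"
        using 3 by (subst X_coef(4)[OF \<mu>]) auto
      then have "(\<i> * of_real \<mu> / of_int n + of_real (d n)) * coef Y n = of_real (wt p n) * coef (kop Kq Y) n"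
        by (simp add: Y KY d_even add.commute)
      then have "b * ((\<i> * of_real \<mu> / of_int n + of_real (d n)) * coef Y n) = b * (of_real (wt p n) * coef (kop Kq Y) n)" by simp
      moreover have "a * ((\<i> * of_real \<mu> / of_int n + of_real (d n)) * coef (X \<mu>) n) = a * (of_real (wt p n) * coef (kop Kq (X \<mu>)) n)"
        using X_coef(4)[OF \<mu> 3] by simp
      ultimately show ?thesis unfolding kx xc(1) by (simp only: distrib_left mult.left_commute[of _ a] mult.left_commute[of _ b])
    qed
  qed
  have "coef x 1 = 2 ^ p * a" "coef x (-1) = 2 ^ p * b" by (simp_all add: xc)
  moreover have "a \<noteq> 0 \<or> b \<noteq> 0" by (auto simp: a_def b_def)
  ultimately have "x \<noteq> 0" by auto
  moreover have "coef x 0 = 0" by (simp add: xc)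
  ultimately show ?thesis using eq by blast
qed

lemma r_s_continuous: "continuous_on {0..\<delta> / 2} r" "continuous_on {0..\<delta> / 2} s"
proof -
  have X: "continuous_on {0..\<delta> / 2} X"
    unfolding continuous_on_iff
  proof (intro ballI allI impI)
    fix \<mu> \<epsilon> :: real assume \<mu>: "\<mu> \<in> {0..\<delta> / 2}" and \<epsilon>: "\<epsilon> > 0"
    let ?L = "2 * 2 ^ p / \<delta>"
    have L: "?L > 0" using \<delta> by simp
    show "\<exists>\<tau>>0. \<forall>\<nu>\<in>{0..\<delta> / 2}. dist \<nu> \<mu> < \<tau> \<longrightarrow> dist (X \<nu>) (X \<mu>) < \<epsilon>"
    proof (intro exI[of _ "\<epsilon> / ?L"] conjI ballI impI)
      show "\<epsilon> / ?L > 0" using \<epsilon> L by (rule divide_pos_pos)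
      fix \<nu> assume \<nu>: "\<nu> \<in> {0..\<delta> / 2}" "dist \<nu> \<mu> < \<epsilon> / ?L"
      have "dist (X \<nu>) (X \<mu>) \<le> ?L * \<bar>\<nu> - \<mu>\<bar>" using X_lipschitz[of \<nu> \<mu>] \<mu> \<nu> by (simp add: dist_norm)
      also have "\<dots> < ?L * (\<epsilon> / ?L)" using \<nu>(2) L by (intro mult_strict_left_mono) (simp_all add: dist_real_def)
      also have "?L * (\<epsilon> / ?L) = \<epsilon>" using L by (metis nonzero_mult_div_cancel_left less_irrefl times_divide_eq_right)
      finally show "dist (X \<nu>) (X \<mu>) < \<epsilon>" .
    qed
  qed
  have c: "bounded_linear (\<lambda>x. coef (kop Kq x) n)" for n
  proof (rule bounded_linear_intro)
    interpret kq: bounded_linear "kop Kq" by (rule kop_bounded_linear[OF Kq_dom])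
    show "coef (kop Kq (x + y)) n = coef (kop Kq x) n + coef (kop Kq y) n" for x y by (simp add: kq.add)
    show "coef (kop Kq (a *\<^sub>R x)) n = a *\<^sub>R coef (kop Kq x) n" for a x by (simp add: kq.scaleR)
    show "norm (coef (kop Kq x) n) \<le> norm x * wnorm p q" for x using Kq_norm[of x n] by (simp add: mult.commute)
  qed
  show "continuous_on {0..\<delta> / 2} r" "continuous_on {0..\<delta> / 2} s"
    unfolding r_def[abs_def] s_def[abs_def]
    by (intro continuous_intros bounded_linear.continuous_on[OF c] X)+
qed

lemma rs_bound:
  assumes "\<bar>\<mu>\<bar> \<le> \<delta> / 2"
  shows "cmod (r \<mu>) \<ge> \<bar>\<mu>\<bar> - \<bar>d 1\<bar> - 2 * 2 ^ p * wnorm p q" "cmod (s \<mu>) \<le> 2 * 2 ^ p * wnorm p q"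
proof -
  have b: "cmod (coef (kop Kq (X \<mu>)) n) \<le> 2 * 2 ^ p * wnorm p q" for n
    using order_trans[OF Kq_norm[of "X \<mu>" n] mult_left_mono[OF X_norm[OF assms] wnorm_nonneg]] by (simp add: mult_ac)
  then show "cmod (s \<mu>) \<le> 2 * 2 ^ p * wnorm p q" by (simp add: s_def)
  have "cmod (\<i> * of_real \<mu>) \<le> cmod (r \<mu>) + cmod (of_real (d 1)) + cmod (coef (kop Kq (X \<mu>)) 1)"
    using norm_triangle_ineq[of "r \<mu> - of_real (d 1)" "coef (kop Kq (X \<mu>)) 1"] norm_triangle_ineq4[of "r \<mu>" "of_real (d 1)"]
    by (simp add: r_def)
  then show "cmod (r \<mu>) \<ge> \<bar>\<mu>\<bar> - \<bar>d 1\<bar> - 2 * 2 ^ p * wnorm p q" using b[of 1] by (simp add: norm_mult)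
qed

text \<open>In the application only the first harmonic of \<open>q\<close> is of order \<epsilon>,
  so \<open>q2\<close> is of order \<epsilon>^2. Mode 1 excites mode 2 with amplitude
  \<open>b\<close> at first order; \<open>err\<close>, of order \<epsilon>^3, bounds what this
  approximation leaves out of the reduced matrix at \<mu> = 0.\<close>

definition "q2 n = (if \<bar>n\<bar> \<ge> 2 then q n else 0)"
definition "b = q 1 / of_real (d 2)"
definition "err = wnorm p q * (2 * 3 ^ p * (wnorm p q2 / \<delta> + (wnorm p q)\<^sup>2 / \<delta>\<^sup>2))"

lemma cmod_q: "cmod (q n) \<le> wnorm p q"
proof -
  have "cmod (q n) \<le> wt p n * cmod (q n)" using wt_ge_1[of p n] by (simp add: mult_le_cancel_right1)
  also have "\<dots> \<le> wnorm p q"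
    unfolding wnorm_def using finite_sum_le_infsum[of "\<lambda>n. wt p n * cmod (q n)" UNIV "{n}"] q by (simp add: wfinite_def)
  finally show ?thesis .
qed

lemma q2: "wfinite p q2"
  unfolding wfinite_def q2_def
  by (rule summable_on_comparison_test[OF q[unfolded wfinite_def]]) auto

text \<open>Two terms of the expansion of the response: \<open>X 0\<close> is \<open>e + y\<close>
  up to second order, where \<open>y\<close> is mode 2 with amplitude \<open>b\<close>. The error is
  estimated by inserting \<open>X 0 - e - y\<close> into the equation, and one more factor
  \<open>q\<close> brings it to third order in the rows 1 and -1.\<close>

lemma rs_zero:
  "cmod (r 0 - (of_real (d 1) - q 0 - q 1 * b)) \<le> err" "cmod (s 0 + q 2 + q 3 * b) \<le> err"
proof -
  have \<delta>0: "\<bar>0\<bar> \<le> \<delta> / 2" using \<delta> by simp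
  define y where "y = cmul (of_real (3 ^ p) * b) (unit 2)"
  interpret K: bounded_linear "kop (K 0)" by (rule kop_bounded_linear[OF K_dom])
  interpret kq: bounded_linear "kop Kq" by (rule kop_bounded_linear[OF Kq_dom])
  define R2 where "R2 n m = - (of_real (di n) * q2 (n - m) * of_real (wt p n / wt p m))" for n m
  have R2d: "dominated R2 (\<lambda>l. 1 / \<delta> * (wt p l * cmod (q2 l)))"
    using dominated_conv(1)[where g = di, OF q2 di_bound] by (simp add: dominated_def R2_def)
  have bb: "cmod b \<le> wnorm p q / \<delta>"
    using cmod_q[of 1] d[of 2] \<delta> by (auto simp: b_def norm_divide intro!: frac_le wnorm_nonneg)
  have yn: "norm y \<le> 3 ^ p * (wnorm p q / \<delta>)"
    using mult_left_mono[OF bb, of "3 ^ p"] by (simp add: y_def norm_mult norm_power)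
  \<comment> \<open>Acting on mode 1, the harmonics 0, 1, -1 of \<open>q\<close> reach the modes 1,
    2, 0. Rows 0 and 1 are switched off by \<open>di\<close>, so only mode 2 remains, and
    \<open>y\<close> cancels it.\<close>
  have ke: "kop (K 0) e + y = kop R2 e"
  proof (rule ell2_eqI)
    fix n
    have K0: "K 0 = (\<lambda>n m. (if n = m then 0 else 0) + R n m)" by (simp add: K_def g_def fun_eq_iff)
    have sum: "(\<Sum>\<^sub>\<infinity>m. Q n m * coef e m) = Q n 1 * 2 ^ p" for Q :: "int \<Rightarrow> int \<Rightarrow> complex"
    proof -
      have "((\<lambda>m. Q n m * coef e m) has_sum (Q n 1 * 2 ^ p)) UNIV"
        by (rule has_sum_finite_neutralI[of "{1}"]) (auto simp: e_def scaleR_conv_of_real)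
      then show ?thesis by (rule infsumI)
    qed
    have l: "coef (kop (K 0) e) n = R n 1 * 2 ^ p"
      unfolding coef_kop[OF K_dom] sum by (simp add: K_def g_def)
    have rr: "coef (kop R2 e) n = R2 n 1 * 2 ^ p" unfolding coef_kop[OF R2d] sum ..
    consider "n = 2" | "\<bar>n\<bar> < 2" | "n \<noteq> 2" "\<bar>n - 1\<bar> \<ge> 2" by fastforce
    then show "coef (kop (K 0) e + y) n = coef (kop R2 e) n"
    proof cases
      case 1
      then show ?thesis unfolding coef_simps l rr by (simp add: R_def R2_def q2_def y_def b_def di_def wt_def)
    next
      case 2
      then show ?thesis unfolding coef_simps l rr by (auto simp: R_def R2_def y_def di_def)
    next
      case 3
      then show ?thesis unfolding coef_simps l rr by (simp add: R_def R2_def q2_def y_def)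
    qed
  qed
  have "norm (X 0 - e - y) \<le> 2 * norm ((X 0 - e - y) + kop (K 0) (X 0 - e - y))" by (rule B_solve(2)[OF \<delta>0])
  also have "(X 0 - e - y) + kop (K 0) (X 0 - e - y) = - (kop (K 0) e + y) - kop (K 0) y"
    using X[OF \<delta>0] by (simp add: K.diff K.add algebra_simps)
  also have "norm (- (kop (K 0) e + y) - kop (K 0) y) \<le> norm (kop R2 e) + norm (kop (K 0) y)"
    unfolding ke using norm_triangle_ineq4[of "- kop R2 e" "kop (K 0) y"] by simp
  also have "norm (kop R2 e) \<le> 1 / \<delta> * wnorm p q2 * 2 ^ p"
    using norm_kop[OF R2d, of e] unfolding dominated_conv(2)[where g = di, OF q2 di_bound] norm_e .
  also have "norm (kop (K 0) y) \<le> 1 / \<delta> * wnorm p q * norm y"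
    using norm_kop[OF K_dom[of 0], of y] unfolding kop_diag_plus(2)[OF g_bound R_dom] dominated_conv(2)[where g = di, OF q di_bound] by simp
  also have "1 / \<delta> * wnorm p q * norm y \<le> 1 / \<delta> * wnorm p q * (3 ^ p * (wnorm p q / \<delta>))"
    using \<delta> by (intro mult_left_mono yn mult_nonneg_nonneg wnorm_nonneg) auto
  also have "1 / \<delta> * wnorm p q2 * 2 ^ p \<le> 1 / \<delta> * wnorm p q2 * 3 ^ p"
    using \<delta> wnorm_nonneg[of p q2] by (intro mult_left_mono power_mono) auto
  finally have zn: "norm (X 0 - e - y) \<le> 2 * 3 ^ p * (wnorm p q2 / \<delta> + (wnorm p q)\<^sup>2 / \<delta>\<^sup>2)"
    by (simp add: power2_eq_square algebra_simps)
  have est: "cmod (coef (kop Kq (X 0)) n - (q (n - 1) + q (n - 2) * b)) \<le> err" for n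
  proof -
    have "coef (kop Kq e) n = q (n - 1)"
    proof -
      have "((\<lambda>m. Kq n m * coef e m) has_sum (q (n - 1))) UNIV"
        by (rule has_sum_finite_neutralI[of "{1}"]) (auto simp: e_def scaleR_conv_of_real Kq_def wt_def)
      then show ?thesis unfolding coef_kop[OF Kq_dom] by (rule infsumI)
    qed
    moreover have "coef (kop Kq y) n = q (n - 2) * b"
    proof -
      have "((\<lambda>m. Kq n m * coef y m) has_sum (q (n - 2) * b)) UNIV"
        by (rule has_sum_finite_neutralI[of "{2}"]) (auto simp: y_def Kq_def wt_def)
      then show ?thesis unfolding coef_kop[OF Kq_dom] by (rule infsumI)
    qed
    ultimately have "coef (kop Kq (X 0)) n - (q (n - 1) + q (n - 2) * b) = coef (kop Kq (X 0 - e - y)) n"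
      by (simp add: kq.diff)
    also have "cmod \<dots> \<le> wnorm p q * norm (X 0 - e - y)" by (rule Kq_norm)
    also have "\<dots> \<le> err" unfolding err_def by (intro mult_left_mono zn wnorm_nonneg)
    finally show ?thesis .
  qed
  have "r 0 - (of_real (d 1) - q 0 - q 1 * b) = - (coef (kop Kq (X 0)) 1 - (q (1 - 1) + q (1 - 2) * b))"
    using q_even[of 1] by (simp add: r_def)
  then show "cmod (r 0 - (of_real (d 1) - q 0 - q 1 * b)) \<le> err" using est[of 1] by (simp only: norm_minus_cancel)
  have "s 0 + q 2 + q 3 * b = - (coef (kop Kq (X 0)) (-1) - (q (-1 - 1) + q (-1 - 2) * b))"
    using q_even[of 2] q_even[of 3] by (simp add: s_def)
  then show "cmod (s 0 + q 2 + q 3 * b) \<le> err" using est[of "-1"] by (simp only: norm_minus_cancel)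
qed

theorem unstable_eigenvalue:
  assumes small: "\<bar>d 1\<bar> + 4 * 2 ^ p * wnorm p q < \<delta> / 2"
    and neg: "cmod (of_real (d 1) - q 0 - q 1 * b) + cmod (q 3 * b) + 2 * err < cmod (q 2)"
  shows "\<exists>\<mu>>0. \<exists>x. x \<noteq> 0 \<and> coef x 0 = 0 \<and> (\<forall>n. n \<noteq> 0 \<longrightarrow>
      (\<i> * of_real \<mu> / of_int n + of_real (d n)) * coef x n = of_real (wt p n) * coef (kop Kq x) n)"
proof -
  let ?F = "\<lambda>\<mu>. cmod (r \<mu>) - cmod (s \<mu>)"
  have "cmod (r 0) \<le> cmod (of_real (d 1) - q 0 - q 1 * b) + err"
    using rs_zero(1) norm_triangle_sub[of "r 0" "of_real (d 1) - q 0 - q 1 * b"] by linarith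
  moreover have "cmod (q 2) \<le> cmod (s 0) + cmod (q 3 * b) + err"
  proof -
    have "cmod (q 2) = cmod ((s 0 + q 2 + q 3 * b) - (s 0 + q 3 * b))" by simp
    then show ?thesis
      using rs_zero(2) norm_triangle_ineq4[of "s 0 + q 2 + q 3 * b" "s 0 + q 3 * b"] norm_triangle_ineq[of "s 0" "q 3 * b"]
      by linarith
  qed
  ultimately have F0: "?F 0 < 0" using neg by linarith
  \<comment> \<open>At the right end the term \<open>\<i> * \<mu>\<close> in \<open>r\<close>
    outweighs everything else; this is the purpose of \<open>small\<close>, as the sign at 0 is that
    of \<open>neg\<close>.\<close>
  have F1: "?F (\<delta> / 2) > 0" using rs_bound[of "\<delta> / 2"] small \<delta> by simp
  have "continuous_on {0..\<delta> / 2} ?F" by (intro continuous_intros r_s_continuous)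
  then have "\<exists>\<mu>\<ge>0. \<mu> \<le> \<delta> / 2 \<and> ?F \<mu> = 0"
    using F0 F1 \<delta> by (intro IVT') auto
  then obtain \<mu> where \<mu>: "0 \<le> \<mu>" "\<mu> \<le> \<delta> / 2" "?F \<mu> = 0" by blast
  have "\<mu> \<noteq> 0" using F0 \<mu>(3) by auto
  with \<mu>(1) have "\<mu> > 0" by simp
  moreover have "\<bar>\<mu>\<bar> \<le> \<delta> / 2" "cmod (r \<mu>) = cmod (s \<mu>)" using \<mu> by auto
  note null_vector[OF this]
  ultimately show ?thesis by blast
qed

end

text \<open>The symbol at amplitude 0, without the \<mu> term, divided by n^2; the relation
  \<open>k\<^sup>2 * wave_c0 j \<gamma> k = k\<^sup>2 * j k + \<gamma>\<close> has been inserted. It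
  equals \<open>- \<rho>\<^sup>2\<close> at n = 1, -1. The row n = 0 is treated apart.\<close>

definition disp :: "(real \<Rightarrow> real) \<Rightarrow> real \<Rightarrow> real \<Rightarrow> real \<Rightarrow> int \<Rightarrow> real" where
  "disp j \<gamma> k \<rho> n = k\<^sup>2 * (j k - j (k * of_int n)) + \<gamma> - (\<gamma> + \<rho>\<^sup>2) / (of_int n)\<^sup>2"

lemma (in profile) G_coeff_eq:
  fixes k c \<gamma> \<alpha>1 \<alpha>2 \<rho> :: real and j :: "real \<Rightarrow> real" and \<phi> :: "real \<Rightarrow> complex"
  assumes k: "k > 0" and \<phi>: "integrable torus \<phi>"
  defines "q \<equiv> wave_q k \<alpha>1 \<alpha>2 (c - wave_c0 j \<gamma> k)"
  shows "n \<noteq> 0 \<Longrightarrow> G_coeff j \<gamma> \<alpha>1 \<alpha>2 k \<eta> c \<mu> \<rho> \<phi> n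
      = (of_int n)\<^sup>2 * ((\<i> * \<mu> / of_int n + of_real (disp j \<gamma> k \<rho> n)) * fourier \<phi> n - conv q (fourier \<phi>) n)"
    and "G_coeff j \<gamma> \<alpha>1 \<alpha>2 k \<eta> c \<mu> \<rho> \<phi> 0 = - of_real (\<rho>\<^sup>2 + \<gamma>) * fourier \<phi> 0"
proof -
  show "G_coeff j \<gamma> \<alpha>1 \<alpha>2 k \<eta> c \<mu> \<rho> \<phi> 0 = - of_real (\<rho>\<^sup>2 + \<gamma>) * fourier \<phi> 0"
    by (simp add: G_coeff_def algebra_simps)
  assume n: "n \<noteq> 0"
  let ?f = "fourier \<phi> n" and ?N = "of_int n :: complex"
  let ?F1 = "fourier (\<lambda>z. of_real (\<eta> z) * \<phi> z) n" and ?F2 = "fourier (\<lambda>z. of_real ((\<eta> z)\<^sup>2) * \<phi> z) n"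
  let ?J = "of_real (j (k * of_int n)) :: complex" and ?K = "of_real (k\<^sup>2) :: complex"
  have K0: "?K * of_real (wave_c0 j \<gamma> k) = ?K * of_real (j k) + of_real \<gamma>"
    using k unfolding of_real_mult[symmetric] of_real_add[symmetric] wave_c0_def by (simp add: field_simps)
  have q: "conv q (fourier \<phi>) n = ?K * (of_real (2 * \<alpha>1) * ?F1 + of_real (3 * \<alpha>2) * ?F2) - ?K * of_real c * ?f + ?K * of_real (wave_c0 j \<gamma> k) * ?f"
    unfolding q_def wave_q_mult[OF \<phi>, symmetric] by (simp add: algebra_simps)
  have i2: "(\<i> * ?N)\<^sup>2 = - (?N\<^sup>2)" by (simp add: power_mult_distrib)
  have r: "?N\<^sup>2 * (\<i> * \<mu> / ?N + of_real (disp j \<gamma> k \<rho> n)) = \<mu> * (\<i> * ?N) + ?N\<^sup>2 * (?K * of_real (j k) + of_real \<gamma>) - ?N\<^sup>2 * ?K * ?J - of_real (\<gamma> + \<rho>\<^sup>2)"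
    using n by (simp add: disp_def field_simps power2_eq_square)
  have "?N\<^sup>2 * ((\<i> * \<mu> / ?N + of_real (disp j \<gamma> k \<rho> n)) * ?f - conv q (fourier \<phi>) n)
      = (?N\<^sup>2 * (\<i> * \<mu> / ?N + of_real (disp j \<gamma> k \<rho> n))) * ?f - ?N\<^sup>2 * conv q (fourier \<phi>) n"
    by (simp add: algebra_simps)
  also have "\<dots> = G_coeff j \<gamma> \<alpha>1 \<alpha>2 k \<eta> c \<mu> \<rho> \<phi> n"
    unfolding r q K0[symmetric] G_coeff_def i2 by (simp add: algebra_simps)
  finally show "G_coeff j \<gamma> \<alpha>1 \<alpha>2 k \<eta> c \<mu> \<rho> \<phi> n
      = ?N\<^sup>2 * ((\<i> * \<mu> / ?N + of_real (disp j \<gamma> k \<rho> n)) * ?f - conv q (fourier \<phi>) n)" by simp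
qed

lemma fser_sobolev:
  assumes a: "(\<lambda>n. cmod (a n)) summable_on UNIV"
    and s: "(\<lambda>n. (1 + (of_int n)\<^sup>2) powr s * (cmod (a n))\<^sup>2) summable_on UNIV"
  shows "fser a \<in> sobolevT s"
  using s fser_L2T[OF a] unfolding sobolevT_def by (simp add: fourier_fser[OF a])

lemma wt_sq_ge: "p \<ge> 1 \<Longrightarrow> 1 + (of_int n)\<^sup>2 \<le> (wt p n)\<^sup>2"
proof -
  assume p: "p \<ge> 1"
  have "1 + (of_int n)\<^sup>2 \<le> (1 + \<bar>of_int n :: real\<bar>)\<^sup>2" by (simp add: power2_sum)
  also have "\<dots> \<le> (wt p n)\<^sup>2"
    unfolding wt_def using power_increasing[OF p, of "1 + \<bar>of_int n :: real\<bar>"] by (intro power_mono) auto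
  finally show ?thesis .
qed

lemma ell2_div_wt_summable:
  assumes p: "p \<ge> 1"
  shows "(\<lambda>n. cmod (coef x n / of_real (wt p n))) summable_on UNIV"
proof -
  have "(\<lambda>n. (cmod (of_real (1 / wt p n)))\<^sup>2) summable_on UNIV"
  proof (rule summable_on_comparison_test[OF summable_on_inverse_square_int])
    show "(cmod (of_real (1 / wt p n)))\<^sup>2 \<le> 1 / (1 + (of_int n)\<^sup>2)" for n
      using wt_sq_ge[OF p, of n] unfolding norm_of_real by (simp add: power_divide frac_le add_pos_nonneg)
  qed auto
  from summable_on_mult_sq[OF summable_coef_sq[of x] this] show ?thesis by (simp add: norm_divide)
qed

lemma wt_sobolev:
  assumes "0 \<le> s" "s \<le> real p"
  shows "(\<lambda>n. (1 + (of_int n)\<^sup>2) powr s * (cmod (coef x n / of_real (wt p n)))\<^sup>2) summable_on UNIV"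
proof (rule summable_on_comparison_test[OF summable_coef_sq[of x]])
  fix n :: int
  let ?y = "1 + \<bar>of_int n :: real\<bar>"
  have "1 + (of_int n)\<^sup>2 \<le> ?y\<^sup>2" by (simp add: power2_sum)
  then have "(1 + (of_int n)\<^sup>2) powr s \<le> (?y\<^sup>2) powr s" using assms(1) by (intro powr_mono2) auto
  also have "\<dots> = (?y powr s)\<^sup>2" by (simp add: powr_power powr_powr mult.commute flip: powr_numeral)
  also have "\<dots> \<le> (?y powr real p)\<^sup>2" using assms by (intro power_mono powr_mono) auto
  also have "\<dots> = (wt p n)\<^sup>2" by (simp add: wt_def powr_realpow)
  finally have "(1 + (of_int n)\<^sup>2) powr s * ((cmod (coef x n))\<^sup>2 / (wt p n)\<^sup>2) \<le> (wt p n)\<^sup>2 * ((cmod (coef x n))\<^sup>2 / (wt p n)\<^sup>2)"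
    by (intro mult_right_mono) auto
  then show "(1 + (of_int n)\<^sup>2) powr s * (cmod (coef x n / of_real (wt p n)))\<^sup>2 \<le> (cmod (coef x n))\<^sup>2"
    by (simp add: norm_divide power_divide)
qed auto

text \<open>Division by the weights turns the \<open>ell2\<close> vector into the coefficients of an
  element of the Sobolev domain, which is why p has to reach \<open>2 + max b 0\<close>. Its
  vanishing mode 0 settles row 0, and a nontrivial kernel violates injectivity.\<close>

lemma (in profile) instability_from_kernel:
  fixes k c \<gamma> \<alpha>1 \<alpha>2 \<rho> b :: real and j :: "real \<Rightarrow> real"
  assumes k: "k > 0" and p: "p \<ge> 1" "2 + max b 0 \<le> real p"
  defines "q \<equiv> wave_q k \<alpha>1 \<alpha>2 (c - wave_c0 j \<gamma> k)"
  assumes x: "x \<noteq> 0" "coef x 0 = 0"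
    and eq: "\<And>n. n \<noteq> 0 \<Longrightarrow> (\<i> * \<mu> / of_int n + of_real (disp j \<gamma> k \<rho> n)) * coef x n
      = of_real (wt p n) * coef (kop (\<lambda>n m. q (n - m) * of_real (inverse (wt p m))) x) n"
  shows "\<not> G_invertible j b \<gamma> \<alpha>1 \<alpha>2 k \<eta> c \<mu> \<rho>"
proof
  assume inv: "G_invertible j b \<gamma> \<alpha>1 \<alpha>2 k \<eta> c \<mu> \<rho>"
  define a where "a n = coef x n / of_real (wt p n)" for n
  have sa: "(\<lambda>n. cmod (a n)) summable_on UNIV" unfolding a_def by (rule ell2_div_wt_summable[OF p(1)])
  have D: "fser a \<in> sobolevT (2 + max b 0)"
    by (rule fser_sobolev[OF sa]) (unfold a_def, rule wt_sobolev[OF _ p(2)], simp)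
  have "wfinite p q" unfolding q_def by (rule wave_q_wfinite)
  have kq: "coef (kop (\<lambda>n m. q (n - m) * of_real (inverse (wt p m))) x) n = conv q a n" for n
    unfolding coef_kop[OF dominated_wconv[OF \<open>wfinite p q\<close>]] conv_def by (simp add: a_def divide_inverse mult_ac)
  have G: "G_coeff j \<gamma> \<alpha>1 \<alpha>2 k \<eta> c \<mu> \<rho> (fser a) n = 0" for n
  proof (cases "n = 0")
    case True
    have "a 0 = 0" by (simp add: a_def x(2))
    then show ?thesis unfolding True G_coeff_eq(2)[OF k fser_integrable[OF sa]] fourier_fser[OF sa] by simp
  next
    case False
    have "(\<i> * \<mu> / of_int n + of_real (disp j \<gamma> k \<rho> n)) * a n = conv q a n"
    proof -
      have "(\<i> * \<mu> / of_int n + of_real (disp j \<gamma> k \<rho> n)) * a n = (\<i> * \<mu> / of_int n + of_real (disp j \<gamma> k \<rho> n)) * coef x n / of_real (wt p n)"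
        by (simp add: a_def)
      also have "\<dots> = conv q a n" unfolding eq[OF False] kq by simp
      finally show ?thesis .
    qed
    moreover have "fourier (fser a) = a" using fourier_fser[OF sa] by auto
    ultimately show ?thesis
      using G_coeff_eq(1)[OF k fser_integrable[OF sa] False, of j \<gamma> \<alpha>1 \<alpha>2 c \<mu> \<rho>] by (simp add: q_def)
  qed
  have "fourier (\<lambda>_. 0) n = 0" for n unfolding fourier_def by simp
  moreover have "(\<lambda>_. 0) \<in> L2T" unfolding L2T_def by simp
  ultimately have "G_maps j \<gamma> \<alpha>1 \<alpha>2 k \<eta> c \<mu> \<rho> (fser a) (\<lambda>_. 0)" unfolding G_maps_def using G by simp
  then have "AE z in torus. fser a z = 0" using inv D unfolding G_invertible_def Let_def by blast
  then have "fourier (fser a) n = fourier (\<lambda>_. 0) n" for n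
    by (rule fourier_cong_AE) (simp_all add: fser_measurable[OF sa])
  then have "a n = 0" for n by (simp add: fourier_fser[OF sa] \<open>\<And>n. fourier (\<lambda>_. 0) n = 0\<close>)
  then have "coef x n = 0" for n by (simp add: a_def)
  then have "x = 0" by (intro ell2_eqI) simp
  with x(1) show False by simp
qed

lemma small_enough:
  fixes C c :: real
  assumes "C \<ge> 0" "c > 0"
  obtains \<epsilon>0 where "\<epsilon>0 > 0" "\<And>\<epsilon>. \<bar>\<epsilon>\<bar> < \<epsilon>0 \<Longrightarrow> C * \<bar>\<epsilon>\<bar> < c"
proof
  show "c / (C + 1) > 0" using assms by simp
  fix \<epsilon> :: real assume "\<bar>\<epsilon>\<bar> < c / (C + 1)"
  then have "(C + 1) * \<bar>\<epsilon>\<bar> < c" using assms by (simp add: pos_less_divide_eq mult.commute)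
  then show "C * \<bar>\<epsilon>\<bar> < c" using abs_ge_zero[of \<epsilon>] unfolding distrib_right by linarith
qed

lemma cmod_q0_2: "n \<in> {2, -2} \<Longrightarrow> cmod (q0 k \<alpha>1 \<alpha>2 c2 \<epsilon> n) = k\<^sup>2 * \<epsilon>\<^sup>2 * \<bar>c2\<bar>"
  unfolding q0_def norm_of_real by (auto simp: abs_mult)

lemma wnorm_q0:
  "wnorm p (q0 k \<alpha>1 \<alpha>2 c2 \<epsilon>) = k\<^sup>2 * \<epsilon>\<^sup>2 * \<bar>3 * \<alpha>2 / 2 - c2\<bar> + 2 * 2 ^ p * (k\<^sup>2 * \<bar>\<alpha>1\<bar> * \<bar>\<epsilon>\<bar>) + 2 * 3 ^ p * (k\<^sup>2 * \<epsilon>\<^sup>2 * \<bar>c2\<bar>)"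
  "wfinite p (q0 k \<alpha>1 \<alpha>2 c2 \<epsilon>)"
proof -
  let ?F = "{0, 1, -1, 2, -2 :: int}"
  have z: "q0 k \<alpha>1 \<alpha>2 c2 \<epsilon> n = 0" if "n \<notin> ?F" for n using that by (auto simp: q0_def)
  show "wfinite p (q0 k \<alpha>1 \<alpha>2 c2 \<epsilon>)" by (rule wfinite_finite(1)[where F = ?F]) (simp, rule z)
  have sum: "wnorm p (q0 k \<alpha>1 \<alpha>2 c2 \<epsilon>) = (\<Sum>n\<in>?F. wt p n * cmod (q0 k \<alpha>1 \<alpha>2 c2 \<epsilon> n))"
    by (rule wfinite_finite(2)) (simp, rule z)
  show "wnorm p (q0 k \<alpha>1 \<alpha>2 c2 \<epsilon>) = k\<^sup>2 * \<epsilon>\<^sup>2 * \<bar>3 * \<alpha>2 / 2 - c2\<bar> + 2 * 2 ^ p * (k\<^sup>2 * \<bar>\<alpha>1\<bar> * \<bar>\<epsilon>\<bar>) + 2 * 3 ^ p * (k\<^sup>2 * \<epsilon>\<^sup>2 * \<bar>c2\<bar>)"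
  proof -
    have "cmod (q0 k \<alpha>1 \<alpha>2 c2 \<epsilon> 0) = k\<^sup>2 * \<epsilon>\<^sup>2 * \<bar>3 * \<alpha>2 / 2 - c2\<bar>"
      unfolding q0_def norm_of_real by (auto simp: abs_mult)
    moreover have "cmod (q0 k \<alpha>1 \<alpha>2 c2 \<epsilon> n) = k\<^sup>2 * \<bar>\<alpha>1\<bar> * \<bar>\<epsilon>\<bar>" if "n \<in> {1, -1}" for n
      using that unfolding q0_def norm_of_real by (auto simp: abs_mult)
    ultimately show ?thesis unfolding sum by (simp add: wt_def cmod_q0_2)
  qed
qed

lemma wnorm_le_mono:
  assumes "wfinite p f" "\<And>n. cmod (g n) \<le> cmod (f n)"
  shows "wfinite p g" "wnorm p g \<le> wnorm p f"
proof -
  have le: "wt p n * cmod (g n) \<le> wt p n * cmod (f n)" for n by (intro mult_left_mono assms(2)) auto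
  show 1: "wfinite p g" unfolding wfinite_def
    by (rule summable_on_comparison_test[OF assms(1)[unfolded wfinite_def] le]) auto
  show "wnorm p g \<le> wnorm p f" unfolding wnorm_def
    by (intro infsum_mono le) (use 1 assms(1) in \<open>simp_all add: wfinite_def\<close>)
qed

lemma cmod_le_wnorm: "wfinite p f \<Longrightarrow> cmod (f n) \<le> wnorm p f"
proof -
  assume f: "wfinite p f"
  have "cmod (f n) \<le> wt p n * cmod (f n)" using wt_ge_1[of p n] by (simp add: mult_le_cancel_right1)
  also have "\<dots> \<le> wnorm p f"
    unfolding wnorm_def using finite_sum_le_infsum[of "\<lambda>n. wt p n * cmod (f n)" UNIV "{n}"] f by (simp add: wfinite_def)
  finally show ?thesis .
qed

theorem unstable_nondegenerate:
  assumes \<gamma>: "\<gamma> > 0" and k: "k > 0" and jeven: "\<And>x. j (- x) = j x"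
    and tw: "traveling_wave_family j \<gamma> \<alpha>1 \<alpha>2 k \<eta> c" and c2: "wave_c2 j \<gamma> \<alpha>1 \<alpha>2 k < 0"
    and \<delta>0: "\<delta>0 > 0" and nd: "\<And>n::nat. n \<ge> 2 \<Longrightarrow> \<bar>k\<^sup>2 * (j k - j (k * real n)) + \<gamma> - \<gamma> / (real n)\<^sup>2\<bar> \<ge> \<delta>0"
  shows "long_wave_unstable j b \<gamma> \<alpha>1 \<alpha>2 k \<eta> c"
  unfolding long_wave_unstable_def
proof (intro allI impI)
  fix \<rho>0 :: real assume \<rho>0: "\<rho>0 > 0"
  define e2 where "e2 = wave_eta2 j \<gamma> \<alpha>1 k"
  define c2' where "c2' = wave_c2 j \<gamma> \<alpha>1 \<alpha>2 k"
  \<comment> \<open>Weights of this order place the eigenfunction in the Sobolev domain.\<close>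
  define p where "p = nat \<lceil>2 + max b 0\<rceil>"
  have p: "2 + max b 0 \<le> real p" unfolding p_def by linarith
  then have p1: "p \<ge> 1" by linarith
  obtain \<epsilon>1 C where e1: "\<epsilon>1 > 0" "\<epsilon>1 \<le> 1" "C \<ge> 0" and tw': "\<And>\<epsilon>. 0 < \<bar>\<epsilon>\<bar> \<Longrightarrow> \<bar>\<epsilon>\<bar> < \<epsilon>1 \<Longrightarrow>
      profile (\<eta> \<epsilon>) \<and>
      wfinite p (\<lambda>n. profile.wave_q (\<eta> \<epsilon>) k \<alpha>1 \<alpha>2 (c \<epsilon> - wave_c0 j \<gamma> k) n - q0 k \<alpha>1 \<alpha>2 c2' \<epsilon> n) \<and>
      wnorm p (\<lambda>n. profile.wave_q (\<eta> \<epsilon>) k \<alpha>1 \<alpha>2 (c \<epsilon> - wave_c0 j \<gamma> k) n - q0 k \<alpha>1 \<alpha>2 c2' \<epsilon> n) \<le> C * \<bar>\<epsilon>\<bar> ^ 3"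
    using wave_q_asymptotics[OF tw, of p] unfolding c2'_def by blast
  \<comment> \<open>\<open>nd\<close> concerns \<rho> = 0. For \<bar>n\<bar> \<ge> 2 the additional
    term \<open>\<rho>\<^sup>2 / n\<^sup>2\<close> will be at most \<open>\<delta>0 / 4\<close>, so
    half of the gap survives.\<close>
  define \<delta> where "\<delta> = \<delta>0 / 2"
  \<comment> \<open>\<open>m * \<epsilon>\<^sup>2\<close> is the leading modulus of
    \<open>q 2\<close> and will also be the value of \<open>\<rho>\<^sup>2\<close>.\<close>
  define m where "m = - (k\<^sup>2 * c2')"
  have \<delta>: "\<delta> > 0" "\<delta> \<le> \<delta>0" using \<delta>0 by (auto simp: \<delta>_def)
  have m: "m > 0" using c2 k unfolding m_def c2'_def by (simp add: mult_less_0_iff)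
  have mc: "k\<^sup>2 * \<bar>c2'\<bar> = m" using c2 by (simp add: m_def c2'_def)
  define a where "a = k\<^sup>2 * \<bar>\<alpha>1\<bar>"
  have a0: "a \<ge> 0" by (simp add: a_def)
  \<comment> \<open>With \<open>E = \<bar>\<epsilon>\<bar>\<close>: \<open>C4 * E\<close> bounds the
    norm of \<open>q\<close>, \<open>C5 * E\<^sup>2\<close> that of its harmonics from the second
    on, and \<open>C8\<close>, \<open>C6\<close>, \<open>C7\<close> times \<open>E ^ 3\<close> bound
    the error term, the diagonal entry and the contribution of \<open>q 3\<close>. The off-diagonal
    entry is of size \<open>m * E\<^sup>2\<close> and wins for small \<epsilon>.\<close>
  define C4 where "C4 = k\<^sup>2 * \<bar>3 * \<alpha>2 / 2 - c2'\<bar> + 2 * 2 ^ p * a + 2 * 3 ^ p * m + C"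
  define C5 where "C5 = 2 * 3 ^ p * m + C"
  define C8 where "C8 = C4 * (2 * 3 ^ p * (C5 / \<delta> + C4\<^sup>2 / \<delta>\<^sup>2))"
  define C6 where "C6 = C + C * (C4 + a) / \<delta> + a\<^sup>2 * m / (\<delta> * \<delta>)"
  define C7 where "C7 = C * C4 / \<delta>"
  have C4: "C4 \<ge> 0" using e1 m a0 by (simp add: C4_def)
  have C5: "C5 \<ge> 0" using e1 m by (simp add: C5_def)
  have C8: "C8 \<ge> 0" using C4 C5 \<delta> by (simp add: C8_def)
  have C6: "C6 \<ge> 0" using C4 e1 a0 m \<delta> by (simp add: C6_def)
  have C7: "C7 \<ge> 0" using C4 e1 \<delta> by (simp add: C7_def)
  \<comment> \<open>The value of \<open>d 2\<close> at \<rho> = 0; \<open>4 * D2\<close> is the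
    denominator of \<open>wave_eta2\<close>.\<close>
  define D2 where "D2 = k\<^sup>2 * (j k - j (k * 2)) + \<gamma> - \<gamma> / 4"
  have D2: "\<bar>D2\<bar> \<ge> \<delta>" using nd[of 2] \<delta> by (simp add: D2_def)
  then have D20: "D2 \<noteq> 0" using \<delta> by auto
  obtain ea where ea: "ea > 0" "\<And>\<epsilon>. \<bar>\<epsilon>\<bar> < ea \<Longrightarrow> m * \<bar>\<epsilon>\<bar> < \<delta>0" using small_enough[of m \<delta>0] m \<delta>0 by auto
  obtain eb where eb: "eb > 0" "\<And>\<epsilon>. \<bar>\<epsilon>\<bar> < eb \<Longrightarrow> C4 * \<bar>\<epsilon>\<bar> < \<delta> / 4" using small_enough[of C4 "\<delta> / 4"] C4 \<delta> by auto
  obtain ec where ec: "ec > 0" "\<And>\<epsilon>. \<bar>\<epsilon>\<bar> < ec \<Longrightarrow> (m + 4 * 2 ^ p * C4) * \<bar>\<epsilon>\<bar> < \<delta> / 2"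
    using small_enough[of "m + 4 * 2 ^ p * C4" "\<delta> / 2"] C4 m \<delta> by auto
  obtain ed where ed: "ed > 0" "\<And>\<epsilon>. \<bar>\<epsilon>\<bar> < ed \<Longrightarrow> (C6 + C7 + 2 * C8 + C) * \<bar>\<epsilon>\<bar> < m"
    using small_enough[of "C6 + C7 + 2 * C8 + C" m] C6 C7 C8 e1 m by auto
  obtain ee where ee: "ee > 0" "\<And>\<epsilon>. \<bar>\<epsilon>\<bar> < ee \<Longrightarrow> sqrt m * \<bar>\<epsilon>\<bar> < \<rho>0" using small_enough[of "sqrt m" \<rho>0] m \<rho>0 by auto
  define \<epsilon>0 where "\<epsilon>0 = Min {\<epsilon>1, ea, eb, ec, ed, ee}"
  have "\<epsilon>0 > 0" using e1 ea eb ec ed ee by (simp add: \<epsilon>0_def)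
  moreover have "\<exists>\<rho>. 0 < \<bar>\<rho>\<bar> \<and> \<bar>\<rho>\<bar> \<le> \<rho>0 \<and> periodic_instability j b \<gamma> \<alpha>1 \<alpha>2 k (\<eta> \<epsilon>) (c \<epsilon>) \<rho>"
    if \<epsilon>: "0 < \<bar>\<epsilon>\<bar>" "\<bar>\<epsilon>\<bar> < \<epsilon>0" for \<epsilon>
  proof -
    have \<epsilon>': "\<bar>\<epsilon>\<bar> < \<epsilon>1" "\<bar>\<epsilon>\<bar> < ea" "\<bar>\<epsilon>\<bar> < eb" "\<bar>\<epsilon>\<bar> < ec" "\<bar>\<epsilon>\<bar> < ed" "\<bar>\<epsilon>\<bar> < ee"
      using \<epsilon> by (simp_all add: \<epsilon>0_def)
    define E where "E = \<bar>\<epsilon>\<bar>"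
    have E: "E > 0" "E \<le> 1" using \<epsilon> \<epsilon>' e1 by (auto simp: E_def)
    have E2: "\<epsilon>\<^sup>2 = E\<^sup>2" by (simp add: E_def)
    have Ep: "E\<^sup>2 \<le> E" "E ^ 3 \<le> E" "E ^ 3 \<le> E\<^sup>2" "E ^ 4 \<le> E ^ 3"
      using E power_decreasing[of 1 2 E] power_decreasing[of 1 3 E] power_decreasing[of 2 3 E] power_decreasing[of 3 4 E] by auto
    interpret profile "\<eta> \<epsilon>" using tw'[of \<epsilon>] \<epsilon> \<epsilon>' by blast
    define q where "q = wave_q k \<alpha>1 \<alpha>2 (c \<epsilon> - wave_c0 j \<gamma> k)"
    define u where "u n = q n - q0 k \<alpha>1 \<alpha>2 c2' \<epsilon> n" for n
    have u: "wfinite p u" "wnorm p u \<le> C * E ^ 3"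
      using tw'[of \<epsilon>] \<epsilon> \<epsilon>' unfolding u_def[abs_def] q_def E_def by blast+
    have un: "cmod (q n - q0 k \<alpha>1 \<alpha>2 c2' \<epsilon> n) \<le> C * E ^ 3" for n
      using cmod_le_wnorm[OF u(1), of n] u(2) by (simp add: u_def)
    have qw: "wfinite p q" unfolding q_def by (rule wave_q_wfinite)
    have \<kappa>: "wnorm p q \<le> C4 * E"
    proof -
      have "wnorm p (\<lambda>n. q0 k \<alpha>1 \<alpha>2 c2' \<epsilon> n + u n) \<le> wnorm p (q0 k \<alpha>1 \<alpha>2 c2' \<epsilon>) + wnorm p u"
        by (rule wfinite_add(2)[OF wnorm_q0(2) u(1)])
      also have "\<dots> \<le> (k\<^sup>2 * E\<^sup>2 * \<bar>3 * \<alpha>2 / 2 - c2'\<bar> + 2 * 2 ^ p * (a * E) + 2 * 3 ^ p * (m * E\<^sup>2)) + C * E ^ 3"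
        unfolding wnorm_q0(1) E2 mc[symmetric] a_def E_def[symmetric] using u(2) by (simp add: mult_ac)
      also have "\<dots> \<le> (k\<^sup>2 * E * \<bar>3 * \<alpha>2 / 2 - c2'\<bar> + 2 * 2 ^ p * (a * E) + 2 * 3 ^ p * (m * E)) + C * E"
        using Ep m e1 a0 by (intro add_mono mult_left_mono mult_right_mono) auto
      also have "\<dots> = C4 * E" by (simp add: C4_def algebra_simps)
      finally show ?thesis by (simp add: u_def)
    qed
    define \<rho> where "\<rho> = sqrt m * E"
    have \<rho>2: "\<rho>\<^sup>2 = m * E\<^sup>2" using m by (simp add: \<rho>_def power_mult_distrib)
    define d where "d = disp j \<gamma> k \<rho>"
    have dlow: "\<bar>d n\<bar> \<ge> \<delta>" if n: "\<bar>n\<bar> \<ge> 2" for n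
    proof -
      define N where "N = nat \<bar>n\<bar>"
      have N: "N \<ge> 2" "\<bar>of_int n :: real\<bar> = real N" using n by (auto simp: N_def)
      have jn: "j (k * of_int n) = j (k * real N)"
      proof (cases "n \<ge> 0")
        case False
        then have N': "real N = - of_int n" using N(2) by simp
        have "k * real N = - (k * of_int n)" unfolding N' by simp
        then show ?thesis by (simp only: jeven)
      qed (use N(2) in simp)
      have n2: "(of_int n)\<^sup>2 = (real N)\<^sup>2" using N(2) by (metis power2_abs)
      have "d n = (k\<^sup>2 * (j k - j (k * real N)) + \<gamma> - \<gamma> / (real N)\<^sup>2) - \<rho>\<^sup>2 / (real N)\<^sup>2"
        unfolding d_def disp_def jn n2 by (simp add: add_divide_distrib)
      moreover have "\<rho>\<^sup>2 / (real N)\<^sup>2 \<le> \<delta>0 / 4"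
      proof -
        have "\<rho>\<^sup>2 \<le> m * E" unfolding \<rho>2 using Ep m by simp
        also have "\<dots> \<le> \<delta>0" using ea(2)[OF \<epsilon>'(2)] by (simp add: E_def)
        finally show ?thesis using power_mono[of 2 "real N" 2] N(1) \<delta>0 by (intro frac_le) auto
      qed
      moreover have "\<rho>\<^sup>2 / (real N)\<^sup>2 \<ge> 0" by simp
      ultimately show ?thesis using nd[OF N(1)] unfolding \<delta>_def by linarith
    qed
    have d1: "d 1 = - (m * E\<^sup>2)" by (simp add: d_def disp_def \<rho>2)
    interpret S: nondegenerate_symbol d q \<delta> p
    proof
      show "d (- n) = d n" for n using jeven[of "k * of_int n"] by (simp add: d_def disp_def)
      show "wnorm p q \<le> \<delta> / 4" using \<kappa> eb(2)[OF \<epsilon>'(3)] by (simp add: E_def)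
      show "q (- n) = q n" "cnj (q n) = q n" for n unfolding q_def by (rule wave_q_even cnj_wave_q)+
    qed (use \<delta> dlow qw in auto)
    have small: "\<bar>d 1\<bar> + 4 * 2 ^ p * wnorm p q < \<delta> / 2"
    proof -
      have "\<bar>d 1\<bar> + 4 * 2 ^ p * wnorm p q \<le> m * E + 4 * 2 ^ p * (C4 * E)"
        unfolding d1 using Ep m \<kappa> by (intro add_mono mult_left_mono) (auto simp: abs_mult)
      also have "\<dots> < \<delta> / 2" using ec(2)[OF \<epsilon>'(4)] by (simp add: E_def algebra_simps)
      finally show ?thesis .
    qed
    have \<kappa>2: "wnorm p S.q2 \<le> C5 * E\<^sup>2"
    proof -
      define t where "t n = (if \<bar>n\<bar> = 2 then q0 k \<alpha>1 \<alpha>2 c2' \<epsilon> n else 0)" for n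
      define v where "v n = (if \<bar>n\<bar> \<ge> 2 then u n else 0)" for n
      have tz: "t n = 0" if "n \<notin> {2, -2}" for n using that by (auto simp: t_def)
      have tw: "wfinite p t" by (rule wfinite_finite(1)[where F = "{2, -2}"]) (simp, rule tz)
      have "wnorm p t = (\<Sum>n\<in>{2, -2}. wt p n * cmod (t n))" by (rule wfinite_finite(2)) (simp, rule tz)
      also have "\<dots> = 2 * 3 ^ p * (m * E\<^sup>2)"
        by (simp add: t_def cmod_q0_2 wt_def E2 mc[symmetric] mult_ac)
      finally have tn: "wnorm p t = 2 * 3 ^ p * (m * E\<^sup>2)" .
      have v: "wfinite p v" "wnorm p v \<le> wnorm p u" by (rule wnorm_le_mono[OF u(1)]; simp add: v_def)+
      have "S.q2 = (\<lambda>n. t n + v n)" by (auto simp: fun_eq_iff S.q2_def t_def v_def u_def q0_def)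
      then have "wnorm p S.q2 \<le> wnorm p t + wnorm p v" using wfinite_add(2)[OF tw v(1)] by simp
      also have "\<dots> \<le> 2 * 3 ^ p * (m * E\<^sup>2) + C * E ^ 3" using tn v(2) u(2) by linarith
      also have "\<dots> \<le> 2 * 3 ^ p * (m * E\<^sup>2) + C * E\<^sup>2" using Ep e1 by (intro add_left_mono mult_left_mono) auto
      finally show ?thesis by (simp add: C5_def algebra_simps)
    qed
    have err: "S.err \<le> C8 * E ^ 3"
    proof -
      have "wnorm p S.q2 / \<delta> + (wnorm p q)\<^sup>2 / \<delta>\<^sup>2 \<le> C5 * E\<^sup>2 / \<delta> + (C4 * E)\<^sup>2 / \<delta>\<^sup>2"
        using \<kappa> \<kappa>2 \<delta> by (intro add_mono divide_right_mono power_mono wnorm_nonneg) auto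
      then have "S.err \<le> (C4 * E) * (2 * 3 ^ p * (C5 * E\<^sup>2 / \<delta> + (C4 * E)\<^sup>2 / \<delta>\<^sup>2))"
        unfolding S.err_def using \<kappa> C4 C5 E \<delta>
        by (intro mult_mono mult_left_mono) (auto intro!: mult_nonneg_nonneg add_nonneg_nonneg divide_nonneg_nonneg wnorm_nonneg)
      also have "\<dots> = C8 * E ^ 3" by (simp add: C8_def power2_eq_square power3_eq_cube algebra_simps)
      finally show ?thesis .
    qed
    have q1: "cmod (q 1) \<le> C4 * E" using S.cmod_q[of 1] \<kappa> by linarith
    have d2: "\<bar>d 2\<bar> \<ge> \<delta>" by (rule dlow) simp
    then have d20: "d 2 \<noteq> 0" using \<delta> by auto
    have bE: "cmod S.b \<le> C4 * E / \<delta>"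
      unfolding S.b_def norm_divide norm_of_real using q1 d2 \<delta> C4 E by (intro frac_le) auto
    have q3: "cmod (q 3 * S.b) \<le> C7 * E ^ 3"
    proof -
      have "cmod (q 3) \<le> C * E ^ 3" using un[of 3] by (simp add: q0_def)
      then have "cmod (q 3 * S.b) \<le> C * E ^ 3 * (C4 * E / \<delta>)"
        unfolding norm_mult using bE e1 E by (intro mult_mono) auto
      also have "\<dots> = C7 * E ^ 4" by (simp add: C7_def power3_eq_cube power4_eq_xxxx)
      also have "\<dots> \<le> C7 * E ^ 3" using Ep C7 by (intro mult_left_mono)
      finally show ?thesis .
    qed
    have q2low: "cmod (q 2) \<ge> m * E\<^sup>2 - C * E ^ 3"
    proof -
      have "q0 k \<alpha>1 \<alpha>2 c2' \<epsilon> 2 = of_real (- (m * E\<^sup>2))" by (simp add: q0_def m_def E2)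
      then have "cmod (q0 k \<alpha>1 \<alpha>2 c2' \<epsilon> 2) = m * E\<^sup>2" using m by (simp only: norm_of_real) (simp add: abs_mult)
      then show ?thesis using un[of 2] norm_triangle_sub[of "q0 k \<alpha>1 \<alpha>2 c2' \<epsilon> 2" "q 2"] by (simp add: norm_minus_commute)
    qed
    have X: "cmod (of_real (d 1) - q 0 - q 1 * S.b) \<le> C6 * E ^ 3"
    proof -
      define Q where "Q = k\<^sup>2 * \<alpha>1 * \<epsilon>"
      have Q: "\<bar>Q\<bar> = a * E" by (simp add: Q_def a_def E_def abs_mult)
      \<comment> \<open>The cancellation behind the choice of \<open>\<rho>\<close>: by the formulas
        for \<open>wave_eta2\<close> and \<open>wave_c2\<close> the leading parts of
        \<open>d 1 - q 0\<close> and of \<open>q 1 * b\<close> agree, so the diagonal entry is of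
        third order.\<close>
      have base: "d 1 - k\<^sup>2 * \<epsilon>\<^sup>2 * (3 * \<alpha>2 / 2 - c2') = Q\<^sup>2 / D2"
      proof -
        have e2D: "4 * D2 * e2 = 2 * \<alpha>1 * k\<^sup>2"
        proof -
          have "3 * \<gamma> + 4 * k\<^sup>2 * (j k - j (2 * k)) = 4 * D2" by (simp add: D2_def algebra_simps)
          then show ?thesis using D20 unfolding e2_def wave_eta2_def by simp
        qed
        have c2e: "c2' = \<alpha>1 * e2 + 3 / 4 * \<alpha>2" by (simp add: c2'_def e2_def wave_c2_def)
        have "d 1 - k\<^sup>2 * \<epsilon>\<^sup>2 * (3 * \<alpha>2 / 2 - c2') = k\<^sup>2 * \<epsilon>\<^sup>2 * (2 * \<alpha>1 * e2)"
          unfolding d1 m_def E2[symmetric] c2e by (simp add: algebra_simps)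
        also have "\<dots> = (k\<^sup>2 * \<epsilon>\<^sup>2 * \<alpha>1 * (4 * D2 * e2) / 2) / D2" using D20 by simp
        also have "\<dots> = Q\<^sup>2 / D2" unfolding e2D by (simp add: Q_def power2_eq_square mult_ac)
        finally show ?thesis .
      qed
      have q00: "cmod (q 0 - of_real (k\<^sup>2 * \<epsilon>\<^sup>2 * (3 * \<alpha>2 / 2 - c2'))) \<le> C * E ^ 3" using un[of 0] by (simp add: q0_def)
      have q1Q: "cmod (q 1 - of_real Q) \<le> C * E ^ 3" using un[of 1] by (simp add: q0_def Q_def)
      have sq: "cmod ((q 1)\<^sup>2 - of_real (Q\<^sup>2)) \<le> C * (C4 + a) * E ^ 3"
      proof -
        have "(q 1)\<^sup>2 - of_real (Q\<^sup>2) = (q 1 - of_real Q) * (q 1 + of_real Q)" by (simp add: power2_eq_square algebra_simps)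
        then have "cmod ((q 1)\<^sup>2 - of_real (Q\<^sup>2)) = cmod (q 1 - of_real Q) * cmod (q 1 + of_real Q)" by (simp add: norm_mult)
        also have "\<dots> \<le> C * E ^ 3 * (C4 * E + a * E)"
          using q1Q q1 Q E e1 norm_triangle_ineq[of "q 1" "of_real Q"] by (intro mult_mono) auto
        also have "\<dots> \<le> C * E ^ 3 * (C4 + a)"
          using E C4 a0 e1 mult_left_le[of E C4] mult_left_le[of E a] by (intro mult_left_mono) auto
        finally show ?thesis by (simp add: mult_ac)
      qed
      have dD: "\<bar>D2 - d 2\<bar> \<le> m * E\<^sup>2"
        using m by (simp add: D2_def d_def disp_def \<rho>2 add_divide_distrib mult.commute abs_mult)
      have X: "of_real (d 1) - q 0 - q 1 * S.b = - (q 0 - of_real (k\<^sup>2 * \<epsilon>\<^sup>2 * (3 * \<alpha>2 / 2 - c2')))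
          - ((q 1)\<^sup>2 - of_real (Q\<^sup>2)) / of_real (d 2) + of_real (Q\<^sup>2 / D2 - Q\<^sup>2 / d 2)"
      proof -
        have "of_real (d 1) = of_real (k\<^sup>2 * \<epsilon>\<^sup>2 * (3 * \<alpha>2 / 2 - c2')) + (of_real (Q\<^sup>2 / D2) :: complex)"
        proof -
          have d1': "d 1 = k\<^sup>2 * \<epsilon>\<^sup>2 * (3 * \<alpha>2 / 2 - c2') + Q\<^sup>2 / D2" using base by linarith
          show ?thesis unfolding of_real_add[symmetric] d1' ..
        qed
        then show ?thesis by (simp add: S.b_def diff_divide_distrib power2_eq_square)
      qed
      have "cmod (of_real (d 1) - q 0 - q 1 * S.b) \<le> cmod (q 0 - of_real (k\<^sup>2 * \<epsilon>\<^sup>2 * (3 * \<alpha>2 / 2 - c2')))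
          + cmod (((q 1)\<^sup>2 - of_real (Q\<^sup>2)) / of_real (d 2)) + cmod (of_real (Q\<^sup>2 / D2 - Q\<^sup>2 / d 2))"
      proof -
        have tri: "cmod (- x - y + z) \<le> cmod x + cmod y + cmod z" for x y z :: complex
          using norm_triangle_ineq[of "- x - y" z] norm_triangle_ineq4[of "- x" y] by simp
        show ?thesis unfolding X by (rule tri)
      qed
      also have "\<dots> \<le> C * E ^ 3 + C * (C4 + a) * E ^ 3 / \<delta> + a\<^sup>2 * m * E ^ 3 / (\<delta> * \<delta>)"
      proof (intro add_mono q00)
        show "cmod (((q 1)\<^sup>2 - of_real (Q\<^sup>2)) / of_real (d 2)) \<le> C * (C4 + a) * E ^ 3 / \<delta>"
          unfolding norm_divide norm_of_real using sq d2 \<delta> e1 C4 a0 E by (intro frac_le) auto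
        have "Q\<^sup>2 / D2 - Q\<^sup>2 / d 2 = Q\<^sup>2 * (d 2 - D2) / (D2 * d 2)" using D20 d20 by (simp add: field_simps)
        have "\<bar>Q\<^sup>2 / D2 - Q\<^sup>2 / d 2\<bar> = (a * E)\<^sup>2 * \<bar>D2 - d 2\<bar> / (\<bar>D2\<bar> * \<bar>d 2\<bar>)"
        proof -
          have "Q\<^sup>2 = (a * E)\<^sup>2" using Q by (metis power2_abs)
          then show ?thesis unfolding \<open>Q\<^sup>2 / D2 - Q\<^sup>2 / d 2 = Q\<^sup>2 * (d 2 - D2) / (D2 * d 2)\<close>
            by (simp add: abs_mult abs_divide abs_minus_commute)
        qed
        also have "\<dots> \<le> (a * E)\<^sup>2 * (m * E\<^sup>2) / (\<delta> * \<delta>)"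
          using dD D2 d2 \<delta> m by (intro frac_le mult_left_mono mult_mono) auto
        also have "(a * E)\<^sup>2 * (m * E\<^sup>2) = a\<^sup>2 * m * E ^ 4" by (simp add: power2_eq_square power4_eq_xxxx)
        also have "a\<^sup>2 * m * E ^ 4 / (\<delta> * \<delta>) \<le> a\<^sup>2 * m * E ^ 3 / (\<delta> * \<delta>)"
          using Ep m \<delta> by (intro divide_right_mono mult_left_mono) auto
        finally show "cmod (of_real (Q\<^sup>2 / D2 - Q\<^sup>2 / d 2)) \<le> a\<^sup>2 * m * E ^ 3 / (\<delta> * \<delta>)" by (simp only: norm_of_real)
      qed
      also have "\<dots> = C6 * E ^ 3" by (simp add: C6_def algebra_simps)
      finally show ?thesis .
    qed
    have neg: "cmod (of_real (d 1) - q 0 - q 1 * S.b) + cmod (q 3 * S.b) + 2 * S.err < cmod (q 2)"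
    proof -
      have "(C6 + C7 + 2 * C8 + C) * E * E\<^sup>2 < m * E\<^sup>2"
        using ed(2)[OF \<epsilon>'(5)] E by (intro mult_strict_right_mono) (auto simp: E_def)
      then have "C6 * E ^ 3 + C7 * E ^ 3 + 2 * (C8 * E ^ 3) < m * E\<^sup>2 - C * E ^ 3"
        by (simp add: power2_eq_square power3_eq_cube algebra_simps)
      then show ?thesis using X q3 err q2low by linarith
    qed
    obtain \<mu> x where \<mu>: "\<mu> > 0" and x: "x \<noteq> 0" "coef x 0 = 0"
      and eq: "\<And>n. n \<noteq> 0 \<Longrightarrow> (\<i> * of_real \<mu> / of_int n + of_real (d n)) * coef x n = of_real (wt p n) * coef (kop S.Kq x) n"
      using S.unstable_eigenvalue[OF small neg] by blast
    have "\<not> G_invertible j b \<gamma> \<alpha>1 \<alpha>2 k (\<eta> \<epsilon>) (c \<epsilon>) (of_real \<mu>) \<rho>"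
    proof (rule instability_from_kernel[OF k p1 p x])
      have Kq: "S.Kq = (\<lambda>n m. q (n - m) * of_real (inverse (wt p m)))" by (simp add: fun_eq_iff S.Kq_def)
      show "(\<i> * of_real \<mu> / of_int n + of_real (disp j \<gamma> k \<rho> n)) * coef x n = of_real (wt p n)
          * coef (kop (\<lambda>n m. wave_q k \<alpha>1 \<alpha>2 (c \<epsilon> - wave_c0 j \<gamma> k) (n - m) * of_real (inverse (wt p m))) x) n"
        if "n \<noteq> 0" for n using eq[OF that] unfolding Kq unfolding d_def q_def .
    qed
    then have "periodic_instability j b \<gamma> \<alpha>1 \<alpha>2 k (\<eta> \<epsilon>) (c \<epsilon>) \<rho>"
      unfolding periodic_instability_def using \<mu> by (intro exI[of _ "of_real \<mu>"]) simp
    moreover have "0 < \<bar>\<rho>\<bar>" "\<bar>\<rho>\<bar> \<le> \<rho>0" using m E ee(2)[OF \<epsilon>'(6)] by (auto simp: \<rho>_def E_def abs_mult)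
    ultimately show ?thesis by blast
  qed
  ultimately show "\<exists>\<epsilon>0>0. \<forall>\<epsilon>. 0 < \<bar>\<epsilon>\<bar> \<and> \<bar>\<epsilon>\<bar> < \<epsilon>0 \<longrightarrow>
      (\<exists>\<rho>. 0 < \<bar>\<rho>\<bar> \<and> \<bar>\<rho>\<bar> \<le> \<rho>0 \<and> periodic_instability j b \<gamma> \<alpha>1 \<alpha>2 k (\<eta> \<epsilon>) (c \<epsilon>) \<rho>)" by blast
qed

text \<open>A Dirichlet kernel at a zero of the multiplier, shifted to high frequency, is almost annihilated:
  as the series of \<open>q\<close> vanishes at \<open>z0\<close>, only the ends of the cut-off contribute to the convolution.\<close>

lemma wave_packet:
  fixes q :: "int \<Rightarrow> complex" and g :: "int \<Rightarrow> complex"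
  assumes q: "wfinite 2 q" and z0: "fser q z0 = 0"
    and g: "\<And>e. e > 0 \<Longrightarrow> \<exists>M. \<forall>n\<ge>M. cmod (g n) \<le> e" and e: "e > 0"
  shows "\<exists>a F. finite F \<and> (\<forall>n\<in>F. n > N0) \<and> (\<forall>n. n \<notin> F \<longrightarrow> a n = 0) \<and> (\<Sum>n\<in>F. (cmod ((of_int n)\<^sup>2 * a n))\<^sup>2) = 1 \<and>
      (\<forall>A. finite A \<longrightarrow> (\<Sum>n\<in>A. cmod ((of_int n)\<^sup>2 * (g n * a n - conv q a n))) \<le> e)"
proof -
  define S where "S = wnorm 2 q"
  have S: "S \<ge> 0" unfolding S_def by (rule wnorm_nonneg)
  \<comment> \<open>The cut-off has K modes of equal amplitude \<open>1 / w\<close> with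
    \<open>w = sqrt K\<close>. Its two ends cost \<open>2 / w\<close> times the norm of
    \<open>q\<close>, and K is chosen to make this at most e / 3. The other two thirds go to
    \<open>g\<close> and to the variation of n^2 over the packet; they fix the starting frequency
    \<open>M\<close>.\<close>
  obtain K0 :: nat where K0: "(6 * S / e + 1)\<^sup>2 < real K0" using reals_Archimedean2 by blast
  define K where "K = K0 + 1"
  define w where "w = sqrt (real K)"
  have w1: "w \<ge> 1" unfolding w_def K_def by simp
  have w2: "w\<^sup>2 = real K" by (simp add: w_def)
  have Sw: "S * (2 / w) \<le> e / 3"
  proof -
    have "(6 * S / e)\<^sup>2 \<le> w\<^sup>2"
    proof -
      have "(6 * S / e)\<^sup>2 \<le> (6 * S / e + 1)\<^sup>2" using S e by (intro power_mono) auto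
      then show ?thesis using K0 unfolding w2 K_def by simp
    qed
    then have "6 * S / e \<le> w" by (rule power2_le_imp_le) (use w1 in auto)
    then show ?thesis using w1 e by (simp add: field_simps)
  qed
  obtain M0 where M0: "\<And>n. n \<ge> M0 \<Longrightarrow> cmod (g n) \<le> e / (3 * w)" using g[of "e / (3 * w)"] e w1 by auto
  define M where "M = max (max M0 (N0 + 1)) (max 1 \<lceil>9 * S * w / e\<rceil>)"
  have M: "M \<ge> M0" "M > N0" "M \<ge> 1" by (auto simp: M_def)
  have M': "real_of_int M \<ge> 1" using M(3) by simp
  have SM: "S * (3 * w / of_int M) \<le> e / 3"
  proof -
    have "\<lceil>9 * S * w / e\<rceil> \<le> M" by (simp add: M_def)
    then have "9 * S * w / e \<le> of_int M" by linarith
    then show ?thesis using e M' by (simp add: field_simps)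
  qed
  define I where "I = {M..<M + int K}"
  have I: "finite I" "card I = K" by (auto simp: I_def)
  define t where "t n = (if n \<in> I then 1 / w else 0)" for n
  define \<tau> where "\<tau> n = t n / (of_int n)\<^sup>2" for n
  define a where "a n = cis (- (of_int n * z0)) * of_real (\<tau> n)" for n
  have t0: "t n \<ge> 0" "t n \<le> 1 / w" for n using w1 by (auto simp: t_def)
  have nz: "n \<noteq> 0" if "n \<in> I" for n using that M(3) by (auto simp: I_def)
  have x: "cmod ((of_int n)\<^sup>2 * a n) = t n" for n
    using nz[of n] t0(1)[of n] by (auto simp: a_def \<tau>_def norm_mult norm_power t_def norm_divide)
  have one: "(\<Sum>n\<in>I. (cmod ((of_int n)\<^sup>2 * a n))\<^sup>2) = 1"
  proof -
    have "(\<Sum>n\<in>I. (cmod ((of_int n)\<^sup>2 * a n))\<^sup>2) = (\<Sum>n\<in>I. 1 / real K)"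
      unfolding x w2[symmetric] by (intro sum.cong) (auto simp: t_def power_divide)
    then show ?thesis using I by (simp add: K_def)
  qed
  define c where "c l = q l * cis (of_int l * z0)" for l
  have sq: "(\<lambda>n. cmod (q n)) summable_on UNIV" by (rule wfinite_summable[OF q])
  have c0: "(\<Sum>\<^sub>\<infinity>l. c l) = 0" using z0 by (simp add: fser_def c_def)
  have sc: "c summable_on UNIV" unfolding c_def by (rule fser_summable[OF sq])
  have \<tau>b: "\<bar>\<tau> n\<bar> \<le> 1" for n
  proof (cases "n \<in> I")
    case True
    then have "real_of_int n \<ge> 1" using M(3) by (simp add: I_def)
    then have n2: "(1::real) \<le> (of_int n)\<^sup>2" by (rule one_le_power)
    have "1 * 1 \<le> w * (of_int n)\<^sup>2" using w1 n2 by (intro mult_mono) auto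
    moreover have "\<tau> n = 1 / (w * (of_int n)\<^sup>2)" using True by (simp add: \<tau>_def t_def)
    ultimately show ?thesis by (simp add: abs_of_nonneg)
  qed (simp add: \<tau>_def t_def)
  have sct: "(\<lambda>l. cmod (q l) * \<bar>\<tau> (n - l) - \<tau> n\<bar>) summable_on UNIV" for n
  proof (rule summable_on_comparison_test[OF summable_on_cmult_left[OF sq, of 2]])
    show "cmod (q l) * \<bar>\<tau> (n - l) - \<tau> n\<bar> \<le> cmod (q l) * 2" for l
      using \<tau>b[of "n - l"] \<tau>b[of n] by (intro mult_left_mono) auto
  qed auto
  \<comment> \<open>After removal of the phase the convolution is the sum of
    \<open>c l * \<tau> (n - l)\<close>; as the sum of \<open>c\<close> vanishes,
    \<open>\<tau> n\<close> may be subtracted, and only differences of the amplitude remain.\<close>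
  have conv: "cmod (conv q a n) \<le> (\<Sum>\<^sub>\<infinity>l. cmod (q l) * \<bar>\<tau> (n - l) - \<tau> n\<bar>)" for n
  proof -
    have s1: "(\<lambda>l. c l * of_real (\<tau> (n - l))) summable_on UNIV"
    proof (rule abs_summable_summable, rule summable_on_comparison_test[OF sq])
      show "norm (c l * of_real (\<tau> (n - l))) \<le> cmod (q l)" for l
        using \<tau>b[of "n - l"] by (simp add: c_def norm_mult mult_left_le)
    qed auto
    have s2: "(\<lambda>l. c l * of_real (\<tau> n)) summable_on UNIV" by (rule summable_on_cmult_left[OF sc])
    have "conv q a n = (\<Sum>\<^sub>\<infinity>l. q l * a (n - l))"
      unfolding conv_def using infsum_int_shift(1)[of "\<lambda>l. q l * a (n - l)" n] by simp
    also have "\<dots> = (\<Sum>\<^sub>\<infinity>l. cis (- (of_int n * z0)) * (c l * of_real (\<tau> (n - l))))"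
    proof (rule infsum_cong)
      fix l
      have "cis (- (of_int (n - l) * z0)) = cis (- (of_int n * z0)) * cis (of_int l * z0)"
        by (simp add: cis_mult left_diff_distrib)
      then show "q l * a (n - l) = cis (- (of_int n * z0)) * (c l * of_real (\<tau> (n - l)))" by (simp add: a_def c_def)
    qed
    also have "\<dots> = cis (- (of_int n * z0)) * ((\<Sum>\<^sub>\<infinity>l. c l * of_real (\<tau> (n - l))) - (\<Sum>\<^sub>\<infinity>l. c l * of_real (\<tau> n)))"
      by (simp add: infsum_cmult_right' infsum_cmult_left' c0)
    also have "(\<Sum>\<^sub>\<infinity>l. c l * of_real (\<tau> (n - l))) - (\<Sum>\<^sub>\<infinity>l. c l * of_real (\<tau> n)) = (\<Sum>\<^sub>\<infinity>l. c l * of_real (\<tau> (n - l) - \<tau> n))"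
      unfolding infsum_minus[OF s1 s2, symmetric] by (simp add: right_diff_distrib)
    finally have "cmod (conv q a n) = cmod (\<Sum>\<^sub>\<infinity>l. c l * of_real (\<tau> (n - l) - \<tau> n))" by (simp add: norm_mult)
    also have "\<dots> \<le> (\<Sum>\<^sub>\<infinity>l. cmod (c l * of_real (\<tau> (n - l) - \<tau> n)))"
      by (rule norm_infsum_bound) (use sct[of n] in \<open>simp add: c_def norm_mult flip: of_real_diff\<close>)
    finally show ?thesis by (simp add: c_def norm_mult flip: of_real_diff)
  qed
  \<comment> \<open>Shifting an interval by l changes its indicator at no more than 2 \<bar>l\<bar>
    points.\<close>
  have jump: "(\<Sum>n\<in>A. \<bar>t (n - l) - t n\<bar>) \<le> 2 * \<bar>of_int l\<bar> / w" if A: "finite A" for A l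
  proof -
    define J where "J = {n. (n \<in> I) \<noteq> (n - l \<in> I)}"
    have "J \<subseteq> (if l \<ge> 0 then {M..<M + l} \<union> {M + int K..<M + int K + l} else {M + int K + l..<M + int K} \<union> {M + l..<M})"
      by (auto simp: J_def I_def)
    moreover have "card (if l \<ge> 0 then {M..<M + l} \<union> {M + int K..<M + int K + l} else {M + int K + l..<M + int K} \<union> {M + l..<M}) \<le> nat (2 * \<bar>l\<bar>)"
      using card_Un_le[of "{M..<M + l}" "{M + int K..<M + int K + l}"] card_Un_le[of "{M + int K + l..<M + int K}" "{M + l..<M}"]
      by (auto simp: nat_mult_distrib)
    ultimately have J: "finite J" "card J \<le> nat (2 * \<bar>l\<bar>)"
      by (auto intro: finite_subset order_trans[OF card_mono] split: if_splits)
    have "(\<Sum>n\<in>A. \<bar>t (n - l) - t n\<bar>) = (\<Sum>n\<in>A \<inter> J. \<bar>t (n - l) - t n\<bar>)"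
      using A by (intro sum.mono_neutral_right) (auto simp: J_def t_def)
    also have "\<dots> \<le> (\<Sum>n\<in>J. \<bar>t (n - l) - t n\<bar>)" using J by (intro sum_mono2) auto
    also have "\<dots> \<le> (\<Sum>n\<in>J. 1 / w)" using t0 w1 by (intro sum_mono) (auto simp: t_def)
    also have "\<dots> \<le> 2 * \<bar>of_int l\<bar> / w"
    proof -
      have "real (card J) \<le> 2 * \<bar>of_int l\<bar>" using J(2) by linarith
      then show ?thesis using w1 by (simp add: divide_right_mono)
    qed
    finally show ?thesis .
  qed
  \<comment> \<open>The weight is n^2, but \<open>\<tau> (n - l)\<close> is normalised by the square
    of n - l. Replacing one by the other costs a relative error of order l^2 / M, which the weight
    \<open>wt 2 l\<close> covers.\<close>
  have slope: "(of_int n)\<^sup>2 * \<bar>\<tau> (n - l) - \<tau> n\<bar> \<le> \<bar>t (n - l) - t n\<bar> + t (n - l) * (3 * (of_int l)\<^sup>2 / of_int M)" for n l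
  proof (cases "n - l \<in> I")
    case False
    then have "(of_int n)\<^sup>2 * \<bar>\<tau> (n - l) - \<tau> n\<bar> \<le> \<bar>t n\<bar>"
      by (cases "n = 0") (auto simp: \<tau>_def t_def abs_divide)
    then show ?thesis using False by (simp add: t_def)
  next
    case True
    define m where "m = n - l"
    have m: "m \<in> I" "real_of_int m \<ge> of_int M" "real_of_int m \<ge> 1" using True M' by (auto simp: m_def I_def)
    have n: "real_of_int n = of_int m + of_int l" by (simp add: m_def)
    have tn: "(of_int n)\<^sup>2 * \<tau> n = t n"
      using nz[of n] by (cases "n = 0") (auto simp: \<tau>_def t_def)
    have tm: "t m = (of_int m)\<^sup>2 * \<tau> m" using m(3) by (auto simp: \<tau>_def)
    have "(of_int n)\<^sup>2 * (\<tau> m - \<tau> n) = (t m - t n) + ((of_int n)\<^sup>2 - (of_int m)\<^sup>2) * \<tau> m"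
      using tn tm by (simp add: algebra_simps)
    then have "\<bar>(of_int n)\<^sup>2 * (\<tau> m - \<tau> n)\<bar> \<le> \<bar>t m - t n\<bar> + \<bar>((of_int n)\<^sup>2 - (of_int m)\<^sup>2) * \<tau> m\<bar>"
      by (simp only: abs_triangle_ineq)
    also have "\<bar>((of_int n)\<^sup>2 - (of_int m)\<^sup>2) * \<tau> m\<bar> \<le> t m * (3 * (of_int l)\<^sup>2 / of_int M)"
    proof -
      have l2: "\<bar>of_int l :: real\<bar> \<le> (of_int l)\<^sup>2"
      proof (cases "l = 0")
        case False
        then have "1 \<le> \<bar>of_int l :: real\<bar>" by (simp add: Ints_nonzero_abs_ge1)
        from self_le_power[OF this, of 2] show ?thesis by simp
      qed simp
      have "(of_int n)\<^sup>2 - (of_int m)\<^sup>2 = 2 * of_int l * of_int m + (of_int l :: real)\<^sup>2" unfolding n by (simp add: power2_eq_square algebra_simps)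
      then have "\<bar>(of_int n)\<^sup>2 - (of_int m)\<^sup>2\<bar> \<le> 2 * \<bar>of_int l\<bar> * of_int m + (of_int l :: real)\<^sup>2"
        using abs_triangle_ineq[of "2 * of_int l * of_int m" "(of_int l :: real)\<^sup>2"] m(3) by (simp add: abs_mult)
      also have "\<dots> \<le> 2 * (of_int l)\<^sup>2 * of_int m + (of_int l)\<^sup>2 * of_int m"
        using l2 m(3) by (intro add_mono mult_right_mono mult_left_mono) (auto simp: mult_le_cancel_left1)
      finally have "\<bar>(of_int n)\<^sup>2 - (of_int m)\<^sup>2\<bar> * \<bar>\<tau> m\<bar> \<le> (3 * (of_int l)\<^sup>2 * of_int m) * \<bar>\<tau> m\<bar>"
        by (intro mult_right_mono) (simp_all add: mult_ac)
      also have \<tau>m: "\<bar>\<tau> m\<bar> = t m / (of_int m)\<^sup>2" using t0(1)[of m] by (simp add: \<tau>_def abs_divide)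
      also have "3 * (of_int l)\<^sup>2 * of_int m * (t m / (of_int m)\<^sup>2) = t m * (3 * (of_int l)\<^sup>2 / of_int m)"
        using m(3) by (simp add: power2_eq_square)
      also have "\<dots> \<le> t m * (3 * (of_int l)\<^sup>2 / of_int M)"
        using m M' t0(1)[of m] by (intro mult_left_mono divide_left_mono) auto
      finally show ?thesis by (simp add: abs_mult \<tau>m)
    qed
    finally show ?thesis by (simp add: abs_mult m_def)
  qed
  have tsum: "(\<Sum>n\<in>A. t (n - l)) \<le> w" if A: "finite A" for A l
  proof -
    have "(\<Sum>n\<in>A. t (n - l)) = (\<Sum>n\<in>(\<lambda>n. n - l) ` A. t n)" by (subst sum.reindex) (auto simp: inj_on_def)
    also have "\<dots> = (\<Sum>n\<in>(\<lambda>n. n - l) ` A \<inter> I. t n)"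
      using A by (intro sum.mono_neutral_right) (auto simp: t_def)
    also have "\<dots> \<le> (\<Sum>n\<in>I. t n)" using I t0 by (intro sum_mono2) auto
    also have "\<dots> = w" using I w1 w2 by (simp add: t_def power2_eq_square field_simps)
    finally show ?thesis .
  qed
  have col: "(\<Sum>n\<in>A. (of_int n)\<^sup>2 * \<bar>\<tau> (n - l) - \<tau> n\<bar>) \<le> wt 2 l * (2 / w + 3 * w / of_int M)" if A: "finite A" for A l
  proof -
    have "(\<Sum>n\<in>A. (of_int n)\<^sup>2 * \<bar>\<tau> (n - l) - \<tau> n\<bar>) \<le> (\<Sum>n\<in>A. \<bar>t (n - l) - t n\<bar> + t (n - l) * (3 * (of_int l)\<^sup>2 / of_int M))"
      by (intro sum_mono slope)
    also have "\<dots> = (\<Sum>n\<in>A. \<bar>t (n - l) - t n\<bar>) + (\<Sum>n\<in>A. t (n - l)) * (3 * (of_int l)\<^sup>2 / of_int M)"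
      by (simp only: sum.distrib sum_distrib_right)
    also have "\<dots> \<le> 2 * \<bar>of_int l\<bar> / w + w * (3 * (of_int l)\<^sup>2 / of_int M)"
      using M' by (intro add_mono mult_right_mono jump tsum A) auto
    also have "\<dots> = \<bar>of_int l\<bar> * (2 / w) + (of_int l)\<^sup>2 * (3 * w / of_int M)" by (simp add: mult_ac)
    also have "\<dots> \<le> wt 2 l * (2 / w) + wt 2 l * (3 * w / of_int M)"
      using w1 M' by (intro add_mono mult_right_mono) (auto simp: wt_def power2_sum)
    finally show ?thesis by (simp add: distrib_left)
  qed
  have total: "(\<Sum>n\<in>A. cmod ((of_int n)\<^sup>2 * (g n * a n - conv q a n))) \<le> e" if A: "finite A" for A
  proof -
    have "(\<Sum>n\<in>A. cmod ((of_int n)\<^sup>2 * (g n * a n - conv q a n))) \<le> (\<Sum>n\<in>A. cmod (g n) * t n + (of_int n)\<^sup>2 * cmod (conv q a n))"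
    proof (rule sum_mono)
      fix n
      have "(of_int n)\<^sup>2 * (g n * a n - conv q a n) = g n * ((of_int n)\<^sup>2 * a n) - (of_int n)\<^sup>2 * conv q a n" by (simp add: algebra_simps)
      then have "cmod ((of_int n)\<^sup>2 * (g n * a n - conv q a n)) \<le> cmod (g n * ((of_int n)\<^sup>2 * a n)) + cmod ((of_int n)\<^sup>2 * conv q a n)"
        by (simp only: norm_triangle_ineq4)
      then show "cmod ((of_int n)\<^sup>2 * (g n * a n - conv q a n)) \<le> cmod (g n) * t n + (of_int n)\<^sup>2 * cmod (conv q a n)"
        unfolding norm_mult[of "g n"] x by (simp add: norm_mult norm_power)
    qed
    also have "\<dots> = (\<Sum>n\<in>A. cmod (g n) * t n) + (\<Sum>n\<in>A. (of_int n)\<^sup>2 * cmod (conv q a n))" by (rule sum.distrib)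
    also have "(\<Sum>n\<in>A. cmod (g n) * t n) \<le> e / 3"
    proof -
      have "(\<Sum>n\<in>A. cmod (g n) * t n) \<le> (\<Sum>n\<in>A. e / (3 * w) * t (n - 0))"
      proof (rule sum_mono)
        show "cmod (g n) * t n \<le> e / (3 * w) * t (n - 0)" for n
        proof (cases "n \<in> I")
          case True
          then have "n \<ge> M0" using M by (auto simp: I_def)
          from mult_right_mono[OF M0[OF this] t0(1)[of n]] show ?thesis by simp
        qed (simp add: t_def)
      qed
      also have "\<dots> \<le> e / (3 * w) * w" unfolding sum_distrib_left[symmetric] using e w1 by (intro mult_left_mono tsum A) auto
      also have "\<dots> = e / 3" using w1 by simp
      finally show ?thesis .
    qed
    also have "(\<Sum>n\<in>A. (of_int n)\<^sup>2 * cmod (conv q a n)) \<le> 2 * e / 3"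
    proof -
      have sA: "(\<lambda>l. (of_int n)\<^sup>2 * (cmod (q l) * \<bar>\<tau> (n - l) - \<tau> n\<bar>)) summable_on UNIV" for n
        by (rule summable_on_cmult_right[OF sct])
      have "(\<Sum>n\<in>A. (of_int n)\<^sup>2 * cmod (conv q a n)) \<le> (\<Sum>n\<in>A. \<Sum>\<^sub>\<infinity>l. (of_int n)\<^sup>2 * (cmod (q l) * \<bar>\<tau> (n - l) - \<tau> n\<bar>))"
        unfolding infsum_cmult_right' by (intro sum_mono mult_left_mono conv) auto
      also have "\<dots> = (\<Sum>\<^sub>\<infinity>l. \<Sum>n\<in>A. (of_int n)\<^sup>2 * (cmod (q l) * \<bar>\<tau> (n - l) - \<tau> n\<bar>))"
        by (rule infsum_sum_finite[OF A sA, symmetric])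
      also have "\<dots> \<le> (\<Sum>\<^sub>\<infinity>l. (wt 2 l * cmod (q l)) * (2 / w + 3 * w / of_int M))"
      proof (rule infsum_mono)
        show "(\<lambda>l. \<Sum>n\<in>A. (of_int n)\<^sup>2 * (cmod (q l) * \<bar>\<tau> (n - l) - \<tau> n\<bar>)) summable_on UNIV"
          by (rule summable_on_sum_finite[OF A sA])
        show "(\<lambda>l. (wt 2 l * cmod (q l)) * (2 / w + 3 * w / of_int M)) summable_on UNIV"
          using q unfolding wfinite_def by (rule summable_on_cmult_left)
        fix l
        have "(\<Sum>n\<in>A. (of_int n)\<^sup>2 * (cmod (q l) * \<bar>\<tau> (n - l) - \<tau> n\<bar>)) = cmod (q l) * (\<Sum>n\<in>A. (of_int n)\<^sup>2 * \<bar>\<tau> (n - l) - \<tau> n\<bar>)"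
          by (simp add: sum_distrib_left mult_ac)
        also have "\<dots> \<le> cmod (q l) * (wt 2 l * (2 / w + 3 * w / of_int M))" by (intro mult_left_mono col A) auto
        finally show "(\<Sum>n\<in>A. (of_int n)\<^sup>2 * (cmod (q l) * \<bar>\<tau> (n - l) - \<tau> n\<bar>)) \<le> (wt 2 l * cmod (q l)) * (2 / w + 3 * w / of_int M)"
          by (simp only: mult_ac)
      qed
      also have "\<dots> = S * (2 / w) + S * (3 * w / of_int M)" unfolding infsum_cmult_left' S_def wnorm_def by (rule distrib_left)
      also have "\<dots> \<le> 2 * e / 3" using Sw SM by linarith
      finally show ?thesis .
    qed
    finally show ?thesis by simp
  qed
  show ?thesis
  proof (intro exI[of _ a] exI[of _ I] conjI ballI allI impI)
    show "n > N0" if "n \<in> I" for n using that M by (auto simp: I_def)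
    show "a n = 0" if "n \<notin> I" for n using that by (simp add: a_def \<tau>_def t_def)
  qed (use I one total in auto)
qed

section \<open>Reflection, and splitting off the modes 1 and -1\<close>

lift_definition reflect :: "ell2 \<Rightarrow> ell2" is "\<lambda>x n. x (- n)"
proof -
  fix f :: "int \<Rightarrow> complex"
  assume "(\<lambda>n. (cmod (f n))\<^sup>2) summable_on UNIV"
  from summable_on_int_shift(1)[OF this, of 0] show "(\<lambda>n. (cmod (f (- n)))\<^sup>2) summable_on UNIV" by simp
qed

lift_definition tail :: "ell2 \<Rightarrow> ell2" is "\<lambda>x n. if \<bar>n\<bar> \<ge> 2 then x n else 0"
proof -
  fix f :: "int \<Rightarrow> complex"
  assume "(\<lambda>n. (cmod (f n))\<^sup>2) summable_on UNIV"
  then show "(\<lambda>n. (cmod (if \<bar>n\<bar> \<ge> 2 then f n else 0))\<^sup>2) summable_on UNIV"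
    by (rule summable_on_comparison_test) auto
qed

lemma coef_reflect [simp]: "coef (reflect x) n = coef x (- n)" by (simp add: reflect.rep_eq)

lemma coef_tail [simp]: "coef (tail x) n = (if \<bar>n\<bar> \<ge> 2 then coef x n else 0)" by (simp add: tail.rep_eq)

lemma cinner_diff_left: "cinner (x - y) z = cinner x z - cinner y z"
  using cinner_add_left[of "x - y" y z] by simp

lemma cinner_diff_right: "cinner x (y - z) = cinner x y - cinner x z"
  using cinner_add_right[of x "y - z" z] by simp

lemma cinner_unit_left: "cinner (unit k) x = cnj (coef x k)"
proof -
  have "((\<lambda>n. coef (unit k) n * cnj (coef x n)) has_sum (cnj (coef x k))) UNIV"
    by (rule has_sum_finite_neutralI[of "{k}"]) auto
  then show ?thesis unfolding cinner_def by (rule infsumI)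
qed

lemma cinner_unit_right: "cinner x (unit k) = coef x k"
  using cinner_commute[of "unit k" x] cinner_unit_left[of k x] by (metis complex_cnj_cnj)

lemma cinner_tail_left: "cinner (tail x) y = cinner (tail x) (tail y)"
  unfolding cinner_def by (rule infsum_cong) simp

lemma norm_split: "coef x 0 = 0 \<Longrightarrow> (norm x)\<^sup>2 = (cmod (coef x 1))\<^sup>2 + (cmod (coef x (-1)))\<^sup>2 + (norm (tail x))\<^sup>2"
proof -
  assume x0: "coef x 0 = 0"
  have "(\<lambda>n. (cmod (coef x n))\<^sup>2) = (\<lambda>n. (if n = 1 \<or> n = -1 then (cmod (coef x n))\<^sup>2 else 0) + (cmod (coef (tail x) n))\<^sup>2)"
  proof
    fix n :: int
    consider "n = 0" | "n = 1" | "n = -1" | "\<bar>n\<bar> \<ge> 2" by fastforce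
    then show "(cmod (coef x n))\<^sup>2 = (if n = 1 \<or> n = -1 then (cmod (coef x n))\<^sup>2 else 0) + (cmod (coef (tail x) n))\<^sup>2"
      by cases (auto simp: x0)
  qed
  moreover have "((\<lambda>n. if n = 1 \<or> n = -1 then (cmod (coef x n))\<^sup>2 else 0) has_sum ((cmod (coef x 1))\<^sup>2 + (cmod (coef x (-1)))\<^sup>2)) UNIV"
    by (rule has_sum_finite_neutralI[of "{1, -1}"]) auto
  ultimately have "((\<lambda>n. (cmod (coef x n))\<^sup>2) has_sum ((cmod (coef x 1))\<^sup>2 + (cmod (coef x (-1)))\<^sup>2 + (norm (tail x))\<^sup>2)) UNIV"
    using has_sum_add[OF _ has_sum_infsum[OF summable_coef_sq[of "tail x"]]] by (simp add: norm_ell2_sq)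
  then show ?thesis unfolding norm_ell2_sq by (simp add: infsumI)
qed

section \<open>Stability\<close>

text \<open>\<open>\<rho>2\<close> stands for \<rho>^2. Row 0 of the operator is treated apart;
  \<open>d 0 = 1\<close> is a positive filler, so that only the modes 1 and -1 spoil the positivity
  of \<open>d\<close> on the whole of \<open>ell2\<close>.\<close>

locale definite_symbol =
  fixes d :: "int \<Rightarrow> real" and q :: "int \<Rightarrow> complex" and \<delta> \<rho>2 Bd :: real
  assumes \<delta>: "0 < \<delta>" "\<delta> \<le> 1" and d: "\<And>n. \<bar>n\<bar> \<ge> 2 \<Longrightarrow> d n \<ge> \<delta>" and d_bound: "\<And>n. \<bar>d n\<bar> \<le> Bd"
    and d_even: "\<And>n. d (- n) = d n" and d1: "d 1 = - \<rho>2" and d0: "d 0 = 1"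
    and \<rho>2: "0 < \<rho>2" "\<rho>2 \<le> 1"
    and q: "wfinite 2 q" and q_even: "\<And>n. q (- n) = q n" and q_real: "\<And>n. cnj (q n) = q n"
begin

definition "\<kappa> = wnorm 2 q"

lemma \<kappa>_nonneg: "\<kappa> \<ge> 0" unfolding \<kappa>_def by (rule wnorm_nonneg)

text \<open>By \<open>1 / 0 = 0\<close> the matrix \<open>A\<close> vanishes on mode 0, and
  \<open>Qk\<close> drops all couplings with mode 0, so that this mode splits off.\<close>

definition "A = kop (\<lambda>n m. if n = m then 1 / of_int n else 0)"
definition "D = kop (\<lambda>n m. if n = m then of_real (d n) else 0)"
definition "Qk n m = (if n \<noteq> 0 \<and> m \<noteq> 0 then q (n - m) else 0)"
definition "Q = kop Qk"

lemma A_bound: "cmod (1 / of_int n) \<le> 1"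
proof (cases "n = 0")
  case False
  then have "1 \<le> \<bar>of_int n :: real\<bar>" by (simp add: Ints_nonzero_abs_ge1)
  then show ?thesis by (simp add: norm_divide)
qed simp

lemma D_bound: "cmod (of_real (d n)) \<le> Bd" using d_bound[of n] by simp

lemmas A_dom = dominated_diag(1)[where g = "\<lambda>n. 1 / of_int n", OF A_bound]
lemmas D_dom = dominated_diag(1)[where g = "\<lambda>n. of_real (d n)", OF D_bound]

lemma Q_dom: "dominated Qk (\<lambda>l. wt 2 l * cmod (q l))"
proof -
  have "cmod (Qk n m) \<le> wt 2 (n - m) * cmod (q (n - m))" for n m
    using mult_right_mono[OF wt_ge_1[of 2 "n - m"], of "cmod (q (n - m))"] by (simp add: Qk_def)
  then show ?thesis using q by (simp add: dominated_def wfinite_def)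
qed

lemma coef_A [simp]: "coef (A x) n = coef x n / of_int n"
  unfolding A_def dominated_diag(3)[where g = "\<lambda>n. 1 / of_int n", OF A_bound] by simp

lemma coef_D [simp]: "coef (D x) n = of_real (d n) * coef x n"
  unfolding D_def dominated_diag(3)[where g = "\<lambda>n. of_real (d n)", OF D_bound] by simp

lemma Q_norm: "norm (Q x) \<le> \<kappa> * norm x"
  unfolding Q_def \<kappa>_def wnorm_def by (rule norm_kop[OF Q_dom])

lemma coef_Q0 [simp]: "coef (Q x) 0 = 0"
  unfolding Q_def coef_kop[OF Q_dom] by (simp add: Qk_def)

lemma coef_Q: "coef x 0 = 0 \<Longrightarrow> n \<noteq> 0 \<Longrightarrow> coef (Q x) n = conv q (coef x) n"
  unfolding Q_def coef_kop[OF Q_dom] conv_def Qk_def by (rule infsum_cong) auto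

lemma A_norm: "norm (A x) \<le> norm x"
  using norm_kop[OF A_dom, of x] unfolding dominated_diag(2)[where g = "\<lambda>n. 1 / of_int n", OF A_bound] by (simp add: A_def)

sublocale A: bounded_linear A unfolding A_def by (rule kop_bounded_linear[OF A_dom])
sublocale D: bounded_linear D unfolding D_def by (rule kop_bounded_linear[OF D_dom])
sublocale Q: bounded_linear Q unfolding Q_def by (rule kop_bounded_linear[OF Q_dom])

definition "L x = D x - Q x"

sublocale L: bounded_linear L unfolding L_def[abs_def]
  by (intro bounded_linear_sub D.bounded_linear_axioms Q.bounded_linear_axioms)

lemma A_cmul: "A (cmul c x) = cmul c (A x)" unfolding A_def by (rule kop_cmul[OF A_dom])

lemma L_cmul: "L (cmul c x) = cmul c (L x)"
proof -
  have "D (cmul c x) = cmul c (D x)" unfolding D_def by (rule kop_cmul[OF D_dom])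
  moreover have "Q (cmul c x) = cmul c (Q x)" unfolding Q_def by (rule kop_cmul[OF Q_dom])
  ultimately show ?thesis by (intro ell2_eqI) (simp add: L_def right_diff_distrib)
qed

lemma A_sym: "cinner (A x) y = cinner x (A y)"
  unfolding A_def by (rule kop_adjoint[OF A_dom]) auto

lemma L_sym: "cinner (L x) y = cinner x (L y)"
proof -
  have "cinner (D x) y = cinner x (D y)" unfolding D_def by (rule kop_adjoint[OF D_dom]) auto
  moreover have "cinner (Q x) y = cinner x (Q y)"
    unfolding Q_def by (rule kop_adjoint[OF Q_dom]) (use q_even[of "n - m" for n m] in \<open>auto simp: Qk_def q_real\<close>)
  ultimately show ?thesis by (simp add: L_def cinner_diff_left cinner_diff_right)
qed

text \<open>\<open>A\<close> reverses parity while \<open>L\<close> preserves it; hence the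
  eigenvalue equation couples the even and the odd part of a solution only through
  \<open>A\<close>.\<close>

lemma A_reflect: "A (reflect x) = - reflect (A x)" by (rule ell2_eqI) simp

lemma L_reflect: "L (reflect x) = reflect (L x)"
proof (rule ell2_eqI)
  fix n
  have "coef (Q (reflect x)) n = (\<Sum>\<^sub>\<infinity>m. Qk (- n) (- m) * coef x (- m))"
    unfolding Q_def coef_kop[OF Q_dom]
  proof (rule infsum_cong)
    fix m
    have "q (- n - - m) = q (n - m)" using q_even[of "n - m"] by simp
    then show "Qk n m * coef (reflect x) m = Qk (- n) (- m) * coef x (- m)" by (simp add: Qk_def)
  qed
  also have "\<dots> = coef (Q x) (- n)"
    unfolding Q_def coef_kop[OF Q_dom] using infsum_int_shift(1)[of "\<lambda>m. Qk (- n) m * coef x m" 0] by simp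
  finally show "coef (L (reflect x)) n = coef (reflect (L x)) n" by (simp add: L_def d_even)
qed

lemma real_form:
  assumes "\<And>x y. cinner (f x) y = cinner x (f y)"
  shows "Im (cinner (f x) x) = 0"
proof -
  have "cinner (f x) x = cnj (cinner (f x) x)" using assms[of x x] cinner_commute[of x "f x"] by simp
  then show ?thesis by (simp add: complex_eq_iff)
qed

lemma D_form: "Re (cinner (D x) x) \<ge> \<delta> * (norm (tail x))\<^sup>2 - \<rho>2 * ((cmod (coef x 1))\<^sup>2 + (cmod (coef x (-1)))\<^sup>2)"
proof -
  let ?f = "\<lambda>n. d n * (cmod (coef x n))\<^sup>2"
  have "(\<lambda>n. of_real (d n) * coef x n * cnj (coef x n)) = (\<lambda>n. of_real (?f n))"
    by (simp only: of_real_mult complex_norm_square mult.assoc)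
  then have "cinner (D x) x = (\<Sum>\<^sub>\<infinity>n. of_real (?f n))" "(\<lambda>n. of_real (?f n) :: complex) summable_on UNIV"
    using cinner_summable[of "D x" x] unfolding cinner_def by simp_all
  then have *: "Re (cinner (D x) x) = (\<Sum>\<^sub>\<infinity>n. ?f n)" "?f summable_on UNIV"
    using infsum_Re[of "\<lambda>n. of_real (?f n)" UNIV] summable_on_Re[of "\<lambda>n. of_real (?f n)" UNIV] by simp_all
  let ?g = "\<lambda>n. \<delta> * (cmod (coef (tail x) n))\<^sup>2 + (if n = 1 \<or> n = -1 then - \<rho>2 * (cmod (coef x n))\<^sup>2 else 0)"
  have g: "(?g has_sum (\<delta> * (norm (tail x))\<^sup>2 + (- \<rho>2 * (cmod (coef x 1))\<^sup>2 + - \<rho>2 * (cmod (coef x (-1)))\<^sup>2))) UNIV"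
    unfolding norm_ell2_sq
    by (intro has_sum_add has_sum_cmult_right has_sum_infsum summable_coef_sq, rule has_sum_finite_neutralI[of "{1, -1}"]) auto
  have "(\<Sum>\<^sub>\<infinity>n. ?g n) \<le> (\<Sum>\<^sub>\<infinity>n. ?f n)"
  proof (rule infsum_mono)
    show "?g summable_on UNIV" using g by (auto simp: has_sum_iff)
    fix n :: int
    have dm: "d (-1) = - \<rho>2" using d_even[of 1] d1 by simp
    consider "n = 0" | "n = 1" | "n = -1" | "\<bar>n\<bar> \<ge> 2" by fastforce
    then show "?g n \<le> ?f n"
    proof cases
      case 4
      then have "n \<noteq> 1" "n \<noteq> -1" by auto
      then show ?thesis using 4 d[OF 4] by (simp add: mult_right_mono)
    qed (auto simp: d0 d1 dm)
  qed (rule *)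
  then show ?thesis unfolding *(1) infsumI[OF g] by (simp add: algebra_simps)
qed

lemma Q_form: "\<bar>Re (cinner (Q x) y)\<bar> \<le> \<kappa> * norm x * norm y"
proof -
  have "\<bar>Re (cinner (Q x) y)\<bar> \<le> norm (Q x) * norm y" using abs_Re_le_cmod cmod_cinner_le order_trans by blast
  also have "\<dots> \<le> \<kappa> * norm x * norm y" by (intro mult_right_mono Q_norm) auto
  finally show ?thesis .
qed

text \<open>Conjugation with the slowly varying weight \<open>1 + \<tau> n\<^sup>2\<close> perturbs the operator by a term of order
  \<open>sqrt \<tau>\<close>; this turns coercivity in \<open>\<ell>\<^sup>2\<close> into solvability in the Sobolev space of order two.\<close>

definition "sw \<tau> n = 1 + \<tau> * (of_int n)\<^sup>2" for \<tau> :: real and n :: int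

lemma sw_ge_1: "\<tau> \<ge> 0 \<Longrightarrow> sw \<tau> n \<ge> 1" by (simp add: sw_def)

text \<open>In the difference of the two weights the cross term \<open>2 * t\<^sup>2 * l * x\<close>
  is absorbed by \<open>2 * (t * \<bar>x\<bar>) \<le> 1 + t\<^sup>2 * x\<^sup>2\<close>, which
  leaves one factor t. The dependence on l is at most quadratic, and \<open>wt 2\<close> covers
  it.\<close>

lemma sw_ratio:
  assumes "0 < t" "t \<le> 1"
  shows "\<bar>sw (t\<^sup>2) n / sw (t\<^sup>2) m - 1\<bar> \<le> 2 * t * wt 2 (n - m)"
proof -
  define l :: real where "l = of_int (n - m)"
  define x :: real where "x = of_int m"
  have m1: "sw (t\<^sup>2) m \<ge> 1" by (rule sw_ge_1) simp
  have "sw (t\<^sup>2) n - sw (t\<^sup>2) m = t\<^sup>2 * (l\<^sup>2 + 2 * l * x)"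
    by (simp add: sw_def l_def x_def power2_eq_square algebra_simps)
  then have "\<bar>sw (t\<^sup>2) n - sw (t\<^sup>2) m\<bar> = t\<^sup>2 * \<bar>l\<^sup>2 + 2 * l * x\<bar>" by (simp add: abs_mult)
  also have "\<dots> \<le> t\<^sup>2 * (l\<^sup>2 + 2 * \<bar>l\<bar> * \<bar>x\<bar>)"
    using abs_triangle_ineq[of "l\<^sup>2" "2 * l * x"] by (intro mult_left_mono) (auto simp: abs_mult)
  also have "\<dots> = t\<^sup>2 * l\<^sup>2 + t * \<bar>l\<bar> * (2 * (t * \<bar>x\<bar>))" by (simp add: power2_eq_square algebra_simps)
  also have "\<dots> \<le> t * (l\<^sup>2 * sw (t\<^sup>2) m) + t * \<bar>l\<bar> * sw (t\<^sup>2) m"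
  proof (intro add_mono mult_left_mono)
    have "t\<^sup>2 \<le> t" using assms by (simp add: power2_eq_square mult_left_le)
    then have "t\<^sup>2 * (l\<^sup>2 * 1) \<le> t * (l\<^sup>2 * sw (t\<^sup>2) m)" using m1 assms by (intro mult_mono) auto
    then show "t\<^sup>2 * l\<^sup>2 \<le> t * (l\<^sup>2 * sw (t\<^sup>2) m)" by simp
    show "2 * (t * \<bar>x\<bar>) \<le> sw (t\<^sup>2) m"
      using zero_le_power2[of "t * \<bar>x\<bar> - 1"] by (simp add: sw_def x_def power2_diff power_mult_distrib)
  qed (use assms in auto)
  also have "\<dots> = t * (l\<^sup>2 + \<bar>l\<bar>) * sw (t\<^sup>2) m" by (simp add: algebra_simps)
  also have "\<dots> \<le> t * (2 * wt 2 (n - m)) * sw (t\<^sup>2) m"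
    using assms m1 zero_le_power2[of l] by (intro mult_right_mono mult_left_mono) (auto simp: wt_def l_def power2_sum)
  finally have "\<bar>sw (t\<^sup>2) n - sw (t\<^sup>2) m\<bar> \<le> 2 * t * wt 2 (n - m) * sw (t\<^sup>2) m" by (simp add: mult_ac)
  moreover have "sw (t\<^sup>2) n / sw (t\<^sup>2) m - 1 = (sw (t\<^sup>2) n - sw (t\<^sup>2) m) / sw (t\<^sup>2) m" using m1 by (simp add: diff_divide_distrib)
  ultimately show ?thesis using m1 by (simp add: abs_divide pos_divide_le_eq)
qed

text \<open>With W the multiplication by \<open>sw (t\<^sup>2)\<close>, this is the kernel of
  \<open>W Q W\<^sup>-\<^sup>1 - Q\<close>.\<close>

definition "Rk t n m = of_real (sw (t\<^sup>2) n / sw (t\<^sup>2) m - 1) * Qk n m"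

lemma R_dom:
  assumes "0 < t" "t \<le> 1"
  shows "dominated (Rk t) (\<lambda>l. 2 * t * (wt 2 l * cmod (q l)))"
proof -
  have "cmod (Rk t n m) \<le> 2 * t * (wt 2 (n - m) * cmod (q (n - m)))" for n m
  proof -
    have "cmod (Rk t n m) \<le> 2 * t * wt 2 (n - m) * cmod (q (n - m))"
      unfolding Rk_def norm_mult norm_of_real using assms
      by (intro mult_mono sw_ratio) (auto simp: Qk_def)
    then show ?thesis by (simp add: mult_ac)
  qed
  then show ?thesis using q by (simp add: dominated_def wfinite_def summable_on_cmult_right)
qed

lemma R_norm: "0 < t \<Longrightarrow> t \<le> 1 \<Longrightarrow> norm (kop (Rk t) x) \<le> 2 * t * \<kappa> * norm x"
  using norm_kop[OF R_dom, of t x] unfolding \<kappa>_def wnorm_def infsum_cmult_right' by simp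

text \<open>The conjugate \<open>W (\<i> \<mu> A + L) W\<^sup>-\<^sup>1\<close>, as
  \<open>coef_B\<close> makes precise; the diagonal matrices \<open>A\<close> and \<open>D\<close>
  commute with W, so only \<open>Q\<close> is corrected.\<close>

definition "B t \<mu> x = cmul (\<i> * \<mu>) (A x) + L x - kop (Rk t) x"

lemma cmul_bounded_linear: "bounded_linear (cmul c)"
proof (rule bounded_linear_intro)
  show "cmul c (x + y) = cmul c x + cmul c y" for x y by (rule ell2_eqI) (simp add: distrib_left)
  show "cmul c (r *\<^sub>R x) = r *\<^sub>R cmul c x" for r x by (rule ell2_eqI) simp
  show "norm (cmul c x) \<le> norm x * cmod c" for x by simp
qed

lemma B_bounded_linear: "0 < t \<Longrightarrow> t \<le> 1 \<Longrightarrow> bounded_linear (B t \<mu>)"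
  unfolding B_def[abs_def]
  by (intro bounded_linear_sub bounded_linear_add bounded_linear_compose[OF cmul_bounded_linear] A.bounded_linear_axioms
      L.bounded_linear_axioms kop_bounded_linear[OF R_dom])

text \<open>After adding a multiple of the projection \<open>J \<circ> P\<close> to the modes \<open>n = 1, -1\<close> the operator \<open>L\<close> is
  positive definite, and multiplication by \<open>1 - \<i> Im \<mu> / Re \<mu>\<close> makes the contribution of \<open>A\<close> skew.\<close>

definition "P x = (coef x 1, coef x (-1))"
definition "J p = cmul (2 * fst p) (unit 1) + cmul (2 * snd p) (unit (-1))"

lemma P_bounded_linear: "bounded_linear P"
proof (rule bounded_linear_intro)
  show "norm (P x) \<le> norm x * 2" for x
    using norm_Pair_le[of "coef x 1" "coef x (-1)"] norm_coef_le[of x 1] norm_coef_le[of x "-1"] by (simp add: P_def)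
qed (simp_all add: P_def)

lemma J_bounded_linear: "bounded_linear J"
proof (rule bounded_linear_intro)
  show "J (p + p') = J p + J p'" for p p' by (rule ell2_eqI) (simp add: J_def algebra_simps)
  show "J (r *\<^sub>R p) = r *\<^sub>R J p" for r p by (rule ell2_eqI) (simp add: J_def scaleR_add_right)
  show "norm (J p) \<le> norm p * 4" for p
    using norm_triangle_ineq[of "cmul (2 * fst p) (unit 1)" "cmul (2 * snd p) (unit (-1))"] norm_fst_le[of "fst p" "snd p"] norm_snd_le[of "snd p" "fst p"]
    by (simp add: J_def norm_mult)
qed

text \<open>The factor 2 in \<open>J\<close> exceeds \<open>\<rho>2\<close> by at least 1, and
  \<open>\<delta>\<close> is at most 1, so \<open>D + J \<circ> P\<close> is bounded below by
  \<open>\<delta>\<close>; \<open>Q\<close> takes away at most \<open>\<delta> / 2\<close> and the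
  correction by \<open>Rk\<close> at most \<open>\<delta> / 4\<close>.\<close>

lemma B_coercive:
  assumes t: "0 < t" "t \<le> 1" and \<mu>: "Re \<mu> > 0" and \<kappa>: "\<kappa> \<le> \<delta> / 2"
    and ts: "cmod (1 - \<i> * of_real (Im \<mu> / Re \<mu>)) * (2 * t * \<kappa>) \<le> \<delta> / 4"
  shows "\<delta> / 4 * (norm x)\<^sup>2 \<le> inner (cmul (1 - \<i> * of_real (Im \<mu> / Re \<mu>)) (B t \<mu> x + J (P x))) x"
proof -
  define \<zeta> where "\<zeta> = 1 - \<i> * of_real (Im \<mu> / Re \<mu>)"
  have \<zeta>\<mu>: "Re (\<zeta> * (\<i> * \<mu>)) = 0" using \<mu> by (simp add: \<zeta>_def field_simps)
  have a: "Re (\<zeta> * (\<i> * \<mu>) * cinner (A x) x) = 0"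
    using real_form[of A x, OF A_sym] \<zeta>\<mu> by simp
  have JP: "cinner (J (P x)) x = of_real (2 * ((cmod (coef x 1))\<^sup>2 + (cmod (coef x (-1)))\<^sup>2))"
    by (simp only: J_def P_def fst_conv snd_conv cinner_add_left cinner_cmul_left cinner_unit_left of_real_mult of_real_add complex_norm_square)
      (simp add: algebra_simps)
  have l: "Re (\<zeta> * (cinner (L x) x + cinner (J (P x)) x)) = Re (cinner (L x) x) + 2 * ((cmod (coef x 1))\<^sup>2 + (cmod (coef x (-1)))\<^sup>2)"
    using real_form[of L x, OF L_sym] unfolding JP by (simp add: \<zeta>_def)
  have r: "Re (\<zeta> * cinner (kop (Rk t) x) x) \<le> \<delta> / 4 * (norm x)\<^sup>2"
  proof -
    have "Re (\<zeta> * cinner (kop (Rk t) x) x) \<le> cmod \<zeta> * (norm (kop (Rk t) x) * norm x)"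
      using complex_Re_le_cmod[of "\<zeta> * cinner (kop (Rk t) x) x"] mult_left_mono[OF cmod_cinner_le[of "kop (Rk t) x" x], of "cmod \<zeta>"]
      by (simp add: norm_mult)
    also have "\<dots> \<le> cmod \<zeta> * (2 * t * \<kappa> * norm x * norm x)" by (intro mult_left_mono mult_right_mono R_norm t) auto
    also have "\<dots> = (cmod \<zeta> * (2 * t * \<kappa>)) * (norm x)\<^sup>2" by (simp add: power2_eq_square)
    also have "\<dots> \<le> \<delta> / 4 * (norm x)\<^sup>2" using ts by (intro mult_right_mono) (auto simp: \<zeta>_def)
    finally show ?thesis .
  qed
  have low: "Re (cinner (L x) x) + 2 * ((cmod (coef x 1))\<^sup>2 + (cmod (coef x (-1)))\<^sup>2) \<ge> \<delta> / 2 * (norm x)\<^sup>2"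
  proof -
    \<comment> \<open>Mode 0 is removed because \<open>norm_split\<close> assumes that it vanishes;
      it is put back with \<open>d 0 = 1\<close>.\<close>
    define x' where "x' = x - cmul (coef x 0) (unit 0)"
    have x'0: "coef x' 0 = 0" and x't: "tail x' = tail x" and x'1: "coef x' 1 = coef x 1" "coef x' (-1) = coef x (-1)"
      by (auto simp: x'_def intro!: ell2_eqI)
    have D0: "Re (cinner (D x) x) = Re (cinner (D x') x') + (cmod (coef x 0))\<^sup>2"
    proof -
      have x: "x = x' + cmul (coef x 0) (unit 0)" by (simp add: x'_def)
      have Du: "D (cmul (coef x 0) (unit 0)) = cmul (coef x 0) (unit 0)" by (rule ell2_eqI) (simp add: d0)
      have "cinner (D x) x = cinner (D x' + cmul (coef x 0) (unit 0)) (x' + cmul (coef x 0) (unit 0))"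
        using x D.add[of x' "cmul (coef x 0) (unit 0)"] Du by metis
      also have "\<dots> = cinner (D x') x' + of_real ((cmod (coef x 0))\<^sup>2)"
        by (simp add: cinner_add_left cinner_add_right cinner_cmul_left cinner_cmul_right cinner_unit_left cinner_unit_right x'0 complex_norm_square del: of_real_power)
      finally show ?thesis by simp
    qed
    have n: "(norm x)\<^sup>2 = (norm x')\<^sup>2 + (cmod (coef x 0))\<^sup>2"
    proof -
      have "cinner x x = cinner x' x' + of_real ((cmod (coef x 0))\<^sup>2)"
      proof -
        have x: "x = x' + cmul (coef x 0) (unit 0)" by (simp add: x'_def)
        have "cinner x x = cinner (x' + cmul (coef x 0) (unit 0)) (x' + cmul (coef x 0) (unit 0))" using x by simp
        also have "\<dots> = cinner x' x' + of_real ((cmod (coef x 0))\<^sup>2)"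
          by (simp add: cinner_add_left cinner_add_right cinner_cmul_left cinner_cmul_right cinner_unit_left cinner_unit_right x'0 complex_norm_square del: of_real_power)
        finally show ?thesis .
      qed
      then show ?thesis by (simp add: power2_norm_eq_inner inner_ell2_def)
    qed
    let ?v = "(cmod (coef x 1))\<^sup>2 + (cmod (coef x (-1)))\<^sup>2"
    have nx': "(norm x')\<^sup>2 = ?v + (norm (tail x))\<^sup>2" using norm_split[OF x'0] by (simp add: x't x'1)
    have "Re (cinner (D x') x') \<ge> \<delta> * (norm (tail x))\<^sup>2 - \<rho>2 * ?v" using D_form[of x'] by (simp add: x't x'1)
    moreover have "\<rho>2 * ?v \<le> 1 * ?v" by (intro mult_right_mono \<rho>2) auto
    moreover have "\<delta> * ?v \<le> 1 * ?v" using \<delta> by (intro mult_right_mono) auto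
    moreover have "\<delta> * (cmod (coef x 0))\<^sup>2 \<le> 1 * (cmod (coef x 0))\<^sup>2" using \<delta> by (intro mult_right_mono) auto
    moreover have "Re (cinner (L x) x) = Re (cinner (D x) x) - Re (cinner (Q x) x)" by (simp add: L_def cinner_diff_left)
    moreover have "Re (cinner (Q x) x) \<le> \<delta> / 2 * (norm x)\<^sup>2"
      using Q_form[of x x] mult_right_mono[OF \<kappa>, of "norm x * norm x"] by (simp add: power2_eq_square mult.assoc)
    moreover have "\<delta> * (norm x)\<^sup>2 = \<delta> * ?v + \<delta> * (norm (tail x))\<^sup>2 + \<delta> * (cmod (coef x 0))\<^sup>2"
      unfolding n nx' by (simp add: algebra_simps)
    ultimately show ?thesis using D0 by linarith
  qed
  have "inner (cmul \<zeta> (B t \<mu> x + J (P x))) x = Re (\<zeta> * (\<i> * \<mu>) * cinner (A x) x) + Re (\<zeta> * (cinner (L x) x + cinner (J (P x)) x)) - Re (\<zeta> * cinner (kop (Rk t) x) x)"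
    unfolding inner_ell2_def cinner_cmul_left B_def cinner_add_left cinner_diff_left by (simp add: algebra_simps)
  then show ?thesis using a l r low unfolding \<zeta>_def[symmetric] by linarith
qed

definition "unweight t x = Abs_ell2 (\<lambda>n. coef x n / of_real (sw (t\<^sup>2) n))"

lemma coef_unweight [simp]: "coef (unweight t x) n = coef x n / of_real (sw (t\<^sup>2) n)"
proof -
  have "cmod (coef x n / of_real (sw (t\<^sup>2) n)) \<le> cmod (coef x n)" for n
    using sw_ge_1[of "t\<^sup>2" n] by (simp add: norm_divide divide_le_eq mult_le_cancel_left1)
  then have "(\<lambda>n. (cmod (coef x n / of_real (sw (t\<^sup>2) n)))\<^sup>2) summable_on UNIV"
    by (intro summable_on_comparison_test[OF summable_coef_sq[of x]]) (auto intro: power_mono)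
  from coef_Abs[OF this] show ?thesis unfolding unweight_def by (rule fun_cong)
qed

lemma coef_B:
  assumes "0 < t" "t \<le> 1"
  shows "coef (B t \<mu> x) n = of_real (sw (t\<^sup>2) n) * coef (cmul (\<i> * \<mu>) (A (unweight t x)) + L (unweight t x)) n"
proof -
  let ?X = "unweight t x"
  have sw0: "sw (t\<^sup>2) m \<noteq> 0" for m using sw_ge_1[of "t\<^sup>2" m] by auto
  have "coef (Q x) n + coef (kop (Rk t) x) n = (\<Sum>\<^sub>\<infinity>m. Qk n m * coef x m + Rk t n m * coef x m)"
    unfolding Q_def coef_kop[OF Q_dom] coef_kop[OF R_dom[OF assms]]
    by (rule infsum_add[symmetric]) (rule dominated_summable'[OF Q_dom], rule dominated_summable'[OF R_dom[OF assms]])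
  also have "\<dots> = (\<Sum>\<^sub>\<infinity>m. of_real (sw (t\<^sup>2) n) * (Qk n m * coef ?X m))"
    by (rule infsum_cong) (simp add: Rk_def algebra_simps)
  also have "\<dots> = of_real (sw (t\<^sup>2) n) * coef (Q ?X) n"
    unfolding infsum_cmult_right' Q_def coef_kop[OF Q_dom] ..
  finally have Qx: "coef (Q x) n + coef (kop (Rk t) x) n = of_real (sw (t\<^sup>2) n) * coef (Q ?X) n" .
  have "coef (B t \<mu> x) n = \<i> * \<mu> * (coef x n / of_int n) + of_real (d n) * coef x n - (coef (Q x) n + coef (kop (Rk t) x) n)"
    by (simp add: B_def L_def)
  also have "\<dots> = of_real (sw (t\<^sup>2) n) * coef (cmul (\<i> * \<mu>) (A ?X) + L ?X) n"
    unfolding Qx using sw0[of n] by (simp add: L_def algebra_simps)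
  finally show ?thesis .
qed

text \<open>\<open>B t \<mu> + J \<circ> P\<close> is invertible by coercivity, and
  \<open>J \<circ> P\<close> has finite rank, so injectivity is all that is missing. It is passed
  from the unweighted operator to \<open>B t \<mu>\<close> by \<open>unweight\<close>, which divides
  by a weight without zeros.\<close>

lemma solvable:
  assumes \<mu>: "Re \<mu> > 0" and \<kappa>: "\<kappa> \<le> \<delta> / 2" and inj: "\<And>x. cmul (\<i> * \<mu>) (A x) + L x = 0 \<Longrightarrow> x = 0"
  shows "\<exists>t>0. t \<le> 1 \<and> (\<forall>f. \<exists>x. B t \<mu> x = f) \<and> (\<exists>C. \<forall>x. norm x \<le> C * norm (B t \<mu> x))"
proof -
  define \<zeta> where "\<zeta> = 1 - \<i> * of_real (Im \<mu> / Re \<mu>)"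
  have \<zeta>0: "\<zeta> \<noteq> 0" by (simp add: \<zeta>_def complex_eq_iff)
  \<comment> \<open>The size of t depends on \<mu> through \<open>\<zeta>\<close>; the summand 1
    keeps the denominator positive if \<open>\<kappa> = 0\<close>.\<close>
  define t where "t = min 1 (\<delta> / (8 * (cmod \<zeta> * \<kappa> + 1)))"
  have den: "8 * (cmod \<zeta> * \<kappa> + 1) > 0" using \<kappa>_nonneg by (simp add: add_nonneg_pos)
  have t: "0 < t" "t \<le> 1" using \<delta> den by (auto simp: t_def)
  have ts: "cmod \<zeta> * (2 * t * \<kappa>) \<le> \<delta> / 4"
  proof -
    have "t * (8 * (cmod \<zeta> * \<kappa> + 1)) \<le> \<delta>"
      using den by (simp add: t_def min_def pos_le_divide_eq)
    then show ?thesis using t by (simp add: algebra_simps)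
  qed
  have bl: "bounded_linear (\<lambda>x. B t \<mu> x + J (P x))"
    by (intro bounded_linear_add B_bounded_linear t bounded_linear_compose[OF J_bounded_linear P_bounded_linear])
  have blz: "bounded_linear (\<lambda>x. cmul \<zeta> (B t \<mu> x + J (P x)))"
    by (rule bounded_linear_compose[OF cmul_bounded_linear bl])
  have co: "\<delta> / 4 * (norm x)\<^sup>2 \<le> inner (cmul \<zeta> (B t \<mu> x + J (P x))) x" for x
    unfolding \<zeta>_def by (rule B_coercive[OF t \<mu> \<kappa>]) (use ts in \<open>simp add: \<zeta>_def\<close>)
  have \<delta>4: "\<delta> / 4 > 0" using \<delta> by simp
  have surj: "\<exists>x. B t \<mu> x + J (P x) = f" for f
  proof -
    obtain x where x: "cmul \<zeta> (B t \<mu> x + J (P x)) = cmul \<zeta> f" using lax_milgram(1)[OF blz \<delta>4 co] by blast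
    have "B t \<mu> x + J (P x) = f"
    proof (rule ell2_eqI)
      fix n
      have "coef (cmul \<zeta> (B t \<mu> x + J (P x))) n = coef (cmul \<zeta> f) n" using x by simp
      then show "coef (B t \<mu> x + J (P x)) n = coef f n" using \<zeta>0 by simp
    qed
    then show ?thesis ..
  qed
  have bound: "\<delta> / (4 * cmod \<zeta>) * norm x \<le> norm (B t \<mu> x + J (P x))" for x
  proof -
    have "\<delta> / 4 * norm x \<le> cmod \<zeta> * norm (B t \<mu> x + J (P x))" using lax_milgram(2)[OF blz \<delta>4 co, of x] by simp
    then show ?thesis using \<zeta>0 by (simp add: field_simps)
  qed
  have injB: "x = 0" if "B t \<mu> x + J (P x) = J (P x)" for x
  proof -
    have sw0: "sw (t\<^sup>2) n \<noteq> 0" for n using sw_ge_1[of "t\<^sup>2" n] by auto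
    have B0: "B t \<mu> x = 0" using that by simp
    have "cmul (\<i> * \<mu>) (A (unweight t x)) + L (unweight t x) = 0"
    proof (rule ell2_eqI)
      fix n
      show "coef (cmul (\<i> * \<mu>) (A (unweight t x)) + L (unweight t x)) n = coef 0 n"
        using coef_B[OF t, of \<mu> x n] sw0[of n] unfolding B0 by simp
    qed
    then have "unweight t x = 0" by (rule inj)
    then have u0: "coef (unweight t x) n = 0" for n by simp
    have "coef x n = 0" for n using u0[of n] sw0[of n] unfolding coef_unweight by simp
    then show ?thesis by (intro ell2_eqI) simp
  qed
  have pos: "\<delta> / (4 * cmod \<zeta>) > 0" using \<delta> \<zeta>0 by simp
  note fr = finite_rank_perturbation[OF bl P_bounded_linear J_bounded_linear surj pos bound injB]
  have "\<forall>f. \<exists>x. B t \<mu> x = f" using fr(1) by simp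
  moreover have "\<exists>C. \<forall>x. norm x \<le> C * norm (B t \<mu> x)" using fr(2) by simp
  ultimately show ?thesis using t by blast
qed

end

section \<open>Failure of invertibility for a degenerate symbol\<close>

lemma L2T_diff: "f \<in> L2T \<Longrightarrow> g \<in> L2T \<Longrightarrow> (\<lambda>z. f z - g z) \<in> L2T"
proof -
  assume f: "f \<in> L2T" and g: "g \<in> L2T"
  have [measurable]: "f \<in> borel_measurable torus" "g \<in> borel_measurable torus" using f g by (auto simp: L2T_def)
  have "integrable torus (\<lambda>z. (cmod (f z - g z))\<^sup>2)"
  proof (rule Bochner_Integration.integrable_bound)
    show "integrable torus (\<lambda>z. 2 * (cmod (f z))\<^sup>2 + 2 * (cmod (g z))\<^sup>2)" using f g by (simp add: L2T_def)
    have "(cmod (f z - g z))\<^sup>2 \<le> 2 * (cmod (f z))\<^sup>2 + 2 * (cmod (g z))\<^sup>2" for z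
    proof -
      have "(cmod (f z - g z))\<^sup>2 \<le> (cmod (f z) + cmod (g z))\<^sup>2" by (intro power_mono norm_triangle_ineq4) auto
      also have "\<dots> \<le> 2 * (cmod (f z))\<^sup>2 + 2 * (cmod (g z))\<^sup>2"
        using sum_squares_bound[of "cmod (f z)" "cmod (g z)"] by (simp add: power2_sum)
      finally show ?thesis .
    qed
    then show "AE z in torus. norm ((cmod (f z - g z))\<^sup>2) \<le> norm (2 * (cmod (f z))\<^sup>2 + 2 * (cmod (g z))\<^sup>2)"
      by (intro AE_I2) auto
  qed measurable
  then show ?thesis by (simp add: L2T_def)
qed

lemma sobolevT_L2T: "f \<in> sobolevT s \<Longrightarrow> f \<in> L2T"
  by (simp add: sobolevT_def)

lemma sobolevT_diff:
  assumes f: "f \<in> sobolevT s" and g: "g \<in> sobolevT s"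
  shows "(\<lambda>z. f z - g z) \<in> sobolevT s"
proof -
  have fg: "fourier (\<lambda>z. f z - g z) n = fourier f n - fourier g n" for n
    by (rule fourier_diff[OF L2T_integrable[OF sobolevT_L2T[OF f]] L2T_integrable[OF sobolevT_L2T[OF g]]])
  let ?w = "\<lambda>n::int. (1 + (of_int n)\<^sup>2) powr s"
  have "(\<lambda>n. ?w n * (cmod (fourier (\<lambda>z. f z - g z) n))\<^sup>2) summable_on UNIV"
  proof (rule summable_on_comparison_test)
    show "(\<lambda>n. 2 * (?w n * (cmod (fourier f n))\<^sup>2) + 2 * (?w n * (cmod (fourier g n))\<^sup>2)) summable_on UNIV"
      using f g by (intro summable_on_add summable_on_cmult_right) (simp_all add: sobolevT_def)
    fix n
    have "(cmod (fourier f n - fourier g n))\<^sup>2 \<le> (cmod (fourier f n) + cmod (fourier g n))\<^sup>2"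
      by (intro power_mono norm_triangle_ineq4) auto
    also have "\<dots> \<le> 2 * (cmod (fourier f n))\<^sup>2 + 2 * (cmod (fourier g n))\<^sup>2"
      using sum_squares_bound[of "cmod (fourier f n)" "cmod (fourier g n)"] by (simp add: power2_sum)
    finally have "?w n * (cmod (fourier f n - fourier g n))\<^sup>2 \<le> ?w n * (2 * (cmod (fourier f n))\<^sup>2 + 2 * (cmod (fourier g n))\<^sup>2)"
      by (intro mult_left_mono) auto
    then show "?w n * (cmod (fourier (\<lambda>z. f z - g z) n))\<^sup>2 \<le> 2 * (?w n * (cmod (fourier f n))\<^sup>2) + 2 * (?w n * (cmod (fourier g n))\<^sup>2)"
      unfolding fg by (simp add: algebra_simps)
  qed auto
  then show ?thesis using L2T_diff[OF sobolevT_L2T[OF f] sobolevT_L2T[OF g]] by (simp add: sobolevT_def)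
qed

lemma fourier_bounded: "f \<in> L2T \<Longrightarrow> cmod (fourier f n) \<le> L2T_norm f"
proof -
  assume f: "f \<in> L2T"
  have "1 * (cmod (fourier f n))\<^sup>2 \<le> 2 * pi * (cmod (fourier f n))\<^sup>2"
    using pi_gt3 by (intro mult_right_mono) auto
  also have "\<dots> \<le> (L2T_norm f)\<^sup>2" using Bessel_finite[OF f, of "{n}"] by simp
  finally have "(cmod (fourier f n))\<^sup>2 \<le> (L2T_norm f)\<^sup>2" by simp
  then show ?thesis by (rule power2_le_imp_le) (rule L2T_norm_nonneg)
qed

lemma fser_L2T_norm_le:
  assumes a: "(\<lambda>n. cmod (a n)) summable_on UNIV"
  shows "L2T_norm (fser a) \<le> 3 * (\<Sum>\<^sub>\<infinity>n. cmod (a n))"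
proof -
  let ?S = "\<Sum>\<^sub>\<infinity>n. cmod (a n)"
  have S: "?S \<ge> 0" by (intro infsum_nonneg) auto
  have "(\<Sum>\<^sub>\<infinity>n. (cmod (a n))\<^sup>2) \<le> (\<Sum>\<^sub>\<infinity>n. ?S * cmod (a n))"
  proof (intro infsum_mono Parseval_fser(1) a summable_on_cmult_right)
    fix n
    have "cmod (a n) \<le> ?S" using finite_sum_le_infsum[OF a, of "{n}"] by simp
    then show "(cmod (a n))\<^sup>2 \<le> ?S * cmod (a n)" unfolding power2_eq_square by (rule mult_right_mono) simp
  qed
  also have "\<dots> = ?S\<^sup>2" by (simp add: infsum_cmult_right' power2_eq_square)
  finally have "(\<Sum>\<^sub>\<infinity>n. (cmod (a n))\<^sup>2) \<le> ?S\<^sup>2" .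
  then have "2 * pi * (\<Sum>\<^sub>\<infinity>n. (cmod (a n))\<^sup>2) \<le> 9 * ?S\<^sup>2"
    using pi_less_4 by (intro mult_mono) (auto intro: infsum_nonneg)
  then have "(L2T_norm (fser a))\<^sup>2 \<le> (3 * ?S)\<^sup>2" unfolding Parseval_fser(2)[OF a] by (simp add: power_mult_distrib)
  then show ?thesis by (rule power2_le_imp_le) (use S in simp)
qed

lemma conv_bounded_summable:
  fixes q f :: "int \<Rightarrow> complex"
  assumes q: "(\<lambda>n. cmod (q n)) summable_on UNIV" and f: "\<And>n. cmod (f n) \<le> B"
  shows "(\<lambda>m. q (n - m) * f m) summable_on UNIV"
proof (rule abs_summable_summable, rule summable_on_comparison_test)
  show "(\<lambda>m. cmod (q (n - m)) * B) summable_on UNIV"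
    by (intro summable_on_cmult_left summable_on_int_shift(1)[OF q])
  show "norm (q (n - m) * f m) \<le> cmod (q (n - m)) * B" for m
    unfolding norm_mult by (intro mult_left_mono f) auto
qed auto

lemma conv_diff_bounded:
  assumes q: "(\<lambda>n. cmod (q n)) summable_on UNIV" and f: "\<And>n. cmod (f n) \<le> B" and g: "\<And>n. cmod (g n) \<le> B'"
  shows "conv q (\<lambda>n. f n - g n) n = conv q f n - conv q g n"
  unfolding conv_def right_diff_distrib
  by (rule infsum_minus[OF conv_bounded_summable[OF q f] conv_bounded_summable[OF q g]])

text \<open>A gliding hump. Packets \<open>a i\<close> with disjoint frequency sets
  \<open>F i\<close> have unit size in H2, while the coefficients of their images have absolute sum
  at most 2^-i; so the images add up to an L2 function \<open>fser Y\<close>. If the operator were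
  invertible, the bound on its inverse would force the solution for this datum to agree with
  \<open>a i\<close> on each \<open>F i\<close>, and then it could not lie in H2, which is the
  domain for b \<le> 0.\<close>

lemma (in profile) degenerate_not_invertible:
  fixes k c \<gamma> \<alpha>1 \<alpha>2 \<rho> b :: real and j :: "real \<Rightarrow> real"
  assumes k: "k > 0" and b: "b \<le> 0" and z0: "wave_fun k \<alpha>1 \<alpha>2 (c - wave_c0 j \<gamma> k) z0 = 0"
    and lim: "\<And>e. e > 0 \<Longrightarrow> \<exists>M. \<forall>n\<ge>M. \<bar>disp j \<gamma> k \<rho> n\<bar> \<le> e"
  shows "\<not> G_invertible j b \<gamma> \<alpha>1 \<alpha>2 k \<eta> c \<mu> \<rho>"
proof
  assume inv: "G_invertible j b \<gamma> \<alpha>1 \<alpha>2 k \<eta> c \<mu> \<rho>"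
  define q where "q = wave_q k \<alpha>1 \<alpha>2 (c - wave_c0 j \<gamma> k)"
  define g where "g n = \<i> * \<mu> / of_int n + of_real (disp j \<gamma> k \<rho> n)" for n
  have q: "wfinite 2 q" "(\<lambda>n. cmod (q n)) summable_on UNIV" unfolding q_def by (rule wave_q_wfinite wave_q_summable)+
  have qz: "fser q z0 = 0" unfolding q_def using fun_cong[OF wave_fun_fser, of k \<alpha>1 \<alpha>2 "c - wave_c0 j \<gamma> k" z0] z0 by simp
  have g0: "\<exists>M. \<forall>n\<ge>M. cmod (g n) \<le> e" if e: "e > 0" for e
  proof -
    obtain M where M: "\<And>n. n \<ge> M \<Longrightarrow> \<bar>disp j \<gamma> k \<rho> n\<bar> \<le> e / 2" using lim[of "e / 2"] e by auto
    have "cmod (g n) \<le> e" if n: "n \<ge> max M (max 1 \<lceil>2 * cmod \<mu> / e\<rceil>)" for n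
    proof -
      have n1: "real_of_int n \<ge> 1" and "2 * cmod \<mu> / e \<le> of_int n" using n by (auto simp: ceiling_le_iff)
      then have "cmod \<mu> / of_int n \<le> e / 2" using e by (simp add: field_simps)
      moreover have "cmod (g n) \<le> cmod (\<i> * \<mu> / of_int n) + \<bar>disp j \<gamma> k \<rho> n\<bar>"
        unfolding g_def using norm_triangle_ineq[of "\<i> * \<mu> / of_int n" "of_real (disp j \<gamma> k \<rho> n)"] by simp
      moreover have "cmod (\<i> * \<mu> / of_int n) = cmod \<mu> / of_int n" using n1 by (simp add: norm_mult norm_divide)
      moreover have "\<bar>disp j \<gamma> k \<rho> n\<bar> \<le> e / 2" using M[of n] n by simp
      ultimately show ?thesis by linarith
    qed
    then show ?thesis by blast
  qed
  define y where "y a n = (of_int n)\<^sup>2 * (g n * a n - conv q a n)" for a n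
  \<comment> \<open>A state is a packet, its support and the right end reached so far;
    \<open>Q\<close> demands that the next support lies beyond that end.\<close>
  define P where "P i s \<longleftrightarrow> (case s of (a, F, N) \<Rightarrow> finite F \<and> (\<forall>n\<in>F. 0 < n \<and> n \<le> N) \<and> 0 \<le> N \<and> (\<forall>n. n \<notin> F \<longrightarrow> a n = 0) \<and>
      (\<Sum>n\<in>F. (cmod ((of_int n)\<^sup>2 * a n))\<^sup>2) = 1 \<and> (\<forall>A. finite A \<longrightarrow> (\<Sum>n\<in>A. cmod (y a n)) \<le> (1/2) ^ i))"
    for i :: nat and s :: "(int \<Rightarrow> complex) \<times> int set \<times> int"
  define Q where "Q s s' \<longleftrightarrow> (case s of (a, F, N) \<Rightarrow> case s' of (a', F', N') \<Rightarrow> (\<forall>n\<in>F'. n > N) \<and> N \<le> N')"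
    for s s' :: "(int \<Rightarrow> complex) \<times> int set \<times> int"
  have ex: "\<exists>a F N'. P i (a, F, N') \<and> (\<forall>n\<in>F. n > N) \<and> N \<le> N'" if N: "N \<ge> 0" for i N
  proof -
    have "((1::real)/2) ^ i > 0" by simp
    from wave_packet[OF q(1) qz g0 this, of N] obtain a F where aF: "finite F" "\<forall>n\<in>F. n > N" "\<forall>n. n \<notin> F \<longrightarrow> a n = 0"
      "(\<Sum>n\<in>F. (cmod ((of_int n)\<^sup>2 * a n))\<^sup>2) = 1"
      "\<forall>A. finite A \<longrightarrow> (\<Sum>n\<in>A. cmod ((of_int n)\<^sup>2 * (g n * a n - conv q a n))) \<le> (1/2) ^ i" by blast
    define M where "M = Max (insert N F)"
    have M: "\<forall>n\<in>F. n \<le> M" "N \<le> M" unfolding M_def using aF(1) by auto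
    have pos: "\<forall>n\<in>F. 0 < n \<and> n \<le> M" using aF(2) N M(1) by force
    have "P i (a, F, M)" unfolding P_def prod.case y_def
      using aF(1,3,4,5) pos M(2) N by (intro conjI) (assumption | linarith)+
    then show ?thesis using aF(2) M(2) by blast
  qed
  have "\<exists>s. \<forall>i. P i (s i) \<and> Q (s i) (s (Suc i))"
  proof (rule dependent_nat_choice)
    show "\<exists>s. P 0 s" using ex[of 0 0] by auto
    fix s i assume "P i s"
    moreover obtain a F N where s: "s = (a, F, N)" by (cases s)
    ultimately have "N \<ge> 0" by (simp add: P_def)
    from ex[OF this, of "Suc i"] show "\<exists>s'. P (Suc i) s' \<and> Q s s'" unfolding s Q_def by auto
  qed
  then obtain s where s: "\<And>i. P i (s i)" "\<And>i. Q (s i) (s (Suc i))" by blast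
  define a where "a i = fst (s i)" for i
  define F where "F i = fst (snd (s i))" for i
  define N where "N i = snd (snd (s i))" for i
  have si: "s i = (a i, F i, N i)" for i by (simp add: a_def F_def N_def)
  have F: "finite (F i)" "\<And>n. n \<in> F i \<Longrightarrow> 0 < n \<and> n \<le> N i" "\<And>n. n \<notin> F i \<Longrightarrow> a i n = 0"
    "(\<Sum>n\<in>F i. (cmod ((of_int n)\<^sup>2 * a i n))\<^sup>2) = 1"
    "\<And>A. finite A \<Longrightarrow> (\<Sum>n\<in>A. cmod (y (a i) n)) \<le> (1/2) ^ i" for i
    using s(1)[of i] unfolding si P_def by auto
  have FN: "\<And>n. n \<in> F (Suc i) \<Longrightarrow> n > N i" "N i \<le> N (Suc i)" for i
    using s(2)[of i] unfolding si Q_def by auto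
  have Nmono: "i \<le> i' \<Longrightarrow> N i \<le> N i'" for i i' by (rule lift_Suc_mono_le[of N]) (rule FN(2))
  have disj1: "n \<notin> F i'" if "i < i'" "n \<in> F i" for i i' n
  proof
    assume "n \<in> F i'"
    moreover obtain m where m: "i' = Suc m" "i \<le> m" using \<open>i < i'\<close> by (cases i') auto
    ultimately have "n > N m" using FN(1) by blast
    then show False using Nmono[OF m(2)] F(2)[OF that(2)] by linarith
  qed
  have disj: "n \<notin> F i'" if "i \<noteq> i'" "n \<in> F i" for i i' n
    using disj1[of i i' n] disj1[of i' i n] that by (cases i i' rule: linorder_cases) auto
  have a0: "a i 0 = 0" for i using F(2,3)[of 0 i] by blast
  have sa: "(\<lambda>n. cmod (a i n)) summable_on UNIV" for i
    by (rule finite_nonzero_values_imp_summable_on, rule finite_subset[OF _ F(1)[of i]]) (use F(3) in auto)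
  have ab: "\<exists>B. \<forall>n. cmod (a i n) \<le> B" for i
    using finite_sum_le_infsum[OF sa[of i], of "{n}" for n] by auto
  have sy: "(\<lambda>n. cmod (y (a i) n)) summable_on UNIV" for i
    by (rule nonneg_bdd_above_summable_on) (auto intro!: bdd_aboveI2[where M = "(1/2) ^ i"] F(5))
  define \<beta> where "\<beta> i = (\<Sum>\<^sub>\<infinity>n. cmod (y (a i) n))" for i
  have \<beta>: "0 \<le> \<beta> i" "\<beta> i \<le> (1/2) ^ i" for i
    unfolding \<beta>_def by (auto intro: infsum_nonneg infsum_le_finite_sums[OF sy] F(5))
  have s\<beta>: "\<beta> summable_on UNIV"
  proof (rule summable_nonneg_imp_summable_on)
    show "summable \<beta>" by (rule summable_comparison_test'[where g = "\<lambda>i. (1/2) ^ i" and N = 0]) (use \<beta> in auto)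
  qed (rule \<beta>)
  have "(\<lambda>x. norm (case x of (i, n) \<Rightarrow> y (a i) n)) summable_on (UNIV \<times> UNIV)"
    using sy s\<beta>[unfolded \<beta>_def[abs_def]] by (subst Infinite_Sum.abs_summable_on_Sigma_iff) (simp add: \<beta>(1)[unfolded \<beta>_def])
  then have prod: "(\<lambda>(i, n). cmod (y (a i) n)) summable_on (UNIV \<times> UNIV)" by (simp add: case_prod_unfold)
  then have prod': "(\<lambda>(n, i). cmod (y (a i) n)) summable_on (UNIV \<times> UNIV)"
    by (subst summable_on_swap) (simp add: case_prod_unfold)
  have col: "(\<lambda>i. cmod (y (a i) n)) summable_on UNIV" for n using summable_on_SigmaD1[OF prod'] by simp
  have col': "(\<lambda>i. y (a i) n) summable_on UNIV" for n by (rule abs_summable_summable) (rule col)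
  define \<sigma> where "\<sigma> n = (\<Sum>\<^sub>\<infinity>i. cmod (y (a i) n))" for n
  have s\<sigma>: "\<sigma> summable_on UNIV" unfolding \<sigma>_def using summable_on_Sigma_banach[OF prod'] by simp
  have \<sigma>\<beta>: "(\<Sum>\<^sub>\<infinity>n. \<sigma> n) = (\<Sum>\<^sub>\<infinity>i. \<beta> i)" unfolding \<sigma>_def \<beta>_def by (rule infsum_swap_banach[OF prod'])
  define Y where "Y n = (\<Sum>\<^sub>\<infinity>i. y (a i) n)" for n
  \<comment> \<open>The datum that remains after the images of the first K packets are subtracted;
    by \<open>Zn\<close> its coefficient sum is bounded by a tail of the series of
    \<open>\<beta>\<close>.\<close>
  define Z where "Z K n = Y n - (\<Sum>i<K. y (a i) n)" for K n
  have Zb: "cmod (Z K n) \<le> \<sigma> n - (\<Sum>i<K. cmod (y (a i) n))" for K n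
  proof -
    have split: "(\<Sum>\<^sub>\<infinity>i. f i) = (\<Sum>i<K. f i) + (\<Sum>\<^sub>\<infinity>i\<in>- {..<K}. f i)" if "f summable_on UNIV" for f :: "nat \<Rightarrow> 'b :: banach"
      using infsum_Un_disjoint[of f "{..<K}" "- {..<K}", OF _ _ Compl_disjoint] summable_on_subset_banach[OF that, of "- {..<K}"]
      unfolding Compl_partition by simp
    have "Z K n = (\<Sum>\<^sub>\<infinity>i\<in>- {..<K}. y (a i) n)" unfolding Z_def Y_def split[OF col'] by simp
    moreover have "\<sigma> n - (\<Sum>i<K. cmod (y (a i) n)) = (\<Sum>\<^sub>\<infinity>i\<in>- {..<K}. cmod (y (a i) n))" unfolding \<sigma>_def split[OF col] by simp
    ultimately show ?thesis using norm_infsum_bound[of "\<lambda>i. y (a i) n" "- {..<K}"] summable_on_subset_banach[OF col[of n], of "- {..<K}"] by simp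
  qed
  have sZ': "(\<lambda>n. \<sigma> n - (\<Sum>i<K. cmod (y (a i) n))) summable_on UNIV" for K
    by (intro summable_on_minus s\<sigma> summable_on_sum_finite sy) auto
  have sZ: "(\<lambda>n. cmod (Z K n)) summable_on UNIV" for K
    by (rule summable_on_comparison_test[OF sZ' Zb]) auto
  have Zn: "(\<Sum>\<^sub>\<infinity>n. cmod (Z K n)) \<le> (\<Sum>\<^sub>\<infinity>i. \<beta> i) - (\<Sum>i<K. \<beta> i)" for K
  proof -
    have "(\<Sum>\<^sub>\<infinity>n. cmod (Z K n)) \<le> (\<Sum>\<^sub>\<infinity>n. \<sigma> n - (\<Sum>i<K. cmod (y (a i) n)))" by (intro infsum_mono sZ sZ' Zb)
    also have "\<dots> = (\<Sum>\<^sub>\<infinity>n. \<sigma> n) - (\<Sum>\<^sub>\<infinity>n. \<Sum>i<K. cmod (y (a i) n))"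
      by (intro infsum_minus s\<sigma> summable_on_sum_finite sy) auto
    also have "(\<Sum>\<^sub>\<infinity>n. \<Sum>i<K. cmod (y (a i) n)) = (\<Sum>i<K. \<beta> i)" unfolding \<beta>_def by (intro infsum_sum_finite sy) auto
    finally show ?thesis unfolding \<sigma>\<beta> .
  qed
  have Z0: "Z 0 = Y" by (simp add: fun_eq_iff Z_def)
  have sY: "(\<lambda>n. cmod (Y n)) summable_on UNIV" using sZ[of 0] unfolding Z0 .
  obtain \<phi> C where \<phi>: "\<phi> \<in> sobolevT (2 + max b 0)" "G_maps j \<gamma> \<alpha>1 \<alpha>2 k \<eta> c \<mu> \<rho> \<phi> (fser Y)"
    and C: "\<And>\<phi> \<psi>. \<phi> \<in> sobolevT (2 + max b 0) \<Longrightarrow> G_maps j \<gamma> \<alpha>1 \<alpha>2 k \<eta> c \<mu> \<rho> \<phi> \<psi> \<Longrightarrow> L2T_norm \<phi> \<le> C * L2T_norm \<psi>"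
    using inv fser_L2T[OF sY] unfolding G_invertible_def Let_def by blast
  have \<phi>L: "\<phi> \<in> L2T" by (rule sobolevT_L2T[OF \<phi>(1)])
  \<comment> \<open>Coefficients of the solution minus the first K packets; they solve the equation
    with datum \<open>Z K\<close>. Their boundedness makes the convolution with the summable
    \<open>q\<close> additive.\<close>
  define f where "f K n = fourier \<phi> n - (\<Sum>i<K. a i n)" for K n
  have fb: "\<exists>B. \<forall>n. cmod (f K n) \<le> B" for K
  proof (induction K)
    case 0 show ?case using fourier_bounded[OF \<phi>L] by (auto simp: f_def)
  next
    case (Suc K)
    then obtain B where B: "\<And>n. cmod (f K n) \<le> B" by blast
    obtain B' where B': "\<And>n. cmod (a K n) \<le> B'" using ab[of K] by blast
    have "cmod (f (Suc K) n) \<le> B + B'" for n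
      using norm_triangle_ineq4[of "f K n" "a K n"] B[of n] B'[of n] by (simp add: f_def algebra_simps)
    then show ?case by blast
  qed
  have G0: "G_coeff j \<gamma> \<alpha>1 \<alpha>2 k \<eta> c \<mu> \<rho> \<phi> n = Y n" for n using \<phi>(2) unfolding G_maps_def by (simp add: fourier_fser[OF sY])
  have f0: "fourier \<phi> = f 0" by (simp add: f_def fun_eq_iff)
  have fK: "n \<noteq> 0 \<Longrightarrow> y (f K) n = Z K n" for K n
  proof (induction K)
    case 0
    then show ?case using G0[of n] G_coeff_eq(1)[OF k L2T_integrable[OF \<phi>L], of n j \<gamma> \<alpha>1 \<alpha>2 c \<mu> \<rho>]
      by (simp add: Z0 y_def g_def q_def f0)
  next
    case (Suc K)
    obtain B B' where B: "\<And>n. cmod (f K n) \<le> B" "\<And>n. cmod (a K n) \<le> B'" using fb[of K] ab[of K] by blast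
    have fS: "f (Suc K) = (\<lambda>n. f K n - a K n)" by (simp add: f_def fun_eq_iff)
    have "y (f (Suc K)) n = y (f K) n - y (a K) n"
      unfolding y_def fS conv_diff_bounded[OF q(2) B] by (simp add: algebra_simps)
    then show ?case using Suc by (simp add: Z_def)
  qed
  define A where "A K n = (\<Sum>i<K. a i n)" for K n
  have Afin: "A K n = 0" if "n \<notin> (\<Union>i<K. F i)" for K n unfolding A_def using that F(3) by (intro sum.neutral) auto
  have finU: "finite (\<Union>i<K. F i)" for K using F(1) by auto
  have sA: "(\<lambda>n. cmod (A K n)) summable_on UNIV" for K
    by (rule finite_nonzero_values_imp_summable_on, rule finite_subset[OF _ finU[of K]]) (use Afin in auto)
  have DA: "fser (A K) \<in> sobolevT (2 + max b 0)" for K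
    by (rule fser_sobolev[OF sA], rule finite_nonzero_values_imp_summable_on, rule finite_subset[OF _ finU[of K]]) (use Afin in auto)
  define \<phi>K where "\<phi>K K z = \<phi> z - fser (A K) z" for K z
  have D: "\<phi>K K \<in> sobolevT (2 + max b 0)" for K unfolding \<phi>K_def[abs_def] by (rule sobolevT_diff[OF \<phi>(1) DA])
  have four: "fourier (\<phi>K K) = f K" for K
    unfolding \<phi>K_def[abs_def] f_def[abs_def]
    by (rule ext, simp only: fourier_diff[OF L2T_integrable[OF \<phi>L] fser_integrable[OF sA]] fourier_fser[OF sA]) (simp add: A_def)
  have GK: "G_maps j \<gamma> \<alpha>1 \<alpha>2 k \<eta> c \<mu> \<rho> (\<phi>K K) (fser (Z K))" for K
    unfolding G_maps_def
  proof (intro conjI allI fser_L2T sZ)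
    fix n
    have int: "integrable torus (\<phi>K K)" by (rule L2T_integrable[OF sobolevT_L2T[OF D]])
    show "fourier (fser (Z K)) n = G_coeff j \<gamma> \<alpha>1 \<alpha>2 k \<eta> c \<mu> \<rho> (\<phi>K K) n"
    proof (cases "n = 0")
      case True
      have "Z K 0 = Y 0" by (simp add: Z_def y_def)
      also have "\<dots> = G_coeff j \<gamma> \<alpha>1 \<alpha>2 k \<eta> c \<mu> \<rho> \<phi> 0" by (simp add: G0)
      also have "\<dots> = G_coeff j \<gamma> \<alpha>1 \<alpha>2 k \<eta> c \<mu> \<rho> (\<phi>K K) 0"
        unfolding G_coeff_eq(2)[OF k int] G_coeff_eq(2)[OF k L2T_integrable[OF \<phi>L]] four f0 by (simp add: f_def a0)
      finally show ?thesis unfolding True fourier_fser[OF sZ] .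
    next
      case False
      show ?thesis unfolding fourier_fser[OF sZ] fK[OF False, symmetric] G_coeff_eq(1)[OF k int False] four y_def g_def q_def ..
    qed
  qed
  have lim0: "(\<lambda>K. 3 * \<bar>C\<bar> * ((\<Sum>\<^sub>\<infinity>i. \<beta> i) - (\<Sum>i<K. \<beta> i))) \<longlonglongrightarrow> 0"
  proof -
    have "\<beta> sums (\<Sum>\<^sub>\<infinity>i. \<beta> i)" by (rule has_sum_imp_sums[OF has_sum_infsum[OF s\<beta>]])
    then have "(\<lambda>K. 3 * \<bar>C\<bar> * ((\<Sum>\<^sub>\<infinity>i. \<beta> i) - (\<Sum>i<K. \<beta> i))) \<longlonglongrightarrow> 3 * \<bar>C\<bar> * ((\<Sum>\<^sub>\<infinity>i. \<beta> i) - (\<Sum>\<^sub>\<infinity>i. \<beta> i))"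
      unfolding sums_def by (intro tendsto_intros)
    then show ?thesis by simp
  qed
  \<comment> \<open>For K > i the remaining function has coefficient
    \<open>fourier \<phi> n - a i n\<close> at n, as the other packets vanish there; the bound on
    the inverse makes it smaller than a quantity tending to 0.\<close>
  have coeffs: "fourier \<phi> n = a i n" if n: "n \<in> F i" for i n
  proof -
    have "cmod (fourier \<phi> n - a i n) \<le> 3 * \<bar>C\<bar> * ((\<Sum>\<^sub>\<infinity>i. \<beta> i) - (\<Sum>i<K. \<beta> i))" if K: "K > i" for K
    proof -
      have "(\<Sum>i'<K. a i' n) = a i n"
        using K disj[OF _ n] F(3) by (subst sum.remove[of _ i]) (auto intro!: sum.neutral)
      then have "cmod (fourier \<phi> n - a i n) = cmod (fourier (\<phi>K K) n)" unfolding four f_def by simp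
      also have "\<dots> \<le> L2T_norm (\<phi>K K)" by (rule fourier_bounded[OF sobolevT_L2T[OF D]])
      also have "\<dots> \<le> C * L2T_norm (fser (Z K))" by (rule C[OF D GK])
      also have "\<dots> \<le> \<bar>C\<bar> * L2T_norm (fser (Z K))" by (intro mult_right_mono L2T_norm_nonneg) auto
      also have "\<dots> \<le> \<bar>C\<bar> * (3 * (\<Sum>\<^sub>\<infinity>n. cmod (Z K n)))" by (intro mult_left_mono fser_L2T_norm_le sZ) auto
      also have "\<dots> \<le> \<bar>C\<bar> * (3 * ((\<Sum>\<^sub>\<infinity>i. \<beta> i) - (\<Sum>i<K. \<beta> i)))" by (intro mult_left_mono Zn) auto
      finally show ?thesis by (simp add: algebra_simps)
    qed
    then have "cmod (fourier \<phi> n - a i n) \<le> 0"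
      by (intro tendsto_lowerbound[OF lim0]) (auto simp: eventually_sequentially intro!: exI[of _ "Suc i"])
    then show ?thesis by simp
  qed
  let ?w = "\<lambda>n. (1 + (of_int n)\<^sup>2) powr (2 + max b 0) * (cmod (fourier \<phi> n))\<^sup>2"
  have sw: "?w summable_on UNIV" using \<phi>(1) by (simp add: sobolevT_def)
  \<comment> \<open>Each of the first K packets contributes at least 1 to the Sobolev sum.\<close>
  obtain K :: nat where K: "(\<Sum>\<^sub>\<infinity>n. ?w n) < real K" using reals_Archimedean2 by blast
  have "real K = (\<Sum>i<K. \<Sum>n\<in>F i. (cmod ((of_int n)\<^sup>2 * a i n))\<^sup>2)" by (simp add: F(4))
  also have "\<dots> \<le> (\<Sum>i<K. \<Sum>n\<in>F i. ?w n)"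
  proof (intro sum_mono)
    fix i n assume n: "n \<in> F i"
    have "((of_int n)\<^sup>2)\<^sup>2 \<le> (1 + (of_int n)\<^sup>2 :: real)\<^sup>2" by (intro power_mono) auto
    also have "\<dots> = (1 + (of_int n)\<^sup>2) powr (2 + max b 0)" using b by (simp add: max_def add_pos_nonneg)
    finally show "(cmod ((of_int n)\<^sup>2 * a i n))\<^sup>2 \<le> ?w n"
      unfolding coeffs[OF n] norm_mult power_mult_distrib by (intro mult_right_mono) (auto simp: norm_power)
  qed
  also have "\<dots> = (\<Sum>n\<in>(\<Union>i<K. F i). ?w n)"
    by (rule sum.UNION_disjoint[symmetric]) (use F(1) disj in auto)
  also have "\<dots> \<le> (\<Sum>\<^sub>\<infinity>n. ?w n)" by (rule finite_sum_le_infsum[OF sw finU]) auto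
  finally show False using K by simp
qed

section \<open>Triviality of the kernel for \<mu> with positive real part\<close>

lemma norm_ell2_mono:
  assumes "r \<ge> 0" "\<And>n. cmod (coef x n) \<le> r * cmod (coef y n)"
  shows "norm x \<le> r * norm y"
proof (rule power2_le_imp_le)
  have "(\<Sum>\<^sub>\<infinity>n. (cmod (coef x n))\<^sup>2) \<le> (\<Sum>\<^sub>\<infinity>n. r\<^sup>2 * (cmod (coef y n))\<^sup>2)"
  proof (intro infsum_mono summable_on_cmult_right summable_coef_sq)
    show "(cmod (coef x n))\<^sup>2 \<le> r\<^sup>2 * (cmod (coef y n))\<^sup>2" for n
      using power_mono[OF assms(2)[of n], of 2] by (simp add: power_mult_distrib)
  qed
  then show "(norm x)\<^sup>2 \<le> (r * norm y)\<^sup>2" by (simp add: norm_ell2_sq power_mult_distrib infsum_cmult_right')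
qed (use assms in simp)

lemma norm_tail_le: "norm (tail x) \<le> norm x"
  using norm_ell2_mono[of 1 "tail x" x] by simp

lemma cinner_split:
  assumes "coef x 0 = 0"
  shows "cinner x y = coef x 1 * cnj (coef y 1) + coef x (-1) * cnj (coef y (-1)) + cinner (tail x) (tail y)"
proof -
  have x: "x = cmul (coef x 1) (unit 1) + cmul (coef x (-1)) (unit (-1)) + tail x"
  proof (rule ell2_eqI)
    fix n :: int
    consider "n = 0" | "n = 1" | "n = -1" | "\<bar>n\<bar> \<ge> 2" by fastforce
    then show "coef x n = coef (cmul (coef x 1) (unit 1) + cmul (coef x (-1)) (unit (-1)) + tail x) n"
    proof cases
      case 4
      then have "n \<noteq> 1" "n \<noteq> -1" by auto
      then show ?thesis using 4 by simp
    qed (use assms in simp_all)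
  qed
  have "cinner x y = cinner (cmul (coef x 1) (unit 1) + cmul (coef x (-1)) (unit (-1)) + tail x) y" using x by simp
  also have "\<dots> = coef x 1 * cnj (coef y 1) + coef x (-1) * cnj (coef y (-1)) + cinner (tail x) y"
    by (simp only: cinner_add_left cinner_cmul_left cinner_unit_left)
  finally show ?thesis unfolding cinner_tail_left[of x y] .
qed

text \<open>Here p and q are the amplitudes at mode 1 of the even and the odd part of a solution,
  and \<open>we\<close>, \<open>wo\<close> the norms of their tails. The first relation says p
  \<approx> - \<rho>^2 q, the second \<zeta> q \<approx> K1 p, so \<zeta> \<approx> - \<rho>^2 K1 <
  0. The numbers t and \<zeta> t are real and t \<noteq> 0, so \<zeta> = \<mu>^2 is real, hence
  positive as Re \<mu> > 0. All errors have to be relative to p, q and K1, whence the constant c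
  that compares \<open>cmod \<zeta>\<close> and \<open>\<xi>\<close> with \<open>K1\<close>.\<close>

lemma no_unstable_pair:
  fixes p q t \<zeta> \<mu> :: complex and \<rho>2 K1 c \<kappa>' \<xi> we wo :: real
  assumes \<mu>: "Re \<mu> > 0" and \<zeta>: "\<zeta> = \<mu>\<^sup>2" and pq: "p \<noteq> 0 \<or> q \<noteq> 0" and w: "0 \<le> we" "0 \<le> wo"
    and \<rho>2: "0 < \<rho>2" "\<rho>2 \<le> 1" and K1: "0 < K1" "K1 \<le> 1" and \<kappa>': "0 \<le> \<kappa>'" "\<kappa>' \<le> 1 / 32" "\<kappa>' * c \<le> 1 / 48"
    and \<zeta>c: "cmod \<zeta> \<le> c * K1" and \<xi>: "0 \<le> \<xi>" "\<xi> \<le> c * K1"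
    and we: "we \<le> \<kappa>' * (cmod p + cmod \<zeta> * cmod q)" and wo: "wo \<le> \<kappa>' * (cmod p + cmod q)"
    and e1: "cmod (p + of_real \<rho>2 * q) \<le> we + \<rho>2 * wo"
    and e2: "cmod (2 * (\<zeta> * q - of_real K1 * p)) \<le> we * \<xi> + 2 * cmod \<zeta> * wo"
    and t: "Im t = 0" "Im (\<zeta> * t) = 0" "cmod (t - 2 * (p * cnj q)) \<le> we * wo"
  shows False
proof -
  define P where "P = cmod p"
  define R where "R = cmod q"
  define Z where "Z = cmod \<zeta>"
  have nn: "P \<ge> 0" "R \<ge> 0" "Z \<ge> 0" by (auto simp: P_def R_def Z_def)
  have ZR: "0 \<le> Z * R" "0 \<le> P * K1" using nn K1 by auto
  have PK: "P * K1 \<le> P" "Z * R * K1 \<le> Z * R" using nn K1 by (auto intro: mult_left_le)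
  have "we * \<xi> \<le> (\<kappa>' * (P + Z * R)) * (c * K1)"
    using we \<xi> w nn \<kappa>' unfolding P_def R_def Z_def by (intro mult_mono) auto
  also have "\<dots> = (\<kappa>' * c) * (P * K1 + Z * R * K1)" by (simp add: algebra_simps)
  also have "\<dots> \<le> 1 / 48 * (P * K1 + Z * R)" using \<kappa>' PK ZR nn K1 by (intro mult_mono) auto
  finally have s1: "we * \<xi> \<le> 1 / 48 * (P * K1 + Z * R)" .
  have "Z * wo \<le> Z * (\<kappa>' * (P + R))" using wo nn unfolding P_def R_def by (intro mult_left_mono) auto
  also have "\<dots> = \<kappa>' * P * Z + \<kappa>' * (Z * R)" by (simp add: algebra_simps)
  also have "\<dots> \<le> \<kappa>' * P * (c * K1) + 1 / 32 * (Z * R)"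
    using \<zeta>c nn \<kappa>' ZR unfolding Z_def by (intro add_mono mult_left_mono mult_right_mono) auto
  also have "\<kappa>' * P * (c * K1) = (\<kappa>' * c) * (P * K1)" by simp
  also have "\<dots> \<le> 1 / 48 * (P * K1)" using \<kappa>' ZR by (intro mult_right_mono) auto
  finally have s2: "Z * wo \<le> 1 / 48 * (P * K1) + 1 / 32 * (Z * R)" by simp
  have e2': "2 * cmod (\<zeta> * q - of_real K1 * p) \<le> we * \<xi> + 2 * (Z * wo)"
    using e2 unfolding norm_mult[of 2] by (simp add: Z_def)
  have "Z * R \<le> cmod (\<zeta> * q - of_real K1 * p) + K1 * P"
    using norm_triangle_ineq[of "\<zeta> * q - of_real K1 * p" "of_real K1 * p"] K1 by (simp add: Z_def R_def P_def norm_mult)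
  \<comment> \<open>A first, crude form of \<zeta> q \<approx> K1 p; with it the error terms
    containing \<open>Z * R\<close> turn into multiples of \<open>P * K1\<close>, which yields
    \<open>E2\<close>.\<close>
  then have ZRb: "Z * R \<le> 2 * (P * K1)" using e2' s1 s2 ZR by (simp add: mult.commute)
  have E2: "cmod (\<zeta> * q - of_real K1 * p) \<le> P * K1 / 6"
  proof -
    have "\<And>E a b u v :: real. 2 * E \<le> a + 2 * b \<Longrightarrow> a \<le> 1 / 48 * (u + v) \<Longrightarrow> b \<le> 1 / 48 * u + 1 / 32 * v \<Longrightarrow>
      v \<le> 2 * u \<Longrightarrow> 0 \<le> u \<Longrightarrow> E \<le> u / 6" by (simp add: field_simps)
    from this[OF e2' s1 s2 ZRb ZR(2)] show ?thesis .
  qed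
  have ZP: "Z * R \<le> 2 * P" using ZRb PK by linarith
  have we3: "we \<le> 3 * P / 32"
  proof -
    have "we \<le> 1 / 32 * (P + Z * R)"
      using we mult_right_mono[OF \<kappa>'(2), of "P + Z * R"] nn ZR unfolding P_def R_def Z_def by linarith
    then show ?thesis using ZP by (simp add: field_simps)
  qed
  have wo3: "wo \<le> 1 / 32 * (P + R)"
    using wo mult_right_mono[OF \<kappa>'(2), of "P + R"] nn unfolding P_def R_def by linarith
  \<comment> \<open>\<open>PS\<close> and \<open>SP\<close> will make \<open>P\<close> and
    \<open>\<rho>2 * R\<close> comparable; together with \<open>pq\<close> this shows that neither
    amplitude vanishes.\<close>
  define S where "S = \<rho>2 * R"
  have S: "0 \<le> S" "S \<le> R" using \<rho>2 nn by (auto simp: S_def intro: mult_left_le_one_le)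
  have "\<rho>2 * wo \<le> \<rho>2 * (1 / 32 * (P + R))" using wo3 \<rho>2 by (intro mult_left_mono) auto
  also have "\<dots> = 1 / 32 * (\<rho>2 * P + S)" by (simp add: S_def algebra_simps)
  also have "\<dots> \<le> 1 / 32 * (P + S)" using \<rho>2 nn by (intro mult_left_mono add_right_mono) (auto intro: mult_left_le_one_le)
  finally have E1: "cmod (p + of_real \<rho>2 * q) \<le> 4 * P / 32 + S / 32" using e1 we3 by (simp add: field_simps)
  have nS: "cmod (of_real \<rho>2 * q) = S" using \<rho>2 by (simp add: norm_mult S_def R_def)
  have "P \<le> cmod (p + of_real \<rho>2 * q) + S"
    using norm_triangle_ineq4[of "p + of_real \<rho>2 * q" "of_real \<rho>2 * q"] nS by (simp add: P_def)
  then have PS: "P \<le> 6 / 5 * S" using E1 S by linarith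
  have "S \<le> cmod (p + of_real \<rho>2 * q) + P"
    using norm_triangle_ineq4[of "p + of_real \<rho>2 * q" p] nS by (simp add: P_def)
  then have SP: "S \<le> 6 / 5 * P" using E1 nn by linarith
  have R0: "R > 0"
  proof (rule ccontr)
    assume "\<not> R > 0"
    then have "R = 0" using nn by simp
    then have "P \<le> 0" using PS by (simp add: S_def)
    then show False using pq \<open>R = 0\<close> by (simp add: P_def R_def)
  qed
  then have P0: "P > 0" using SP \<rho>2 mult_pos_pos[OF \<rho>2(1) R0] by (simp add: S_def[symmetric])
  have E1': "cmod (p + of_real \<rho>2 * q) \<le> P / 6" using E1 SP nn by linarith
  \<comment> \<open>The main part \<open>2 * (p * cnj q)\<close> of t outweighs the contribution of
    the tails.\<close>
  have "t \<noteq> 0"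
  proof
    assume "t = 0"
    then have "2 * (P * R) \<le> we * wo" using t(3) by (simp add: norm_mult P_def R_def)
    also have "\<dots> \<le> (3 * P / 32) * (3 * R / 32)"
    proof (intro mult_mono we3)
      show "wo \<le> 3 * R / 32" using wo3 PS S R0 by (simp add: field_simps)
    qed (use nn w in auto)
    also have "\<dots> = 9 / 1024 * (P * R)" by simp
    finally show False using mult_pos_pos[OF P0 R0] by linarith
  qed
  then have Ret: "Re t \<noteq> 0" using t(1) by (simp add: complex_eq_iff)
  then have "Im \<zeta> = 0" using t by simp
  then have "Im \<mu> = 0" using \<mu> unfolding \<zeta> by (simp add: power2_eq_square)
  then have \<zeta>r: "\<zeta> = of_real ((Re \<mu>)\<^sup>2)" unfolding \<zeta> by (simp add: complex_eq_iff power2_eq_square)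
  define s where "s = Re (p * cnj q)"
  have qq: "q * cnj q = of_real (R\<^sup>2)" unfolding R_def by (rule complex_norm_square[symmetric])
  have "(p + of_real \<rho>2 * q) * cnj q = p * cnj q + of_real \<rho>2 * (q * cnj q)" by (simp add: algebra_simps)
  then have "Re ((p + of_real \<rho>2 * q) * cnj q) = s + \<rho>2 * R\<^sup>2" unfolding qq s_def by simp
  moreover have "Re ((p + of_real \<rho>2 * q) * cnj q) \<le> P / 6 * R"
    using complex_Re_le_cmod[of "(p + of_real \<rho>2 * q) * cnj q"] mult_right_mono[OF E1' nn(2)] by (simp add: norm_mult R_def)
  ultimately have a: "s + \<rho>2 * R\<^sup>2 \<le> P / 6 * R" by simp
  have "(\<zeta> * q - of_real K1 * p) * cnj q = of_real ((Re \<mu>)\<^sup>2) * (q * cnj q) - of_real K1 * (p * cnj q)"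
    unfolding \<zeta>r by (simp add: algebra_simps)
  then have "Re ((\<zeta> * q - of_real K1 * p) * cnj q) = (Re \<mu>)\<^sup>2 * R\<^sup>2 - K1 * s" unfolding qq s_def by simp
  moreover have "Re ((\<zeta> * q - of_real K1 * p) * cnj q) \<le> P * K1 / 6 * R"
    using complex_Re_le_cmod[of "(\<zeta> * q - of_real K1 * p) * cnj q"] mult_right_mono[OF E2 nn(2)] by (simp add: norm_mult R_def)
  ultimately have "(Re \<mu>)\<^sup>2 * R\<^sup>2 \<le> K1 * (s + P * R / 6)" by (simp add: algebra_simps)
  \<comment> \<open>By the first relation s is close to \<open>- \<rho>2 * R\<^sup>2\<close>, hence
    negative, whereas the left end of the chain is nonnegative.\<close>
  also have "s + P * R / 6 < 0"
  proof -
    have "P * R \<le> 6 / 5 * S * R" using PS nn by (intro mult_right_mono) auto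
    moreover have "S * R = \<rho>2 * R\<^sup>2" by (simp add: S_def power2_eq_square)
    moreover have "\<rho>2 * R\<^sup>2 > 0" using \<rho>2 R0 by simp
    ultimately show ?thesis using a by linarith
  qed
  then have "K1 * (s + P * R / 6) < 0" using K1 by (simp add: mult_pos_neg)
  finally have "(Re \<mu>)\<^sup>2 * R\<^sup>2 < 0" .
  moreover have "0 \<le> (Re \<mu>)\<^sup>2 * R\<^sup>2" by simp
  ultimately show False by linarith
qed

context definite_symbol
begin

text \<open>The rows with \<bar>n\<bar> \<ge> 2 are divided by \<open>d n\<close>; the part of
  \<open>Q x\<close> that comes from the tail itself is absorbed since
  \<open>\<kappa> \<le> \<delta> / 2\<close>.\<close>

lemma tail_estimate:
  assumes x0: "coef x 0 = 0" and \<kappa>: "\<kappa> \<le> \<delta> / 2" and f: "\<And>n. \<bar>n\<bar> \<ge> 2 \<Longrightarrow> coef (L x) n = coef f n"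
    and x1: "cmod (coef x 1) \<le> m" "cmod (coef x (-1)) \<le> m"
  shows "norm (tail x) \<le> 2 / \<delta> * (2 * \<kappa> * m + norm (tail f))"
proof -
  have m: "m \<ge> 0" using norm_ge_zero[of "coef x 1"] x1 by linarith
  have "norm (tail x) \<le> 1 / \<delta> * norm (tail (D x))"
  proof (rule norm_ell2_mono)
    fix n
    show "cmod (coef (tail x) n) \<le> 1 / \<delta> * cmod (coef (tail (D x)) n)"
    proof (cases "\<bar>n\<bar> \<ge> 2")
      case True
      have "\<delta> * cmod (coef x n) \<le> \<bar>d n\<bar> * cmod (coef x n)" using d[OF True] by (intro mult_right_mono) auto
      then show ?thesis using True \<delta> by (simp add: norm_mult field_simps)
    qed simp
  qed (use \<delta> in simp)
  also have "tail (D x) = tail f + tail (Q x)"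
  proof (rule ell2_eqI)
    fix n
    show "coef (tail (D x)) n = coef (tail f + tail (Q x)) n" using f[of n] by (simp add: L_def algebra_simps)
  qed
  also have "1 / \<delta> * norm (tail f + tail (Q x)) \<le> 1 / \<delta> * (norm (tail f) + \<kappa> * norm x)"
    using norm_triangle_ineq[of "tail f" "tail (Q x)"] norm_tail_le[of "Q x"] Q_norm[of x] \<delta> by (intro mult_left_mono) auto
  finally have "\<delta> * norm (tail x) \<le> norm (tail f) + \<kappa> * norm x" using \<delta> by (simp add: field_simps)
  moreover have "norm x \<le> 2 * m + norm (tail x)"
  proof (rule power2_le_imp_le)
    have "(norm x)\<^sup>2 \<le> m\<^sup>2 + m\<^sup>2 + (norm (tail x))\<^sup>2"
      unfolding norm_split[OF x0] using x1 by (intro add_mono power_mono) auto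
    moreover have "(2 * m + norm (tail x))\<^sup>2 = m\<^sup>2 + m\<^sup>2 + (norm (tail x))\<^sup>2 + (2 * m\<^sup>2 + 4 * (m * norm (tail x)))"
      by (simp add: power2_eq_square algebra_simps)
    moreover have "0 \<le> 2 * m\<^sup>2 + 4 * (m * norm (tail x))" using m by simp
    ultimately show "(norm x)\<^sup>2 \<le> (2 * m + norm (tail x))\<^sup>2" by linarith
  qed (use m in simp)
  then have "\<kappa> * norm x \<le> \<kappa> * (2 * m) + \<delta> / 2 * norm (tail x)"
    using mult_left_mono[OF _ \<kappa>_nonneg, of "norm x" "2 * m + norm (tail x)"] mult_right_mono[OF \<kappa>, of "norm (tail x)"]
    by (simp add: distrib_left)
  ultimately have "\<delta> / 2 * norm (tail x) \<le> 2 * \<kappa> * m + norm (tail f)" by (simp add: algebra_simps)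
  then show ?thesis using \<delta> by (simp add: field_simps)
qed

text \<open>The vector y plays the role of \<eta>', normalised at mode 1, and the two-mode vector
  that of the derivative of \<eta> with respect to \<epsilon>. Testing with them gives the two
  relations of \<open>no_unstable_pair\<close>; \<open>\<xi>\<close> is the error of the second
  vector.\<close>

lemma kernel_trivial:
  assumes \<mu>: "Re \<mu> > 0" and \<kappa>: "\<kappa> \<le> \<delta> / 2" "2 / \<delta> * (\<rho>2 + \<kappa>) \<le> 1" "(2 / \<delta>)\<^sup>2 * (\<rho>2 + 2 * \<kappa>)\<^sup>2 \<le> 1 / 2"
    and \<kappa>': "4 * (2 / \<delta>)\<^sup>2 * \<kappa> \<le> 1 / 32" "4 * (2 / \<delta>)\<^sup>2 * \<kappa> * c \<le> 1 / 48"
    and K1: "0 < K1" "K1 \<le> 1" "(\<rho>2 + 2 * \<kappa>)\<^sup>2 \<le> c * K1"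
    and y: "reflect y = - y" "cmod (coef y 1) \<ge> 1 / 2" "norm (tail y) \<le> 1" "L y = cmul (- of_real \<rho>2) (A (A y))"
    and z: "coef (L (unit 1 + unit (-1) + cmul (of_real \<beta>) (unit 2 + unit (-2)))) 1 = - of_real K1"
      "norm (tail (L (unit 1 + unit (-1) + cmul (of_real \<beta>) (unit 2 + unit (-2))))) \<le> \<xi>" "\<xi> \<le> c * K1" "\<bar>\<beta>\<bar> \<le> 1"
    and eq: "cmul (\<i> * \<mu>) (A \<phi>) + L \<phi> = 0"
  shows "\<phi> = 0"
proof (rule ccontr)
  assume "\<phi> \<noteq> 0"
  define \<zeta> where "\<zeta> = \<mu>\<^sup>2"
  define h where "h = 2 / \<delta>"
  have h: "h \<ge> 1" using \<delta> by (simp add: h_def)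
  have \<mu>0: "\<mu> \<noteq> 0" using \<mu> by auto
  have L\<phi>: "L \<phi> = cmul (- (\<i> * \<mu>)) (A \<phi>)"
  proof (rule ell2_eqI)
    fix n
    have "coef (cmul (\<i> * \<mu>) (A \<phi>) + L \<phi>) n = 0" using eq by simp
    then show "coef (L \<phi>) n = coef (cmul (- (\<i> * \<mu>)) (A \<phi>)) n" by (simp add: eq_neg_iff_add_eq_0 add.commute)
  qed
  have \<phi>0: "coef \<phi> 0 = 0"
  proof -
    have "coef (L \<phi>) 0 = 0" unfolding L\<phi> by simp
    then show ?thesis by (simp add: L_def d0)
  qed
  \<comment> \<open>Both forms are real, and the form of \<open>L\<close> is
    \<open>- (\<i> * \<mu>)\<close> times that of \<open>A\<close>; the imaginary part shows that
    \<open>Re \<mu>\<close> times the form of \<open>A\<close> vanishes.\<close>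
  have L0: "Re (cinner (L \<phi>) \<phi>) = 0"
  proof -
    have 1: "cinner (L \<phi>) \<phi> = - (\<i> * \<mu>) * cinner (A \<phi>) \<phi>" unfolding L\<phi> by (simp add: cinner_cmul_left)
    have "Im (cinner (A \<phi>) \<phi>) = 0" "Im (cinner (L \<phi>) \<phi>) = 0" by (intro real_form A_sym L_sym)+
    moreover from this have "Re \<mu> * Re (cinner (A \<phi>) \<phi>) = 0" unfolding 1 by simp
    ultimately show ?thesis unfolding 1 using \<mu> by simp
  qed
  define m where "m = max (cmod (coef \<phi> 1)) (cmod (coef \<phi> (-1)))"
  let ?v = "(cmod (coef \<phi> 1))\<^sup>2 + (cmod (coef \<phi> (-1)))\<^sup>2"
  have v2: "?v \<le> 2 * m\<^sup>2"
    using power_mono[of "cmod (coef \<phi> 1)" m 2] power_mono[of "cmod (coef \<phi> (-1))" m 2] by (simp add: m_def)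
  \<comment> \<open>Since the form of \<open>L\<close> vanishes, its positive part on the tail is
    paid for by the modes 1 and -1, which therefore control the whole vector.\<close>
  have w: "(norm (tail \<phi>))\<^sup>2 \<le> ?v"
  proof -
    have "Re (cinner (Q \<phi>) \<phi>) \<le> \<kappa> * (?v + (norm (tail \<phi>))\<^sup>2)"
      using Q_form[of \<phi> \<phi>] norm_split[OF \<phi>0] by (simp add: power2_eq_square mult.assoc)
    moreover have "\<kappa> * (norm (tail \<phi>))\<^sup>2 \<le> \<delta> / 2 * (norm (tail \<phi>))\<^sup>2" by (intro mult_right_mono \<kappa>) auto
    moreover have "Re (cinner (D \<phi>) \<phi>) = Re (cinner (Q \<phi>) \<phi>)" using L0 by (simp add: L_def cinner_diff_left)
    ultimately have "\<delta> / 2 * (norm (tail \<phi>))\<^sup>2 \<le> (\<rho>2 + \<kappa>) * ?v"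
      using D_form[of \<phi>] by (simp add: distrib_left distrib_right)
    then have "(norm (tail \<phi>))\<^sup>2 \<le> (2 / \<delta> * (\<rho>2 + \<kappa>)) * ?v" using \<delta> by (simp add: field_simps)
    also have "\<dots> \<le> 1 * ?v" by (intro mult_right_mono \<kappa>) auto
    finally show ?thesis by simp
  qed
  have \<phi>m: "norm \<phi> \<le> 2 * m"
  proof (rule power2_le_imp_le)
    show "(norm \<phi>)\<^sup>2 \<le> (2 * m)\<^sup>2" using norm_split[OF \<phi>0] w v2 by (simp add: power_mult_distrib)
  qed (simp add: m_def le_max_iff_disj)
  then have m0: "m > 0" using \<open>\<phi> \<noteq> 0\<close> zero_less_norm_iff[of \<phi>] by linarith
  \<comment> \<open>From the rows 1 and -1, where \<open>A\<close> is 1 and -1 and \<open>d\<close>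
    is \<open>- \<rho>2\<close>.\<close>
  have \<mu>b: "cmod \<mu> \<le> \<rho>2 + 2 * \<kappa>"
  proof -
    have row: "cmod \<mu> * cmod (coef \<phi> n) \<le> \<rho>2 * m + \<kappa> * (2 * m)" if "n = 1 \<or> n = -1" for n
    proof -
      have dn: "d n = - \<rho>2" using that d1 d_even[of 1] by auto
      have "\<i> * \<mu> * (coef \<phi> n / of_int n) = of_real \<rho>2 * coef \<phi> n + coef (Q \<phi>) n"
      proof -
        have "coef (L \<phi>) n = - (\<i> * \<mu>) * (coef \<phi> n / of_int n)" unfolding L\<phi> by simp
        then have "- of_real \<rho>2 * coef \<phi> n - coef (Q \<phi>) n = - (\<i> * \<mu>) * (coef \<phi> n / of_int n)" by (simp add: L_def dn)
        then show ?thesis by (simp add: algebra_simps)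
      qed
      then have "cmod (\<i> * \<mu> * (coef \<phi> n / of_int n)) \<le> cmod (of_real \<rho>2 * coef \<phi> n) + cmod (coef (Q \<phi>) n)"
        by (simp only: norm_triangle_ineq)
      moreover have "cmod (\<i> * \<mu> * (coef \<phi> n / of_int n)) = cmod \<mu> * cmod (coef \<phi> n)" using that by (auto simp: norm_mult)
      moreover have "cmod (of_real \<rho>2 * coef \<phi> n) \<le> \<rho>2 * m" using that \<rho>2 by (auto simp: norm_mult m_def)
      moreover have "cmod (coef (Q \<phi>) n) \<le> \<kappa> * (2 * m)"
        using norm_coef_le[of "Q \<phi>" n] Q_norm[of \<phi>] mult_left_mono[OF \<phi>m \<kappa>_nonneg] by linarith
      ultimately show ?thesis by linarith
    qed
    have "cmod \<mu> * m \<le> \<rho>2 * m + \<kappa> * (2 * m)" using row[of 1] row[of "-1"] unfolding m_def[symmetric] by (simp add: m_def max_def split: if_splits)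
    then have "cmod \<mu> * m \<le> (\<rho>2 + 2 * \<kappa>) * m" by (simp add: algebra_simps)
    then show ?thesis using m0 by simp
  qed
  have \<zeta>b: "cmod \<zeta> \<le> (\<rho>2 + 2 * \<kappa>)\<^sup>2" unfolding \<zeta>_def norm_power by (intro power_mono \<mu>b) auto
  define e where "e = cmul (1 / 2) (\<phi> + reflect \<phi>)"
  \<comment> \<open>The odd part is scaled by \<open>\<i> / \<mu>\<close>, so that the system
    becomes \<open>L e = - \<zeta> A o'\<close>, \<open>L o' = A e\<close> and contains \<mu> only
    through \<open>\<zeta> = \<mu>\<^sup>2\<close>.\<close>
  define o' where "o' = cmul (\<i> / \<mu> / 2) (\<phi> - reflect \<phi>)"
  define p where "p = coef e 1"
  define r where "r = coef o' 1"
  have e0: "coef e 0 = 0" "coef o' 0 = 0" by (simp_all add: e_def o'_def \<phi>0)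
  have em: "coef e (-1) = p" "coef o' (-1) = - r" by (simp_all add: e_def o'_def p_def r_def algebra_simps)
  have Ar: "A (\<phi> + reflect \<phi>) = A \<phi> - reflect (A \<phi>)" "A (\<phi> - reflect \<phi>) = A \<phi> + reflect (A \<phi>)"
    by (simp_all add: A.add A.diff A_reflect)
  have Lr: "L (\<phi> + reflect \<phi>) = L \<phi> + reflect (L \<phi>)" "L (\<phi> - reflect \<phi>) = L \<phi> - reflect (L \<phi>)"
    by (simp_all add: L.add L.diff L_reflect)
  have Le: "L e = cmul (- \<zeta>) (A o')" unfolding e_def o'_def L_cmul A_cmul Ar Lr L\<phi>
    by (rule ell2_eqI) (use \<mu>0 in \<open>simp add: \<zeta>_def power2_eq_square field_simps\<close>)
  have Lo: "L o' = A e" unfolding e_def o'_def L_cmul A_cmul Ar Lr L\<phi>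
    by (rule ell2_eqI) (use \<mu>0 in \<open>simp add: field_simps\<close>)
  define we where "we = norm (tail e)"
  define wo where "wo = norm (tail o')"
  have tA: "norm (tail (A x)) \<le> norm (tail x)" for x
  proof -
    have "tail (A x) = A (tail x)" by (rule ell2_eqI) simp
    then show ?thesis using A_norm[of "tail x"] by simp
  qed
  have tcm: "tail (cmul a x) = cmul a (tail x)" for a x by (rule ell2_eqI) simp
  have wo1: "wo \<le> h * (2 * \<kappa> * cmod r + we)"
  proof -
    have "wo \<le> h * (2 * \<kappa> * cmod r + norm (tail (A e)))"
      unfolding wo_def h_def by (rule tail_estimate[OF e0(2) \<kappa>(1)]) (simp_all add: Lo em r_def)
    also have "\<dots> \<le> h * (2 * \<kappa> * cmod r + we)" unfolding we_def using h by (intro mult_left_mono add_left_mono tA) auto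
    finally show ?thesis .
  qed
  have we1: "we \<le> h * (2 * \<kappa> * cmod p + cmod \<zeta> * wo)"
  proof -
    have "we \<le> h * (2 * \<kappa> * cmod p + norm (tail (cmul (- \<zeta>) (A o'))))"
      unfolding we_def h_def by (rule tail_estimate[OF e0(1) \<kappa>(1)]) (simp_all add: Le em p_def)
    also have "\<dots> \<le> h * (2 * \<kappa> * cmod p + cmod \<zeta> * wo)"
      unfolding wo_def tcm norm_cmul norm_minus_cancel using h by (intro mult_left_mono add_left_mono tA) auto
    finally show ?thesis .
  qed
  \<comment> \<open>The two tail estimates are inserted into each other;
    \<open>h\<^sup>2 * cmod \<zeta> \<le> 1 / 2\<close> lets the tail on the right be absorbed, and
    \<open>4 * h\<^sup>2 * \<kappa>\<close> is the factor that results.\<close>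
  define \<kappa>' where "\<kappa>' = 4 * h\<^sup>2 * \<kappa>"
  have \<kappa>'0: "\<kappa>' \<ge> 0" using \<kappa>_nonneg by (simp add: \<kappa>'_def)
  have hh: "h * \<kappa> \<le> h\<^sup>2 * \<kappa>" using h \<kappa>_nonneg by (intro mult_right_mono) (auto simp: power2_eq_square mult_le_cancel_left1)
  have wn: "0 \<le> we" "0 \<le> wo" by (auto simp: we_def wo_def)
  have h\<zeta>: "h\<^sup>2 * cmod \<zeta> \<le> 1 / 2"
    using \<kappa>(3) mult_left_mono[OF \<zeta>b, of "h\<^sup>2"] unfolding h_def[symmetric] by simp
  have we2: "we \<le> \<kappa>' * (cmod p + cmod \<zeta> * cmod r)"
  proof -
    have "we \<le> h * (2 * \<kappa> * cmod p + cmod \<zeta> * (h * (2 * \<kappa> * cmod r + we)))"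
      using h by (intro order_trans[OF we1] mult_left_mono add_left_mono wo1) auto
    also have "\<dots> = 2 * (h * \<kappa>) * cmod p + 2 * (h\<^sup>2 * \<kappa>) * (cmod \<zeta> * cmod r) + (h\<^sup>2 * cmod \<zeta>) * we"
      by (simp add: algebra_simps power2_eq_square)
    also have "\<dots> \<le> 2 * (h\<^sup>2 * \<kappa>) * cmod p + 2 * (h\<^sup>2 * \<kappa>) * (cmod \<zeta> * cmod r) + 1 / 2 * we"
    proof -
      have "2 * (h * \<kappa>) * cmod p \<le> 2 * (h\<^sup>2 * \<kappa>) * cmod p" using hh by (intro mult_right_mono) auto
      moreover have "(h\<^sup>2 * cmod \<zeta>) * we \<le> 1 / 2 * we" by (intro mult_right_mono h\<zeta> wn)
      ultimately show ?thesis by linarith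
    qed
    finally show ?thesis by (simp add: \<kappa>'_def algebra_simps)
  qed
  have wo2: "wo \<le> \<kappa>' * (cmod p + cmod r)"
  proof -
    have "wo \<le> h * (2 * \<kappa> * cmod r + h * (2 * \<kappa> * cmod p + cmod \<zeta> * wo))"
      using h by (intro order_trans[OF wo1] mult_left_mono add_left_mono we1) auto
    also have "\<dots> = 2 * (h * \<kappa>) * cmod r + 2 * (h\<^sup>2 * \<kappa>) * cmod p + (h\<^sup>2 * cmod \<zeta>) * wo"
      by (simp add: algebra_simps power2_eq_square)
    also have "\<dots> \<le> 2 * (h\<^sup>2 * \<kappa>) * cmod r + 2 * (h\<^sup>2 * \<kappa>) * cmod p + 1 / 2 * wo"
    proof -
      have "2 * (h * \<kappa>) * cmod r \<le> 2 * (h\<^sup>2 * \<kappa>) * cmod r" using hh by (intro mult_right_mono) auto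
      moreover have "(h\<^sup>2 * cmod \<zeta>) * wo \<le> 1 / 2 * wo" by (intro mult_right_mono h\<zeta> wn)
      ultimately show ?thesis by linarith
    qed
    finally show ?thesis by (simp add: \<kappa>'_def algebra_simps)
  qed
  have pr: "p \<noteq> 0 \<or> r \<noteq> 0"
  proof (rule ccontr)
    assume "\<not> (p \<noteq> 0 \<or> r \<noteq> 0)"
    then have "coef \<phi> 1 + coef \<phi> (-1) = 0" "coef \<phi> 1 - coef \<phi> (-1) = 0" using \<mu>0 by (auto simp: p_def r_def e_def o'_def)
    then have "coef \<phi> 1 = 0" "coef \<phi> (-1) = 0" by (auto simp: eq_neg_iff_add_eq_0[symmetric])
    then show False using m0 by (simp add: m_def)
  qed
  \<comment> \<open>\<open>L o' = A e\<close> is tested with y. As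
    \<open>L y = - \<rho>2 A A y\<close> holds exactly, all terms in the odd part carry the factor
    \<open>\<rho>2\<close>.\<close>
  have e1: "cmod (p + of_real \<rho>2 * r) \<le> we + \<rho>2 * wo"
  proof -
    have ym: "coef y (-1) = - coef y 1"
    proof -
      have "coef (reflect y) 1 = coef (- y) 1" using y(1) by simp
      then show ?thesis by simp
    qed
    have "cinner (A e) y = cinner o' (L y)" using L_sym[of o' y] by (simp add: Lo)
    also have "\<dots> = - of_real \<rho>2 * cinner (A o') (A y)" unfolding y(4) cinner_cmul_right by (simp add: A_sym)
    finally have "cinner (A e) y + of_real \<rho>2 * cinner (A o') (A y) = 0" by simp
    moreover have "cinner (A e) y = 2 * p * cnj (coef y 1) + cinner (tail (A e)) (tail y)"
      using cinner_split[of "A e" y] by (simp add: em ym p_def)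
    moreover have "cinner (A o') (A y) = 2 * r * cnj (coef y 1) + cinner (tail (A o')) (tail (A y))"
      using cinner_split[of "A o'" "A y"] by (simp add: em ym r_def)
    ultimately have "2 * cnj (coef y 1) * (p + of_real \<rho>2 * r) = - (cinner (tail (A e)) (tail y) + of_real \<rho>2 * cinner (tail (A o')) (tail (A y)))"
      by (simp add: algebra_simps eq_neg_iff_add_eq_0)
    then have "cmod (2 * cnj (coef y 1) * (p + of_real \<rho>2 * r)) \<le> cmod (cinner (tail (A e)) (tail y)) + cmod (of_real \<rho>2 * cinner (tail (A o')) (tail (A y)))"
      by (simp only: norm_minus_cancel norm_triangle_ineq)
    moreover have "cmod (cinner (tail (A e)) (tail y)) \<le> we * 1"
      unfolding we_def using y(3) tA by (intro order_trans[OF cmod_cinner_le] mult_mono) auto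
    moreover have "cmod (of_real \<rho>2 * cinner (tail (A o')) (tail (A y))) \<le> \<rho>2 * (wo * 1)"
    proof -
      have "cmod (cinner (tail (A o')) (tail (A y))) \<le> wo * 1"
        unfolding wo_def using order_trans[OF tA y(3)] tA by (intro order_trans[OF cmod_cinner_le] mult_mono) auto
      then show ?thesis using \<rho>2 by (simp add: norm_mult)
    qed
    moreover have "1 * cmod (p + of_real \<rho>2 * r) \<le> cmod (2 * cnj (coef y 1) * (p + of_real \<rho>2 * r))"
      unfolding norm_mult[of _ "p + of_real \<rho>2 * r"] using y(2) by (intro mult_right_mono) (auto simp: norm_mult)
    ultimately show ?thesis by simp
  qed
  define Z where "Z = unit 1 + unit (-1) + cmul (of_real \<beta>) (unit 2 + unit (-2))"
  \<comment> \<open>\<open>L e = - \<zeta> A o'\<close> is tested with the even vector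
    \<open>Z\<close>. By symmetry \<open>L\<close> falls on \<open>Z\<close>, whose image is
    \<open>- K1\<close> at the modes 1 and -1 and small on the tail.\<close>
  have e2: "cmod (2 * (\<zeta> * r - of_real K1 * p)) \<le> we * \<xi> + 2 * cmod \<zeta> * wo"
  proof -
    have rZ: "reflect Z = Z" by (rule ell2_eqI) (auto simp: Z_def)
    have LZ: "coef (L Z) 1 = - of_real K1" "coef (L Z) (-1) = - of_real K1"
    proof -
      show 1: "coef (L Z) 1 = - of_real K1" unfolding Z_def by (rule z(1))
      have "coef (L Z) (-1) = coef (reflect (L Z)) 1" by simp
      also have "reflect (L Z) = L Z" using L_reflect[of Z] rZ by simp
      finally show "coef (L Z) (-1) = - of_real K1" using 1 by simp
    qed
    have tZ: "norm (tail Z) \<le> 2"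
    proof -
      have "tail Z = cmul (of_real \<beta>) (unit 2) + cmul (of_real \<beta>) (unit (-2))" by (rule ell2_eqI) (simp add: Z_def)
      then have "norm (tail Z) \<le> norm (cmul (of_real \<beta>) (unit 2)) + norm (cmul (of_real \<beta>) (unit (-2)))"
        using norm_triangle_ineq by metis
      then show ?thesis using z(4) by simp
    qed
    have "cinner e (L Z) = - \<zeta> * cinner (A o') Z" using L_sym[of e Z] by (simp add: Le cinner_cmul_left)
    moreover have "cinner e (L Z) = - 2 * of_real K1 * p + cinner (tail e) (tail (L Z))"
      using cinner_split[OF e0(1), of "L Z"] by (simp add: LZ em p_def)
    moreover have "cinner (A o') Z = 2 * r + cinner (tail (A o')) (tail Z)"
      using cinner_split[of "A o'" Z] by (simp add: em r_def Z_def)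
    ultimately have "2 * (\<zeta> * r - of_real K1 * p) = - (cinner (tail e) (tail (L Z)) + \<zeta> * cinner (tail (A o')) (tail Z))"
      by (simp add: algebra_simps eq_neg_iff_add_eq_0)
    then have "cmod (2 * (\<zeta> * r - of_real K1 * p)) \<le> cmod (cinner (tail e) (tail (L Z))) + cmod (\<zeta> * cinner (tail (A o')) (tail Z))"
      by (simp only: norm_minus_cancel norm_triangle_ineq)
    moreover have "cmod (cinner (tail e) (tail (L Z))) \<le> we * \<xi>"
      unfolding we_def Z_def using z(2) by (intro order_trans[OF cmod_cinner_le] mult_left_mono) auto
    moreover have "cmod (cinner (tail (A o')) (tail Z)) \<le> wo * 2"
      unfolding wo_def using tA tZ by (intro order_trans[OF cmod_cinner_le] mult_mono) auto
    then have "cmod (\<zeta> * cinner (tail (A o')) (tail Z)) \<le> cmod \<zeta> * (wo * 2)" unfolding norm_mult by (rule mult_left_mono) simp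
    ultimately show ?thesis by simp
  qed
  \<comment> \<open>The number is \<open>cinner (L o') o'\<close>, and \<zeta> times it is
    \<open>- cinner (L e) e\<close>; both are real because \<open>L\<close> is symmetric.\<close>
  have t1: "Im (cinner (A e) o') = 0" using real_form[of L o', OF L_sym] by (simp add: Lo)
  have t2: "Im (\<zeta> * cinner (A e) o') = 0"
  proof -
    have "cinner (L e) e = - \<zeta> * cinner (A o') e" by (simp add: Le cinner_cmul_left)
    moreover have "cinner (A o') e = cnj (cinner (A e) o')" using A_sym[of o' e] cinner_commute[of "A e" o'] by simp
    moreover have "cnj (cinner (A e) o') = cinner (A e) o'" using t1 by (simp add: complex_eq_iff)
    ultimately have "\<zeta> * cinner (A e) o' = - cinner (L e) e" by simp
    then show ?thesis using real_form[of L e, OF L_sym] by simp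
  qed
  have t3: "cmod (cinner (A e) o' - 2 * (p * cnj r)) \<le> we * wo"
  proof -
    have "cinner (A e) o' - 2 * (p * cnj r) = cinner (tail (A e)) (tail o')"
      using cinner_split[of "A e" o'] by (simp add: em p_def r_def)
    then show ?thesis unfolding we_def wo_def using tA[of e]
      by (metis cmod_cinner_le mult_right_mono norm_ge_zero order_trans)
  qed
  show False
  proof (rule no_unstable_pair[OF \<mu> \<zeta>_def pr wn \<rho>2 K1(1,2) \<kappa>'0 _ _ _ _ z(3) we2 wo2 e1 e2 t1 t2 t3])
    show "\<kappa>' \<le> 1 / 32" "\<kappa>' * c \<le> 1 / 48" using \<kappa>' by (simp_all add: \<kappa>'_def h_def)
    show "cmod \<zeta> \<le> c * K1" using \<zeta>b K1(3) by linarith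
    show "0 \<le> \<xi>" using z(2) norm_ge_zero order_trans by blast
  qed
qed

end

section \<open>Invertibility on the torus from the problem for sequences\<close>

lemma neg_mult_eq_iff: "g \<noteq> 0 \<Longrightarrow> - g * x = p \<longleftrightarrow> x = - p / g" for g x p :: complex
  by (auto simp: nonzero_eq_divide_eq mult.commute)

context definite_symbol
begin

lemma conv_q: "n \<noteq> 0 \<Longrightarrow> conv q (coef x) n = coef (Q x) n + q n * coef x 0"
proof -
  assume n: "n \<noteq> 0"
  have s: "(\<lambda>m. q (n - m) * coef x m) summable_on UNIV"
    by (rule conv_bounded_summable[OF wfinite_summable[OF q] norm_coef_le])
  have "conv q (coef x) n - coef (Q x) n = (\<Sum>\<^sub>\<infinity>m. q (n - m) * coef x m - Qk n m * coef x m)"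
    unfolding conv_def Q_def coef_kop[OF Q_dom] by (rule infsum_minus[OF s dominated_summable'[OF Q_dom], symmetric])
  also have "\<dots> = (\<Sum>\<^sub>\<infinity>m\<in>{0}. q (n - m) * coef x m)"
    by (rule infsum_cong_neutral) (use n in \<open>auto simp: Qk_def\<close>)
  finally show ?thesis by (simp add: diff_eq_eq add.commute)
qed

text \<open>The rows of \<open>G_coeff\<close> in terms of the coefficients, with
  \<open>g = \<rho>\<^sup>2 + \<gamma>\<close>. Row 0 determines \<open>X 0\<close> alone; in the
  other rows it then appears as the known term \<open>q n * X 0\<close>.\<close>

definition "grow g \<mu> X n = (if n = 0 then - of_real g * X 0
  else (of_int n)\<^sup>2 * ((\<i> * \<mu> / of_int n + of_real (d n)) * X n - conv q X n))" for g :: real and n :: int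

lemma grow_iff:
  assumes g: "g \<noteq> 0"
  shows "grow g \<mu> (coef X) n = p n \<longleftrightarrow> coef (cmul (\<i> * \<mu>) (A X) + L X) n = (if n = 0 then - p 0 / of_real g else p n / (of_int n)\<^sup>2 + q n * coef X 0)"
proof (cases "n = 0")
  case True
  then show ?thesis using neg_mult_eq_iff[of "of_real g" "coef X 0" "p 0"] g by (simp add: grow_def L_def d0)
next
  case False
  then have "grow g \<mu> (coef X) n = (of_int n)\<^sup>2 * (coef (cmul (\<i> * \<mu>) (A X) + L X) n - q n * coef X 0)"
    by (simp add: grow_def conv_q L_def algebra_simps)
  then show ?thesis using False by (auto simp: field_simps)
qed

text \<open>Data of the conjugated problem. The rows are divided by n^2, which compensates the
  quadratic growth of \<open>sw\<close>; for the term with \<open>q n\<close> the weight is covered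
  by the decay of \<open>q\<close>.\<close>

lemma weighted_rhs:
  assumes t: "0 < t" "t \<le> 1" and g: "g > 0"
  obtains C where "C \<ge> 0" "\<And>p. \<exists>F. norm F \<le> C * norm p \<and>
    (\<forall>n. coef F n = of_real (sw (t\<^sup>2) n) * (if n = 0 then - coef p 0 / of_real g else coef p n / (of_int n)\<^sup>2 - q n * (coef p 0 / of_real g)))"
proof -
  have t2: "t\<^sup>2 \<le> 1" using t by (simp add: power_le_one)
  have "(\<lambda>n. cmod (of_real (sw (t\<^sup>2) n) * q n)) summable_on UNIV"
  proof (rule summable_on_comparison_test)
    show "(\<lambda>n. wt 2 n * cmod (q n)) summable_on UNIV" using q by (simp add: wfinite_def)
    fix n
    have "sw (t\<^sup>2) n \<le> wt 2 n"
      using mult_right_mono[OF t2, of "(of_int n)\<^sup>2"] by (simp add: sw_def wt_def power2_sum)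
    then show "cmod (of_real (sw (t\<^sup>2) n) * q n) \<le> wt 2 n * cmod (q n)"
      using sw_ge_1[of "t\<^sup>2" n] by (simp add: norm_mult mult_right_mono)
  qed auto
  then have sb: "(\<lambda>n. (cmod (of_real (sw (t\<^sup>2) n) * q n))\<^sup>2) summable_on UNIV" by (rule Parseval_fser(1))
  define b where "b = Abs_ell2 (\<lambda>n. of_real (sw (t\<^sup>2) n) * q n)"
  have b: "coef b n = of_real (sw (t\<^sup>2) n) * q n" for n unfolding b_def coef_Abs[OF sb] ..
  define b' where "b' = b - cmul (coef b 0) (unit 0)"
  define a where "a n = (if n = 0 then - 1 / of_real g else of_real (sw (t\<^sup>2) n / (of_int n)\<^sup>2) :: complex)" for n :: int
  have a: "cmod (a n) \<le> 2 + 1 / g" for n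
  proof (cases "n = 0")
    case False
    then have n1: "1 \<le> (of_int n :: real)\<^sup>2" by (metis of_int_eq_0_iff one_le_power abs_ge_zero power2_abs Ints_nonzero_abs_ge1 Ints_of_int)
    then have "sw (t\<^sup>2) n \<le> 2 * (of_int n)\<^sup>2" using mult_right_mono[OF t2, of "(of_int n)\<^sup>2"] by (simp add: sw_def)
    then have "sw (t\<^sup>2) n / (of_int n)\<^sup>2 \<le> 2" using n1 by (subst pos_divide_le_eq) linarith+
    moreover have "0 \<le> sw (t\<^sup>2) n / (of_int n)\<^sup>2" using sw_ge_1[of "t\<^sup>2" n] by simp
    moreover have "0 \<le> 1 / g" using g by simp
    ultimately show ?thesis using False unfolding a_def if_not_P[OF False] norm_of_real by linarith
  qed (use g in \<open>simp add: a_def norm_divide\<close>)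
  show thesis
  proof
    show "0 \<le> 2 + 1 / g + norm b' / g" using g by simp
    fix p
    have "(\<lambda>n. (cmod (a n * coef p n))\<^sup>2) summable_on UNIV"
    proof (rule summable_on_comparison_test)
      show "(\<lambda>n. (2 + 1 / g)\<^sup>2 * (cmod (coef p n))\<^sup>2) summable_on UNIV" by (intro summable_on_cmult_right summable_coef_sq)
      show "(cmod (a n * coef p n))\<^sup>2 \<le> (2 + 1 / g)\<^sup>2 * (cmod (coef p n))\<^sup>2" for n
        unfolding norm_mult power_mult_distrib by (intro mult_right_mono power_mono a) auto
    qed auto
    from coef_Abs[OF this] obtain F1 where F1: "coef F1 = (\<lambda>n. a n * coef p n)" by blast
    have "norm F1 \<le> (2 + 1 / g) * norm p"
      by (rule norm_ell2_mono) (use g a in \<open>auto simp: F1 norm_mult intro: mult_right_mono\<close>)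
    moreover have "norm (cmul (- coef p 0 / of_real g) b') \<le> norm b' / g * norm p"
      using mult_left_mono[OF norm_coef_le[of p 0], of "norm b' / g"] g by (simp add: norm_divide mult.commute)
    ultimately have "norm (F1 + cmul (- coef p 0 / of_real g) b') \<le> (2 + 1 / g + norm b' / g) * norm p"
      using norm_triangle_ineq[of F1 "cmul (- coef p 0 / of_real g) b'"] by (simp add: distrib_right)
    moreover have "coef (F1 + cmul (- coef p 0 / of_real g) b') n
        = of_real (sw (t\<^sup>2) n) * (if n = 0 then - coef p 0 / of_real g else coef p n / (of_int n)\<^sup>2 - q n * (coef p 0 / of_real g))" for n
      by (cases "n = 0") (simp_all add: F1 a_def b'_def b sw_def field_simps)
    ultimately show "\<exists>F. norm F \<le> (2 + 1 / g + norm b' / g) * norm p \<and>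
      (\<forall>n. coef F n = of_real (sw (t\<^sup>2) n) * (if n = 0 then - coef p 0 / of_real g else coef p n / (of_int n)\<^sup>2 - q n * (coef p 0 / of_real g)))"
      by blast
  qed
qed

text \<open>A solution of the conjugated problem in \<open>ell2\<close>, divided by
  \<open>sw\<close>, has two derivatives; conversely, the summability assumed in the second part
  allows the weight to be put on \<open>X\<close>.\<close>

lemma sequence_invertible:
  assumes \<mu>: "Re \<mu> > 0" and \<kappa>: "\<kappa> \<le> \<delta> / 2" and inj: "\<And>x. cmul (\<i> * \<mu>) (A x) + L x = 0 \<Longrightarrow> x = 0" and g: "g > 0"
  shows "\<exists>X. (\<lambda>n. (1 + (of_int n)\<^sup>2)\<^sup>2 * (cmod (coef X n))\<^sup>2) summable_on UNIV \<and> (\<forall>n. grow g \<mu> (coef X) n = coef p n)"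
    and "\<exists>C. \<forall>X p. (\<lambda>n. (1 + (of_int n)\<^sup>2)\<^sup>2 * (cmod (coef X n))\<^sup>2) summable_on UNIV \<and> (\<forall>n. grow g \<mu> (coef X) n = coef p n) \<longrightarrow> norm X \<le> C * norm p"
proof -
  obtain t C where t: "0 < t" "t \<le> 1" and surj: "\<And>f. \<exists>x. B t \<mu> x = f" and C: "\<And>x. norm x \<le> C * norm (B t \<mu> x)"
    using solvable[OF \<mu> \<kappa> inj] by blast
  obtain C' where C': "C' \<ge> 0" and rhs: "\<And>p. \<exists>F. norm F \<le> C' * norm p \<and>
    (\<forall>n. coef F n = of_real (sw (t\<^sup>2) n) * (if n = 0 then - coef p 0 / of_real g else coef p n / (of_int n)\<^sup>2 - q n * (coef p 0 / of_real g)))"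
    using weighted_rhs[OF t g] by blast
  have t2: "t\<^sup>2 \<le> 1" "t\<^sup>2 > 0" using t by (auto simp: power_le_one)
  have sw0: "sw (t\<^sup>2) n \<noteq> 0" for n using sw_ge_1[of "t\<^sup>2" n] by auto
  have g0: "g \<noteq> 0" using g by simp
  have swl: "t\<^sup>2 * (1 + (of_int n)\<^sup>2) \<le> sw (t\<^sup>2) n" for n using t2 by (simp add: sw_def distrib_left)
  have swu: "sw (t\<^sup>2) n \<le> 1 + (of_int n)\<^sup>2" for n using mult_right_mono[OF t2(1), of "(of_int n)\<^sup>2"] by (simp add: sw_def)
  show "\<exists>X. (\<lambda>n. (1 + (of_int n)\<^sup>2)\<^sup>2 * (cmod (coef X n))\<^sup>2) summable_on UNIV \<and> (\<forall>n. grow g \<mu> (coef X) n = coef p n)"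
  proof -
    obtain F where F: "\<And>n. coef F n = of_real (sw (t\<^sup>2) n) * (if n = 0 then - coef p 0 / of_real g else coef p n / (of_int n)\<^sup>2 - q n * (coef p 0 / of_real g))"
      using rhs[of p] by blast
    obtain x where x: "B t \<mu> x = F" using surj by blast
    define X where "X = unweight t x"
    have eq: "coef (cmul (\<i> * \<mu>) (A X) + L X) n = (if n = 0 then - coef p 0 / of_real g else coef p n / (of_int n)\<^sup>2 - q n * (coef p 0 / of_real g))" for n
    proof -
      have "of_real (sw (t\<^sup>2) n) * coef (cmul (\<i> * \<mu>) (A X) + L X) n = coef F n" using coef_B[OF t, of \<mu> x n] unfolding x X_def by simp
      then show ?thesis unfolding F using sw0[of n] by (simp only: mult_cancel_left of_real_eq_0_iff) simp
    qed
    have X0: "coef X 0 = - coef p 0 / of_real g" using eq[of 0] by (simp add: L_def d0)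
    have "grow g \<mu> (coef X) n = coef p n" for n
      unfolding grow_iff[OF g0] eq X0 by simp
    moreover have "(\<lambda>n. (1 + (of_int n)\<^sup>2)\<^sup>2 * (cmod (coef X n))\<^sup>2) summable_on UNIV"
    proof (rule summable_on_comparison_test)
      show "(\<lambda>n. (1 / t\<^sup>2)\<^sup>2 * (cmod (coef x n))\<^sup>2) summable_on UNIV" by (intro summable_on_cmult_right summable_coef_sq)
      fix n
      have "(1 + (of_int n)\<^sup>2) * cmod (coef X n) = (1 + (of_int n)\<^sup>2) / sw (t\<^sup>2) n * cmod (coef x n)"
        using sw_ge_1[of "t\<^sup>2" n] by (simp add: X_def norm_divide)
      also have "\<dots> \<le> 1 / t\<^sup>2 * cmod (coef x n)"
        using swl[of n] t2 sw_ge_1[of "t\<^sup>2" n] by (intro mult_right_mono) (auto simp: field_simps)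
      finally have "((1 + (of_int n)\<^sup>2) * cmod (coef X n))\<^sup>2 \<le> (1 / t\<^sup>2 * cmod (coef x n))\<^sup>2" by (intro power_mono) auto
      then show "(1 + (of_int n)\<^sup>2)\<^sup>2 * (cmod (coef X n))\<^sup>2 \<le> (1 / t\<^sup>2)\<^sup>2 * (cmod (coef x n))\<^sup>2" by (simp only: power_mult_distrib)
    qed auto
    ultimately show ?thesis by blast
  qed
  have "norm X \<le> \<bar>C\<bar> * C' * norm p"
    if S: "(\<lambda>n. (1 + (of_int n)\<^sup>2)\<^sup>2 * (cmod (coef X n))\<^sup>2) summable_on UNIV" and R: "\<And>n. grow g \<mu> (coef X) n = coef p n" for X p
  proof -
    obtain F where F: "norm F \<le> C' * norm p" "\<And>n. coef F n = of_real (sw (t\<^sup>2) n) * (if n = 0 then - coef p 0 / of_real g else coef p n / (of_int n)\<^sup>2 - q n * (coef p 0 / of_real g))"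
      using rhs[of p] by blast
    have "(\<lambda>n. (cmod (of_real (sw (t\<^sup>2) n) * coef X n))\<^sup>2) summable_on UNIV"
    proof (rule summable_on_comparison_test[OF S])
      fix n
      have "(sw (t\<^sup>2) n)\<^sup>2 \<le> (1 + (of_int n)\<^sup>2)\<^sup>2" using sw_ge_1[of "t\<^sup>2" n] by (intro power_mono swu) simp
      then show "(cmod (of_real (sw (t\<^sup>2) n) * coef X n))\<^sup>2 \<le> (1 + (of_int n)\<^sup>2)\<^sup>2 * (cmod (coef X n))\<^sup>2"
        by (simp add: norm_mult power_mult_distrib mult_right_mono)
    qed auto
    from coef_Abs[OF this] obtain x where x: "coef x = (\<lambda>n. of_real (sw (t\<^sup>2) n) * coef X n)" by blast
    have X: "X = unweight t x" by (rule ell2_eqI) (simp add: x sw0)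
    have "coef X 0 = - coef p 0 / of_real g" using R[of 0] neg_mult_eq_iff[of "of_real g" "coef X 0" "coef p 0"] g by (simp add: grow_def)
    then have "coef (cmul (\<i> * \<mu>) (A X) + L X) n = (if n = 0 then - coef p 0 / of_real g else coef p n / (of_int n)\<^sup>2 - q n * (coef p 0 / of_real g))" for n
      using R[of n] unfolding grow_iff[OF g0] by simp
    then have "B t \<mu> x = F" by (intro ell2_eqI) (simp only: coef_B[OF t] F(2) X[symmetric])
    then have "norm x \<le> C * norm F" using C[of x] by simp
    also have "\<dots> \<le> \<bar>C\<bar> * (C' * norm p)" using F(1) by (intro mult_mono) auto
    finally have "norm x \<le> \<bar>C\<bar> * C' * norm p" by (simp add: mult.assoc)
    moreover have "norm X \<le> 1 * norm x"
    proof (rule norm_ell2_mono)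
      show "cmod (coef X n) \<le> 1 * cmod (coef x n)" for n
        using sw_ge_1[of "t\<^sup>2" n] by (simp add: x norm_mult mult_le_cancel_right1)
    qed simp
    ultimately show ?thesis by simp
  qed
  then show "\<exists>C. \<forall>X p. (\<lambda>n. (1 + (of_int n)\<^sup>2)\<^sup>2 * (cmod (coef X n))\<^sup>2) summable_on UNIV \<and> (\<forall>n. grow g \<mu> (coef X) n = coef p n) \<longrightarrow> norm X \<le> C * norm p"
    by blast
qed

end

lemma summable_of_weighted_sq:
  assumes "(\<lambda>n. (1 + (of_int n)\<^sup>2)\<^sup>2 * (cmod (f n))\<^sup>2) summable_on UNIV"
  shows "(\<lambda>n. cmod (f n)) summable_on UNIV"
proof -
  have 1: "1 \<le> 1 + (of_int n :: real)\<^sup>2" and nz: "1 + (of_int n)\<^sup>2 \<noteq> (0 :: real)" for n :: int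
    using zero_le_power2[of "of_int n :: real"] by (linarith, linarith)
  have "(\<lambda>n. (cmod (of_real (1 / (1 + (of_int n)\<^sup>2))))\<^sup>2) summable_on UNIV"
  proof (rule summable_on_comparison_test[OF summable_on_inverse_square_int])
    fix n :: int
    have "(1 / (1 + (of_int n)\<^sup>2))\<^sup>2 \<le> (1 / (1 + (of_int n)\<^sup>2 :: real)) ^ 1"
      by (intro power_decreasing) (simp_all add: divide_le_eq add_pos_nonneg)
    then show "(cmod (of_real (1 / (1 + (of_int n)\<^sup>2))))\<^sup>2 \<le> 1 / (1 + (of_int n)\<^sup>2)"
      unfolding norm_of_real by simp
  qed auto
  moreover have "(\<lambda>n. (cmod (of_real (1 + (of_int n)\<^sup>2) * f n))\<^sup>2) summable_on UNIV"
    using assms by (simp only: norm_mult norm_of_real power_mult_distrib power2_abs)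
  ultimately have "(\<lambda>n. cmod (of_real (1 / (1 + (of_int n)\<^sup>2))) * cmod (of_real (1 + (of_int n)\<^sup>2) * f n)) summable_on UNIV"
    by (rule summable_on_mult_sq)
  moreover have "cmod (of_real (1 / (1 + (of_int n)\<^sup>2))) * cmod (of_real (1 + (of_int n)\<^sup>2) * f n) = cmod (f n)" for n :: int
    unfolding norm_mult norm_of_real using nz[of n] by (simp add: abs_divide)
  ultimately show ?thesis by (simp only:)
qed

text \<open>For b \<le> 0 the domain is H2, whose elements agree almost everywhere with their
  absolutely convergent series; so surjectivity, injectivity and the bound come from those for
  sequences. The factor 3 is due to 2 pi \<le> 9.\<close>

lemma (in profile) invertible_from_definite:
  fixes k c \<gamma> \<alpha>1 \<alpha>2 \<rho> b :: real and j :: "real \<Rightarrow> real"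
  assumes k: "k > 0" and b: "b \<le> 0" and g: "\<rho>\<^sup>2 + \<gamma> > 0" and \<mu>: "Re \<mu> > 0"
  defines "q \<equiv> wave_q k \<alpha>1 \<alpha>2 (c - wave_c0 j \<gamma> k)" and "d \<equiv> \<lambda>n. if n = 0 then 1 else disp j \<gamma> k \<rho> n"
  assumes S: "definite_symbol d q \<delta> \<rho>2 Bd" and \<kappa>: "wnorm 2 q \<le> \<delta> / 2"
    and inj: "\<And>x. cmul (\<i> * \<mu>) (definite_symbol.A x) + definite_symbol.L d q x = 0 \<Longrightarrow> x = 0"
  shows "G_invertible j b \<gamma> \<alpha>1 \<alpha>2 k \<eta> c \<mu> \<rho>"
proof -
  interpret S: definite_symbol d q \<delta> \<rho>2 Bd by (rule S)
  have row: "G_coeff j \<gamma> \<alpha>1 \<alpha>2 k \<eta> c \<mu> \<rho> \<phi> n = S.grow (\<rho>\<^sup>2 + \<gamma>) \<mu> (fourier \<phi>) n" if \<phi>: "integrable torus \<phi>" for \<phi> n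
  proof (cases "n = 0")
    case True
    show ?thesis unfolding True S.grow_def if_P[OF refl] by (rule G_coeff_eq(2)[OF k \<phi>])
  next
    case False
    then have dn: "d n = disp j \<gamma> k \<rho> n" by (simp add: d_def)
    show ?thesis unfolding S.grow_def if_not_P[OF False] dn unfolding q_def by (rule G_coeff_eq(1)[OF k \<phi> False])
  qed
  have w: "(1 + (of_int n)\<^sup>2 :: real) powr (2 + max b 0) = (1 + (of_int n)\<^sup>2)\<^sup>2" for n :: int
    using b zero_le_power2[of "of_int n :: real"] by (simp add: max_def powr_numeral add_pos_nonneg)
  have dom: "\<phi> \<in> sobolevT (2 + max b 0) \<longleftrightarrow> \<phi> \<in> L2T \<and> (\<lambda>n. (1 + (of_int n)\<^sup>2)\<^sup>2 * (cmod (fourier \<phi> n))\<^sup>2) summable_on UNIV" for \<phi>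
    unfolding sobolevT_def w by simp
  have \<kappa>': "S.\<kappa> \<le> \<delta> / 2" using \<kappa> by (simp add: S.\<kappa>_def)
  have L2: "\<exists>p. coef p = fourier \<psi> \<and> norm p \<le> L2T_norm \<psi>" if \<psi>: "\<psi> \<in> L2T" for \<psi>
  proof -
    from coef_Abs[OF Bessel(1)[OF \<psi>]] obtain p where p: "coef p = fourier \<psi>" by blast
    have "(norm p)\<^sup>2 \<le> (L2T_norm \<psi>)\<^sup>2"
    proof -
      have "1 * (norm p)\<^sup>2 \<le> 2 * pi * (norm p)\<^sup>2" using pi_gt3 by (intro mult_right_mono) auto
      then show ?thesis using Bessel(2)[OF \<psi>] by (simp add: norm_ell2_sq p)
    qed
    then have "norm p \<le> L2T_norm \<psi>" by (rule power2_le_imp_le) (rule L2T_norm_nonneg)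
    with p show ?thesis by blast
  qed
  have surj: "\<exists>\<phi>\<in>sobolevT (2 + max b 0). G_maps j \<gamma> \<alpha>1 \<alpha>2 k \<eta> c \<mu> \<rho> \<phi> \<psi>" if \<psi>: "\<psi> \<in> L2T" for \<psi>
  proof -
    obtain p where p: "coef p = fourier \<psi>" using L2[OF \<psi>] by blast
    obtain X where X: "(\<lambda>n. (1 + (of_int n)\<^sup>2)\<^sup>2 * (cmod (coef X n))\<^sup>2) summable_on UNIV" "\<And>n. S.grow (\<rho>\<^sup>2 + \<gamma>) \<mu> (coef X) n = coef p n"
      using S.sequence_invertible(1)[OF \<mu> \<kappa>' inj g, of p] by blast
    note s = summable_of_weighted_sq[OF X(1)]
    have f: "fourier (fser (coef X)) = coef X" using fourier_fser[OF s] by auto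
    have "fser (coef X) \<in> sobolevT (2 + max b 0)" unfolding dom f using X(1) fser_L2T[OF s] by simp
    moreover have "G_maps j \<gamma> \<alpha>1 \<alpha>2 k \<eta> c \<mu> \<rho> (fser (coef X)) \<psi>"
      unfolding G_maps_def row[OF fser_integrable[OF s]] f X(2) p using \<psi> by simp
    ultimately show ?thesis by blast
  qed
  obtain C where C: "\<And>X p. (\<lambda>n. (1 + (of_int n)\<^sup>2)\<^sup>2 * (cmod (coef X n))\<^sup>2) summable_on UNIV \<Longrightarrow> (\<And>n. S.grow (\<rho>\<^sup>2 + \<gamma>) \<mu> (coef X) n = coef p n) \<Longrightarrow> norm X \<le> C * norm p"
    using S.sequence_invertible(2)[OF \<mu> \<kappa>' inj g] by blast
  have bound: "\<exists>X. coef X = fourier \<phi> \<and> norm X \<le> \<bar>C\<bar> * L2T_norm \<psi> \<and> (AE z in torus. \<phi> z = fser (coef X) z) \<and> L2T_norm \<phi> \<le> 3 * norm X"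
    if \<phi>: "\<phi> \<in> sobolevT (2 + max b 0)" and G: "G_maps j \<gamma> \<alpha>1 \<alpha>2 k \<eta> c \<mu> \<rho> \<phi> \<psi>" for \<phi> \<psi>
  proof -
    have \<phi>2: "\<phi> \<in> L2T" and ws: "(\<lambda>n. (1 + (of_int n)\<^sup>2)\<^sup>2 * (cmod (fourier \<phi> n))\<^sup>2) summable_on UNIV" using \<phi> unfolding dom by auto
    have \<psi>: "\<psi> \<in> L2T" using G by (simp add: G_maps_def)
    obtain X where X: "coef X = fourier \<phi>" using L2[OF \<phi>2] by blast
    obtain p where p: "coef p = fourier \<psi>" "norm p \<le> L2T_norm \<psi>" using L2[OF \<psi>] by blast
    note i = L2T_integrable[OF \<phi>2]
    have "norm X \<le> C * norm p"
    proof (rule C)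
      show "(\<lambda>n. (1 + (of_int n)\<^sup>2)\<^sup>2 * (cmod (coef X n))\<^sup>2) summable_on UNIV" unfolding X by (rule ws)
      show "S.grow (\<rho>\<^sup>2 + \<gamma>) \<mu> (coef X) n = coef p n" for n
        using G unfolding G_maps_def row[OF i] X p(1) by simp
    qed
    also have "\<dots> \<le> \<bar>C\<bar> * L2T_norm \<psi>" using p(2) by (intro mult_mono) auto
    finally have n: "norm X \<le> \<bar>C\<bar> * L2T_norm \<psi>" .
    note s = summable_of_weighted_sq[OF ws]
    have AE: "AE z in torus. \<phi> z = fser (coef X) z" unfolding X by (rule AE_eq_fser[OF i s])
    have "L2T_norm \<phi> = L2T_norm (fser (coef X))"
      by (rule L2T_norm_cong_AE[OF AE]) (use \<phi>2 s in \<open>simp_all add: L2T_def X fser_measurable\<close>)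
    moreover have "(L2T_norm (fser (coef X)))\<^sup>2 \<le> (3 * norm X)\<^sup>2"
    proof -
      have "2 * pi * (norm X)\<^sup>2 \<le> 9 * (norm X)\<^sup>2" using pi_less_4 by (intro mult_right_mono) auto
      then show ?thesis using Parseval_fser(2)[OF s] unfolding X[symmetric] by (simp add: norm_ell2_sq power_mult_distrib)
    qed
    then have "L2T_norm (fser (coef X)) \<le> 3 * norm X" by (rule power2_le_imp_le) simp
    ultimately show ?thesis using X n AE by auto
  qed
  have z: "L2T_norm (\<lambda>_. 0) = 0" by (simp add: L2T_norm_def)
  have "AE z in torus. \<phi> z = 0" if \<phi>: "\<phi> \<in> sobolevT (2 + max b 0)" "G_maps j \<gamma> \<alpha>1 \<alpha>2 k \<eta> c \<mu> \<rho> \<phi> (\<lambda>_. 0)" for \<phi>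
  proof -
    obtain X where X: "norm X \<le> 0" "AE z in torus. \<phi> z = fser (coef X) z" using bound[OF \<phi>] unfolding z by auto
    have "fser (coef X) z = 0" for z using X(1) by (simp add: fser_def)
    then show ?thesis using X(2) by simp
  qed
  moreover have "\<exists>C. \<forall>\<phi>\<in>sobolevT (2 + max b 0). \<forall>\<psi>. G_maps j \<gamma> \<alpha>1 \<alpha>2 k \<eta> c \<mu> \<rho> \<phi> \<psi> \<longrightarrow> L2T_norm \<phi> \<le> C * L2T_norm \<psi>"
  proof (rule exI[of _ "3 * \<bar>C\<bar>"], intro ballI allI impI)
    fix \<phi> \<psi> assume "\<phi> \<in> sobolevT (2 + max b 0)" "G_maps j \<gamma> \<alpha>1 \<alpha>2 k \<eta> c \<mu> \<rho> \<phi> \<psi>"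
    from bound[OF this] show "L2T_norm \<phi> \<le> 3 * \<bar>C\<bar> * L2T_norm \<psi>" by fastforce
  qed
  ultimately show ?thesis using surj unfolding G_invertible_def Let_def by blast
qed

lemma norm_ell2_le_sum:
  assumes f: "(f has_sum S) UNIV" and le: "\<And>n. cmod (coef x n) \<le> f n"
  shows "norm x \<le> S"
proof (rule power2_le_imp_le)
  have f0: "0 \<le> f n" for n using le[of n] norm_ge_zero order_trans by blast
  have s: "f summable_on UNIV" and S: "(\<Sum>\<^sub>\<infinity>n. f n) = S" using f by (auto simp: has_sum_iff)
  have fS: "f n \<le> S" for n using finite_sum_le_infsum[OF s, of "{n}"] f0 by (simp add: S)
  have "(\<Sum>\<^sub>\<infinity>n. (cmod (coef x n))\<^sup>2) \<le> (\<Sum>\<^sub>\<infinity>n. S * f n)"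
  proof (intro infsum_mono summable_coef_sq summable_on_cmult_right s)
    show "(cmod (coef x n))\<^sup>2 \<le> S * f n" for n
      unfolding power2_eq_square using le[of n] fS[of n] f0[of n] by (intro mult_mono) auto
  qed
  then show "(norm x)\<^sup>2 \<le> S\<^sup>2" unfolding norm_ell2_sq infsum_cmult_right' S power2_eq_square[of S] .
  show "0 \<le> S" using f0[of 0] fS[of 0] by linarith
qed

context definite_symbol
begin

lemma coef_Q_unit: "m \<noteq> 0 \<Longrightarrow> coef (Q (unit m)) n = (if n = 0 then 0 else q (n - m))"
proof -
  assume m: "m \<noteq> 0"
  have "coef (Q (unit m)) n = (\<Sum>\<^sub>\<infinity>l\<in>{m}. Qk n l)"
    unfolding Q_def coef_kop[OF Q_dom] by (rule infsum_cong_neutral) auto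
  then show ?thesis using m by (simp add: Qk_def)
qed

lemma coef_L_two_mode:
  fixes \<beta> :: real
  assumes "n \<noteq> 0"
  defines "z \<equiv> unit 1 + unit (-1) + cmul (of_real \<beta>) (unit 2 + unit (-2))"
  shows "coef (L z) n = of_real (d n) * coef z n - (q (n - 1) + q (n + 1) + of_real \<beta> * (q (n - 2) + q (n + 2)))"
proof -
  have "Q (cmul (of_real \<beta>) (unit 2 + unit (-2))) = cmul (of_real \<beta>) (Q (unit 2 + unit (-2)))"
    unfolding Q_def by (rule kop_cmul[OF Q_dom])
  then show ?thesis using assms(1) by (simp add: L_def z_def Q.add coef_Q_unit)
qed

text \<open>\<open>s\<close> is the first harmonic of \<open>q\<close>. It sends the modes 1, -1 to
  2, -2, where \<open>d 2 * \<beta>\<close> may cancel it, and the modes 2, -2 to 3, -3, which gives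
  \<open>\<beta> * s\<close>; the remainder \<open>r\<close> acts through four shifts.\<close>

lemma norm_tail_two_mode:
  fixes s W \<beta> :: real
  defines "r \<equiv> \<lambda>n. q n - (if \<bar>n\<bar> = 1 then of_real s else 0)" and "z \<equiv> unit 1 + unit (-1) + cmul (of_real \<beta>) (unit 2 + unit (-2))"
  assumes r: "(\<lambda>n. cmod (r n)) summable_on UNIV" "(\<Sum>\<^sub>\<infinity>n. cmod (r n)) \<le> W" and \<beta>: "\<bar>\<beta>\<bar> \<le> 1"
  shows "norm (tail (L z)) \<le> 2 * \<bar>d 2 * \<beta> - s\<bar> + 2 * \<bar>\<beta> * s\<bar> + 4 * W"
proof -
  let ?R = "\<Sum>\<^sub>\<infinity>n. cmod (r n)"
  have sh: "((\<lambda>n. cmod (r (n - m))) has_sum ?R) UNIV" for m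
    using summable_on_int_shift(2)[OF r(1), of m] infsum_int_shift(2)[of "\<lambda>n. cmod (r n)" m] by (simp add: has_sum_iff)
  have sh': "((\<lambda>n. cmod (r (n + m))) has_sum ?R) UNIV" for m using sh[of "- m"] by simp
  define f2 where "f2 n = (if \<bar>n\<bar> = 2 then \<bar>d 2 * \<beta> - s\<bar> else 0)" for n :: int
  define f3 where "f3 n = (if \<bar>n\<bar> = 3 then \<bar>\<beta> * s\<bar> else 0)" for n :: int
  have f2: "(f2 has_sum (\<Sum>n\<in>{2, -2}. f2 n)) UNIV" by (rule has_sum_finite_neutralI[of "{2, -2}"]) (auto simp: f2_def)
  have f3: "(f3 has_sum (\<Sum>n\<in>{3, -3}. f3 n)) UNIV" by (rule has_sum_finite_neutralI[of "{3, -3}"]) (auto simp: f3_def)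
  have "norm (tail (L z)) \<le> ((\<Sum>n\<in>{2, -2}. f2 n) + (\<Sum>n\<in>{3, -3}. f3 n)) + (?R + ?R + (?R + ?R))"
  proof (rule norm_ell2_le_sum)
    show "((\<lambda>n. f2 n + f3 n + (cmod (r (n - 1)) + cmod (r (n + 1)) + (cmod (r (n - 2)) + cmod (r (n + 2))))) has_sum
        ((\<Sum>n\<in>{2, -2}. f2 n) + (\<Sum>n\<in>{3, -3}. f3 n)) + (?R + ?R + (?R + ?R))) UNIV"
      by (intro has_sum_add f2 f3 sh sh')
    fix n :: int
    let ?rest = "r (n - 1) + r (n + 1) + of_real \<beta> * (r (n - 2) + r (n + 2))"
    have rest: "cmod ?rest \<le> cmod (r (n - 1)) + cmod (r (n + 1)) + (cmod (r (n - 2)) + cmod (r (n + 2)))"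
    proof -
      have "cmod (of_real \<beta> * (r (n - 2) + r (n + 2))) \<le> 1 * cmod (r (n - 2) + r (n + 2))"
        unfolding norm_mult using \<beta> by (intro mult_right_mono) auto
      then show ?thesis
        using norm_triangle_ineq[of "r (n - 1) + r (n + 1)" "of_real \<beta> * (r (n - 2) + r (n + 2))"]
          norm_triangle_ineq[of "r (n - 1)" "r (n + 1)"] norm_triangle_ineq[of "r (n - 2)" "r (n + 2)"] by linarith
    qed
    have d2: "d (-2) = d 2" using d_even[of 2] by simp
    show "cmod (coef (tail (L z)) n) \<le> f2 n + f3 n + (cmod (r (n - 1)) + cmod (r (n + 1)) + (cmod (r (n - 2)) + cmod (r (n + 2))))"
    proof (cases "\<bar>n\<bar> \<ge> 2")
      case True
      then have n0: "n \<noteq> 0" by auto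
      define m where "m = (if \<bar>n\<bar> = 2 then of_real (d 2 * \<beta> - s) else if \<bar>n\<bar> = 3 then - of_real (\<beta> * s) else 0 :: complex)"
      have eq: "coef (L z) n = m - ?rest"
      proof -
        consider "n = 2" | "n = -2" | "n = 3" | "n = -3" | "\<bar>n\<bar> \<ge> 4" using True by fastforce
        then show ?thesis unfolding z_def coef_L_two_mode[OF n0] r_def m_def
        proof cases
          case 5
          then have "n \<noteq> 1" "n \<noteq> -1" "n \<noteq> 2" "n \<noteq> -2" "n \<noteq> 3" "n \<noteq> -3" "\<bar>n - 1\<bar> \<noteq> 1" "\<bar>n + 1\<bar> \<noteq> 1" "\<bar>n - 2\<bar> \<noteq> 1" "\<bar>n + 2\<bar> \<noteq> 1" "\<bar>n\<bar> \<noteq> 2" "\<bar>n\<bar> \<noteq> 3" by auto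
          then show "of_real (d n) * coef (unit 1 + unit (-1) + cmul (of_real \<beta>) (unit 2 + unit (-2))) n - (q (n - 1) + q (n + 1) + of_real \<beta> * (q (n - 2) + q (n + 2)))
            = (if \<bar>n\<bar> = 2 then of_real (d 2 * \<beta> - s) else if \<bar>n\<bar> = 3 then - of_real (\<beta> * s) else 0)
            - (q (n - 1) - (if \<bar>n - 1\<bar> = 1 then of_real s else 0) + (q (n + 1) - (if \<bar>n + 1\<bar> = 1 then of_real s else 0)) +
              of_real \<beta> * (q (n - 2) - (if \<bar>n - 2\<bar> = 1 then of_real s else 0) + (q (n + 2) - (if \<bar>n + 2\<bar> = 1 then of_real s else 0))))" by simp
        qed (simp_all add: d2 algebra_simps)
      qed
      have "cmod m \<le> f2 n + f3 n"
        unfolding m_def f2_def f3_def by (auto simp: norm_minus_cancel norm_of_real simp del: of_real_mult of_real_diff)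
      then show ?thesis using True rest norm_triangle_ineq4[of m ?rest] by (simp add: eq)
    qed (simp add: f2_def f3_def)
  qed
  then show ?thesis using r(2) by (simp add: f2_def f3_def)
qed

end

lemma (in profile) h_mult_wfinite: "wfinite 0 (\<lambda>n. of_int n * h n)"
  unfolding wfinite_def
proof (rule summable_on_comparison_test)
  show "(\<lambda>n. wt 1 n * cmod (h n)) summable_on UNIV" using h_wfinite[of 1] by (simp add: wfinite_def)
  show "wt 0 n * cmod (of_int n * h n) \<le> wt 1 n * cmod (h n)" for n by (simp add: wt_def norm_mult mult_right_mono)
qed auto

text \<open>Coefficient form of (\<eta>^2)' = 2 \<eta> \<eta>': the sum is averaged with its image
  under m \<mapsto> n - m.\<close>

lemma (in profile) conv_derivative: "conv h (\<lambda>n. of_int n * h n) n = of_int n * conv h h n / 2"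
proof -
  have s: "(\<lambda>m. h (n - m) * (of_int m * h m)) summable_on UNIV" by (rule wfinite_conv(3)[OF h_wfinite h_mult_wfinite])
  have s': "(\<lambda>m. h m * (of_int (n - m) * h (n - m))) summable_on UNIV"
    using summable_on_int_shift(1)[OF s, of n] by simp
  have "conv h (\<lambda>n. of_int n * h n) n = (\<Sum>\<^sub>\<infinity>m. h m * (of_int (n - m) * h (n - m)))"
    unfolding conv_def using infsum_int_shift(1)[of "\<lambda>m. h (n - m) * (of_int m * h m)" n] by simp
  then have "2 * conv h (\<lambda>n. of_int n * h n) n = (\<Sum>\<^sub>\<infinity>m. h (n - m) * (of_int m * h m)) + (\<Sum>\<^sub>\<infinity>m. h m * (of_int (n - m) * h (n - m)))"
    unfolding conv_def by simp
  also have "\<dots> = (\<Sum>\<^sub>\<infinity>m. h (n - m) * (of_int m * h m) + h m * (of_int (n - m) * h (n - m)))"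
    by (rule infsum_add[OF s s', symmetric])
  also have "\<dots> = (\<Sum>\<^sub>\<infinity>m. of_int n * (h (n - m) * h m))" by (rule infsum_cong) (simp add: algebra_simps)
  also have "\<dots> = of_int n * conv h h n" unfolding conv_def by (rule infsum_cmult_right')
  finally show ?thesis by (simp add: nonzero_eq_divide_eq mult.commute)
qed

text \<open>Differentiating the travelling wave equation shows that \<open>\<eta>'\<close> spans the kernel of the linearization
  at \<open>\<rho> = 0\<close>, \<open>\<mu> = 0\<close>.\<close>

lemma (in profile) derivative_kernel:
  fixes k c \<gamma> \<rho> :: real and j :: "real \<Rightarrow> real"
  assumes k: "k > 0" and n: "n \<noteq> 0"
    and st: "of_real (k\<^sup>2 * (of_int n)\<^sup>2) * (of_real (c - j (k * of_int n)) * h n - conv h h n) = of_real \<gamma> * h n"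
  shows "of_real (disp j \<gamma> k \<rho> n) * (of_int n * h n) - conv (wave_q k 1 0 (c - wave_c0 j \<gamma> k)) (\<lambda>n. of_int n * h n) n
    = - of_real (\<rho>\<^sup>2) * (of_int n * h n) / (of_int n)\<^sup>2"
proof -
  let ?Y = "\<lambda>n. of_int n * h n" and ?a = "c - wave_c0 j \<gamma> k" and ?N = "of_int n :: complex"
  have w0: "wfinite 0 (\<lambda>n. if n = 0 then - of_real (k\<^sup>2 * ?a) else 0)" by (rule wfinite_finite(1)[of "{0}"]) auto
  have q: "wave_q k 1 0 ?a = (\<lambda>n. of_real (2 * k\<^sup>2) * h n + (if n = 0 then - of_real (k\<^sup>2 * ?a) else 0))"
    by (auto simp: fun_eq_iff wave_q_eq algebra_simps)
  have "conv (\<lambda>n. if n = 0 then - of_real (k\<^sup>2 * ?a) else 0) ?Y n = (\<Sum>\<^sub>\<infinity>m\<in>{n}. - of_real (k\<^sup>2 * ?a) * ?Y m)"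
    unfolding conv_def by (rule infsum_cong_neutral) auto
  moreover have "conv (\<lambda>n. of_real (2 * k\<^sup>2) * h n) ?Y n = of_real (2 * k\<^sup>2) * conv h ?Y n"
    unfolding conv_def infsum_cmult_right'[symmetric] by (simp only: mult.assoc)
  ultimately have cq: "conv (wave_q k 1 0 ?a) ?Y n = of_real (k\<^sup>2) * (?N * conv h h n) - of_real (k\<^sup>2 * ?a) * ?Y n"
    unfolding q conv_add_left[OF wfinite_cmult(1)[OF h_wfinite] w0 h_mult_wfinite] conv_derivative by simp
  have N: "?N \<noteq> 0" using n by simp
  have K: "k\<^sup>2 * wave_c0 j \<gamma> k = k\<^sup>2 * j k + \<gamma>" using k by (simp add: wave_c0_def field_simps)
  have dd: "disp j \<gamma> k \<rho> n + k\<^sup>2 * ?a = k\<^sup>2 * (c - j (k * of_int n)) - (\<gamma> + \<rho>\<^sup>2) / (of_int n)\<^sup>2"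
    unfolding disp_def right_diff_distrib K by simp
  have st': "of_real (k\<^sup>2) * conv h h n = of_real (k\<^sup>2 * (c - j (k * of_int n))) * h n - of_real \<gamma> * h n / ?N\<^sup>2"
  proof -
    have "?N\<^sup>2 * (of_real (k\<^sup>2 * (c - j (k * of_int n))) * h n - of_real (k\<^sup>2) * conv h h n) = of_real \<gamma> * h n"
      using st by (simp add: algebra_simps)
    then have "of_real (k\<^sup>2 * (c - j (k * of_int n))) * h n - of_real (k\<^sup>2) * conv h h n = of_real \<gamma> * h n / ?N\<^sup>2"
      using N by (simp add: nonzero_eq_divide_eq mult.commute)
    then show ?thesis by (simp only: diff_eq_eq eq_diff_eq) (simp add: add.commute)
  qed
  have "of_real (disp j \<gamma> k \<rho> n) * ?Y n - conv (wave_q k 1 0 ?a) ?Y n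
      = of_real (disp j \<gamma> k \<rho> n + k\<^sup>2 * ?a) * ?Y n - ?N * (of_real (k\<^sup>2) * conv h h n)"
    unfolding cq by (simp add: algebra_simps)
  also have "\<dots> = - of_real (\<rho>\<^sup>2) * ?Y n / ?N\<^sup>2"
    unfolding dd st' using N by (simp add: algebra_simps add_divide_distrib)
  finally show ?thesis .
qed

section \<open>Consequences of the growth hypothesis, and stability for decreasing symbols\<close>

lemma symbol_lower_bound: "hyp_J2 j b \<Longrightarrow> \<exists>A>0. \<forall>\<^sub>F \<kappa> in at_top. A * \<kappa> powr b \<le> j \<kappa>"
proof -
  assume "hyp_J2 j b"
  then obtain A1 A2 where A: "A1 > 0" "\<forall>\<^sub>F \<kappa> in at_top. A1 * \<kappa> powr b \<le> j \<kappa> \<and> j \<kappa> \<le> A2 * \<kappa> powr b"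
    unfolding hyp_J2_def by blast
  from A(2) have "\<forall>\<^sub>F \<kappa> in at_top. A1 * \<kappa> powr b \<le> j \<kappa>" by (rule eventually_mono) simp
  with A(1) show ?thesis by blast
qed

text \<open>For b > 0 the lower bound on the symbol would be unbounded. Where the lemma is applied,
  its conclusion makes H2 the domain of the operator.\<close>

lemma symbol_bounded_imp:
  assumes "hyp_J2 j b" and B: "\<And>x. x \<ge> x0 \<Longrightarrow> j x \<le> B"
  shows "b \<le> 0"
proof (rule ccontr)
  assume "\<not> b \<le> 0"
  obtain A1 where A1: "A1 > 0" "\<forall>\<^sub>F \<kappa> in at_top. A1 * \<kappa> powr b \<le> j \<kappa>"
    using symbol_lower_bound[OF assms(1)] by blast
  have "filterlim (\<lambda>\<kappa>. A1 * exp (b * ln \<kappa>)) at_top at_top"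
    using \<open>\<not> b \<le> 0\<close> A1(1)
    by (intro filterlim_tendsto_pos_mult_at_top[OF tendsto_const] filterlim_compose[OF exp_at_top] ln_at_top) auto
  moreover have "\<forall>\<^sub>F \<kappa> in at_top. A1 * exp (b * ln \<kappa>) = A1 * \<kappa> powr b"
    using eventually_gt_at_top[of 0] by eventually_elim (simp add: powr_def)
  ultimately have "filterlim (\<lambda>\<kappa>. A1 * \<kappa> powr b) at_top at_top" by (simp only: filterlim_cong[OF refl refl])
  then have "\<forall>\<^sub>F \<kappa> in at_top. B < A1 * \<kappa> powr b" by (simp add: filterlim_at_top_dense)
  then have "\<forall>\<^sub>F \<kappa> in at_top. B < A1 * \<kappa> powr b \<and> A1 * \<kappa> powr b \<le> j \<kappa> \<and> \<kappa> \<ge> x0"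
    using A1(2) eventually_ge_at_top[of x0] by eventually_elim auto
  then obtain \<kappa> where "B < A1 * \<kappa> powr b" "A1 * \<kappa> powr b \<le> j \<kappa>" "\<kappa> \<ge> x0"
    using eventually_happens[of _ "at_top :: real filter"] by auto
  then show False using B[of \<kappa>] by linarith
qed

lemma symbol_eventually_pos:
  assumes "hyp_J2 j b"
  shows "\<exists>y>x. j y > 0"
proof -
  obtain A1 where A1: "A1 > 0" "\<forall>\<^sub>F \<kappa> in at_top. A1 * \<kappa> powr b \<le> j \<kappa>"
    using symbol_lower_bound[OF assms] by blast
  have "\<forall>\<^sub>F \<kappa> in at_top. A1 * \<kappa> powr b \<le> j \<kappa> \<and> \<kappa> > max x 0"
    using A1(2) eventually_gt_at_top[of "max x 0"] by eventually_elim auto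
  then obtain \<kappa> where \<kappa>: "A1 * \<kappa> powr b \<le> j \<kappa>" "\<kappa> > x" "\<kappa> > 0"
    using eventually_happens[of _ "at_top :: real filter"] by auto
  have "A1 * \<kappa> powr b > 0" using A1(1) \<kappa>(3) by simp
  then show ?thesis using \<kappa> by (intro exI[of _ \<kappa>]) auto
qed

theorem stable_decreasing:
  assumes \<gamma>: "\<gamma> > 0" and k: "k > 0" and jeven: "\<And>x. j (- x) = j x" and J2: "hyp_J2 j b" and dec: "strict_antimono_on {0<..} j"
    and tw: "traveling_wave_family j \<gamma> 1 0 k \<eta> c"
  shows "long_wave_stable j b \<gamma> 1 0 k \<eta> c"
proof -
  have mono: "j y < j x" if "0 < x" "x < y" for x y
    using dec that by (simp add: monotone_on_def)
  \<comment> \<open>A decreasing symbol is positive because it is positive at arbitrarily large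
    arguments.\<close>
  have jpos: "j x > 0" if "x > 0" for x
  proof -
    obtain y where "y > x" "j y > 0" using symbol_eventually_pos[OF J2, of x] by blast
    then show ?thesis using mono[OF that, of y] by linarith
  qed
  have b: "b \<le> 0"
  proof (rule symbol_bounded_imp[OF J2])
    show "j x \<le> j k" if "x \<ge> k" for x using mono[OF k, of x] that by (cases "x = k") auto
  qed
  have jle: "0 \<le> j (k * of_int n)" "j (k * of_int n) \<le> j k" if "n \<noteq> 0" for n :: int
  proof -
    have "j (k * of_int n) = j (k * \<bar>of_int n\<bar>)" using jeven[of "k * of_int n"] by (cases "n \<ge> 0") (auto simp: abs_if)
    moreover have "k * \<bar>of_int n\<bar> \<ge> k" using k that by simp
    ultimately show "0 \<le> j (k * of_int n)" "j (k * of_int n) \<le> j k"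
      using mono[OF k, of "k * \<bar>of_int n\<bar>"] jpos[of "k * \<bar>of_int n\<bar>"] k by (cases "k * \<bar>of_int n\<bar> = k"; force)+
  qed
  have jb: "\<bar>j (k * of_int n)\<bar> \<le> \<bar>j 0\<bar> + j k" for n :: int
    using jle[of n] jpos[OF k] by (cases "n = 0") auto
  define e2 where "e2 = wave_eta2 j \<gamma> 1 k"
  have j2: "j k - j (2 * k) > 0" using mono[OF k, of "2 * k"] k by simp
  then have den: "3 * \<gamma> + 4 * k\<^sup>2 * (j k - j (2 * k)) > 0" using \<gamma> k by (simp add: add_pos_pos)
  have e2: "e2 > 0" unfolding e2_def wave_eta2_def using den k by simp
  \<comment> \<open>\<open>2 * e2\<close> is \<open>k\<^sup>2\<close> divided by the value of
    \<open>d 2\<close> at \<rho> = 0; this is what later cancels the forcing of mode 2.\<close>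
  have e2d: "(3 * \<gamma> / 4 + k\<^sup>2 * (j k - j (2 * k))) * (2 * e2) = k\<^sup>2"
    unfolding e2_def wave_eta2_def using den by (simp add: field_simps)
  have c2: "wave_c2 j \<gamma> 1 0 k = e2" by (simp add: wave_c2_def e2_def)
  obtain \<epsilon>1 C where e1: "\<epsilon>1 > 0" "\<epsilon>1 \<le> 1" "C \<ge> 0" and tw': "\<And>\<epsilon>. 0 < \<bar>\<epsilon>\<bar> \<Longrightarrow> \<bar>\<epsilon>\<bar> < \<epsilon>1 \<Longrightarrow>
      profile (\<eta> \<epsilon>) \<and> gRMKP_solution j \<gamma> 1 0 k (\<lambda>x y t. \<eta> \<epsilon> (k * (x - c \<epsilon> * t))) \<and>
      wfinite 2 (\<lambda>n. profile.h (\<eta> \<epsilon>) n - h0 e2 \<epsilon> n) \<and> wnorm 2 (\<lambda>n. profile.h (\<eta> \<epsilon>) n - h0 e2 \<epsilon> n) \<le> C * \<bar>\<epsilon>\<bar> ^ 3 \<and>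
      wfinite 2 (\<lambda>n. profile.wave_q (\<eta> \<epsilon>) k 1 0 (c \<epsilon> - wave_c0 j \<gamma> k) n - q0 k 1 0 e2 \<epsilon> n) \<and>
      wnorm 2 (\<lambda>n. profile.wave_q (\<eta> \<epsilon>) k 1 0 (c \<epsilon> - wave_c0 j \<gamma> k) n - q0 k 1 0 e2 \<epsilon> n) \<le> C * \<bar>\<epsilon>\<bar> ^ 3"
    using wave_q_asymptotics[OF tw, of 2] unfolding c2 e2_def by blast
  \<comment> \<open>\<open>K * \<epsilon>\<^sup>2\<close> is the leading part of \<open>q 2\<close>,
    positive as the symbol is decreasing. \<open>C4\<close>, \<open>Cr\<close> and \<open>Cg\<close>
    bound \<open>q\<close>, \<open>q\<close> without its first harmonic, and \<open>h\<close>
    without its first harmonic, relative to \<open>E\<close>, \<open>E\<^sup>2\<close> and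
    \<open>E\<^sup>2\<close>.\<close>
  define K where "K = k\<^sup>2 * e2"
  have K: "K > 0" using k e2 by (simp add: K_def)
  define C4 where "C4 = 8 * k\<^sup>2 + 19 * K + C"
  define Cr where "Cr = 19 * K + C"
  define Cg where "Cg = 9 * e2 + C"
  have C4: "C4 \<ge> 0" and Cr: "Cr \<ge> 0" and Cg: "Cg \<ge> 0" using K e1 e2 by (auto simp: C4_def Cr_def Cg_def)
  \<comment> \<open>\<open>M\<close> is the constant c of \<open>kernel_trivial\<close>. Its
    summands make \<open>M * (\<rho>2 + K * E\<^sup>2)\<close> dominate both the square of
    \<open>\<rho>2 + 2 * \<kappa>\<close> and the tail \<open>\<xi>\<close>.\<close>
  define M where "M = 6 + 8 * C4\<^sup>2 / K + e2 + 4 * Cr / K"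
  have M: "M \<ge> 2" "M \<ge> e2" "M * K \<ge> 8 * C4\<^sup>2" "M * K \<ge> 4 * K + 4 * Cr"
  proof -
    have nn: "8 * C4\<^sup>2 / K \<ge> 0" "4 * Cr / K \<ge> 0" "0 \<le> e2 * K" using K Cr e2 by simp_all
    show "M \<ge> 2" "M \<ge> e2" using nn e2 unfolding M_def by linarith+
    have "M * K = 6 * K + 8 * C4\<^sup>2 + e2 * K + 4 * Cr" using K by (simp add: M_def distrib_right)
    then show "M * K \<ge> 8 * C4\<^sup>2" "M * K \<ge> 4 * K + 4 * Cr" using nn K Cr zero_le_power2[of C4] by linarith+
  qed
  \<comment> \<open>For \<bar>n\<bar> \<ge> 2 the symbol is at least
    \<open>\<gamma> - (\<gamma> + \<rho>\<^sup>2) / 4\<close>, since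
    \<open>j (k n) \<le> j k\<close>.\<close>
  define \<delta> where "\<delta> = min 1 (\<gamma> / 2)"
  have \<delta>: "\<delta> > 0" "\<delta> \<le> 1" "\<delta> \<le> \<gamma> / 2" using \<gamma> by (auto simp: \<delta>_def)
  define H where "H = 4 * (2 / \<delta>)\<^sup>2"
  have H: "H > 0" using \<delta> by (simp add: H_def)
  obtain ea where ea: "ea > 0" "\<And>\<epsilon>. \<bar>\<epsilon>\<bar> < ea \<Longrightarrow> C4 * \<bar>\<epsilon>\<bar> < \<delta> / 16" using small_enough[of C4 "\<delta> / 16"] C4 \<delta> by auto
  obtain eb where eb: "eb > 0" "\<And>\<epsilon>. \<bar>\<epsilon>\<bar> < eb \<Longrightarrow> (H * M * C4) * \<bar>\<epsilon>\<bar> < 1 / 48"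
    using small_enough[of "H * M * C4" "1 / 48"] C4 H M by auto
  obtain ec where ec: "ec > 0" "\<And>\<epsilon>. \<bar>\<epsilon>\<bar> < ec \<Longrightarrow> (6 * K + 4 * Cg + 2 * e2) * \<bar>\<epsilon>\<bar> < 1"
    using small_enough[of "6 * K + 4 * Cg + 2 * e2" 1] K Cg e2 by auto
  obtain ed where ed: "ed > 0" "\<And>\<epsilon>. \<bar>\<epsilon>\<bar> < ed \<Longrightarrow> (4 * C) * \<bar>\<epsilon>\<bar> < K" using small_enough[of "4 * C" K] e1 K by auto
  define \<epsilon>0 where "\<epsilon>0 = Min {\<epsilon>1, ea, eb, ec, ed}"
  have \<epsilon>0: "\<epsilon>0 > 0" using e1 ea eb ec ed by (simp add: \<epsilon>0_def)
  \<comment> \<open>The bound on \<rho> does not depend on \<epsilon>, and neither parameter is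
    assumed small compared with the other.\<close>
  have "\<not> periodic_instability j b \<gamma> 1 0 k (\<eta> \<epsilon>) (c \<epsilon>) \<rho>"
    if \<epsilon>: "0 < \<bar>\<epsilon>\<bar>" "\<bar>\<epsilon>\<bar> < \<epsilon>0" and \<rho>: "0 < \<bar>\<rho>\<bar>" "\<bar>\<rho>\<bar> \<le> \<delta> / 8" for \<epsilon> \<rho>
  proof -
    have \<epsilon>': "\<bar>\<epsilon>\<bar> < \<epsilon>1" "\<bar>\<epsilon>\<bar> < ea" "\<bar>\<epsilon>\<bar> < eb" "\<bar>\<epsilon>\<bar> < ec" "\<bar>\<epsilon>\<bar> < ed"
      using \<epsilon> by (simp_all add: \<epsilon>0_def)
    define E where "E = \<bar>\<epsilon>\<bar>"
    have E: "E > 0" "E \<le> 1" using \<epsilon> \<epsilon>' e1 by (auto simp: E_def)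
    have E2: "\<epsilon>\<^sup>2 = E\<^sup>2" by (simp add: E_def)
    have Ep: "E\<^sup>2 \<le> E" "E ^ 3 \<le> E\<^sup>2" "E ^ 3 = E * E\<^sup>2" "E ^ 3 \<le> E" "0 < E\<^sup>2" "E\<^sup>2 \<le> 1"
      using E power_decreasing[of 1 2 E] power_decreasing[of 2 3 E] power_decreasing[of 1 3 E] power_le_one[of E 2]
      by (auto simp: power3_eq_cube power2_eq_square)
    have small: "C4 * E < \<delta> / 16" "(H * M * C4) * E < 1 / 48" "(6 * K + 4 * Cg + 2 * e2) * E < 1" "(4 * C) * E < K"
      using ea(2)[OF \<epsilon>'(2)] eb(2)[OF \<epsilon>'(3)] ec(2)[OF \<epsilon>'(4)] ed(2)[OF \<epsilon>'(5)] by (simp_all add: E_def)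
    have KE: "0 \<le> K * E" "0 \<le> Cg * E" "0 \<le> e2 * E" using K Cg e2 E by auto
    have small3: "6 * (K * E) < 1" "4 * (Cg * E) < 1" "2 * (e2 * E) < 1"
      using small(3) KE unfolding distrib_right mult.assoc by linarith+
    define \<rho>2 where "\<rho>2 = \<rho>\<^sup>2"
    have \<rho>2: "0 < \<rho>2" "\<rho>2 \<le> \<delta> / 8" "\<rho>2 \<le> 1 / 8"
    proof -
      show "0 < \<rho>2" using \<rho>(1) by (simp add: \<rho>2_def)
      have "\<bar>\<rho>\<bar> * \<bar>\<rho>\<bar> \<le> (\<delta> / 8) * 1" using \<rho> \<delta> by (intro mult_mono) auto
      then show "\<rho>2 \<le> \<delta> / 8" by (simp add: \<rho>2_def power2_eq_square)
      then show "\<rho>2 \<le> 1 / 8" using \<delta> by simp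
    qed
    interpret profile "\<eta> \<epsilon>" using tw'[of \<epsilon>] \<epsilon> \<epsilon>' by blast
    define q where "q = wave_q k 1 0 (c \<epsilon> - wave_c0 j \<gamma> k)"
    define u where "u n = q n - q0 k 1 0 e2 \<epsilon> n" for n
    have u: "wfinite 2 u" "wnorm 2 u \<le> C * E ^ 3"
      using tw'[of \<epsilon>] \<epsilon> \<epsilon>' unfolding u_def[abs_def] q_def E_def by blast+
    have un: "cmod (u n) \<le> C * E ^ 3" for n using cmod_le_wnorm[OF u(1), of n] u(2) by simp
    have qw: "wfinite 2 q" unfolding q_def by (rule wave_q_wfinite)
    define r where "r n = q n - (if \<bar>n\<bar> = 1 then of_real (k\<^sup>2 * \<epsilon>) else 0)" for n
    have r: "wfinite 2 r" "wnorm 2 r \<le> Cr * E\<^sup>2"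
    proof -
      have eq: "r = (\<lambda>n. q0 k 0 0 e2 \<epsilon> n + u n)" by (auto simp: fun_eq_iff r_def u_def q0_def)
      show "wfinite 2 r" unfolding eq by (rule wfinite_add(1)[OF wnorm_q0(2) u(1)])
      have "wnorm 2 r \<le> wnorm 2 (q0 k 0 0 e2 \<epsilon>) + wnorm 2 u" unfolding eq by (rule wfinite_add(2)[OF wnorm_q0(2) u(1)])
      also have "wnorm 2 (q0 k 0 0 e2 \<epsilon>) = 19 * K * E\<^sup>2" unfolding wnorm_q0(1) E2 using e2 by (simp add: K_def)
      also have "wnorm 2 u \<le> C * E\<^sup>2" using u(2) mult_left_mono[OF Ep(2) e1(3)] by linarith
      finally show "wnorm 2 r \<le> Cr * E\<^sup>2" by (simp add: Cr_def distrib_right)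
    qed
    have \<kappa>: "wnorm 2 q \<le> C4 * E"
    proof -
      have f: "wfinite 2 (\<lambda>n. if \<bar>n\<bar> = 1 then of_real (k\<^sup>2 * \<epsilon>) else 0)"
        "wnorm 2 (\<lambda>n. if \<bar>n\<bar> = 1 then of_real (k\<^sup>2 * \<epsilon>) else 0) = (\<Sum>n\<in>{1, -1}. wt 2 n * cmod (if \<bar>n\<bar> = 1 then of_real (k\<^sup>2 * \<epsilon>) else 0))"
        by (rule wfinite_finite[of "{1, -1}"]; auto)+
      have "q = (\<lambda>n. r n + (if \<bar>n\<bar> = 1 then of_real (k\<^sup>2 * \<epsilon>) else 0))" by (auto simp: r_def fun_eq_iff)
      then have "wnorm 2 q \<le> wnorm 2 r + wnorm 2 (\<lambda>n. if \<bar>n\<bar> = 1 then of_real (k\<^sup>2 * \<epsilon>) else 0)"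
        using wfinite_add(2)[OF r(1) f(1)] by simp
      also have "wnorm 2 (\<lambda>n. if \<bar>n\<bar> = 1 then of_real (k\<^sup>2 * \<epsilon>) else 0) = 8 * k\<^sup>2 * E"
        unfolding f(2) E_def by (simp add: wt_def norm_mult norm_power)
      also have "wnorm 2 r \<le> Cr * E" using r(2) mult_left_mono[OF Ep(1) Cr] by linarith
      finally show ?thesis by (simp add: C4_def Cr_def algebra_simps)
    qed
    define d where "d n = (if n = 0 then 1 else disp j \<gamma> k \<rho> n)" for n :: int
    define Bd where "Bd = 1 + k\<^sup>2 * j k + \<gamma> + (\<gamma> + \<rho>\<^sup>2)"
    have dle: "\<bar>d n\<bar> \<le> Bd" for n
    proof (cases "n = 0")
      case True
      then show ?thesis using \<gamma> jpos[OF k] by (simp add: d_def Bd_def)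
    next
      case False
      then have "1 \<le> \<bar>of_int n :: real\<bar>" by (simp add: Ints_nonzero_abs_ge1)
      then have n2: "1 \<le> (of_int n :: real)\<^sup>2" using power_mono[of 1 "\<bar>of_int n :: real\<bar>" 2] by simp
      have "(\<gamma> + \<rho>\<^sup>2) / (of_int n)\<^sup>2 \<le> (\<gamma> + \<rho>\<^sup>2) / 1" using n2 \<gamma> by (intro divide_left_mono) auto
      moreover have "0 \<le> (\<gamma> + \<rho>\<^sup>2) / (of_int n)\<^sup>2" using \<gamma> by simp
      moreover have "0 \<le> k\<^sup>2 * (j k - j (k * of_int n))" using jle(2)[OF False] by simp
      moreover have "k\<^sup>2 * (j k - j (k * of_int n)) \<le> k\<^sup>2 * j k" using jle(1)[OF False] by (intro mult_left_mono) auto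
      moreover have "\<And>X Y Z R :: real. Y \<le> \<gamma> + R \<Longrightarrow> 0 \<le> Y \<Longrightarrow> 0 \<le> X \<Longrightarrow> X \<le> Z \<Longrightarrow> 0 \<le> R \<Longrightarrow> \<bar>X + \<gamma> - Y\<bar> \<le> 1 + Z + \<gamma> + (\<gamma> + R)"
        using \<gamma> by linarith
      ultimately show ?thesis unfolding d_def disp_def Bd_def if_not_P[OF False] by simp
    qed
    have S: "definite_symbol d q \<delta> \<rho>2 Bd"
    proof
      show "0 < \<delta>" "\<delta> \<le> 1" by (rule \<delta>)+
      show "\<bar>d n\<bar> \<le> Bd" for n by (rule dle)
      show "d (- n) = d n" for n using jeven[of "k * of_int n"] by (simp add: d_def disp_def)
      show "d 1 = - \<rho>2" by (simp add: d_def disp_def \<rho>2_def)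
      show "d 0 = 1" by (simp add: d_def)
      show "0 < \<rho>2" "\<rho>2 \<le> 1" using \<rho>2 by auto
      show "wfinite 2 q" by (rule qw)
      show "q (- n) = q n" for n unfolding q_def by (rule wave_q_even)
      show "cnj (q n) = q n" for n unfolding q_def by (rule cnj_wave_q)
      fix n :: int assume n: "\<bar>n\<bar> \<ge> 2"
      then have "2 \<le> \<bar>of_int n :: real\<bar>" by linarith
      then have "4 \<le> (of_int n :: real)\<^sup>2" using power_mono[of 2 "\<bar>of_int n :: real\<bar>" 2] by simp
      then have "(\<gamma> + \<rho>\<^sup>2) / (of_int n)\<^sup>2 \<le> (\<gamma> + \<rho>\<^sup>2) / 4" using \<gamma> by (intro divide_left_mono) auto
      moreover have n0: "n \<noteq> 0" using n by auto
      then have "0 \<le> k\<^sup>2 * (j k - j (k * of_int n))" using jle(2) by simp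
      moreover have "\<And>X Y :: real. Y \<le> (\<gamma> + \<rho>\<^sup>2) / 4 \<Longrightarrow> 0 \<le> X \<Longrightarrow> \<delta> \<le> X + \<gamma> - Y"
        using \<delta> \<rho>2(2) unfolding \<rho>2_def by (simp add: field_simps)
      ultimately show "\<delta> \<le> d n" unfolding d_def disp_def if_not_P[OF n0] by blast
    qed
    interpret S: definite_symbol d q \<delta> \<rho>2 Bd by (rule S)
    have S\<kappa>: "S.\<kappa> \<le> C4 * E" unfolding S.\<kappa>_def by (rule \<kappa>)
    have st: "of_real (k\<^sup>2 * (of_int n)\<^sup>2) * (of_real (c \<epsilon> - j (k * of_int n)) * h n - conv h h n) = of_real \<gamma> * h n" for n
      using steady_fourier[of j \<gamma> k "c \<epsilon>", OF _ k jeven jb] tw'[of \<epsilon>] \<epsilon> \<epsilon>' by blast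
    define g where "g n = h n - (if \<bar>n\<bar> = 1 then of_real (\<epsilon> / 2) else 0)" for n
    have g: "wfinite 2 g" "wnorm 2 g \<le> Cg * E\<^sup>2"
    proof -
      have f: "wfinite 2 (\<lambda>n. if \<bar>n\<bar> = 2 then of_real (\<epsilon>\<^sup>2 * e2 / 2) else 0)"
        "wnorm 2 (\<lambda>n. if \<bar>n\<bar> = 2 then of_real (\<epsilon>\<^sup>2 * e2 / 2) else 0) = (\<Sum>n\<in>{2, -2}. wt 2 n * cmod (if \<bar>n\<bar> = 2 then of_real (\<epsilon>\<^sup>2 * e2 / 2) else 0))"
        by (rule wfinite_finite[of "{2, -2}"]; auto)+
      have hh: "wfinite 2 (\<lambda>n. h n - h0 e2 \<epsilon> n)" "wnorm 2 (\<lambda>n. h n - h0 e2 \<epsilon> n) \<le> C * E ^ 3"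
        using tw'[of \<epsilon>] \<epsilon> \<epsilon>' unfolding E_def by blast+
      have eq: "g = (\<lambda>n. (h n - h0 e2 \<epsilon> n) + (if \<bar>n\<bar> = 2 then of_real (\<epsilon>\<^sup>2 * e2 / 2) else 0))" by (auto simp: g_def h0_def fun_eq_iff)
      show "wfinite 2 g" unfolding eq by (rule wfinite_add(1)[OF hh(1) f(1)])
      have "wnorm 2 g \<le> C * E ^ 3 + wnorm 2 (\<lambda>n. if \<bar>n\<bar> = 2 then of_real (\<epsilon>\<^sup>2 * e2 / 2) else 0)"
        unfolding eq using wfinite_add(2)[OF hh(1) f(1)] hh(2) by linarith
      also have "wnorm 2 (\<lambda>n. if \<bar>n\<bar> = 2 then of_real (\<epsilon>\<^sup>2 * e2 / 2) else 0) = 9 * e2 * E\<^sup>2"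
      proof -
        have "cmod (of_real (\<epsilon>\<^sup>2 * e2 / 2)) = e2 * E\<^sup>2 / 2" unfolding norm_of_real E2 using e2 by simp
        then show ?thesis unfolding f(2) by (simp add: wt_def)
      qed
      also have "C * E ^ 3 \<le> C * E\<^sup>2" using mult_left_mono[OF Ep(2) e1(3)] .
      finally show "wnorm 2 g \<le> Cg * E\<^sup>2" by (simp add: Cg_def algebra_simps)
    qed
    have \<epsilon>c: "cmod (of_real (2 / \<epsilon>)) = 2 / E" by (simp add: E_def norm_divide)
    have gE: "2 / E * (Cg * E\<^sup>2) \<le> 1 / 2"
    proof -
      have "2 / E * (Cg * E\<^sup>2) = 2 * (Cg * E)" using E by (simp add: power2_eq_square)
      then show ?thesis using small3(2) by linarith
    qed
    note wfinite_summable[OF h_mult_wfinite]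
    from coef_Abs[OF Parseval_fser(1)[OF this]] obtain y' where y': "coef y' = (\<lambda>n. of_int n * h n)" by blast
    \<comment> \<open>Up to the factor \<open>- \<i>\<close> these are the coefficients of \<eta>'
      multiplied by 2 / \<epsilon>, so that mode 1 is close to 1.\<close>
    define y where "y = cmul (of_real (2 / \<epsilon>)) y'"
    have y: "coef y n = of_real (2 / \<epsilon>) * (of_int n * h n)" for n by (simp add: y_def y')
    have Ly': "S.L y' = cmul (- of_real \<rho>2) (S.A (S.A y'))"
    proof (rule ell2_eqI)
      fix n
      show "coef (S.L y') n = coef (cmul (- of_real \<rho>2) (S.A (S.A y'))) n"
      proof (cases "n = 0")
        case True
        then show ?thesis by (simp add: S.L_def y')
      next
        case False
        have "coef (S.Q y') n = conv q (coef y') n" by (rule S.coef_Q) (use False in \<open>simp_all add: y'\<close>)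
        then show ?thesis using derivative_kernel[where j = j and c = "c \<epsilon>" and \<gamma> = \<gamma> and k = k and n = n and \<rho> = \<rho>, OF k False st, folded q_def] False
          by (simp add: S.L_def y' d_def \<rho>2_def power2_eq_square)
      qed
    qed
    have yL: "S.L y = cmul (- of_real \<rho>2) (S.A (S.A y))"
      unfolding y_def S.L_cmul S.A_cmul Ly' by (rule ell2_eqI) simp
    have yr: "reflect y = - y" by (rule ell2_eqI) (simp add: y h_even)
    have y1: "cmod (coef y 1) \<ge> 1 / 2"
    proof -
      have "coef y 1 = 1 + of_real (2 / \<epsilon>) * g 1" using \<epsilon> by (simp add: y g_def algebra_simps)
      moreover have "cmod (of_real (2 / \<epsilon>) * g 1) \<le> 1 / 2"
      proof -
        have "cmod (of_real (2 / \<epsilon>) * g 1) \<le> 2 / E * (Cg * E\<^sup>2)"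
          unfolding norm_mult \<epsilon>c using E cmod_le_wnorm[OF g(1), of 1] g(2) by (intro mult_left_mono) auto
        then show ?thesis using gE by linarith
      qed
      ultimately show ?thesis
        using norm_triangle_ineq4[of "coef y 1" "of_real (2 / \<epsilon>) * g 1"] by simp
    qed
    have yt: "norm (tail y) \<le> 1"
    proof -
      have "norm (tail y) \<le> 2 / E * wnorm 2 g"
      proof (rule norm_ell2_le_sum)
        show "((\<lambda>n. 2 / E * (wt 2 n * cmod (g n))) has_sum (2 / E * wnorm 2 g)) UNIV"
          unfolding wnorm_def using g(1) by (intro has_sum_cmult_right has_sum_infsum) (simp add: wfinite_def)
        fix n
        show "cmod (coef (tail y) n) \<le> 2 / E * (wt 2 n * cmod (g n))"
        proof (cases "\<bar>n\<bar> \<ge> 2")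
          case True
          have "\<bar>of_int n\<bar> \<le> wt 2 n" by (simp add: wt_def power2_sum)
          then have "\<bar>of_int n\<bar> * cmod (g n) \<le> wt 2 n * cmod (g n)" by (rule mult_right_mono) simp
          moreover have "g n = h n" using True by (auto simp: g_def)
          moreover have "cmod (coef y n) = 2 / E * (\<bar>of_int n\<bar> * cmod (h n))" unfolding y norm_mult \<epsilon>c by simp
          ultimately show ?thesis using True E by (simp add: divide_right_mono)
        qed (use E in simp)
      qed
      also have "\<dots> \<le> 2 / E * (Cg * E\<^sup>2)" using g(2) E by (intro mult_left_mono) auto
      finally show ?thesis using gE by linarith
    qed
    \<comment> \<open>The derivative of \<epsilon> cos z + \<epsilon>^2 e2 cos 2z with respect to
      \<epsilon> is cos z + 2 \<epsilon> e2 cos 2z; \<open>\<beta>\<close> is the ratio of its two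
      amplitudes.\<close>
    define \<beta> where "\<beta> = 2 * \<epsilon> * e2"
    have \<beta>: "\<bar>\<beta>\<bar> = 2 * (e2 * E)" "\<bar>\<beta>\<bar> \<le> 1" using small3(3) e2 by (simp_all add: \<beta>_def E_def abs_mult mult_ac)
    define v where "v = Re (q 0 + q 2 + of_real \<beta> * (q 1 + q 3))"
    \<comment> \<open>In units of \<open>K * E\<^sup>2\<close> the leading contributions to
      \<open>v\<close> are -1 from \<open>q 0\<close>, 1 from \<open>q 2\<close> and 2 from
      \<open>\<beta> * q 1\<close>, so \<open>K1\<close> is close to
      \<open>\<rho>2 + 2 * K * E\<^sup>2\<close>.\<close>
    define K1 where "K1 = \<rho>2 + v"
    have z1: "coef (S.L (unit 1 + unit (-1) + cmul (of_real \<beta>) (unit 2 + unit (-2)))) 1 = - of_real K1"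
    proof -
      have "q (-1) = q 1" using S.q_even[of 1] by simp
      moreover have "Im (q n) = 0" for n using S.q_real[of n] by (simp add: complex_eq_iff)
      then have "q 0 + q 2 + of_real \<beta> * (q 1 + q 3) = of_real v" unfolding v_def by (simp add: complex_eq_iff)
      moreover have "coef (S.L (unit 1 + unit (-1) + cmul (of_real \<beta>) (unit 2 + unit (-2)))) 1
          = of_real (d 1) - (q 0 + q 2 + of_real \<beta> * (q (-1) + q 3))"
        using S.coef_L_two_mode[of 1 \<beta>] by simp
      ultimately show ?thesis by (simp add: K1_def S.d1)
    qed
    have v: "\<bar>v - 2 * (K * E\<^sup>2)\<bar> \<le> 4 * (C * E ^ 3)"
    proof -
      have "q 0 + q 2 + of_real \<beta> * (q 1 + q 3) - of_real (2 * (K * E\<^sup>2)) = u 0 + u 2 + of_real \<beta> * (u 1 + u 3)"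
        unfolding E2[symmetric] by (simp add: u_def q0_def \<beta>_def K_def power2_eq_square algebra_simps)
      moreover have "Re (q 0 + q 2 + of_real \<beta> * (q 1 + q 3) - of_real (2 * (K * E\<^sup>2))) = v - 2 * (K * E\<^sup>2)" by (simp add: v_def)
      ultimately have "\<bar>v - 2 * (K * E\<^sup>2)\<bar> \<le> cmod (u 0 + u 2 + of_real \<beta> * (u 1 + u 3))" using abs_Re_le_cmod by metis
      moreover have "cmod (of_real \<beta> * (u 1 + u 3)) \<le> 1 * cmod (u 1 + u 3)"
        unfolding norm_mult using \<beta>(2) by (intro mult_right_mono) auto
      ultimately show ?thesis
        using norm_triangle_ineq[of "u 0 + u 2" "of_real \<beta> * (u 1 + u 3)"] norm_triangle_ineq[of "u 0" "u 2"] norm_triangle_ineq[of "u 1" "u 3"]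
          un[of 0] un[of 1] un[of 2] un[of 3] by linarith
    qed
    have CE: "4 * (C * E ^ 3) \<le> K * E\<^sup>2"
      using mult_right_mono[of "4 * C * E" K "E\<^sup>2"] small(4) by (simp add: Ep(3) mult.assoc)
    have K1: "\<rho>2 + K * E\<^sup>2 \<le> K1" "K1 \<le> \<rho>2 + 3 * (K * E\<^sup>2)" using v CE unfolding K1_def by linarith+
    have KE2: "0 < K * E\<^sup>2" "K * E\<^sup>2 \<le> K * E" using K Ep E by auto
    have K1': "0 < K1" "K1 \<le> 1" using K1 KE2 \<rho>2 small3(1) by linarith+
    have MK: "M * (\<rho>2 + K * E\<^sup>2) \<le> M * K1" using K1(1) M by (intro mult_left_mono) auto
    define \<xi> where "\<xi> = \<rho>2 * (e2 * E) + 4 * (K * E\<^sup>2) + 4 * (Cr * E\<^sup>2)"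
    have zt: "norm (tail (S.L (unit 1 + unit (-1) + cmul (of_real \<beta>) (unit 2 + unit (-2))))) \<le> \<xi>"
    proof -
      have rs: "(\<lambda>n. cmod (q n - (if \<bar>n\<bar> = 1 then of_real (k\<^sup>2 * \<epsilon>) else 0))) summable_on UNIV"
        using wfinite_summable[OF r(1)] by (simp add: r_def)
      have "(\<Sum>\<^sub>\<infinity>n. cmod (r n)) \<le> wnorm 2 r"
        unfolding wnorm_def using wfinite_summable[OF r(1)] r(1) wt_ge_1
        by (intro infsum_mono) (auto simp: wfinite_def mult_le_cancel_right1)
      then have rW: "(\<Sum>\<^sub>\<infinity>n. cmod (q n - (if \<bar>n\<bar> = 1 then of_real (k\<^sup>2 * \<epsilon>) else 0))) \<le> Cr * E\<^sup>2"
        using r(2) unfolding r_def by linarith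
      \<comment> \<open>\<open>\<beta>\<close> cancels the leading forcing of mode 2 exactly at
        \<rho> = 0; what is left carries the factor \<open>\<rho>2\<close>.\<close>
      have "d 2 * \<beta> - k\<^sup>2 * \<epsilon> = - (\<rho>2 * \<beta> / 4)"
      proof -
        have d2: "d 2 = 3 * \<gamma> / 4 + k\<^sup>2 * (j k - j (2 * k)) - \<rho>2 / 4" by (simp add: d_def disp_def \<rho>2_def mult.commute field_simps)
        have "d 2 * \<beta> = (3 * \<gamma> / 4 + k\<^sup>2 * (j k - j (2 * k))) * (2 * e2) * \<epsilon> - \<rho>2 * \<beta> / 4"
          unfolding d2 \<beta>_def by (simp add: algebra_simps)
        then show ?thesis unfolding e2d by simp
      qed
      then have a: "2 * \<bar>d 2 * \<beta> - k\<^sup>2 * \<epsilon>\<bar> = \<rho>2 * (e2 * E)" using \<beta>(1) \<rho>2(1) by (simp add: abs_mult)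
      have b: "2 * \<bar>\<beta> * (k\<^sup>2 * \<epsilon>)\<bar> = 4 * (K * E\<^sup>2)" using \<beta>(1) by (simp add: abs_mult K_def E_def power2_eq_square)
      show ?thesis using S.norm_tail_two_mode[OF rs rW \<beta>(2)] unfolding a b \<xi>_def by simp
    qed
    have \<xi>: "\<xi> \<le> M * K1"
    proof -
      have "e2 * E \<le> M" using M(2) e2 E mult_left_mono[of E 1 e2] by linarith
      then have "\<rho>2 * (e2 * E) \<le> \<rho>2 * M" using \<rho>2 by (intro mult_left_mono) auto
      moreover have "(4 * K + 4 * Cr) * E\<^sup>2 \<le> M * K * E\<^sup>2" by (intro mult_right_mono M(4)) simp
      ultimately show ?thesis using MK unfolding \<xi>_def by (simp add: algebra_simps)
    qed
    have sq: "(\<rho>2 + 2 * S.\<kappa>)\<^sup>2 \<le> M * K1"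
    proof -
      have "(\<rho>2 + 2 * S.\<kappa>)\<^sup>2 \<le> (\<rho>2 + 2 * (C4 * E))\<^sup>2" using S\<kappa> S.\<kappa>_nonneg \<rho>2 by (intro power_mono) auto
      also have "\<dots> \<le> 2 * \<rho>2\<^sup>2 + 8 * (C4 * E)\<^sup>2"
        using zero_le_power2[of "\<rho>2 - 2 * (C4 * E)"] by (simp add: power2_eq_square algebra_simps)
      also have "\<dots> \<le> M * \<rho>2 + (8 * C4\<^sup>2) * E\<^sup>2"
      proof -
        have "2 * \<rho>2\<^sup>2 \<le> M * \<rho>2" unfolding power2_eq_square mult.assoc[symmetric] using M(1) \<rho>2 by (intro mult_right_mono) auto
        then show ?thesis by (simp add: power_mult_distrib)
      qed
      also have "\<dots> \<le> M * \<rho>2 + M * K * E\<^sup>2" by (intro add_left_mono mult_right_mono M(3)) simp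
      finally show ?thesis using MK by (simp add: algebra_simps)
    qed
    have small': "\<rho>2 + 2 * S.\<kappa> \<le> \<delta> / 4" "\<rho>2 + S.\<kappa> \<le> \<delta> / 4" "S.\<kappa> \<le> \<delta> / 2"
      using S\<kappa> small(1) \<rho>2(2) \<delta>(1) S.\<kappa>_nonneg by linarith+
    have i1: "2 / \<delta> * (\<rho>2 + S.\<kappa>) \<le> 1" using small'(2) \<delta> by (simp add: field_simps)
    have i2: "(2 / \<delta>)\<^sup>2 * (\<rho>2 + 2 * S.\<kappa>)\<^sup>2 \<le> 1 / 2"
    proof -
      have "2 / \<delta> * (\<rho>2 + 2 * S.\<kappa>) \<le> 1 / 2" using small'(1) \<delta> by (simp add: field_simps)
      then have "(2 / \<delta> * (\<rho>2 + 2 * S.\<kappa>))\<^sup>2 \<le> (1 / 2)\<^sup>2" using \<rho>2 S.\<kappa>_nonneg \<delta> by (intro power_mono) auto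
      then show ?thesis unfolding power_mult_distrib by (simp add: power2_eq_square)
    qed
    have i4: "H * S.\<kappa> * M \<le> 1 / 48"
    proof -
      have "H * S.\<kappa> * M \<le> H * (C4 * E) * M" using S\<kappa> H M by (intro mult_right_mono mult_left_mono) auto
      then show ?thesis using small(2) by (simp add: mult_ac)
    qed
    have i3: "H * S.\<kappa> \<le> 1 / 32"
    proof -
      have "H * S.\<kappa> * 2 \<le> H * S.\<kappa> * M" using H S.\<kappa>_nonneg M by (intro mult_left_mono) auto
      then show ?thesis using i4 by linarith
    qed
    have inj: "x = 0" if "Re \<mu> > 0" "cmul (\<i> * \<mu>) (S.A x) + S.L x = 0" for \<mu> x
      by (rule S.kernel_trivial[OF that(1) small'(3) i1 i2 i3[unfolded H_def] i4[unfolded H_def] K1' sq yr y1 yt yL z1 zt \<xi> \<beta>(2) that(2)])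
    have "G_invertible j b \<gamma> 1 0 k (\<eta> \<epsilon>) (c \<epsilon>) \<mu> \<rho>" if \<mu>: "Re \<mu> > 0" for \<mu>
    proof (rule invertible_from_definite[OF k b _ \<mu>])
      show "0 < \<rho>\<^sup>2 + \<gamma>" using \<gamma> by (simp add: add_nonneg_pos)
      show "definite_symbol (\<lambda>n. if n = 0 then 1 else disp j \<gamma> k \<rho> n) (wave_q k 1 0 (c \<epsilon> - wave_c0 j \<gamma> k)) \<delta> \<rho>2 Bd"
        using S unfolding d_def[abs_def] q_def .
      show "wnorm 2 (wave_q k 1 0 (c \<epsilon> - wave_c0 j \<gamma> k)) \<le> \<delta> / 2" using small'(3)[unfolded S.\<kappa>_def] unfolding q_def .
      show "x = 0" if "cmul (\<i> * \<mu>) (S.A x) + definite_symbol.L (\<lambda>n. if n = 0 then 1 else disp j \<gamma> k \<rho> n) (wave_q k 1 0 (c \<epsilon> - wave_c0 j \<gamma> k)) x = 0" for x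
        using inj[OF \<mu>, of x] that unfolding d_def[abs_def] q_def by blast
    qed
    then show ?thesis unfolding periodic_instability_def by blast
  qed
  then show ?thesis unfolding long_wave_stable_def using \<epsilon>0 \<delta>(1)
    by (intro exI[of _ "\<delta> / 8"] conjI exI[of _ \<epsilon>0]) auto
qed

lemma fser_q0:
  "fser (q0 k \<alpha>1 \<alpha>2 c2 \<epsilon>) z = of_real (k\<^sup>2 * \<epsilon>\<^sup>2 * (3 * \<alpha>2 / 2 - c2) + 2 * (k\<^sup>2 * \<alpha>1 * \<epsilon>) * cos z + 2 * (k\<^sup>2 * \<epsilon>\<^sup>2 * c2) * cos (2 * z))"
proof -
  have "fser (q0 k \<alpha>1 \<alpha>2 c2 \<epsilon>) z = (\<Sum>\<^sub>\<infinity>n\<in>{0, 1, -1, 2, -2}. q0 k \<alpha>1 \<alpha>2 c2 \<epsilon> n * cis (of_int n * z))"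
    unfolding fser_def by (rule infsum_cong_neutral) (auto simp: q0_def)
  also have "\<dots> = (\<Sum>n\<in>{0, 1, -1, 2, -2}. q0 k \<alpha>1 \<alpha>2 c2 \<epsilon> n * cis (of_int n * z))" by simp
  finally show ?thesis by (simp add: complex_eq_iff q0_def)
qed

text \<open>The supremum of a series is at most the sum of the moduli of its coefficients, which is
  \<open>wnorm 0\<close>.\<close>

lemma (in profile) wave_fun_approx:
  assumes "wfinite 0 (\<lambda>n. wave_q k \<alpha>1 \<alpha>2 a n - q0 k \<alpha>1 \<alpha>2 c2 \<epsilon> n)" "wnorm 0 (\<lambda>n. wave_q k \<alpha>1 \<alpha>2 a n - q0 k \<alpha>1 \<alpha>2 c2 \<epsilon> n) \<le> W"
  shows "\<bar>wave_fun k \<alpha>1 \<alpha>2 a z - (k\<^sup>2 * \<epsilon>\<^sup>2 * (3 * \<alpha>2 / 2 - c2) + 2 * (k\<^sup>2 * \<alpha>1 * \<epsilon>) * cos z + 2 * (k\<^sup>2 * \<epsilon>\<^sup>2 * c2) * cos (2 * z))\<bar> \<le> W"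
    (is "\<bar>_ - ?T\<bar> \<le> W")
proof -
  let ?u = "\<lambda>n. wave_q k \<alpha>1 \<alpha>2 a n - q0 k \<alpha>1 \<alpha>2 c2 \<epsilon> n"
  have su: "(\<lambda>n. cmod (?u n)) summable_on UNIV" by (rule wfinite_summable[OF assms(1)])
  have s0: "(\<lambda>n. cmod (q0 k \<alpha>1 \<alpha>2 c2 \<epsilon> n)) summable_on UNIV" by (rule wfinite_summable[OF wnorm_q0(2)])
  have "fser (wave_q k \<alpha>1 \<alpha>2 a) z - fser (q0 k \<alpha>1 \<alpha>2 c2 \<epsilon>) z = fser ?u z"
    unfolding fser_def left_diff_distrib
    by (rule infsum_minus[OF fser_summable[OF wave_q_summable] fser_summable[OF s0], symmetric])
  then have "of_real (wave_fun k \<alpha>1 \<alpha>2 a z) - of_real ?T = fser ?u z"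
    unfolding fser_q0 fun_cong[OF wave_fun_fser, symmetric] .
  then have "of_real (wave_fun k \<alpha>1 \<alpha>2 a z - ?T) = fser ?u z" by (simp only: of_real_diff)
  then have "cmod (of_real (wave_fun k \<alpha>1 \<alpha>2 a z - ?T)) \<le> (\<Sum>\<^sub>\<infinity>n. cmod (?u n))" using fser_bound[OF su] by simp
  also have "\<dots> \<le> W" using assms(2) by (simp add: wnorm_def wt_def)
  finally show ?thesis unfolding norm_of_real .
qed

lemma zero_of_sign_change:
  fixes f :: "real \<Rightarrow> real"
  assumes f: "continuous_on UNIV f" and ab: "a \<le> b" "f a * f b \<le> 0"
  shows "\<exists>z. f z = 0"
proof -
  have c: "continuous_on {a..b} f" by (rule continuous_on_subset[OF f]) simp
  from ab(2) consider "f a \<le> 0" "0 \<le> f b" | "f b \<le> 0" "0 \<le> f a" unfolding mult_le_0_iff by blast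
  then show ?thesis
  proof cases
    case 1
    then show ?thesis using IVT'[OF _ _ ab(1) c, of 0] by blast
  next
    case 2
    then show ?thesis using IVT2'[OF _ _ ab(1) c, of 0] by blast
  qed
qed

text \<open>In the degenerate case \<open>j (k n)\<close> tends to the speed \<open>wave_c0 j \<gamma> k\<close>, so at high frequency the operator
  is \<open>n\<^sup>2\<close> times multiplication by \<open>- wave_fun\<close>, which has a zero.\<close>

theorem unstable_degenerate:
  assumes k: "k > 0" and tw: "traveling_wave_family j \<gamma> \<alpha>1 \<alpha>2 k \<eta> c" and b: "b \<le> 0"
    and \<alpha>: "\<alpha>1 = 1 \<or> \<alpha>1 = 0 \<and> \<alpha>2 = -1"
    and lim: "\<And>\<rho> e. e > 0 \<Longrightarrow> \<exists>M. \<forall>n\<ge>M. \<bar>disp j \<gamma> k \<rho> n\<bar> \<le> e"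
  shows "long_wave_unstable j b \<gamma> \<alpha>1 \<alpha>2 k \<eta> c"
  unfolding long_wave_unstable_def
proof (intro allI impI)
  fix \<rho>0 :: real assume \<rho>0: "\<rho>0 > 0"
  define c2 where "c2 = wave_c2 j \<gamma> \<alpha>1 \<alpha>2 k"
  obtain \<epsilon>1 C where e1: "\<epsilon>1 > 0" "\<epsilon>1 \<le> 1" "C \<ge> 0" and tw': "\<And>\<epsilon>. 0 < \<bar>\<epsilon>\<bar> \<Longrightarrow> \<bar>\<epsilon>\<bar> < \<epsilon>1 \<Longrightarrow>
      profile (\<eta> \<epsilon>) \<and>
      wfinite 0 (\<lambda>n. profile.wave_q (\<eta> \<epsilon>) k \<alpha>1 \<alpha>2 (c \<epsilon> - wave_c0 j \<gamma> k) n - q0 k \<alpha>1 \<alpha>2 c2 \<epsilon> n) \<and>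
      wnorm 0 (\<lambda>n. profile.wave_q (\<eta> \<epsilon>) k \<alpha>1 \<alpha>2 (c \<epsilon> - wave_c0 j \<gamma> k) n - q0 k \<alpha>1 \<alpha>2 c2 \<epsilon> n) \<le> C * \<bar>\<epsilon>\<bar> ^ 3"
    using wave_q_asymptotics[OF tw, of 0] unfolding c2_def by blast
  define D where "D = k\<^sup>2 * (\<bar>3 * \<alpha>2 / 2 - c2\<bar> + 2 * \<bar>c2\<bar>)"
  have D: "D \<ge> 0" by (simp add: D_def)
  have k2: "k\<^sup>2 > 0" using k by simp
  obtain ea where ea: "ea > 0" "\<And>\<epsilon>. \<bar>\<epsilon>\<bar> < ea \<Longrightarrow> (D + C) * \<bar>\<epsilon>\<bar> < k\<^sup>2 / 2" using small_enough[of "D + C" "k\<^sup>2 / 2"] D e1 k2 by auto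
  define \<epsilon>0 where "\<epsilon>0 = min \<epsilon>1 ea"
  have "\<epsilon>0 > 0" using e1 ea by (simp add: \<epsilon>0_def)
  moreover have "\<exists>\<rho>. 0 < \<bar>\<rho>\<bar> \<and> \<bar>\<rho>\<bar> \<le> \<rho>0 \<and> periodic_instability j b \<gamma> \<alpha>1 \<alpha>2 k (\<eta> \<epsilon>) (c \<epsilon>) \<rho>"
    if \<epsilon>: "0 < \<bar>\<epsilon>\<bar>" "\<bar>\<epsilon>\<bar> < \<epsilon>0" for \<epsilon>
  proof -
    have \<epsilon>': "\<bar>\<epsilon>\<bar> < \<epsilon>1" "\<bar>\<epsilon>\<bar> < ea" using \<epsilon> by (simp_all add: \<epsilon>0_def)
    define E where "E = \<bar>\<epsilon>\<bar>"
    have E: "E > 0" "E \<le> 1" "\<epsilon>\<^sup>2 = E\<^sup>2" using \<epsilon> \<epsilon>' e1 by (auto simp: E_def)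
    interpret profile "\<eta> \<epsilon>" using tw'[of \<epsilon>] \<epsilon> \<epsilon>' by blast
    define f where "f = wave_fun k \<alpha>1 \<alpha>2 (c \<epsilon> - wave_c0 j \<gamma> k)"
    have cf: "continuous_on UNIV f" unfolding f_def wave_fun_def[abs_def] by (intro continuous_intros \<eta>_continuous)
    have ap: "\<bar>f z - (k\<^sup>2 * \<epsilon>\<^sup>2 * (3 * \<alpha>2 / 2 - c2) + 2 * (k\<^sup>2 * \<alpha>1 * \<epsilon>) * cos z + 2 * (k\<^sup>2 * \<epsilon>\<^sup>2 * c2) * cos (2 * z))\<bar> \<le> C * E ^ 3" for z
      unfolding f_def E_def by (rule wave_fun_approx) (use tw'[of \<epsilon>] \<epsilon> \<epsilon>' in blast)+
    have CE: "C * E ^ 3 \<le> (C * E) * E\<^sup>2" by (simp add: power2_eq_square power3_eq_cube)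
    have DCE: "(D + C) * E < k\<^sup>2 / 2" using ea(2)[OF \<epsilon>'(2)] by (simp add: E_def)
    \<comment> \<open>For \<open>\<alpha>1 = 1\<close> the leading term 2 k^2 \<epsilon> cos z has
      opposite signs at 0 and pi. For \<open>\<alpha>1 = 0\<close> the terms of order \<epsilon>^2
      dominate: in units of k^2 \<epsilon>^2 they are -9/4 at 0 and 3/4 at pi / 2.\<close>
    have "\<exists>z. f z = 0"
    proof (cases "\<alpha>1 = 1")
      case True
      have C3: "C * E ^ 3 \<le> C * E\<^sup>2" using power_decreasing[of 2 3 E] E e1 by (intro mult_left_mono) auto
      have TD: "\<bar>k\<^sup>2 * \<epsilon>\<^sup>2 * (3 * \<alpha>2 / 2 - c2) + 2 * (k\<^sup>2 * \<epsilon>\<^sup>2 * c2)\<bar> \<le> D * E\<^sup>2"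
      proof -
        have "k\<^sup>2 * \<epsilon>\<^sup>2 * (3 * \<alpha>2 / 2 - c2) + 2 * (k\<^sup>2 * \<epsilon>\<^sup>2 * c2) = (k\<^sup>2 * E\<^sup>2) * ((3 * \<alpha>2 / 2 - c2) + 2 * c2)"
          unfolding E(3) by (simp add: algebra_simps)
        moreover have "\<bar>(k\<^sup>2 * E\<^sup>2) * ((3 * \<alpha>2 / 2 - c2) + 2 * c2)\<bar> \<le> (k\<^sup>2 * E\<^sup>2) * (\<bar>3 * \<alpha>2 / 2 - c2\<bar> + 2 * \<bar>c2\<bar>)"
        proof -
          have "\<bar>(3 * \<alpha>2 / 2 - c2) + 2 * c2\<bar> \<le> \<bar>3 * \<alpha>2 / 2 - c2\<bar> + 2 * \<bar>c2\<bar>" by arith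
          moreover have "\<bar>k\<^sup>2 * E\<^sup>2\<bar> = k\<^sup>2 * E\<^sup>2" by simp
          ultimately show ?thesis unfolding abs_mult[of "k\<^sup>2 * E\<^sup>2"] by (simp only: mult_left_mono zero_le_power2 mult_nonneg_nonneg)
        qed
        moreover have "(k\<^sup>2 * E\<^sup>2) * (\<bar>3 * \<alpha>2 / 2 - c2\<bar> + 2 * \<bar>c2\<bar>) = D * E\<^sup>2" by (simp add: D_def)
        ultimately show ?thesis by (simp only:)
      qed
      have small: "(D + C) * E\<^sup>2 < k\<^sup>2 / 2 * E" using mult_strict_right_mono[OF DCE E(1)] by (simp add: power2_eq_square mult.assoc)
      then have DC: "D * E\<^sup>2 + C * E\<^sup>2 < k\<^sup>2 * E / 2" by (simp add: distrib_right)
      have kE: "k\<^sup>2 * E > 0" using k2 E by simp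
      have c0: "\<bar>f 0 - 2 * (k\<^sup>2 * \<epsilon>)\<bar> \<le> k\<^sup>2 * E" using ap[of 0] TD C3 DC kE True by (simp add: abs_if split: if_splits)
      have cp: "\<bar>f pi + 2 * (k\<^sup>2 * \<epsilon>)\<bar> \<le> k\<^sup>2 * E" using ap[of pi] TD C3 DC kE True by (simp add: abs_if split: if_splits)
      have "f 0 * f pi \<le> 0"
      proof (cases "\<epsilon> > 0")
        case True
        then have "k\<^sup>2 * E = k\<^sup>2 * \<epsilon>" by (simp add: E_def)
        then have "f 0 \<ge> 0" "f pi \<le> 0" using c0 cp kE by linarith+
        then show ?thesis by (simp add: mult_nonneg_nonpos)
      next
        case False
        then have "k\<^sup>2 * E = - (k\<^sup>2 * \<epsilon>)" by (simp add: E_def)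
        then have "f 0 \<le> 0" "f pi \<ge> 0" using c0 cp kE by linarith+
        then show ?thesis by (simp add: mult_nonpos_nonneg)
      qed
      then show ?thesis by (rule zero_of_sign_change[OF cf, rotated]) simp
    next
      case False
      then have \<alpha>': "\<alpha>1 = 0" "\<alpha>2 = -1" using \<alpha> by auto
      then have c2': "c2 = - 3 / 4" by (simp add: c2_def wave_c2_def)
      have "0 \<le> D * E" using D E by simp
      then have "C * E \<le> k\<^sup>2 / 2" using DCE unfolding distrib_right by linarith
      then have CE2: "C * E ^ 3 \<le> k\<^sup>2 / 2 * E\<^sup>2" by (intro order_trans[OF CE] mult_right_mono) auto
      have kE: "k\<^sup>2 * E\<^sup>2 > 0" using k2 E by simp
      have "\<bar>f 0 + 9 / 4 * (k\<^sup>2 * E\<^sup>2)\<bar> \<le> C * E ^ 3" using ap[of 0] by (simp add: \<alpha>' c2' E(3) mult_ac)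
      moreover have "\<bar>f (pi / 2) - 3 / 4 * (k\<^sup>2 * E\<^sup>2)\<bar> \<le> C * E ^ 3" using ap[of "pi / 2"] by (simp add: \<alpha>' c2' E(3) mult_ac)
      ultimately have "f 0 \<le> 0" "0 \<le> f (pi / 2)" using CE2 kE by linarith+
      then have "f 0 * f (pi / 2) \<le> 0" by (simp add: mult_nonpos_nonneg)
      then show ?thesis by (rule zero_of_sign_change[OF cf, rotated]) simp
    qed
    then obtain z0 where "f z0 = 0" by blast
    \<comment> \<open>Invertibility fails for every \<mu> and \<rho>, so \<mu> = 1 and the given
      bound \<open>\<rho>0\<close> serve.\<close>
    then have "\<not> G_invertible j b \<gamma> \<alpha>1 \<alpha>2 k (\<eta> \<epsilon>) (c \<epsilon>) 1 \<rho>0"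
      unfolding f_def by (rule degenerate_not_invertible[OF k b _ lim])
    then have "periodic_instability j b \<gamma> \<alpha>1 \<alpha>2 k (\<eta> \<epsilon>) (c \<epsilon>) \<rho>0"
      unfolding periodic_instability_def by (intro exI[of _ 1]) simp
    then show ?thesis using \<rho>0 by (intro exI[of _ \<rho>0]) simp
  qed
  ultimately show "\<exists>\<epsilon>0>0. \<forall>\<epsilon>. 0 < \<bar>\<epsilon>\<bar> \<and> \<bar>\<epsilon>\<bar> < \<epsilon>0 \<longrightarrow>
      (\<exists>\<rho>. 0 < \<bar>\<rho>\<bar> \<and> \<bar>\<rho>\<bar> \<le> \<rho>0 \<and> periodic_instability j b \<gamma> \<alpha>1 \<alpha>2 k (\<eta> \<epsilon>) (c \<epsilon>) \<rho>)" by blast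
qed

section \<open>Separation of the symbol from zero, and the conclusion\<close>

lemma uniform_gap:
  fixes g :: "nat \<Rightarrow> real"
  assumes "\<And>n. n \<ge> 2 \<Longrightarrow> g n \<noteq> 0" "s > 0" "\<And>n. n \<ge> N \<Longrightarrow> \<bar>g n\<bar> \<ge> s"
  shows "\<exists>\<delta>>0. \<forall>n\<ge>2. \<bar>g n\<bar> \<ge> \<delta>"
proof -
  define \<delta> where "\<delta> = Min (insert s ((\<lambda>n. \<bar>g n\<bar>) ` {2..<N}))"
  have "\<delta> > 0" unfolding \<delta>_def using assms(1,2) by (subst Min_gr_iff) auto
  moreover have "\<bar>g n\<bar> \<ge> \<delta>" if "n \<ge> 2" for n
  proof (cases "n < N")
    case True
    then show ?thesis using that unfolding \<delta>_def by (intro Min_le) auto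
  next
    case False
    then have "\<delta> \<le> s" unfolding \<delta>_def by (intro Min_le) auto
    then show ?thesis using assms(3)[of n] False by linarith
  qed
  ultimately show ?thesis by blast
qed

lemma inverse_square_small: "e > 0 \<Longrightarrow> \<exists>N::nat. \<forall>n\<ge>N. a / (real n)\<^sup>2 \<le> e"
proof -
  assume e: "e > 0"
  have "a / (real n)\<^sup>2 \<le> e" if n: "n \<ge> Suc (nat \<lceil>\<bar>a\<bar> / e\<rceil>)" for n
  proof -
    have n1: "real n \<ge> 1" "\<bar>a\<bar> / e \<le> real n" using n by linarith+
    have "\<bar>a\<bar> \<le> real n * e" using n1(2) e by (simp add: pos_divide_le_eq)
    also have "\<dots> \<le> (real n)\<^sup>2 * e" using n1(1) e by (intro mult_right_mono) (auto simp: power2_eq_square mult_le_cancel_left1)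
    finally have "a \<le> e * (real n)\<^sup>2" by (simp add: mult.commute)
    then show ?thesis using n1(1) by (simp add: pos_divide_le_eq)
  qed
  then show ?thesis by blast
qed

text \<open>For an increasing symbol \<open>a n\<close> increases with n \<ge> 1. It becomes
  positive, or stays below a negative constant, or increases to 0. In the first two cases the gap
  holds beyond some n, and admissibility excludes a zero at each of the finitely many n before; in
  the third the symbol is bounded by \<open>j k + \<gamma> / k\<^sup>2\<close>, whence b \<le> 0,
  and \<open>disp\<close> tends to 0.\<close>

lemma symbol_dichotomy:
  assumes \<gamma>: "\<gamma> > 0" and J2: "hyp_J2 j b" and J3: "hyp_J3 j" and adm: "admissible j \<gamma> k"
  shows "(\<exists>\<delta>>0. \<forall>n::nat\<ge>2. \<bar>k\<^sup>2 * (j k - j (k * real n)) + \<gamma> - \<gamma> / (real n)\<^sup>2\<bar> \<ge> \<delta>) \<or>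
    b \<le> 0 \<and> (\<forall>\<rho> e. e > 0 \<longrightarrow> (\<exists>M. \<forall>n\<ge>M. \<bar>disp j \<gamma> k \<rho> n\<bar> \<le> e))"
proof (cases "strict_mono_on {0<..} j")
  case False
  have k: "k > 0" using adm by (simp add: admissible_def)
  have dec: "strict_antimono_on {0<..} j" using J3 False by (auto simp: hyp_J3_def)
  have "\<bar>k\<^sup>2 * (j k - j (k * real n)) + \<gamma> - \<gamma> / (real n)\<^sup>2\<bar> \<ge> 3 * \<gamma> / 4" if n: "n \<ge> 2" for n :: nat
  proof -
    have "k < k * real n" using n k by simp
    then have "j (k * real n) < j k" using dec k by (simp add: monotone_on_def)
    then have "0 \<le> k\<^sup>2 * (j k - j (k * real n))" by simp
    moreover have "4 \<le> (real n)\<^sup>2" using n power_mono[of 2 "real n" 2] by simp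
    then have "\<gamma> / (real n)\<^sup>2 \<le> \<gamma> / 4" using \<gamma> n by (intro divide_left_mono) auto
    moreover have "\<And>X Y :: real. 0 \<le> X \<Longrightarrow> Y \<le> \<gamma> / 4 \<Longrightarrow> 3 * \<gamma> / 4 \<le> \<bar>X + \<gamma> - Y\<bar>" by linarith
    ultimately show ?thesis by blast
  qed
  then show ?thesis using \<gamma> by (intro disjI1 exI[of _ "3 * \<gamma> / 4"]) auto
next
  case True
  have k: "k > 0" using adm by (simp add: admissible_def)
  define g where "g n = k\<^sup>2 * (j k - j (k * real n)) + \<gamma> - \<gamma> / (real n)\<^sup>2" for n
  define a where "a n = k\<^sup>2 * (j (k * real n) - j k) - \<gamma>" for n
  have ga: "g n = - a n - \<gamma> / (real n)\<^sup>2" for n by (simp add: g_def a_def algebra_simps)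
  have g0: "g n \<noteq> 0" if n: "n \<ge> 2" for n
  proof
    assume "g n = 0"
    moreover have "\<gamma> * ((real n)\<^sup>2 - 1) / (real n)\<^sup>2 = \<gamma> - \<gamma> / (real n)\<^sup>2" using n by (simp add: field_simps)
    ultimately have "k\<^sup>2 * (j (k * real n) - j k) = \<gamma> * ((real n)\<^sup>2 - 1) / (real n)\<^sup>2" by (simp add: g_def algebra_simps)
    then show False using adm True n unfolding admissible_def by blast
  qed
  have jm: "j x \<le> j y" if "0 < x" "x \<le> y" for x y
    using True that by (cases "x = y") (auto simp: monotone_on_def intro: less_imp_le)
  have am: "a m \<le> a n" if "1 \<le> m" "m \<le> n" for m n
    unfolding a_def using that k by (intro diff_right_mono mult_left_mono jm) auto
  have gn: "0 \<le> \<gamma> / (real n)\<^sup>2" for n using \<gamma> by simp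
  consider "\<exists>m\<ge>1. a m > 0" | "\<exists>s>0. \<forall>n\<ge>1. a n \<le> - s" | "\<forall>n\<ge>1. a n \<le> 0" "\<forall>s>0. \<exists>n\<ge>1. a n > - s"
    by (meson not_le)
  then show ?thesis
  proof cases
    case 1
    then obtain m where m: "m \<ge> 1" "a m > 0" by blast
    have "\<exists>\<delta>>0. \<forall>n\<ge>2. \<bar>g n\<bar> \<ge> \<delta>"
    proof (rule uniform_gap[OF g0 m(2)])
      show "a m \<le> \<bar>g n\<bar>" if "n \<ge> m" for n using am[OF m(1) that] gn[of n] m(2) unfolding ga by linarith
    qed
    then show ?thesis unfolding g_def by blast
  next
    case 2
    then obtain s where s: "s > 0" "\<And>n. n \<ge> 1 \<Longrightarrow> a n \<le> - s" by blast
    obtain N where N: "\<And>n. n \<ge> N \<Longrightarrow> \<gamma> / (real n)\<^sup>2 \<le> s / 2" using inverse_square_small[of "s / 2" \<gamma>] s(1) by auto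
    have "\<exists>\<delta>>0. \<forall>n\<ge>2. \<bar>g n\<bar> \<ge> \<delta>"
    proof (rule uniform_gap[OF g0])
      show "s / 2 > 0" using s by simp
      show "s / 2 \<le> \<bar>g n\<bar>" if n: "n \<ge> max 1 N" for n
      proof -
        have "\<And>x y. x \<le> - s \<Longrightarrow> y \<le> s / 2 \<Longrightarrow> s / 2 \<le> \<bar>- x - y\<bar>" by linarith
        then show ?thesis using s(2)[of n] N[of n] n unfolding ga by simp
      qed
    qed
    then show ?thesis unfolding g_def by blast
  next
    case 3
    have "j x \<le> j k + \<gamma> / k\<^sup>2" if x: "x \<ge> k" for x
    proof -
      define n where "n = nat \<lceil>x / k\<rceil>"
      have "x / k \<le> real n" unfolding n_def by linarith
      then have xn: "x \<le> k * real n" using k by (simp add: pos_divide_le_eq mult.commute)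
      then have "n \<ge> 1" using x k by (cases n) auto
      then have "k\<^sup>2 * (j (k * real n) - j k) \<le> \<gamma>" using 3(1) by (simp add: a_def)
      then have "j (k * real n) \<le> j k + \<gamma> / k\<^sup>2" using k by (simp add: field_simps)
      then show ?thesis using jm[of x "k * real n"] xn x k by linarith
    qed
    then have "b \<le> 0" by (rule symbol_bounded_imp[OF J2])
    moreover have "\<exists>M. \<forall>n\<ge>M. \<bar>disp j \<gamma> k \<rho> n\<bar> \<le> e" if e: "e > 0" for \<rho> e
    proof -
      obtain m where m: "m \<ge> 1" "a m > - e" using 3(2) e by blast
      obtain N where N: "\<And>n. n \<ge> N \<Longrightarrow> (\<gamma> + \<rho>\<^sup>2) / (real n)\<^sup>2 \<le> e" using inverse_square_small[OF e, of "\<gamma> + \<rho>\<^sup>2"] by auto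
      have "\<bar>disp j \<gamma> k \<rho> n\<bar> \<le> e" if n: "n \<ge> int (max m N)" for n
      proof -
        define i where "i = nat n"
        have i: "n = int i" "i \<ge> m" "i \<ge> N" using n by (auto simp: i_def)
        have "disp j \<gamma> k \<rho> n = - a i - (\<gamma> + \<rho>\<^sup>2) / (real i)\<^sup>2" by (simp add: disp_def a_def i(1) algebra_simps)
        moreover have "- e < a i" "a i \<le> 0" using am[OF m(1) i(2)] m 3(1) i(2) by auto
        moreover have "0 \<le> (\<gamma> + \<rho>\<^sup>2) / (real i)\<^sup>2" using \<gamma> by simp
        moreover note N[OF i(3)]
        ultimately show ?thesis by linarith
      qed
      then show ?thesis by blast
    qed
    ultimately show ?thesis by blast
  qed
qed

text \<open>All instability claims reduce to the sign of c2; the dichotomy decides between an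
  eigenvalue and the failure of a bounded inverse.\<close>

theorem unstable_of_negative_c2:
  assumes \<gamma>: "\<gamma> > 0" and J: "hyp_J1 j" "hyp_J2 j b" "hyp_J3 j" and adm: "admissible j \<gamma> k"
    and tw: "traveling_wave_family j \<gamma> \<alpha>1 \<alpha>2 k \<eta> c" and \<alpha>: "\<alpha>1 = 1 \<or> \<alpha>1 = 0 \<and> \<alpha>2 = -1" and c2: "wave_c2 j \<gamma> \<alpha>1 \<alpha>2 k < 0"
  shows "long_wave_unstable j b \<gamma> \<alpha>1 \<alpha>2 k \<eta> c"
proof -
  have k: "k > 0" using adm by (simp add: admissible_def)
  have je: "\<And>x. j (- x) = j x" using J(1) by (simp add: hyp_J1_def)
  from symbol_dichotomy[OF \<gamma> J(2,3) adm] show ?thesis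
  proof (elim disjE exE conjE)
    fix \<delta> :: real assume "\<delta> > 0" "\<forall>n\<ge>2. \<delta> \<le> \<bar>k\<^sup>2 * (j k - j (k * real n)) + \<gamma> - \<gamma> / (real n)\<^sup>2\<bar>"
    then show ?thesis by (intro unstable_nondegenerate[OF \<gamma> k je tw c2, of \<delta>]) auto
  next
    assume "b \<le> 0" "\<forall>\<rho> e. e > 0 \<longrightarrow> (\<exists>M. \<forall>n\<ge>M. \<bar>disp j \<gamma> k \<rho> n\<bar> \<le> e)"
    then show ?thesis by (intro unstable_degenerate[OF k tw _ \<alpha>]) auto
  qed
qed

theorem theorem1p7:
  fixes j :: "real \<Rightarrow> real" and b \<gamma> k \<alpha>1 \<alpha>2 :: real
    and \<eta> :: "real \<Rightarrow> real \<Rightarrow> real" and c :: "real \<Rightarrow> real"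
  assumes "\<gamma> > 0"
    and "hyp_J1 j" and "hyp_J2 j b" and "hyp_J3 j"
    and "admissible j \<gamma> k"
    and "\<alpha>1 \<in> {0, 1}" and "\<alpha>2 \<in> {-1, 0}"
    and "traveling_wave_family j \<gamma> \<alpha>1 \<alpha>2 k \<eta> c"
  shows "(\<alpha>1 = 1 \<and> \<alpha>2 = 0 \<longrightarrow>
            (strict_mono_on {0<..} j \<and> \<bar>k^2 * (j (2 * k) - j k)\<bar> > 3 * \<gamma> / 4 \<longrightarrow>
               long_wave_unstable j b \<gamma> \<alpha>1 \<alpha>2 k \<eta> c) \<and>
            (strict_antimono_on {0<..} j \<longrightarrow>
               long_wave_stable j b \<gamma> \<alpha>1 \<alpha>2 k \<eta> c)) \<and>
         (\<alpha>1 = 0 \<and> \<alpha>2 = -1 \<longrightarrow>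
            long_wave_unstable j b \<gamma> \<alpha>1 \<alpha>2 k \<eta> c) \<and>
         (\<alpha>1 = 1 \<and> \<alpha>2 = -1 \<longrightarrow>
            2 * k^2 / (3 * \<gamma> + 4 * k^2 * (j k - j (2 * k))) < 3 / 4 \<longrightarrow>
            long_wave_unstable j b \<gamma> \<alpha>1 \<alpha>2 k \<eta> c)"
proof -
  have k: "k > 0" using assms(5) by (simp add: admissible_def)
  note unst = unstable_of_negative_c2[OF assms(1-5,8)]
  have "long_wave_unstable j b \<gamma> \<alpha>1 \<alpha>2 k \<eta> c"
    if \<alpha>: "\<alpha>1 = 1" "\<alpha>2 = 0" and inc: "strict_mono_on {0<..} j" and big: "\<bar>k^2 * (j (2 * k) - j k)\<bar> > 3 * \<gamma> / 4"
  proof (rule unst)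
    \<comment> \<open>Monotonicity removes the absolute value in \<open>big\<close>, which then
      makes the denominator of \<open>wave_eta2\<close> negative.\<close>
    have "j k < j (2 * k)" using inc k by (simp add: monotone_on_def)
    then have "k\<^sup>2 * (j (2 * k) - j k) > 3 * \<gamma> / 4" using big by (simp add: abs_mult)
    then have "3 * \<gamma> + 4 * k\<^sup>2 * (j k - j (2 * k)) < 0" by (simp add: algebra_simps)
    then have "2 * k\<^sup>2 / (3 * \<gamma> + 4 * k\<^sup>2 * (j k - j (2 * k))) < 0" using k by (intro divide_pos_neg) auto
    then show "wave_c2 j \<gamma> \<alpha>1 \<alpha>2 k < 0" by (simp add: \<alpha> wave_c2_def wave_eta2_def)
  qed (simp add: \<alpha>)
  moreover have "long_wave_stable j b \<gamma> \<alpha>1 \<alpha>2 k \<eta> c"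
    if \<alpha>: "\<alpha>1 = 1" "\<alpha>2 = 0" and dec: "strict_antimono_on {0<..} j"
    using stable_decreasing[OF assms(1) k _ assms(3) dec] assms(2,8) unfolding \<alpha> by (simp add: hyp_J1_def)
  \<comment> \<open>Here \<open>wave_eta2\<close> vanishes and c2 = - 3 / 4.\<close>
  moreover have "long_wave_unstable j b \<gamma> \<alpha>1 \<alpha>2 k \<eta> c" if \<alpha>: "\<alpha>1 = 0" "\<alpha>2 = -1"
    by (rule unst) (simp_all add: \<alpha> wave_c2_def)
  \<comment> \<open>The hypothesis says that \<open>wave_eta2\<close> is less than 3 / 4, that is,
    c2 < 0.\<close>
  moreover have "long_wave_unstable j b \<gamma> \<alpha>1 \<alpha>2 k \<eta> c"
    if \<alpha>: "\<alpha>1 = 1" "\<alpha>2 = -1" and "2 * k^2 / (3 * \<gamma> + 4 * k^2 * (j k - j (2 * k))) < 3 / 4"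
    by (rule unst) (use that in \<open>simp_all add: wave_c2_def wave_eta2_def\<close>)
  ultimately show ?thesis by blast
qed

end
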